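(* Let $\{h_\theta:|\theta|<1\}$ be a family of joint densities satisfying the model assumptions of the context, with score function $\dot\ell_0$ at $\theta=0$. Suppose $\dot\ell_0(X,Y)$ is not of the form $a(X)+b(Y)$ (almost surely under $h_0$) for any functions $a,b$. Then the test based on the Blum–Kiefer–Rosenblatt statistic $\hat T_{BKR}$ is asymptotically unbiased: for every $\alpha\in(0,1)$, every sequence $(t_n)$ with $\lim_nP_{n,0}[n\hat T_{BKR}\ge t_n]=\alpha$, all $0<\epsilon\le M<\infty$, and every $(\theta_n)$ with $\epsilon/\sqrt n\le|\theta_n|\le M/\sqrt n$ (and $|\theta_n|<1$), $$\liminf_{n\to\infty}P_{n,\theta_n}[n\hat T_{BKR}\ge t_n]>\alpha .$$
   Context: Model assumptions. $\{h_\theta(x,y):|\theta|<1\}$ is a family of joint probability densities with respect to Lebesgue measure on $\mathbb R^2$, and $h_0(x,y)=f_0(x)g_0(y)$ with $f_0,g_0$ probability densities (so $X,Y$ are independent under $\theta=0$). The score function $\dot\ell_0(x,y)=\frac{\partial}{\partial\theta}\log h_\theta(x,y)\big|_{\theta=0}$ exists and the family is quadratic mean differentiable at $0$: $$\iint\Big(\sqrt{h_\theta}-\sqrt{h_0}-\tfrac12\theta\,\dot\ell_0\sqrt{h_0}\Big)^2dx\,dy=o(\theta^2)\quad(\theta\to0),$$ and $E_0[\dot\ell_0(X,Y)^2]>0$. (Quadratic mean differentiability implies $E_0\dot\ell_0^2<\infty$ and $E_0\dot\ell_0=0$.) $P_{n,\theta}$ denotes the joint law of an i.i.d. sample $(X_1,Y_1),\dots,(X_n,Y_n)$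 from $h_\theta$. Statistic. Let $\hat F,\hat F_1,\hat F_2$ be the empirical joint and marginal cdfs of the sample, $\hat Q_j(u)=\inf\{x:\hat F_j(x)\ge u\}$, and $\hat C(u,v)=\hat F(\hat Q_1(u),\hat Q_2(v))$ the empirical copula. Then $$\hat T_{BKR}=\int_0^1\!\!\int_0^1\big(\hat C(u,v)-uv\big)^2du\,dv .$$ *)

theory Defs
  imports "HOL-Probability.Probability"
begin

definition prob_density :: "('a::euclidean_space \<Rightarrow> real) \<Rightarrow> bool" where
  "prob_density f \<longleftrightarrow>
     f \<in> borel_measurable borel \<and> (\<forall>x. 0 \<le> f x) \<and> (\<integral>\<^sup>+x. ennreal (f x) \<partial>lborel) = 1"

definition density_law :: "('a::euclidean_space \<Rightarrow> real) \<Rightarrow> 'a measure" where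
  "density_law f = density lborel (\<lambda>x. ennreal (f x))"

(* The score is a Borel version of the derivative of log h_theta at 0, determined h_0-almost
   everywhere. Positivity near 0 is required explicitly because ln is total in HOL. *)
definition is_score_at_0 :: "(real \<Rightarrow> real \<times> real \<Rightarrow> real) \<Rightarrow> (real \<times> real \<Rightarrow> real) \<Rightarrow> bool" where
  "is_score_at_0 h s \<longleftrightarrow>
     s \<in> borel_measurable borel \<and>
     (AE z in density_law (h 0).
        (\<forall>\<^sub>F \<theta> in nhds 0. 0 < h \<theta> z) \<and>
        ((\<lambda>\<theta>. ln (h \<theta> z)) has_real_derivative s z) (at 0))"

(* The nonnegative integral is used so that a divergent integral counts as infinite rather than
   as 0, the value of the Bochner integral of a non-integrable function. *)
definition qmd_at_0 :: "(real \<Rightarrow> real \<times> real \<Rightarrow> real) \<Rightarrow> (real \<times> real \<Rightarrow> real) \<Rightarrow> bool" where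
  "qmd_at_0 h s \<longleftrightarrow>
     ((\<lambda>\<theta>. (\<integral>\<^sup>+z. ennreal ((sqrt (h \<theta> z) - sqrt (h 0 z) - 1/2 * \<theta> * s z * sqrt (h 0 z))\<^sup>2) \<partial>lborel)
            / ennreal (\<theta>\<^sup>2)) \<longlongrightarrow> 0) (at 0)"

(* A sample of size n is the restriction of w to the indices {..<n}. *)
definition sample_law :: "(real \<Rightarrow> real \<times> real \<Rightarrow> real) \<Rightarrow> nat \<Rightarrow> real \<Rightarrow> (nat \<Rightarrow> real \<times> real) measure" where
  "sample_law h n \<theta> = Pi\<^sub>M {..<n} (\<lambda>_. density_law (h \<theta>))"

definition ecdf_joint :: "nat \<Rightarrow> (nat \<Rightarrow> real \<times> real) \<Rightarrow> real \<Rightarrow> real \<Rightarrow> real" where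
  "ecdf_joint n w x y = real (card {i \<in> {..<n}. fst (w i) \<le> x \<and> snd (w i) \<le> y}) / real n"

definition ecdf :: "nat \<Rightarrow> (nat \<Rightarrow> real) \<Rightarrow> real \<Rightarrow> real" where
  "ecdf n a x = real (card {i \<in> {..<n}. a i \<le> x}) / real n"

(* Only meaningful for 0 < u \<le> 1: at u = 0 the infimum is over all reals. *)
definition equantile :: "nat \<Rightarrow> (nat \<Rightarrow> real) \<Rightarrow> real \<Rightarrow> real" where
  "equantile n a u = Inf {x. u \<le> ecdf n a x}"

definition ecopula :: "nat \<Rightarrow> (nat \<Rightarrow> real \<times> real) \<Rightarrow> real \<Rightarrow> real \<Rightarrow> real" where
  "ecopula n w u v =
     ecdf_joint n w (equantile n (\<lambda>i. fst (w i)) u) (equantile n (\<lambda>i. snd (w i)) v)"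

(* LBINT u=0..1 integrates over the open interval (0,1). *)
definition T_BKR :: "nat \<Rightarrow> (nat \<Rightarrow> real \<times> real) \<Rightarrow> real" where
  "T_BKR n w = (LBINT u=0..1. (LBINT v=0..1. (ecopula n w u v - u * v)\<^sup>2))"

definition rejection_prob ::
    "(real \<Rightarrow> real \<times> real \<Rightarrow> real) \<Rightarrow> nat \<Rightarrow> real \<Rightarrow> real \<Rightarrow> real" where
  "rejection_prob h n \<theta> c =
     measure (sample_law h n \<theta>) {w \<in> space (sample_law h n \<theta>). c \<le> real n * T_BKR n w}"

end

theory Submission
  imports Defs
begin

text \<open>
Expressed through ranks, the statistic is the squared $L^2$ norm of the empirical copula process, and
its coefficients in the sine basis of the unit square are rank statistics. These are close in mean square
to the sums $S_{jk} = n^{-1/2}\sum_i \phi_{jk}(X_i, Y_i)$ with $\phi_{jk}(x, y) = 2\cos(\pi j F(x))\cos(\pi k G(y))$,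
weighted by $\lambda_{jk} = (\pi^2 j k)^{-2}$. By Bessel's inequality and because the expected statistic
converges to $1/36 = \sum\lambda_{jk}$, the statistic is approximated from both sides by finite quadratic
forms in the $S_{jk}$.

Under independence these sums are asymptotically standard normal. Under local alternatives, which up
to a small total variation error are tilts with density $1 + \theta s'$ for a bounded approximation $s'$
of the score, the $S_{jk}$ acquire the shifts $\delta E[s' \phi_{jk}]$. The cosine products together with the
additive functions are complete, so a non-additive score has some nonzero coefficient. Shifting one
coordinate raises every tail of a positive quadratic form in a Gaussian vector by an amount that does
not depend on the number of the other coordinates, and shifting the others cannot lower it.
A sequence violating the claim would have a subsequence along which $t_n$ and $\sqrt n\,\theta_n$
converge, which these bounds exclude.
\<close>

section \<open>Product measures and total variation\<close>

text \<open>No limit law of \<open>n * T_BKR n w\<close> is constructed and no process convergence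
  is used. Only finite sections of the limiting form appear, so the estimates must be uniform in the
  truncation. This fixes the order of choices: the gap \<open>g\<close> depends on \<alpha>,
  \<epsilon>, one score coefficient and a bound for the critical values; the margin \<eta>, the
  truncation level and the bounded replacement of the score are picked afterwards, small relative to
  \<open>g\<close>. The statistic is nonlinear in the sample, so it is studied only under
  independence, where the two rank vectors are independent and exchangeable and have exact moments.
  Its lower approximation is carried to the alternatives by a second-moment contiguity bound, which
  needs a bounded score; this, and nonnegativity of \<open>1 + \<theta> * s' z\<close>, is why the
  score is truncated. The upper approximation is needed only under the null law, to locate \<alpha>.
  The constant 1/36 is the squared integral of \<open>u * (1 - u)\<close> over the unit interval and
  also \<open>(pi^2 / 6)^2 / pi^4\<close>; the agreement of the two replaces Parseval's
  identity.\<close>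

lemma PiM_density:
  fixes f :: "'a \<Rightarrow> real"
  assumes M: "sigma_finite_measure M" and fin: "finite I"
    and f [measurable]: "f \<in> borel_measurable M" and nn: "\<And>x. 0 \<le> f x"
    and one: "(\<integral>\<^sup>+x. ennreal (f x) \<partial>M) = 1"
  shows "Pi\<^sub>M I (\<lambda>_. density M (\<lambda>x. ennreal (f x))) =
    density (Pi\<^sub>M I (\<lambda>_. M)) (\<lambda>w. ennreal (\<Prod>i\<in>I. f (w i)))"
proof -
  interpret S: product_sigma_finite "\<lambda>_. M"
    using M by (simp add: product_sigma_finite_def)
  let ?D = "density M (\<lambda>x. ennreal (f x))"
  interpret D: prob_space ?D
    by (rule prob_spaceI) (simp add: emeasure_density one cong: nn_integral_cong)
  interpret P: product_sigma_finite "\<lambda>_. ?D"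
    by (simp add: product_sigma_finite_def D.sigma_finite_measure_axioms)
  show ?thesis
  proof (rule P.PiM_eqI[symmetric, OF fin])
    show "sets (density (Pi\<^sub>M I (\<lambda>_. M)) (\<lambda>w. ennreal (\<Prod>i\<in>I. f (w i)))) = sets (Pi\<^sub>M I (\<lambda>_. ?D))"
      by (simp cong: sets_PiM_cong)
    fix A assume A: "\<And>i. i \<in> I \<Longrightarrow> A i \<in> sets ?D"
    then have A' [measurable]: "\<And>i. i \<in> I \<Longrightarrow> A i \<in> sets M" by simp
    have B: "Pi\<^sub>E I A \<in> sets (Pi\<^sub>M I (\<lambda>_. M))"
      using fin A' by (auto intro: sets_PiM_I_finite)
    have "emeasure (density (Pi\<^sub>M I (\<lambda>_. M)) (\<lambda>w. ennreal (\<Prod>i\<in>I. f (w i)))) (Pi\<^sub>E I A) =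
      (\<integral>\<^sup>+w. ennreal (\<Prod>i\<in>I. f (w i)) * indicator (Pi\<^sub>E I A) w \<partial>Pi\<^sub>M I (\<lambda>_. M))"
      using B by (subst emeasure_density) auto
    also have "\<dots> = (\<integral>\<^sup>+w. (\<Prod>i\<in>I. ennreal (f (w i)) * indicator (A i) (w i)) \<partial>Pi\<^sub>M I (\<lambda>_. M))"
    proof (rule nn_integral_cong)
      fix w assume w: "w \<in> space (Pi\<^sub>M I (\<lambda>_. M))"
      have "(indicator (Pi\<^sub>E I A) w :: ennreal) = (\<Prod>i\<in>I. indicator (A i) (w i))"
      proof (cases "w \<in> Pi\<^sub>E I A")
        case True then show ?thesis by (auto simp: indicator_def PiE_iff)
      next
        case False
        then obtain i where "i \<in> I" "w i \<notin> A i" using w by (auto simp: PiE_iff space_PiM)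
        then have "(\<Prod>i\<in>I. indicator (A i) (w i) :: ennreal) = 0"
          by (intro prod_zero[OF fin] bexI[of _ i]) auto
        with False show ?thesis by (simp add: indicator_def)
      qed
      then show "ennreal (\<Prod>i\<in>I. f (w i)) * indicator (Pi\<^sub>E I A) w =
        (\<Prod>i\<in>I. ennreal (f (w i)) * indicator (A i) (w i))"
        using nn by (simp add: prod_ennreal prod.distrib)
    qed
    also have "\<dots> = (\<Prod>i\<in>I. \<integral>\<^sup>+x. ennreal (f x) * indicator (A i) x \<partial>M)"
      using A' by (intro S.product_nn_integral_prod[OF fin, of "\<lambda>i x. ennreal (f x) * indicator (A i) x"]) auto
    also have "\<dots> = (\<Prod>i\<in>I. emeasure ?D (A i))"
      using A' by (intro prod.cong refl) (subst emeasure_density, auto)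
    finally show "emeasure (density (Pi\<^sub>M I (\<lambda>_. M)) (\<lambda>w. ennreal (\<Prod>i\<in>I. f (w i)))) (Pi\<^sub>E I A) =
      (\<Prod>i\<in>I. emeasure ?D (A i))" .
  qed
qed

lemma has_integral_1_densityI:
  fixes f :: "'a \<Rightarrow> real"
  assumes f [measurable]: "f \<in> borel_measurable M" and nn: "\<And>x. 0 \<le> f x"
    and one: "(\<integral>\<^sup>+x. ennreal (f x) \<partial>M) = 1"
  shows "integrable M f" "(\<integral>x. f x \<partial>M) = 1"
  using nn by (auto intro!: integrableI_nonneg simp: one integral_eq_nn_integral)

lemma measure_density_eq_integral:
  fixes f :: "'a \<Rightarrow> real"
  assumes f: "integrable M f" and nn: "\<And>x. 0 \<le> f x" and A: "A \<in> sets M"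
  shows "measure (density M (\<lambda>x. ennreal (f x))) A = (\<integral>x. f x * indicator A x \<partial>M)"
proof -
  have [measurable]: "f \<in> borel_measurable M" using f by simp
  have "emeasure (density M (\<lambda>x. ennreal (f x))) A = (\<integral>\<^sup>+x. ennreal (f x * indicator A x) \<partial>M)"
    using A by (subst emeasure_density) (auto intro!: nn_integral_cong simp: indicator_def)
  moreover have "(\<integral>x. f x * indicator A x \<partial>M) = enn2real (\<integral>\<^sup>+x. ennreal (f x * indicator A x) \<partial>M)"
    using A nn by (intro integral_eq_nn_integral) auto
  ultimately show ?thesis by (simp add: measure_def)
qed

text \<open>Factor \<open>F - G\<close> into the difference and the sum of the square roots and
  weight the two factors by \<eta>. The first term on the right integrates to a multiple of one
  minus the Hellinger affinity, the second to \<open>2 * \<eta>\<close>, so \<eta> can be tuned when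
  the affinity is close to 1.\<close>

lemma abs_diff_le_sqrt_terms:
  fixes F G \<eta> :: real
  assumes "0 \<le> F" "0 \<le> G" "0 < \<eta>"
  shows "\<bar>F - G\<bar> \<le> (F + G - 2 * (sqrt F * sqrt G)) / (2 * \<eta>) + \<eta> * (F + G)"
proof -
  define a b where "a = sqrt F" and "b = sqrt G"
  have ab: "0 \<le> a" "0 \<le> b" "F = a\<^sup>2" "G = b\<^sup>2" using assms by (auto simp: a_def b_def)
  have "F - G = (a - b) * (a + b)" by (simp add: ab power2_eq_square algebra_simps)
  then have 1: "\<bar>F - G\<bar> = \<bar>a - b\<bar> * (a + b)" using ab by (simp add: abs_mult)
  have "0 \<le> (\<bar>a - b\<bar> - \<eta> * (a + b))\<^sup>2" by simp
  also have "\<dots> = (a - b)\<^sup>2 + \<eta>\<^sup>2 * (a + b)\<^sup>2 - 2 * \<eta> * \<bar>F - G\<bar>"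
    by (simp add: 1 power2_diff power_mult_distrib)
  also have "(a + b)\<^sup>2 \<le> 2 * (F + G)"
    using zero_le_power2[of "a - b"] by (simp add: ab power2_diff power2_sum)
  finally have "2 * \<eta> * \<bar>F - G\<bar> \<le> (a - b)\<^sup>2 + \<eta>\<^sup>2 * (2 * (F + G))"
    by (simp add: mult_left_mono)
  also have "\<dots> = 2 * \<eta> * ((a - b)\<^sup>2 / (2 * \<eta>) + \<eta> * (F + G))"
    using assms(3) by (simp add: distrib_left power2_eq_square)
  finally have "\<bar>F - G\<bar> \<le> (a - b)\<^sup>2 / (2 * \<eta>) + \<eta> * (F + G)"
    using assms(3) by simp
  also have "(a - b)\<^sup>2 = F + G - 2 * (sqrt F * sqrt G)"
    by (simp add: ab(3,4) power2_diff) (use assms in \<open>simp add: a_def b_def\<close>)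
  finally show ?thesis .
qed

text \<open>Total variation does not factor over a product, but the affinity does. A Hellinger bound
  \<open>c\<close> of order \<open>1 / n\<close> for a single observation therefore gives control of
  the whole sample that does not deteriorate with its size.\<close>

lemma PiM_tv_le_hellinger:
  fixes f g :: "'a \<Rightarrow> real" and c \<eta> :: real
  assumes M: "sigma_finite_measure M" and fin: "finite I"
    and f [measurable]: "f \<in> borel_measurable M" and f0: "\<And>x. 0 \<le> f x"
    and f1: "(\<integral>\<^sup>+x. ennreal (f x) \<partial>M) = 1"
    and g [measurable]: "g \<in> borel_measurable M" and g0: "\<And>x. 0 \<le> g x"
    and g1: "(\<integral>\<^sup>+x. ennreal (g x) \<partial>M) = 1"
    and H: "(\<integral>\<^sup>+x. ennreal ((sqrt (f x) - sqrt (g x))\<^sup>2) \<partial>M) \<le> ennreal c" and c: "0 \<le> c"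
    and \<eta>: "0 < \<eta>" and A: "A \<in> sets (Pi\<^sub>M I (\<lambda>_. M))"
  shows "\<bar>measure (Pi\<^sub>M I (\<lambda>_. density M (\<lambda>x. ennreal (f x)))) A -
          measure (Pi\<^sub>M I (\<lambda>_. density M (\<lambda>x. ennreal (g x)))) A\<bar> \<le> card I * c / (2 * \<eta>) + 2 * \<eta>"
proof -
  interpret S: product_sigma_finite "\<lambda>_. M"
    using M by (simp add: product_sigma_finite_def)
  let ?N = "Pi\<^sub>M I (\<lambda>_. M)"
  note fi = has_integral_1_densityI[OF f f0 f1] and gi = has_integral_1_densityI[OF g g0 g1]
  define F where "F w = (\<Prod>i\<in>I. f (w i))" for w
  define G where "G w = (\<Prod>i\<in>I. g (w i))" for w
  have F0: "0 \<le> F w" and G0: "0 \<le> G w" for w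
    by (auto simp: F_def G_def f0 g0 intro: prod_nonneg)
  have [measurable]: "F \<in> borel_measurable ?N" "G \<in> borel_measurable ?N"
    by (auto simp: F_def[abs_def] G_def[abs_def] intro!: borel_measurable_prod)
  have Fi: "integrable ?N F" "(\<integral>w. F w \<partial>?N) = 1"
    unfolding F_def using S.product_integral_prod[OF fin, of "\<lambda>_. f"] fi
    by (auto intro!: S.product_integrable_prod[OF fin, of "\<lambda>_. f"])
  have Gi: "integrable ?N G" "(\<integral>w. G w \<partial>?N) = 1"
    unfolding G_def using S.product_integral_prod[OF fin, of "\<lambda>_. g"] gi
    by (auto intro!: S.product_integrable_prod[OF fin, of "\<lambda>_. g"])
  \<comment> \<open>Integrand of the Hellinger affinity \<rho>; the squared Hellinger distance is
    \<open>2 - 2 * \<rho>\<close>.\<close>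
  define r where "r x = sqrt (f x) * sqrt (g x)" for x
  have r_le: "r x \<le> (f x + g x) / 2" and r0: "0 \<le> r x" for x
    using arith_geo_mean_sqrt[of "f x" "g x"] f0 g0 by (auto simp: r_def real_sqrt_mult)
  have ri: "integrable M r"
  proof (rule Bochner_Integration.integrable_bound[where f="\<lambda>x. (f x + g x) / 2"])
    show "r \<in> borel_measurable M" by (simp add: r_def[abs_def])
  qed (use fi gi r_le r0 f0 g0 in \<open>auto intro!: AE_I2\<close>)
  define \<rho> where "\<rho> = (\<integral>x. r x \<partial>M)"
  have \<rho>0: "0 \<le> \<rho>" by (simp add: \<rho>_def r0)
  have \<rho>1: "\<rho> \<le> 1"
    using integral_mono[OF ri, of "\<lambda>x. (f x + g x) / 2"] fi gi r_le by (simp add: \<rho>_def)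
  have sq: "(sqrt (f x) - sqrt (g x))\<^sup>2 = f x + g x - 2 * r x" for x
    using f0[of x] g0[of x] by (simp add: power2_diff r_def)
  have c\<rho>: "2 - 2 * \<rho> \<le> c"
  proof -
    have "integrable M (\<lambda>x. (sqrt (f x) - sqrt (g x))\<^sup>2)"
      unfolding sq using ri fi gi by simp
    then have "ennreal (\<integral>x. (sqrt (f x) - sqrt (g x))\<^sup>2 \<partial>M) \<le> ennreal c"
      using H by (subst nn_integral_eq_integral[symmetric]) auto
    then have "(\<integral>x. (sqrt (f x) - sqrt (g x))\<^sup>2 \<partial>M) \<le> c" using c by simp
    then show ?thesis using ri fi gi by (simp add: sq \<rho>_def)
  qed
  have R: "(\<Prod>i\<in>I. r (w i)) = sqrt (F w) * sqrt (G w)" for w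
  proof -
    have "(\<Prod>i\<in>J. sqrt (h (w i))) = sqrt (\<Prod>i\<in>J. h (w i))" for h J
      by (induction J rule: infinite_finite_induct) (simp_all add: real_sqrt_mult)
    then show ?thesis by (simp add: F_def G_def r_def prod.distrib)
  qed
  have Ri: "integrable ?N (\<lambda>w. sqrt (F w) * sqrt (G w))"
    and R\<rho>: "(\<integral>w. sqrt (F w) * sqrt (G w) \<partial>?N) = \<rho> ^ card I"
    using S.product_integral_prod[OF fin, of "\<lambda>_. r"] S.product_integrable_prod[OF fin, of "\<lambda>_. r"] ri
    by (auto simp: R \<rho>_def)
  have mF: "measure (Pi\<^sub>M I (\<lambda>_. density M (\<lambda>x. ennreal (f x)))) A = (\<integral>w. F w * indicator A w \<partial>?N)"
    unfolding PiM_density[OF M fin f f0 f1] F_def[symmetric]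
    using Fi(1) F0 A by (rule measure_density_eq_integral)
  have mG: "measure (Pi\<^sub>M I (\<lambda>_. density M (\<lambda>x. ennreal (g x)))) A = (\<integral>w. G w * indicator A w \<partial>?N)"
    unfolding PiM_density[OF M fin g g0 g1] G_def[symmetric]
    using Gi(1) G0 A by (rule measure_density_eq_integral)
  have iA: "integrable ?N (\<lambda>w. F w * indicator A w)" "integrable ?N (\<lambda>w. G w * indicator A w)"
    using Fi Gi A by (auto intro: integrable_real_mult_indicator)
  have "\<bar>(\<integral>w. F w * indicator A w \<partial>?N) - (\<integral>w. G w * indicator A w \<partial>?N)\<bar> =
    \<bar>\<integral>w. (F w - G w) * indicator A w \<partial>?N\<bar>"
    using iA by (simp add: left_diff_distrib)
  also have "\<dots> \<le> (\<integral>w. \<bar>(F w - G w) * indicator A w\<bar> \<partial>?N)"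
    by (rule integral_abs_bound)
  also have "\<dots> \<le> (\<integral>w. (F w + G w - 2 * (sqrt (F w) * sqrt (G w))) / (2 * \<eta>) + \<eta> * (F w + G w) \<partial>?N)"
  proof (rule integral_mono)
    show "integrable ?N (\<lambda>w. \<bar>(F w - G w) * indicator A w\<bar>)"
      using iA by (auto simp: left_diff_distrib)
    show "integrable ?N (\<lambda>w. (F w + G w - 2 * (sqrt (F w) * sqrt (G w))) / (2 * \<eta>) + \<eta> * (F w + G w))"
      using Fi Gi Ri by auto
    fix w
    have "\<bar>(F w - G w) * indicator A w\<bar> \<le> \<bar>F w - G w\<bar>" by (simp add: indicator_def)
    then show "\<bar>(F w - G w) * indicator A w\<bar> \<le>
       (F w + G w - 2 * (sqrt (F w) * sqrt (G w))) / (2 * \<eta>) + \<eta> * (F w + G w)"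
      using abs_diff_le_sqrt_terms[OF F0 G0 \<eta>, of w w] by linarith
  qed
  also have "\<dots> = (2 - 2 * \<rho> ^ card I) / (2 * \<eta>) + 2 * \<eta>"
    using Fi Gi Ri R\<rho> by simp
  also have "\<dots> \<le> card I * c / (2 * \<eta>) + 2 * \<eta>"
  proof -
    \<comment> \<open>Bernoulli turns the affinity \<open>\<rho> ^ card I\<close> of the samples
      into a linear loss per observation; its condition is that \<open>\<rho> - 1\<close> is at
      least -1.\<close>
    have "1 + real (card I) * (\<rho> - 1) \<le> (1 + (\<rho> - 1)) ^ card I"
      by (rule Bernoulli_inequality) (use \<rho>0 in simp)
    then have "2 - 2 * \<rho> ^ card I \<le> card I * (2 - 2 * \<rho>)" by (simp add: algebra_simps)
    also have "\<dots> \<le> card I * c" using c\<rho> by (intro mult_left_mono) auto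
    finally show ?thesis using \<eta> by (simp add: divide_right_mono)
  qed
  finally show ?thesis unfolding mF mG .
qed

text \<open>Quantitative contiguity. The second moment of the likelihood ratio multiplies over
  coordinates and stays below \<open>exp (card I * v)\<close>, so with \<open>v\<close> of order
  \<open>1 / n\<close> events that are rare under the base law remain rare under the tilted one;
  \<kappa> balances the two terms.\<close>

lemma PiM_density_contiguity:
  fixes l :: "'a \<Rightarrow> real" and v \<kappa> :: real
  assumes M: "prob_space M" and fin: "finite I"
    and l [measurable]: "l \<in> borel_measurable M" and l0: "\<And>x. 0 \<le> l x"
    and l1: "(\<integral>\<^sup>+x. ennreal (l x) \<partial>M) = 1"
    and l2: "integrable M (\<lambda>x. (l x)\<^sup>2)" "(\<integral>x. (l x)\<^sup>2 \<partial>M) \<le> 1 + v"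
    and \<kappa>: "0 < \<kappa>" and A: "A \<in> sets (Pi\<^sub>M I (\<lambda>_. M))"
  shows "measure (Pi\<^sub>M I (\<lambda>_. density M (\<lambda>x. ennreal (l x)))) A \<le>
    \<kappa> / 2 * exp (card I * v) + measure (Pi\<^sub>M I (\<lambda>_. M)) A / (2 * \<kappa>)"
proof -
  interpret M: prob_space M by fact
  have sf: "sigma_finite_measure M" by unfold_locales
  interpret S: product_sigma_finite "\<lambda>_. M"
    using sf by (simp add: product_sigma_finite_def)
  let ?N = "Pi\<^sub>M I (\<lambda>_. M)"
  interpret N: prob_space ?N by (rule prob_space_PiM) (rule M)
  note li = has_integral_1_densityI[OF l l0 l1]
  define L where "L w = (\<Prod>i\<in>I. l (w i))" for w
  have L0: "0 \<le> L w" for w by (auto simp: L_def l0 intro: prod_nonneg)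
  have [measurable]: "L \<in> borel_measurable ?N"
    by (auto simp: L_def[abs_def] intro!: borel_measurable_prod)
  have Li: "integrable ?N L" "(\<integral>w. L w \<partial>?N) = 1"
    unfolding L_def using S.product_integral_prod[OF fin, of "\<lambda>_. l"] li
    by (auto intro!: S.product_integrable_prod[OF fin, of "\<lambda>_. l"])
  have L2: "integrable ?N (\<lambda>w. (L w)\<^sup>2)" "(\<integral>w. (L w)\<^sup>2 \<partial>?N) = (\<integral>x. (l x)\<^sup>2 \<partial>M) ^ card I"
    using S.product_integral_prod[OF fin, of "\<lambda>_ x. (l x)\<^sup>2"] S.product_integrable_prod[OF fin, of "\<lambda>_ x. (l x)\<^sup>2"] l2
    by (auto simp: L_def prod_power_distrib[symmetric])
  have "measure (Pi\<^sub>M I (\<lambda>_. density M (\<lambda>x. ennreal (l x)))) A = (\<integral>w. L w * indicator A w \<partial>?N)"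
    unfolding PiM_density[OF sf fin l l0 l1] L_def[symmetric]
    using Li(1) L0 A by (rule measure_density_eq_integral)
  also have "\<dots> \<le> (\<integral>w. \<kappa> / 2 * (L w)\<^sup>2 + indicator A w / (2 * \<kappa>) \<partial>?N)"
  proof (rule integral_mono)
    show "integrable ?N (\<lambda>w. L w * indicator A w)"
      using Li A by (auto intro: integrable_real_mult_indicator)
    show "integrable ?N (\<lambda>w. \<kappa> / 2 * (L w)\<^sup>2 + indicator A w / (2 * \<kappa>))"
      using L2 A by (intro Bochner_Integration.integrable_add integrable_mult_right integrable_divide)
        (auto intro!: integrable_real_indicator simp: N.emeasure_eq_measure)
    fix w
    \<comment> \<open>Completing the square, with the indicator equal to its own square, gives the
      pointwise bound that separates the likelihood from the event.\<close>
    have "0 \<le> (\<kappa> * L w - indicator A w)\<^sup>2 / (2 * \<kappa>)" using \<kappa> by simp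
    then show "L w * indicator A w \<le> \<kappa> / 2 * (L w)\<^sup>2 + indicator A w / (2 * \<kappa>)"
      using \<kappa> by (cases "w \<in> A") (simp_all add: power2_eq_square field_simps)
  qed
  also have "\<dots> = \<kappa> / 2 * (\<integral>x. (l x)\<^sup>2 \<partial>M) ^ card I + measure ?N A / (2 * \<kappa>)"
    using L2 A
    by (subst Bochner_Integration.integral_add) (auto intro!: integrable_real_indicator simp: N.emeasure_eq_measure)
  also have "(\<integral>x. (l x)\<^sup>2 \<partial>M) ^ card I \<le> exp v ^ card I"
    using l2(2) exp_ge_add_one_self[of v] by (intro power_mono) (auto intro: order_trans)
  also have "exp v ^ card I = exp (card I * v)" by (simp add: exp_of_nat_mult)
  finally show ?thesis using \<kappa> by simp
qed

text \<open>Only the diagonal survives, by independence and centring. The free weights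
  \<open>c i\<close> make the formula usable conditionally: below they are errors computed from the
  other, independent sample.\<close>

lemma PiM_integral_sum_square:
  fixes \<psi> :: "'a \<Rightarrow> real"
  assumes M: "prob_space M" and fin: "finite I"
    and \<psi> [measurable]: "\<psi> \<in> borel_measurable M" and bd: "\<And>x. \<bar>\<psi> x\<bar> \<le> B"
    and mean: "(\<integral>x. \<psi> x \<partial>M) = 0"
  shows "(\<integral>w. (\<Sum>i\<in>I. c i * \<psi> (w i))\<^sup>2 \<partial>Pi\<^sub>M I (\<lambda>_. M)) = (\<Sum>i\<in>I. (c i)\<^sup>2) * (\<integral>x. (\<psi> x)\<^sup>2 \<partial>M)"
proof -
  interpret M: prob_space M by fact
  interpret S: product_sigma_finite "\<lambda>_. M"
    by (simp add: product_sigma_finite_def M.sigma_finite_measure_axioms)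
  let ?N = "Pi\<^sub>M I (\<lambda>_. M)"
  interpret N: prob_space ?N by (rule prob_space_PiM) (rule M)
  have i1: "integrable M \<psi>" by (rule M.integrable_const_bound[where B=B]) (auto simp: bd)
  have B0: "0 \<le> B" using bd[of undefined] by linarith
  have bd2: "norm (\<psi> x * \<psi> y) \<le> B * B" for x y
    unfolding norm_mult using bd B0 by (intro mult_mono) auto
  have bd3: "\<psi> x * \<psi> x \<le> B * B" for x
    using bd2[of x x] by simp
  have i2: "integrable M (\<lambda>x. \<psi> x * \<psi> x)"
    by (rule M.integrable_const_bound[where B="B*B"]) (use bd2 bd3 in auto)
  have cross: "(\<integral>w. \<psi> (w i) * \<psi> (w l) \<partial>?N) = (if i = l then (\<integral>x. (\<psi> x)\<^sup>2 \<partial>M) else 0)"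
    if il: "i \<in> I" "l \<in> I" for i l
  proof -
    \<comment> \<open>Writes the product of two evaluations as a product over all coordinates. The
      two conditionals multiply at the same coordinate when \<open>i = l\<close>, so one formula
      covers diagonal and off-diagonal terms.\<close>
    define f where "f k x = (if k = i then \<psi> x else 1) * (if k = l then \<psi> x else 1)" for k x
    have fint: "integrable M (f k)" for k
      using i1 i2 unfolding f_def[abs_def] by (cases "k = i"; cases "k = l") simp_all
    have "(\<integral>w. \<psi> (w i) * \<psi> (w l) \<partial>?N) = (\<integral>w. (\<Prod>k\<in>I. f k (w k)) \<partial>?N)"
      using il fin by (simp add: f_def prod.distrib prod.delta)
    also have "\<dots> = (\<Prod>k\<in>I. \<integral>x. f k x \<partial>M)"
      by (rule S.product_integral_prod[OF fin]) (rule fint)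
    also have "\<dots> = (if i = l then (\<integral>x. (\<psi> x)\<^sup>2 \<partial>M) else 0)"
    proof (cases "i = l")
      case True
      have "(\<Prod>k\<in>I. \<integral>x. f k x \<partial>M) = (\<Prod>k\<in>I. if k = i then (\<integral>x. (\<psi> x)\<^sup>2 \<partial>M) else 1)"
        using True by (intro prod.cong refl) (auto simp: f_def power2_eq_square M.prob_space)
      then show ?thesis using True il fin by simp
    next
      case False
      then have "(\<integral>x. f i x \<partial>M) = 0" using mean by (simp add: f_def)
      then show ?thesis using False il by (auto intro!: prod_zero[OF fin])
    qed
    finally show ?thesis .
  qed
  have int: "integrable ?N (\<lambda>w. \<psi> (w i) * \<psi> (w l))" if "i \<in> I" "l \<in> I" for i l
    using that by (intro N.integrable_const_bound[where B="B*B"]) (use bd2 bd3 in auto)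
  have "(\<integral>w. (\<Sum>i\<in>I. c i * \<psi> (w i))\<^sup>2 \<partial>?N) =
    (\<integral>w. (\<Sum>i\<in>I. \<Sum>l\<in>I. (c i * c l) * (\<psi> (w i) * \<psi> (w l))) \<partial>?N)"
    by (simp add: power2_eq_square sum_product algebra_simps)
  also have "\<dots> = (\<Sum>i\<in>I. \<Sum>l\<in>I. (c i * c l) * (\<integral>w. \<psi> (w i) * \<psi> (w l) \<partial>?N))"
    using int by (simp add: integrable_mult_right)
  also have "\<dots> = (\<Sum>i\<in>I. \<Sum>l\<in>I. if i = l then (c i * c l) * (\<integral>x. (\<psi> x)\<^sup>2 \<partial>M) else 0)"
    by (intro sum.cong refl) (simp add: cross)
  also have "\<dots> = (\<Sum>i\<in>I. (c i)\<^sup>2) * (\<integral>x. (\<psi> x)\<^sup>2 \<partial>M)"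
    using fin by (simp add: sum_distrib_right power2_eq_square)
  finally show ?thesis .
qed

text \<open>Sampling pairs from a product law is the same as sampling the two coordinates
  separately. This makes the two rank vectors functions of independent factors, so that their
  moments can be computed one factor at a time.\<close>

lemma distr_PiM_pair:
  assumes \<mu>: "prob_space \<mu>" and \<nu>: "prob_space \<nu>" and fin: "finite I"
  shows "distr (Pi\<^sub>M I (\<lambda>_. \<mu>) \<Otimes>\<^sub>M Pi\<^sub>M I (\<lambda>_. \<nu>)) (Pi\<^sub>M I (\<lambda>_. \<mu> \<Otimes>\<^sub>M \<nu>))
      (\<lambda>(x, y). \<lambda>i\<in>I. (x i, y i)) = Pi\<^sub>M I (\<lambda>_. \<mu> \<Otimes>\<^sub>M \<nu>)"
proof -
  interpret \<mu>: prob_space \<mu> by fact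
  interpret \<nu>: prob_space \<nu> by fact
  interpret pr: pair_prob_space \<mu> \<nu> ..
  interpret S1: product_sigma_finite "\<lambda>_. \<mu>"
    by (simp add: product_sigma_finite_def \<mu>.sigma_finite_measure_axioms)
  interpret S2: product_sigma_finite "\<lambda>_. \<nu>"
    by (simp add: product_sigma_finite_def \<nu>.sigma_finite_measure_axioms)
  interpret S: product_sigma_finite "\<lambda>_. \<mu> \<Otimes>\<^sub>M \<nu>"
    by (simp add: product_sigma_finite_def pr.P.sigma_finite_measure_axioms)
  let ?X = "Pi\<^sub>M I (\<lambda>_. \<mu>)" and ?Y = "Pi\<^sub>M I (\<lambda>_. \<nu>)"
  interpret X: prob_space ?X by (rule prob_space_PiM) (rule \<mu>)
  interpret Y: prob_space ?Y by (rule prob_space_PiM) (rule \<nu>)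
  interpret XY: pair_prob_space ?X ?Y ..
  have mz [measurable]: "(\<lambda>(x, y). \<lambda>i\<in>I. (x i, y i)) \<in> measurable (?X \<Otimes>\<^sub>M ?Y) (Pi\<^sub>M I (\<lambda>_. \<mu> \<Otimes>\<^sub>M \<nu>))"
    unfolding split_beta' by measurable
  show ?thesis
  proof (rule S.PiM_eqI[OF fin])
    fix A assume A [measurable]: "\<And>i. i \<in> I \<Longrightarrow> A i \<in> sets (\<mu> \<Otimes>\<^sub>M \<nu>)"
    have B: "Pi\<^sub>E I A \<in> sets (Pi\<^sub>M I (\<lambda>_. \<mu> \<Otimes>\<^sub>M \<nu>))"
      using fin A by (auto intro: sets_PiM_I_finite)
    have ind: "(indicator ((\<lambda>(x, y). \<lambda>i\<in>I. (x i, y i)) -` Pi\<^sub>E I A \<inter> space (?X \<Otimes>\<^sub>M ?Y)) (x, y) :: ennreal) =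
      (\<Prod>i\<in>I. indicator (A i) (x i, y i))" if "x \<in> space ?X" "y \<in> space ?Y" for x y
    proof (cases "\<forall>i\<in>I. (x i, y i) \<in> A i")
      case True then show ?thesis using that by (auto simp: indicator_def PiE_iff space_pair_measure)
    next
      case False
      then obtain i where "i \<in> I" "(x i, y i) \<notin> A i" by auto
      then have "(\<Prod>i\<in>I. indicator (A i) (x i, y i) :: ennreal) = 0"
        by (intro prod_zero[OF fin] bexI[of _ i]) auto
      with \<open>i \<in> I\<close> \<open>(x i, y i) \<notin> A i\<close> show ?thesis by (auto simp: indicator_def PiE_iff)
    qed
    have "emeasure (distr (?X \<Otimes>\<^sub>M ?Y) (Pi\<^sub>M I (\<lambda>_. \<mu> \<Otimes>\<^sub>M \<nu>)) (\<lambda>(x, y). \<lambda>i\<in>I. (x i, y i))) (Pi\<^sub>E I A) =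
      emeasure (?X \<Otimes>\<^sub>M ?Y) ((\<lambda>(x, y). \<lambda>i\<in>I. (x i, y i)) -` Pi\<^sub>E I A \<inter> space (?X \<Otimes>\<^sub>M ?Y))"
      using B by (intro emeasure_distr mz)
    also have "\<dots> = (\<integral>\<^sup>+x. \<integral>\<^sup>+y. indicator ((\<lambda>(x, y). \<lambda>i\<in>I. (x i, y i)) -` Pi\<^sub>E I A \<inter> space (?X \<Otimes>\<^sub>M ?Y)) (x, y) \<partial>?Y \<partial>?X)"
      using measurable_sets[OF mz B] by (intro Y.emeasure_pair_measure)
    also have "\<dots> = (\<integral>\<^sup>+x. \<integral>\<^sup>+y. (\<Prod>i\<in>I. indicator (A i) (x i, y i)) \<partial>?Y \<partial>?X)"
      by (intro nn_integral_cong ind)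
    also have "\<dots> = (\<integral>\<^sup>+x. (\<Prod>i\<in>I. \<integral>\<^sup>+v. indicator (A i) (x i, v) \<partial>\<nu>) \<partial>?X)"
    proof (rule nn_integral_cong)
      fix x assume x: "x \<in> space ?X"
      show "(\<integral>\<^sup>+y. (\<Prod>i\<in>I. indicator (A i) (x i, y i)) \<partial>?Y) = (\<Prod>i\<in>I. \<integral>\<^sup>+v. indicator (A i) (x i, v) \<partial>\<nu>)"
      proof (rule S2.product_nn_integral_prod[OF fin, of "\<lambda>i v. indicator (A i) (x i, v)"])
        fix i assume i: "i \<in> I"
        then have "x i \<in> space \<mu>" using x by (auto simp: space_PiM PiE_iff)
        then show "(\<lambda>v. indicator (A i) (x i, v) :: ennreal) \<in> borel_measurable \<nu>"
          using i A[OF i] by measurable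
      qed
    qed
    also have "\<dots> = (\<Prod>i\<in>I. \<integral>\<^sup>+u. \<integral>\<^sup>+v. indicator (A i) (u, v) \<partial>\<nu> \<partial>\<mu>)"
      using A by (intro S1.product_nn_integral_prod[OF fin, of "\<lambda>i u. \<integral>\<^sup>+v. indicator (A i) (u, v) \<partial>\<nu>"]) measurable
    also have "\<dots> = (\<Prod>i\<in>I. emeasure (\<mu> \<Otimes>\<^sub>M \<nu>) (A i))"
      using A by (intro prod.cong refl \<nu>.emeasure_pair_measure[symmetric])
    finally show "emeasure (distr (?X \<Otimes>\<^sub>M ?Y) (Pi\<^sub>M I (\<lambda>_. \<mu> \<Otimes>\<^sub>M \<nu>)) (\<lambda>(x, y). \<lambda>i\<in>I. (x i, y i))) (Pi\<^sub>E I A) =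
      (\<Prod>i\<in>I. emeasure (\<mu> \<Otimes>\<^sub>M \<nu>) (A i))" .
  qed simp
qed

text \<open>Integrating out coordinate \<open>i\<close> last leaves, for fixed other coordinates,
  the mass of a single point.\<close>

lemma AE_PiM_neq:
  fixes \<mu> :: "real measure"
  assumes \<mu>: "real_distribution \<mu>" and atomless: "\<And>a. measure \<mu> {a} = 0"
    and fin: "finite I" and il: "i \<in> I" "l \<in> I" "i \<noteq> l"
  shows "AE x in Pi\<^sub>M I (\<lambda>_. \<mu>). x i \<noteq> x l"
proof -
  interpret \<mu>: real_distribution \<mu> by fact
  interpret S: product_sigma_finite "\<lambda>_. \<mu>"
    by (simp add: product_sigma_finite_def \<mu>.sigma_finite_measure_axioms)
  define J where "J = I - {i}"
  have J: "finite J" "i \<notin> J" "I = insert i J" "l \<in> J" using fin il by (auto simp: J_def)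
  define N where "N = Pi\<^sub>M I (\<lambda>_. \<mu>)"
  have mm [measurable]: "(\<lambda>x. x i) \<in> borel_measurable N" "(\<lambda>x. x l) \<in> borel_measurable N"
    using il by (auto simp: N_def)
  have S0: "{x \<in> space N. x i = x l} \<in> sets N" by measurable
  have "emeasure N {x \<in> space N. x i = x l} = (\<integral>\<^sup>+x. indicator {x \<in> space N. x i = x l} x \<partial>N)"
    using S0 by simp
  also have "\<dots> = (\<integral>\<^sup>+x. of_bool (x i = x l) \<partial>N)"
    by (intro nn_integral_cong) (auto simp: indicator_def)
  also have "\<dots> = (\<integral>\<^sup>+x. \<integral>\<^sup>+y. of_bool (y = x l) \<partial>\<mu> \<partial>Pi\<^sub>M J (\<lambda>_. \<mu>))"
  proof -
    have [measurable]: "Measurable.pred N (\<lambda>x. x i = x l)"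
      using S0 by (simp add: pred_def)
    have "(\<lambda>x. of_bool (x i = x l) :: ennreal) \<in> borel_measurable N"
      by measurable
    then have "(\<lambda>x. of_bool (x i = x l) :: ennreal) \<in> borel_measurable (Pi\<^sub>M (insert i J) (\<lambda>_. \<mu>))"
      unfolding N_def J(3) .
    from S.product_nn_integral_insert[OF J(1,2) this] show ?thesis
      using il unfolding N_def J(3) by simp
  qed
  also have "\<dots> = (\<integral>\<^sup>+x. emeasure \<mu> {x l} \<partial>Pi\<^sub>M J (\<lambda>_. \<mu>))"
  proof (rule nn_integral_cong)
    fix x
    have "(\<integral>\<^sup>+y. of_bool (y = x l) \<partial>\<mu>) = (\<integral>\<^sup>+y. indicator {x l} y \<partial>\<mu>)"
      by (intro nn_integral_cong) (auto simp: indicator_def)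
    then show "(\<integral>\<^sup>+y. of_bool (y = x l) \<partial>\<mu>) = emeasure \<mu> {x l}" by simp
  qed
  also have "\<dots> = 0" by (simp add: \<mu>.emeasure_eq_measure atomless)
  finally have "emeasure N {x \<in> space N. x i = x l} = 0" .
  then have "AE x in N. x i \<noteq> x l"
    using S0 by (subst AE_iff_measurable[OF S0]) auto
  then show ?thesis unfolding N_def .
qed

section \<open>Tail probabilities from Laplace transforms at the integers\<close>

text \<open>Weierstrass approximation on the unit interval: expectations of a polynomial are
  combinations of moments and converge, and the approximation error is uniform in the
  measure.\<close>

lemma moments_polynomial_tendsto:
  fixes P :: "nat \<Rightarrow> 'a measure" and Y :: "nat \<Rightarrow> 'a \<Rightarrow> real" and P' :: "'b measure" and Y' :: "'b \<Rightarrow> real"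
    and f :: "real \<Rightarrow> real"
  assumes P: "\<And>n. prob_space (P n)" and P': "prob_space P'"
    and Y [measurable]: "\<And>n. Y n \<in> borel_measurable (P n)" and Y01: "\<And>n w. 0 \<le> Y n w \<and> Y n w \<le> 1"
    and Y' [measurable]: "Y' \<in> borel_measurable P'" and Y'01: "\<And>w. 0 \<le> Y' w \<and> Y' w \<le> 1"
    and mom: "\<And>m. (\<lambda>n. \<integral>w. Y n w ^ m \<partial>P n) \<longlonglongrightarrow> (\<integral>w. Y' w ^ m \<partial>P')"
    and f: "continuous_on UNIV f"
  shows "(\<lambda>n. \<integral>w. f (Y n w) \<partial>P n) \<longlonglongrightarrow> (\<integral>w. f (Y' w) \<partial>P')"
proof (rule LIMSEQ_I)
  fix e :: real assume e: "0 < e"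
  have fm [measurable]: "f \<in> borel_measurable borel" using f by (rule borel_measurable_continuous_onI)
  have "compact {0..1::real}" "continuous_on {0..1} f"
    using f by (auto intro: continuous_on_subset)
  then obtain p where p: "real_polynomial_function p" "\<And>x. x \<in> {0..1} \<Longrightarrow> \<bar>f x - p x\<bar> < e/3"
    using Stone_Weierstrass_real_polynomial_function[of "{0..1}" f "e/3"] e by auto
  then obtain a d where p_sum: "p = (\<lambda>x. \<Sum>i\<le>d. a i * x ^ i)"
    by (auto simp: real_polynomial_function_iff_sum)
  have pm [measurable]: "p \<in> borel_measurable borel" unfolding p_sum by measurable
  obtain B where B: "\<And>x. x \<in> {0..1} \<Longrightarrow> \<bar>f x\<bar> \<le> B"
    using compact_continuous_image[OF \<open>continuous_on {0..1} f\<close> \<open>compact {0..1}\<close>]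
    by (fastforce dest!: compact_imp_bounded simp: bounded_iff)
  \<comment> \<open>Stated for an arbitrary probability space because it serves the members of the
    sequence and the limit, which live on different types.\<close>
  have main: "\<bar>(\<integral>w. f (Z w) \<partial>Q) - (\<integral>w. p (Z w) \<partial>Q)\<bar> \<le> e/3 \<and>
      (\<integral>w. p (Z w) \<partial>Q) = (\<Sum>i\<le>d. a i * (\<integral>w. Z w ^ i \<partial>Q))"
    if Q: "prob_space Q" and Z [measurable]: "Z \<in> borel_measurable Q" and Z01: "\<And>w. 0 \<le> Z w \<and> Z w \<le> 1"
    for Q :: "'c measure" and Z
  proof -
    interpret Q: prob_space Q by fact
    have fi: "integrable Q (\<lambda>w. f (Z w))"
      by (rule Q.integrable_const_bound[where B=B]) (use Z01 B in auto)
    have zi: "integrable Q (\<lambda>w. Z w ^ i)" for i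
      by (rule Q.integrable_const_bound[where B=1]) (use Z01 in \<open>auto simp: power_le_one\<close>)
    then have pi: "integrable Q (\<lambda>w. p (Z w))" unfolding p_sum by auto
    have "\<bar>(\<integral>w. f (Z w) \<partial>Q) - (\<integral>w. p (Z w) \<partial>Q)\<bar> = \<bar>\<integral>w. f (Z w) - p (Z w) \<partial>Q\<bar>"
      using fi pi by simp
    also have "\<dots> \<le> (\<integral>w. \<bar>f (Z w) - p (Z w)\<bar> \<partial>Q)" by (rule integral_abs_bound)
    also have "\<dots> \<le> (\<integral>w. e/3 \<partial>Q)"
      using fi pi p(2) Z01 by (intro integral_mono) (auto intro: less_imp_le)
    also have "\<dots> = e/3" by (simp add: Q.prob_space)
    finally show ?thesis using zi by (simp add: p_sum)
  qed
  have "(\<lambda>n. \<integral>w. p (Y n w) \<partial>P n) \<longlonglongrightarrow> (\<integral>w. p (Y' w) \<partial>P')"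
  proof -
    have 1: "(\<integral>w. p (Y n w) \<partial>P n) = (\<Sum>i\<le>d. a i * (\<integral>w. Y n w ^ i \<partial>P n))" for n
      using main[OF P[of n] Y[of n] Y01[of n]] by blast
    have 2: "(\<integral>w. p (Y' w) \<partial>P') = (\<Sum>i\<le>d. a i * (\<integral>w. Y' w ^ i \<partial>P'))"
      using main[OF P' Y' Y'01] by blast
    show ?thesis unfolding 1 2 by (intro tendsto_intros mom)
  qed
  from LIMSEQ_D[OF this, of "e/3"] e obtain n0 where
    *: "\<And>n. n \<ge> n0 \<Longrightarrow> \<bar>(\<integral>w. p (Y n w) \<partial>P n) - (\<integral>w. p (Y' w) \<partial>P')\<bar> < e/3" by auto
  then have "\<bar>(\<integral>w. f (Y n w) \<partial>P n) - (\<integral>w. f (Y' w) \<partial>P')\<bar> < e" if "n \<ge> n0" for n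
  proof -
    have "\<bar>(\<integral>w. f (Y n w) \<partial>P n) - (\<integral>w. p (Y n w) \<partial>P n)\<bar> \<le> e/3"
      using main[OF P[of n] Y[of n] Y01[of n]] by blast
    moreover have "\<bar>(\<integral>w. f (Y' w) \<partial>P') - (\<integral>w. p (Y' w) \<partial>P')\<bar> \<le> e/3"
      using main[OF P' Y' Y'01] by blast
    moreover have "\<bar>(\<integral>w. p (Y n w) \<partial>P n) - (\<integral>w. p (Y' w) \<partial>P')\<bar> < e/3"
      using that * by blast
    ultimately show ?thesis unfolding abs_le_iff abs_less_iff by linarith
  qed
  then show "\<exists>no. \<forall>n\<ge>no. norm ((\<integral>w. f (Y n w) \<partial>P n) - (\<integral>w. f (Y' w) \<partial>P')) < e" by auto
qed

text \<open>The values of a Laplace transform at the integers are the moments of $e^{-Q}$, which lies in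
$[0, 1]$; so polynomial approximation replaces a continuity theorem here.\<close>
lemma laplace_tail_sandwich:
  fixes P :: "nat \<Rightarrow> 'a measure" and Q :: "nat \<Rightarrow> 'a \<Rightarrow> real" and P' :: "'b measure" and Q' :: "'b \<Rightarrow> real"
  assumes P: "\<And>n. prob_space (P n)" and P': "prob_space P'"
    and Q [measurable]: "\<And>n. Q n \<in> borel_measurable (P n)" and Q0: "\<And>n w. 0 \<le> Q n w"
    and Q' [measurable]: "Q' \<in> borel_measurable P'" and Q'0: "\<And>w. 0 \<le> Q' w"
    and lap: "\<And>m::nat. (\<lambda>n. \<integral>w. exp (- (real m * Q n w)) \<partial>P n) \<longlonglongrightarrow> (\<integral>w. exp (- (real m * Q' w)) \<partial>P')"
    and \<eta>: "0 < \<eta>"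
  shows "\<forall>\<^sub>F n in sequentially. measure P' {w \<in> space P'. x + \<eta> \<le> Q' w} - \<eta> \<le> measure (P n) {w \<in> space (P n). x \<le> Q n w}"
    and "\<forall>\<^sub>F n in sequentially. measure (P n) {w \<in> space (P n). x \<le> Q n w} \<le> measure P' {w \<in> space P'. x - \<eta> \<le> Q' w} + \<eta>"
proof -
  have key: "\<exists>f. continuous_on UNIV f \<and> (\<forall>q. of_bool (z + \<eta> \<le> q) \<le> f (exp (- q)) \<and> f (exp (- q)) \<le> of_bool (z \<le> q))
      \<and> (\<forall>y. 0 \<le> f y \<and> f y \<le> (1::real))" for z :: real
  proof -
    define a b where "a = exp (- z)" and "b = exp (- (z + \<eta>))"
    have ab: "b < a" using \<eta> by (simp add: a_def b_def)
    \<comment> \<open>A ramp in the variable \<open>exp (- q)\<close>. The map is decreasing, so the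
      ramp is 1 below \<open>b\<close> (large \<open>q\<close>) and 0 above \<open>a\<close> (small
      \<open>q\<close>), and it interpolates between the indicators of the two tails.\<close>
    define f where "f y = max 0 (min 1 ((a - y) / (a - b)))" for y
    have "continuous_on UNIV f" unfolding f_def[abs_def] using ab by (intro continuous_intros) auto
    moreover have "of_bool (z + \<eta> \<le> q) \<le> f (exp (- q)) \<and> f (exp (- q)) \<le> of_bool (z \<le> q)" for q
    proof -
      have 1: "f (exp (- q)) = 1" if "z + \<eta> \<le> q"
      proof -
        have "exp (- q) \<le> b" using that by (simp add: b_def)
        then show ?thesis using ab by (simp add: f_def)
      qed
      have 2: "f (exp (- q)) = 0" if "q < z"
      proof -
        have "a \<le> exp (- q)" using that by (simp add: a_def)
        then show ?thesis using ab by (simp add: f_def divide_nonpos_pos)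
      qed
      have "0 \<le> f (exp (- q)) \<and> f (exp (- q)) \<le> 1" by (simp add: f_def)
      with 1 2 show ?thesis by (cases "z + \<eta> \<le> q"; cases "z \<le> q") (auto simp: not_le)
    qed
    moreover have "\<forall>y. 0 \<le> f y \<and> f y \<le> 1" by (simp add: f_def)
    ultimately show ?thesis by blast
  qed
  \<comment> \<open>One ramp yields both inequalities, with the shift \<eta> on opposite sides; the
    two conclusions are the instances at \<open>x\<close> and at \<open>x - \<eta>\<close>.\<close>
  have gen: "\<forall>\<^sub>F n in sequentially.
      measure P' {w \<in> space P'. z + \<eta> \<le> Q' w} - \<eta> \<le> measure (P n) {w \<in> space (P n). z \<le> Q n w} \<and>
      measure (P n) {w \<in> space (P n). z + \<eta> \<le> Q n w} \<le> measure P' {w \<in> space P'. z \<le> Q' w} + \<eta>" for z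
  proof -
    obtain f where fc: "continuous_on UNIV f"
      and f1: "\<And>q. of_bool (z + \<eta> \<le> q) \<le> f (exp (- q))" and f2: "\<And>q. f (exp (- q)) \<le> of_bool (z \<le> q)"
      and f01: "\<And>y. 0 \<le> f y \<and> f y \<le> (1::real)"
      using key[of z] by blast
    have fm [measurable]: "f \<in> borel_measurable borel" using fc by (rule borel_measurable_continuous_onI)
    have bounds: "measure R {w \<in> space R. z + \<eta> \<le> V w} \<le> (\<integral>w. f (exp (- V w)) \<partial>R) \<and>
        (\<integral>w. f (exp (- V w)) \<partial>R) \<le> measure R {w \<in> space R. z \<le> V w}"
      if R: "prob_space R" and V [measurable]: "V \<in> borel_measurable R" for R :: "'c measure" and V
    proof -
      interpret R: prob_space R by fact
      have fi: "integrable R (\<lambda>w. f (exp (- V w)))"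
        by (rule R.integrable_const_bound[where B=1]) (use f01 in auto)
      have "measure R {w \<in> space R. z + \<eta> \<le> V w} = (\<integral>w. indicator {w \<in> space R. z + \<eta> \<le> V w} w \<partial>R)"
        by simp
      also have "\<dots> \<le> (\<integral>w. f (exp (- V w)) \<partial>R)"
      proof (intro integral_mono fi)
        fix w assume "w \<in> space R"
        then show "indicat_real {w \<in> space R. z + \<eta> \<le> V w} w \<le> f (exp (- V w))"
          using f1[of "V w"] by (simp add: indicator_def)
      qed (auto intro!: integrable_real_indicator simp: R.emeasure_eq_measure)
      finally have *: "measure R {w \<in> space R. z + \<eta> \<le> V w} \<le> (\<integral>w. f (exp (- V w)) \<partial>R)" .
      have "(\<integral>w. f (exp (- V w)) \<partial>R) \<le> (\<integral>w. indicator {w \<in> space R. z \<le> V w} w \<partial>R)"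
      proof (intro integral_mono fi)
        fix w assume "w \<in> space R"
        then show "f (exp (- V w)) \<le> indicat_real {w \<in> space R. z \<le> V w} w"
          using f2[of "V w"] by (simp add: indicator_def)
      qed (auto intro!: integrable_real_indicator simp: R.emeasure_eq_measure)
      with * show ?thesis by simp
    qed
    have "(\<lambda>n. \<integral>w. f (exp (- Q n w)) \<partial>P n) \<longlonglongrightarrow> (\<integral>w. f (exp (- Q' w)) \<partial>P')"
    proof (rule moments_polynomial_tendsto[OF P P' _ _ _ _ _ fc])
      fix m
      show "(\<lambda>n. \<integral>w. exp (- Q n w) ^ m \<partial>P n) \<longlonglongrightarrow> (\<integral>w. exp (- Q' w) ^ m \<partial>P')"
        using lap[of m] by (simp add: exp_of_nat_mult[symmetric])
    qed (use Q0 Q'0 in auto)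
    from order_tendstoD(1)[OF this, of "(\<integral>w. f (exp (- Q' w)) \<partial>P') - \<eta>"]
         order_tendstoD(2)[OF this, of "(\<integral>w. f (exp (- Q' w)) \<partial>P') + \<eta>"] \<eta>
    have "\<forall>\<^sub>F n in sequentially. (\<integral>w. f (exp (- Q' w)) \<partial>P') - \<eta> < (\<integral>w. f (exp (- Q n w)) \<partial>P n)"
      "\<forall>\<^sub>F n in sequentially. (\<integral>w. f (exp (- Q n w)) \<partial>P n) < (\<integral>w. f (exp (- Q' w)) \<partial>P') + \<eta>" by auto
    then show ?thesis
    proof eventually_elim
      case (elim n)
      then show ?case using bounds[OF P[of n] Q[of n]] bounds[OF P' Q'] by linarith
    qed
  qed
  show "\<forall>\<^sub>F n in sequentially. measure P' {w \<in> space P'. x + \<eta> \<le> Q' w} - \<eta> \<le> measure (P n) {w \<in> space (P n). x \<le> Q n w}"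
    using gen[of x] by eventually_elim simp
  show "\<forall>\<^sub>F n in sequentially. measure (P n) {w \<in> space (P n). x \<le> Q n w} \<le> measure P' {w \<in> space P'. x - \<eta> \<le> Q' w} + \<eta>"
    using gen[of "x - \<eta>"] by eventually_elim simp
qed

section \<open>Quadratic forms in Gaussian vectors\<close>

abbreviation gauss :: "'i set \<Rightarrow> ('i \<Rightarrow> real) measure" where
  "gauss I \<equiv> Pi\<^sub>M I (\<lambda>_. std_normal_distribution)"

lemma prob_space_gauss: "prob_space (gauss I)"
  using real_dist_normal_dist by (intro prob_space_PiM) (simp add: real_distribution_def)

lemma measurable_gauss_component [measurable (raw)]: "i \<in> I \<Longrightarrow> (\<lambda>z. z i) \<in> borel_measurable (gauss I)"
  using measurable_component_singleton[of i I "\<lambda>_. std_normal_distribution"] by simp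

lemma product_sigma_finite_gauss: "product_sigma_finite (\<lambda>_. std_normal_distribution)"
  using real_dist_normal_dist
  by (simp add: product_sigma_finite_def real_distribution_def prob_space_imp_sigma_finite)

lemma iexp_add: "iexp (a + b) = iexp a * iexp b"
  by (simp add: distrib_left exp_add)

lemma iexp_sum: "finite I \<Longrightarrow> iexp (\<Sum>i\<in>I. f i) = (\<Prod>i\<in>I. iexp (f i))"
  by (induction I rule: finite_induct) (simp_all add: iexp_add del: of_real_add)

lemma integrable_iexp_std_normal: "integrable std_normal_distribution (\<lambda>x. iexp (c * x))"
proof -
  interpret real_distribution std_normal_distribution by (rule real_dist_normal_dist)
  show ?thesis by (rule integrable_const_bound[where B=1]) auto
qed

lemma integral_gauss_iexp:
  assumes fin: "finite I"
  shows "(\<integral>z. iexp (\<Sum>i\<in>I. c i * z i) \<partial>gauss I) = complex_of_real (exp (- (\<Sum>i\<in>I. (c i)\<^sup>2) / 2))"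
proof -
  interpret S: product_sigma_finite "\<lambda>_. std_normal_distribution" by (rule product_sigma_finite_gauss)
  have "(\<integral>z. iexp (\<Sum>i\<in>I. c i * z i) \<partial>gauss I) = (\<integral>z. (\<Prod>i\<in>I. iexp (c i * z i)) \<partial>gauss I)"
    by (simp only: iexp_sum[OF fin])
  also have "\<dots> = (\<Prod>i\<in>I. \<integral>x. iexp (c i * x) \<partial>std_normal_distribution)"
    by (rule S.product_integral_prod[OF fin]) (rule integrable_iexp_std_normal)
  also have "\<dots> = (\<Prod>i\<in>I. complex_of_real (exp (- ((c i)\<^sup>2) / 2)))"
    using char_std_normal_distribution[unfolded char_def, THEN fun_cong]
    by (intro prod.cong refl) (simp del: of_real_mult)
  also have "\<dots> = complex_of_real (exp (\<Sum>i\<in>I. - ((c i)\<^sup>2) / 2))"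
    by (simp add: exp_sum fin)
  also have "(\<Sum>i\<in>I. - ((c i)\<^sup>2) / 2) = - (\<Sum>i\<in>I. (c i)\<^sup>2) / 2"
    by (simp add: sum_negf sum_divide_distrib)
  finally show ?thesis .
qed

text \<open>Writing $e^{-x^2}$ as a Gaussian average of characters reduces Laplace transforms of
quadratic forms to characteristic functions.\<close>
lemma laplace_quadratic_form:
  fixes S :: "'i \<Rightarrow> 'a \<Rightarrow> real"
  assumes fin: "finite I" and Q: "prob_space Q" and S [measurable]: "\<And>i. i \<in> I \<Longrightarrow> S i \<in> borel_measurable Q"
  shows "complex_of_real (\<integral>w. exp (- (\<Sum>i\<in>I. (s i)\<^sup>2 * (S i w)\<^sup>2) / 2) \<partial>Q) =
      (\<integral>g. (\<integral>w. iexp (\<Sum>i\<in>I. s i * g i * S i w) \<partial>Q) \<partial>gauss I)"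
    and "(\<lambda>g. \<integral>w. iexp (\<Sum>i\<in>I. s i * g i * S i w) \<partial>Q) \<in> borel_measurable (gauss I)"
proof -
  interpret Q: prob_space Q by fact
  interpret G: prob_space "gauss I" by (rule prob_space_gauss)
  interpret QG: pair_prob_space Q "gauss I" ..
  interpret GQ: pair_prob_space "gauss I" Q ..
  have m1: "(\<lambda>(w, g). iexp (\<Sum>i\<in>I. s i * g i * S i w)) \<in> borel_measurable (Q \<Otimes>\<^sub>M gauss I)"
    unfolding split_beta' by measurable
  have m2: "(\<lambda>(g, w). iexp (\<Sum>i\<in>I. s i * g i * S i w)) \<in> borel_measurable (gauss I \<Otimes>\<^sub>M Q)"
    unfolding split_beta' by measurable
  show "(\<lambda>g. \<integral>w. iexp (\<Sum>i\<in>I. s i * g i * S i w) \<partial>Q) \<in> borel_measurable (gauss I)"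
    using m2 by (rule Q.borel_measurable_lebesgue_integral)
  have "complex_of_real (\<integral>w. exp (- (\<Sum>i\<in>I. (s i)\<^sup>2 * (S i w)\<^sup>2) / 2) \<partial>Q) =
     (\<integral>w. complex_of_real (exp (- (\<Sum>i\<in>I. (s i)\<^sup>2 * (S i w)\<^sup>2) / 2)) \<partial>Q)"
    by (rule integral_complex_of_real[symmetric])
  also have "\<dots> = (\<integral>w. (\<integral>g. iexp (\<Sum>i\<in>I. s i * g i * S i w) \<partial>gauss I) \<partial>Q)"
  proof (rule Bochner_Integration.integral_cong[OF refl])
    fix w
    show "complex_of_real (exp (- (\<Sum>i\<in>I. (s i)\<^sup>2 * (S i w)\<^sup>2) / 2)) = (\<integral>g. iexp (\<Sum>i\<in>I. s i * g i * S i w) \<partial>gauss I)"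
      using integral_gauss_iexp[OF fin, of "\<lambda>i. s i * S i w"]
      by (simp add: power_mult_distrib mult.commute mult.left_commute)
  qed
  also have "\<dots> = (\<integral>g. (\<integral>w. iexp (\<Sum>i\<in>I. s i * g i * S i w) \<partial>Q) \<partial>gauss I)"
  proof (rule QG.Fubini_integral[symmetric])
    show "integrable (Q \<Otimes>\<^sub>M gauss I) (\<lambda>(w, g). iexp (\<Sum>i\<in>I. s i * g i * S i w))"
      by (rule QG.P.integrable_const_bound[where B=1, OF _ m1]) auto
  qed
  finally show "complex_of_real (\<integral>w. exp (- (\<Sum>i\<in>I. (s i)\<^sup>2 * (S i w)\<^sup>2) / 2) \<partial>Q) =
      (\<integral>g. (\<integral>w. iexp (\<Sum>i\<in>I. s i * g i * S i w) \<partial>Q) \<partial>gauss I)" .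
qed

definition qform :: "'i set \<Rightarrow> ('i \<Rightarrow> real) \<Rightarrow> ('i \<Rightarrow> real) \<Rightarrow> real" where
  "qform I l x = (\<Sum>i\<in>I. l i * (x i)\<^sup>2)"

lemma qform_nonneg: "(\<And>i. i \<in> I \<Longrightarrow> 0 \<le> l i) \<Longrightarrow> 0 \<le> qform I l x"
  by (auto simp: qform_def intro!: sum_nonneg)

text \<open>The Laplace transform of the form is a Gaussian average of characteristic functions of
  linear combinations of the \<open>S n i\<close>. Those converge pointwise by
  \<open>char_lim\<close> and have modulus at most 1, so dominated convergence applies; no
  multivariate continuity theorem enters. The vector \<open>a\<close> becomes the mean of the
  limiting Gaussian vector.\<close>

lemma qform_tail_sandwich:
  fixes P :: "nat \<Rightarrow> 'a measure" and S :: "nat \<Rightarrow> 'i \<Rightarrow> 'a \<Rightarrow> real" and l a :: "'i \<Rightarrow> real"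
  assumes fin: "finite I" and l0: "\<And>i. 0 \<le> l i"
    and P: "\<And>n. prob_space (P n)" and S [measurable]: "\<And>n i. i \<in> I \<Longrightarrow> S n i \<in> borel_measurable (P n)"
    and char_lim: "\<And>u. (\<lambda>n. \<integral>w. iexp (\<Sum>i\<in>I. u i * S n i w) \<partial>P n) \<longlonglongrightarrow>
       complex_of_real (exp (- (\<Sum>i\<in>I. (u i)\<^sup>2) / 2)) * iexp (\<Sum>i\<in>I. u i * a i)"
    and \<eta>: "0 < \<eta>"
  shows "\<forall>\<^sub>F n in sequentially. measure (gauss I) {z \<in> space (gauss I). x + \<eta> \<le> qform I l (\<lambda>i. z i + a i)} - \<eta>
      \<le> measure (P n) {w \<in> space (P n). x \<le> qform I l (\<lambda>i. S n i w)}"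
    and "\<forall>\<^sub>F n in sequentially. measure (P n) {w \<in> space (P n). x \<le> qform I l (\<lambda>i. S n i w)}
      \<le> measure (gauss I) {z \<in> space (gauss I). x - \<eta> \<le> qform I l (\<lambda>i. z i + a i)} + \<eta>"
proof -
  interpret G: prob_space "gauss I" by (rule prob_space_gauss)
  have lap: "(\<lambda>n. \<integral>w. exp (- (real m * qform I l (\<lambda>i. S n i w))) \<partial>P n) \<longlonglongrightarrow>
     (\<integral>z. exp (- (real m * qform I l (\<lambda>i. z i + a i))) \<partial>gauss I)" for m
  proof -
    \<comment> \<open>Chosen so that half of \<open>(s i)\<^sup>2\<close> is the weight
      \<open>m * l i\<close> in the exponent.\<close>
    define s where "s i = sqrt (2 * real m * l i)" for i
    have s2: "(s i)\<^sup>2 = 2 * real m * l i" for i by (simp add: s_def l0)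
    have e: "exp (- (real m * qform I l y)) = exp (- (\<Sum>i\<in>I. (s i)\<^sup>2 * (y i)\<^sup>2) / 2)" for y
      by (simp add: s2 qform_def sum_distrib_left sum_divide_distrib algebra_simps)
    have "(\<lambda>n. \<integral>g. (\<integral>w. iexp (\<Sum>i\<in>I. s i * g i * S n i w) \<partial>P n) \<partial>gauss I) \<longlonglongrightarrow>
       (\<integral>g. (\<integral>z. iexp (\<Sum>i\<in>I. s i * g i * (z i + a i)) \<partial>gauss I) \<partial>gauss I)"
    proof (rule integral_dominated_convergence[where w="\<lambda>_. 1"])
      show "(\<lambda>g. \<integral>z. iexp (\<Sum>i\<in>I. s i * g i * (z i + a i)) \<partial>gauss I) \<in> borel_measurable (gauss I)"
        using fin prob_space_gauss by (rule laplace_quadratic_form(2)) measurable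
      show "(\<lambda>g. \<integral>w. iexp (\<Sum>i\<in>I. s i * g i * S n i w) \<partial>P n) \<in> borel_measurable (gauss I)" for n
        using fin P S by (rule laplace_quadratic_form(2))
      show "AE g in gauss I. (\<lambda>n. \<integral>w. iexp (\<Sum>i\<in>I. s i * g i * S n i w) \<partial>P n) \<longlonglongrightarrow>
         (\<integral>z. iexp (\<Sum>i\<in>I. s i * g i * (z i + a i)) \<partial>gauss I)"
      proof (rule AE_I2)
        fix g
        have "(\<integral>z. iexp (\<Sum>i\<in>I. s i * g i * (z i + a i)) \<partial>gauss I) =
          (\<integral>z. iexp (\<Sum>i\<in>I. s i * g i * a i) * iexp (\<Sum>i\<in>I. (s i * g i) * z i) \<partial>gauss I)"
          by (simp only: iexp_add[symmetric] sum.distrib[symmetric]) (simp add: algebra_simps)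
        also have "\<dots> = iexp (\<Sum>i\<in>I. s i * g i * a i) * (\<integral>z. iexp (\<Sum>i\<in>I. (s i * g i) * z i) \<partial>gauss I)"
          by (rule integral_mult_right_zero)
        also have "\<dots> = complex_of_real (exp (- (\<Sum>i\<in>I. (s i * g i)\<^sup>2) / 2)) * iexp (\<Sum>i\<in>I. s i * g i * a i)"
          unfolding integral_gauss_iexp[OF fin] by (rule mult.commute)
        finally show "(\<lambda>n. \<integral>w. iexp (\<Sum>i\<in>I. s i * g i * S n i w) \<partial>P n) \<longlonglongrightarrow>
         (\<integral>z. iexp (\<Sum>i\<in>I. s i * g i * (z i + a i)) \<partial>gauss I)"
          using char_lim[of "\<lambda>i. s i * g i"] by simp
      qed
      show "AE g in gauss I. norm (\<integral>w. iexp (\<Sum>i\<in>I. s i * g i * S n i w) \<partial>P n) \<le> 1" for n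
      proof (rule AE_I2)
        fix g
        interpret Pn: prob_space "P n" by (rule P)
        have "norm (\<integral>w. iexp (\<Sum>i\<in>I. s i * g i * S n i w) \<partial>P n) \<le> (\<integral>w. norm (iexp (\<Sum>i\<in>I. s i * g i * S n i w)) \<partial>P n)"
          by (rule integral_norm_bound)
        also have "\<dots> = 1" by (simp add: Pn.prob_space del: of_real_sum)
        finally show "norm (\<integral>w. iexp (\<Sum>i\<in>I. s i * g i * S n i w) \<partial>P n) \<le> 1" .
      qed
    qed simp
    then have "(\<lambda>n. complex_of_real (\<integral>w. exp (- (\<Sum>i\<in>I. (s i)\<^sup>2 * (S n i w)\<^sup>2) / 2) \<partial>P n)) \<longlonglongrightarrow>
      complex_of_real (\<integral>z. exp (- (\<Sum>i\<in>I. (s i)\<^sup>2 * (z i + a i)\<^sup>2) / 2) \<partial>gauss I)"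
      using laplace_quadratic_form(1)[OF fin P S, where s=s]
        laplace_quadratic_form(1)[OF fin prob_space_gauss, where S="\<lambda>i z. z i + a i" and s=s]
      by simp
    then show ?thesis unfolding e tendsto_of_real_iff .
  qed
  have m1: "(\<lambda>w. qform I l (\<lambda>i. S n i w)) \<in> borel_measurable (P n)" for n
    unfolding qform_def by measurable
  have m2: "(\<lambda>z. qform I l (\<lambda>i. z i + a i)) \<in> borel_measurable (gauss I)"
    unfolding qform_def by measurable
  show "\<forall>\<^sub>F n in sequentially. measure (gauss I) {z \<in> space (gauss I). x + \<eta> \<le> qform I l (\<lambda>i. z i + a i)} - \<eta>
      \<le> measure (P n) {w \<in> space (P n). x \<le> qform I l (\<lambda>i. S n i w)}"
    by (rule laplace_tail_sandwich(1)[OF P prob_space_gauss m1 _ m2 _ lap \<eta>]) (auto intro: qform_nonneg l0)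
  show "\<forall>\<^sub>F n in sequentially. measure (P n) {w \<in> space (P n). x \<le> qform I l (\<lambda>i. S n i w)}
      \<le> measure (gauss I) {z \<in> space (gauss I). x - \<eta> \<le> qform I l (\<lambda>i. z i + a i)} + \<eta>"
    by (rule laplace_tail_sandwich(2)[OF P prob_space_gauss m1 _ m2 _ lap \<eta>]) (auto intro: qform_nonneg l0)
qed

section \<open>Effect of a shift on the tails of a Gaussian quadratic form\<close>

lemma std_normal_density_le_1: "std_normal_density x \<le> 1"
proof -
  have "1 \<le> sqrt (2 * pi)" using pi_gt3 by (simp add: real_le_rsqrt)
  then have "1 / sqrt (2 * pi) \<le> 1" by simp
  moreover have "exp (- x\<^sup>2 / 2) \<le> 1" by simp
  ultimately show ?thesis unfolding std_normal_density_def
    by (intro mult_le_one) auto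
qed

lemma std_normal_interval_le:
  assumes "a \<le> b"
  shows "measure std_normal_distribution {a..b} \<le> b - a"
proof -
  interpret real_distribution std_normal_distribution by (rule real_dist_normal_dist)
  have "emeasure std_normal_distribution {a..b} = (\<integral>\<^sup>+x. ennreal (std_normal_density x) * indicator {a..b} x \<partial>lborel)"
    by (subst emeasure_density) auto
  also have "\<dots> \<le> (\<integral>\<^sup>+x. indicator {a..b} x \<partial>lborel)"
    using std_normal_density_le_1 by (intro nn_integral_mono) (auto simp: indicator_def)
  also have "\<dots> = ennreal (b - a)" using assms by simp
  finally show ?thesis using assms by (simp add: emeasure_eq_measure)
qed

text \<open>The set lies in two symmetric intervals, and subadditivity of the square root bounds
  their lengths by a quantity that depends on \<open>b - a\<close> only. The uniformity in the
  location is what slicing requires, since there the remaining coordinates move the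
  location.\<close>

lemma std_normal_square_concentration:
  assumes "0 < l" "a \<le> b"
  shows "measure std_normal_distribution {z. a \<le> l * z\<^sup>2 \<and> l * z\<^sup>2 < b} \<le> 2 * sqrt ((b - a) / l)"
proof -
  interpret real_distribution std_normal_distribution by (rule real_dist_normal_dist)
  define p q where "p = sqrt (max 0 a / l)" and "q = sqrt (max 0 b / l)"
  have pq: "p \<le> q" using assms by (auto simp: p_def q_def intro!: divide_right_mono)
  have "q \<le> p + sqrt ((b - a) / l)"
  proof -
    have "max 0 b / l \<le> max 0 a / l + (b - a) / l"
      unfolding add_divide_distrib[symmetric] using assms by (intro divide_right_mono) auto
    then have "q \<le> sqrt (max 0 a / l + (b - a) / l)" unfolding q_def by simp
    also have "\<dots> \<le> p + sqrt ((b - a) / l)"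
      unfolding p_def using assms by (intro sqrt_add_le_add_sqrt) auto
    finally show ?thesis .
  qed
  have "{z. a \<le> l * z\<^sup>2 \<and> l * z\<^sup>2 < b} \<subseteq> {p..q} \<union> {-q..-p}"
  proof
    fix z assume z: "z \<in> {z. a \<le> l * z\<^sup>2 \<and> l * z\<^sup>2 < b}"
    have "p \<le> \<bar>z\<bar>"
    proof -
      have "max 0 a / l \<le> z\<^sup>2" using z assms by (auto simp: pos_divide_le_eq mult.commute)
      then show ?thesis unfolding p_def by (metis real_sqrt_abs real_sqrt_le_iff)
    qed
    moreover have "\<bar>z\<bar> \<le> q"
    proof -
      have "z\<^sup>2 \<le> max 0 b / l" using z assms by (auto simp: pos_le_divide_eq mult.commute)
      then show ?thesis unfolding q_def by (metis real_sqrt_abs real_sqrt_le_iff)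
    qed
    ultimately show "z \<in> {p..q} \<union> {-q..-p}" by auto
  qed
  then have "prob {z. a \<le> l * z\<^sup>2 \<and> l * z\<^sup>2 < b} \<le> prob ({p..q} \<union> {-q..-p})"
    by (intro finite_measure_mono) auto
  also have "\<dots> \<le> prob {p..q} + prob {-q..-p}"
    by (rule measure_Un_le) auto
  also have "\<dots> \<le> (q - p) + (-p - (-q))"
    using pq by (intro add_mono std_normal_interval_le) auto
  also have "\<dots> \<le> 2 * sqrt ((b - a) / l)" using \<open>q \<le> p + _\<close> by simp
  finally show ?thesis .
qed

lemma std_normal_antiderivative:
  obtains F where "\<And>x. (F has_real_derivative std_normal_density x) (at x)"
    and "\<And>a b. a \<le> b \<Longrightarrow> measure std_normal_distribution {a<..<b} = F b - F a"
proof -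
  interpret real_distribution std_normal_distribution by (rule real_dist_normal_dist)
  have cont: "isCont std_normal_density x" for x
    unfolding std_normal_density_def[abs_def] by (intro continuous_intros) auto
  have "\<exists>F. \<forall>x. -\<infinity> < ereal x \<longrightarrow> ereal x < \<infinity> \<longrightarrow> (F has_vector_derivative std_normal_density x) (at x)"
    by (rule einterval_antiderivative) (auto simp: cont)
  then obtain F where F: "\<And>x. (F has_real_derivative std_normal_density x) (at x)"
    by (auto simp: has_real_derivative_iff_has_vector_derivative)
  have "measure std_normal_distribution {a<..<b} = F b - F a" if "a \<le> b" for a b
  proof -
    have "measure std_normal_distribution {a<..<b} = (\<integral>x. std_normal_density x * indicator {a<..<b} x \<partial>lborel)"
      by (intro measure_density_eq_integral) (auto simp: integrable_normal_density)
    also have "\<dots> = (\<integral>x. std_normal_density x * indicator {a..b} x \<partial>lborel)"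
    proof (rule integral_cong_AE)
      have "AE x in lborel. x \<noteq> a" "AE x in lborel. x \<noteq> b" by (auto intro: AE_lborel_singleton)
      then show "AE x in lborel. std_normal_density x * indicator {a<..<b} x = std_normal_density x * indicator {a..b} x"
        by eventually_elim (auto simp: indicator_def)
    qed auto
    also have "\<dots> = F b - F a"
      by (rule integral_FTC_Icc_real[OF that F cont])
    finally show ?thesis .
  qed
  with F that show ?thesis by blast
qed

text \<open>Up to sign this is the derivative, in the shift \<open>y\<close>, of the mass of an
  interval of half-width \<open>x\<close>; the factorization shows its sign and size for
  \<open>x\<close> and \<open>y\<close> nonnegative.\<close>

lemma std_normal_density_shift_diff:
  "std_normal_density (y - x) - std_normal_density (y + x) = std_normal_density (y + x) * (exp (2 * y * x) - 1)"
proof -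
  have "exp (- (y - x)\<^sup>2 / 2) = exp (- (y + x)\<^sup>2 / 2) * exp (2 * y * x)"
    by (simp add: exp_add[symmetric] power2_eq_square field_simps)
  then show ?thesis by (simp add: std_normal_density_def right_diff_distrib)
qed

text \<open>The mass of a shifted interval is a difference of values of an antiderivative and can be
  differentiated in the shift: it is even, and decreasing for nonnegative shifts. The third claim is
  the quantitative version, uniform over radii in \<open>[x1, x2]\<close>.\<close>

lemma std_normal_ball_shift:
  defines "p \<equiv> \<lambda>x a. measure std_normal_distribution {z. \<bar>z + a\<bar> < x}"
  shows "p x \<bar>a\<bar> = p x a" "0 \<le> a \<Longrightarrow> a \<le> b \<Longrightarrow> 0 \<le> x \<Longrightarrow> p x b \<le> p x a"
    "0 < x1 \<Longrightarrow> 0 < a \<Longrightarrow> x1 \<le> x \<Longrightarrow> x \<le> x2 \<Longrightarrow>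
      p x a + a / 2 * (std_normal_density (a + x2) * (a * x1)) \<le> p x 0"
proof -
  interpret real_distribution std_normal_distribution by (rule real_dist_normal_dist)
  obtain F where F: "\<And>x. (F has_real_derivative std_normal_density x) (at x)"
    and mF: "\<And>a b. a \<le> b \<Longrightarrow> measure std_normal_distribution {a<..<b} = F b - F a"
    using std_normal_antiderivative by blast
  \<comment> \<open>Evenness of the density makes \<open>F x + F (- x)\<close> constant.\<close>
  have refl_F: "F (- c) - F (- d) = F d - F c" if "c \<le> d" for c d
  proof -
    have "((\<lambda>x. F x + F (- x)) has_real_derivative (std_normal_density x + std_normal_density (- x) * (- 1))) (at x)" for x
      by (intro DERIV_add F DERIV_chain2[OF F] DERIV_minus DERIV_ident)
    then have "((\<lambda>x. F x + F (- x)) has_real_derivative 0) (at x)" for x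
      by (simp add: std_normal_density_def)
    then have "F c + F (- c) = F d + F (- d)"
      using DERIV_isconst_all[of "\<lambda>x. F x + F (- x)" c d] by auto
    then show ?thesis by linarith
  qed
  have pF: "p x a = F (x + a) - F (a - x)" if "0 \<le> x" for x a
  proof -
    have "{z. \<bar>z + a\<bar> < x} = {- x - a<..<x - a}" by auto
    then have "p x a = F (x - a) - F (- x - a)" using mF that by (simp add: p_def)
    also have "\<dots> = F (x + a) - F (a - x)"
      using refl_F[of "a - x" "x + a"] that by simp
    finally show ?thesis .
  qed
  have pneg: "p x (- a) = p x a" for x a
  proof (cases "0 \<le> x")
    case True
    then show ?thesis using refl_F[of "- a - x" "x - a"] by (simp add: pF algebra_simps)
  next
    case False
    then have "{z. \<bar>z + a\<bar> < x} = {}" "{z. \<bar>z - a\<bar> < x} = {}" by auto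
    then show ?thesis unfolding p_def by (simp del: Collect_empty_eq)
  qed
  show "p x \<bar>a\<bar> = p x a" using pneg by (simp add: abs_if)
  have dp: "((\<lambda>a. F (x + a) - F (a - x)) has_real_derivative (std_normal_density (x + a) - std_normal_density (a - x))) (at a)" for x a
  proof -
    have "((\<lambda>a. F (x + a) - F (a - x)) has_real_derivative (std_normal_density (x + a) * (0 + 1) - std_normal_density (a - x) * (1 - 0))) (at a)"
      by (intro DERIV_diff DERIV_chain2[OF F] DERIV_add DERIV_const DERIV_ident)
    then show ?thesis by simp
  qed
  have mono: "p x b \<le> p x a" if "0 \<le> a" "a \<le> b" "0 \<le> x" for a b x
  proof -
    have "F (x + b) - F (b - x) \<le> F (x + a) - F (a - x)"
    proof (rule DERIV_nonpos_imp_nonincreasing[OF that(2)])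
      fix y assume "a \<le> y" "y \<le> b"
      then have "0 \<le> std_normal_density (y + x) * (exp (2 * y * x) - 1)" using that by auto
      then have "std_normal_density (x + y) - std_normal_density (y - x) \<le> 0"
        unfolding std_normal_density_shift_diff[symmetric] by (simp add: add.commute)
      then show "\<exists>d. ((\<lambda>a. F (x + a) - F (a - x)) has_real_derivative d) (at y) \<and> d \<le> 0"
        using dp by blast
    qed
    then show ?thesis using pF that by simp
  qed
  show "0 \<le> a \<Longrightarrow> a \<le> b \<Longrightarrow> 0 \<le> x \<Longrightarrow> p x b \<le> p x a" by (rule mono)
  assume A: "0 < x1" "0 < a" "x1 \<le> x" "x \<le> x2"
  \<comment> \<open>The derivative vanishes at shift 0, so the mean value theorem is applied on the
    upper half \<open>[a/2, a]\<close> only; there \<open>2 * \<xi> * x\<close> is at least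
    \<open>a * x1\<close>. On the lower half monotonicity suffices.\<close>
  have "\<exists>\<xi>>a/2. \<xi> < a \<and> (F (x + a) - F (a - x)) - (F (x + a/2) - F (a/2 - x)) =
    (a - a/2) * (std_normal_density (x + \<xi>) - std_normal_density (\<xi> - x))"
    using A by (intro MVT2 dp) auto
  then obtain \<xi> where \<xi>: "a/2 < \<xi>" "\<xi> < a" and eq: "p x a - p x (a/2) =
    - (a/2) * (std_normal_density (\<xi> + x) * (exp (2 * \<xi> * x) - 1))"
    using A unfolding std_normal_density_shift_diff[symmetric] by (auto simp: pF algebra_simps)
  have "std_normal_density (a + x2) \<le> std_normal_density (\<xi> + x)"
  proof -
    have "(\<xi> + x)\<^sup>2 \<le> (a + x2)\<^sup>2" using \<xi> A by (intro power_mono) auto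
    then show ?thesis by (simp add: std_normal_density_def divide_right_mono)
  qed
  moreover have "a * x1 \<le> exp (2 * \<xi> * x) - 1"
  proof -
    have "a * x1 \<le> (2 * \<xi>) * x" using \<xi> A by (intro mult_mono) auto
    then show ?thesis using exp_ge_add_one_self[of "2 * \<xi> * x"] by linarith
  qed
  ultimately have "std_normal_density (a + x2) * (a * x1) \<le> std_normal_density (\<xi> + x) * (exp (2 * \<xi> * x) - 1)"
    using A by (intro mult_mono) auto
  then have "a / 2 * (std_normal_density (a + x2) * (a * x1)) \<le> a / 2 * (std_normal_density (\<xi> + x) * (exp (2 * \<xi> * x) - 1))"
    using A by (intro mult_left_mono) auto
  then have "p x a + a / 2 * (std_normal_density (a + x2) * (a * x1)) \<le> p x (a/2)"
    using eq by linarith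
  also have "\<dots> \<le> p x 0" using A by (intro mono) auto
  finally show "p x a + a / 2 * (std_normal_density (a + x2) * (a * x1)) \<le> p x 0" .
qed

lemma prob_space_std_normal: "prob_space std_normal_distribution"
  using real_dist_normal_dist by (simp add: real_distribution_def)

lemma sigma_finite_std_normal: "sigma_finite_measure std_normal_distribution"
  using prob_space_std_normal by (rule prob_space_imp_sigma_finite)

lemma qform_insert_measurable:
  assumes "finite J" "i \<notin> J"
  shows "(\<lambda>z. c * (z i + a)\<^sup>2 + qform J l (\<lambda>j. z j + b j)) \<in> borel_measurable (gauss (insert i J))"
proof -
  have "(\<lambda>z. z j) \<in> borel_measurable (gauss (insert i J))" if "j \<in> insert i J" for j
    using that by (intro measurable_gauss_component)
  then show ?thesis unfolding qform_def
    by (intro borel_measurable_add borel_measurable_times borel_measurable_power borel_measurable_sum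
        borel_measurable_const) auto
qed

lemma qform_measurable: "(\<lambda>z. qform J l (\<lambda>j. z j + b j)) \<in> borel_measurable (gauss J)"
  unfolding qform_def by measurable

text \<open>Fubini with coordinate \<open>i\<close> innermost. The set \<open>B\<close> is kept
  general because half-lines are needed for the shift comparison and thin shells for
  anticoncentration.\<close>

lemma gauss_slice:
  assumes J: "finite J" "i \<notin> J" and B [measurable]: "B \<in> sets borel"
  shows "measure (gauss (insert i J)) {z \<in> space (gauss (insert i J)). c * (z i + a)\<^sup>2 + qform J l (\<lambda>j. z j + b j) \<in> B} =
    (\<integral>x. measure std_normal_distribution {y. c * (y + a)\<^sup>2 + qform J l (\<lambda>j. x j + b j) \<in> B} \<partial>gauss J)"
    and "integrable (gauss J) (\<lambda>x. measure std_normal_distribution {y. c * (y + a)\<^sup>2 + qform J l (\<lambda>j. x j + b j) \<in> B})"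
proof -
  interpret G: prob_space "gauss (insert i J)" by (rule prob_space_gauss)
  interpret GJ: prob_space "gauss J" by (rule prob_space_gauss)
  interpret S: product_sigma_finite "\<lambda>_. std_normal_distribution" by (rule product_sigma_finite_gauss)
  define f where "f z = (indicator B (c * (z i + a)\<^sup>2 + qform J l (\<lambda>j. z j + b j)) :: real)" for z
  have Qm: "(\<lambda>z. c * (z i + a)\<^sup>2 + qform J l (\<lambda>j. z j + b j)) \<in> borel_measurable (gauss (insert i J))"
    by (rule qform_insert_measurable[OF J])
  have fm: "f \<in> borel_measurable (gauss (insert i J))"
    unfolding f_def[abs_def] by (rule measurable_compose[OF Qm borel_measurable_indicator[OF B]])
  have set_meas: "{z \<in> space (gauss (insert i J)). c * (z i + a)\<^sup>2 + qform J l (\<lambda>j. z j + b j) \<in> B} \<in> sets (gauss (insert i J))"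
  proof -
    have "{z \<in> space (gauss (insert i J)). c * (z i + a)\<^sup>2 + qform J l (\<lambda>j. z j + b j) \<in> B} =
      (\<lambda>z. c * (z i + a)\<^sup>2 + qform J l (\<lambda>j. z j + b j)) -` B \<inter> space (gauss (insert i J))" by blast
    then show ?thesis by (simp only: measurable_sets[OF Qm B])
  qed
  have fi: "integrable (gauss (insert i J)) f"
    using fm by (rule G.integrable_const_bound[where B=1, rotated]) (auto simp: f_def)
  have eq: "f (x(i := y)) = indicator {y. c * (y + a)\<^sup>2 + qform J l (\<lambda>j. x j + b j) \<in> B} y" for x y
  proof -
    have "qform J l (\<lambda>j. (x(i := y)) j + b j) = qform J l (\<lambda>j. x j + b j)"
      unfolding qform_def using J by (intro sum.cong) auto
    then show ?thesis by (simp add: f_def indicator_def)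
  qed
  have sl [measurable]: "{y. c * (y + a)\<^sup>2 + s \<in> B} \<in> sets borel" for s :: real
    by measurable
  have inner: "(\<integral>y. f (x(i := y)) \<partial>std_normal_distribution) =
      measure std_normal_distribution {y. c * (y + a)\<^sup>2 + qform J l (\<lambda>j. x j + b j) \<in> B}" for x
    unfolding eq by simp
  have "measure (gauss (insert i J)) {z \<in> space (gauss (insert i J)). c * (z i + a)\<^sup>2 + qform J l (\<lambda>j. z j + b j) \<in> B} =
     (\<integral>z. indicator {z \<in> space (gauss (insert i J)). c * (z i + a)\<^sup>2 + qform J l (\<lambda>j. z j + b j) \<in> B} z \<partial>gauss (insert i J))"
    (is "measure _ ?A = _")
  proof -
    have "?A \<inter> space (gauss (insert i J)) = ?A" by blast
    then show ?thesis by (simp only: Bochner_Integration.integral_indicator)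
  qed
  also have "\<dots> = (\<integral>z. f z \<partial>gauss (insert i J))"
    by (intro Bochner_Integration.integral_cong[OF refl]) (simp only: f_def indicator_def mem_Collect_eq simp_thms)
  also have "\<dots> = (\<integral>x. (\<integral>y. f (x(i := y)) \<partial>std_normal_distribution) \<partial>gauss J)"
    by (rule S.product_integral_insert[OF J fi])
  finally show "measure (gauss (insert i J)) {z \<in> space (gauss (insert i J)). c * (z i + a)\<^sup>2 + qform J l (\<lambda>j. z j + b j) \<in> B} =
    (\<integral>x. measure std_normal_distribution {y. c * (y + a)\<^sup>2 + qform J l (\<lambda>j. x j + b j) \<in> B} \<partial>gauss J)"
    unfolding inner .
  have m1: "(\<lambda>x. \<integral>y. indicat_real B (c * (y + a)\<^sup>2 + qform J l (\<lambda>j. x j + b j)) \<partial>std_normal_distribution) \<in> borel_measurable (gauss J)"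
  proof (rule sigma_finite_measure.borel_measurable_lebesgue_integral[OF sigma_finite_std_normal])
    have "(\<lambda>p. qform J l (\<lambda>j. fst p j + b j)) \<in> borel_measurable (gauss J \<Otimes>\<^sub>M std_normal_distribution)"
      by (rule measurable_compose[OF measurable_fst qform_measurable])
    moreover have "(\<lambda>p. c * (snd p + a)\<^sup>2) \<in> borel_measurable (gauss J \<Otimes>\<^sub>M std_normal_distribution)"
    proof (rule measurable_compose[OF measurable_snd])
      show "(\<lambda>y. c * (y + a)\<^sup>2) \<in> borel_measurable std_normal_distribution" by simp
    qed
    ultimately have "(\<lambda>p. c * (snd p + a)\<^sup>2 + qform J l (\<lambda>j. fst p j + b j)) \<in> borel_measurable (gauss J \<Otimes>\<^sub>M std_normal_distribution)"
      by (intro borel_measurable_add)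
    from measurable_compose[OF this borel_measurable_indicator[OF B]]
    show "(\<lambda>(x, y). indicat_real B (c * (y + a)\<^sup>2 + qform J l (\<lambda>j. x j + b j)))
        \<in> borel_measurable (gauss J \<Otimes>\<^sub>M std_normal_distribution)"
      unfolding split_beta' .
  qed
  have m2: "(\<integral>y. indicat_real B (c * (y + a)\<^sup>2 + qform J l (\<lambda>j. x j + b j)) \<partial>std_normal_distribution) =
      measure std_normal_distribution {y. c * (y + a)\<^sup>2 + qform J l (\<lambda>j. x j + b j) \<in> B}" for x
  proof -
    have "(\<integral>y. indicat_real B (c * (y + a)\<^sup>2 + qform J l (\<lambda>j. x j + b j)) \<partial>std_normal_distribution) =
      (\<integral>y. indicator {y. c * (y + a)\<^sup>2 + qform J l (\<lambda>j. x j + b j) \<in> B} y \<partial>std_normal_distribution)"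
      by (intro Bochner_Integration.integral_cong) (auto simp: indicator_def)
    also have "\<dots> = measure std_normal_distribution ({y. c * (y + a)\<^sup>2 + qform J l (\<lambda>j. x j + b j) \<in> B} \<inter> space std_normal_distribution)"
      by (rule Bochner_Integration.integral_indicator)
    also have "space std_normal_distribution = UNIV" by simp
    finally show ?thesis unfolding Int_UNIV_right .
  qed
  show "integrable (gauss J) (\<lambda>x. measure std_normal_distribution {y. c * (y + a)\<^sup>2 + qform J l (\<lambda>j. x j + b j) \<in> B})"
  proof (rule GJ.integrable_const_bound[where B=1])
    show "AE x in gauss J. norm (measure std_normal_distribution {y. c * (y + a)\<^sup>2 + qform J l (\<lambda>j. x j + b j) \<in> B}) \<le> 1"
      by (rule AE_I2) (simp only: real_norm_def abs_of_nonneg[OF measure_nonneg] prob_space.prob_le_1[OF prob_space_std_normal])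
  qed (rule m1[unfolded m2])
qed

text \<open>No case split on the sign of \<open>t - s\<close> is needed: the square root takes
  negative values at negative arguments, so for \<open>t < s\<close> the right-hand side is empty,
  as it should be.\<close>

lemma square_plus_less_set:
  fixes c :: real
  assumes "0 < c"
  shows "{y. c * (y + a)\<^sup>2 + s \<in> {..<t}} = {y. \<bar>y + a\<bar> < sqrt ((t - s) / c)}"
proof -
  have 1: "c * (y + a)\<^sup>2 + s < t \<longleftrightarrow> (y + a)\<^sup>2 < (t - s) / c" for y
    using assms by (simp add: pos_less_divide_eq mult.commute less_diff_eq)
  have 2: "(y + a)\<^sup>2 < (t - s) / c \<longleftrightarrow> \<bar>y + a\<bar> < sqrt ((t - s) / c)" for y
    by (metis real_sqrt_abs real_sqrt_less_iff)
  show ?thesis by (simp only: lessThan_iff 1 2)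
qed

lemma slice_shift_le:
  fixes c :: real
  assumes c: "0 < c"
  shows "measure std_normal_distribution {y. c * (y + a)\<^sup>2 + s \<in> {..<t}} \<le>
    measure std_normal_distribution {y. c * (y + 0)\<^sup>2 + s \<in> {..<t}}"
proof (cases "0 \<le> sqrt ((t - s) / c)")
  case True
  then show ?thesis
  proof -
    define x where "x = sqrt ((t - s) / c)"
    have "measure std_normal_distribution {y. \<bar>y + a\<bar> < x} = measure std_normal_distribution {y. \<bar>y + \<bar>a\<bar>\<bar> < x}"
      by (rule std_normal_ball_shift(1)[symmetric])
    also have "\<dots> \<le> measure std_normal_distribution {y. \<bar>y + 0\<bar> < x}"
      by (rule std_normal_ball_shift(2)) (use True x_def in auto)
    finally show ?thesis unfolding square_plus_less_set[OF c] x_def .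
  qed
next
  case False
  then have "\<not> \<bar>y + a\<bar> < sqrt ((t - s) / c)" for y using abs_ge_zero[of "y + a"] by linarith
  then have "{y. \<bar>y + a\<bar> < sqrt ((t - s) / c)} = {}" by blast
  then show ?thesis unfolding square_plus_less_set[OF c] by (simp del: Collect_empty_eq)
qed

lemma gauss_one_shift_le:
  assumes J: "finite J" "i \<notin> J" and c: "0 < c"
  shows "measure (gauss (insert i J)) {z \<in> space (gauss (insert i J)). c * (z i + a)\<^sup>2 + qform J l (\<lambda>j. z j + b j) \<in> {..<t}}
    \<le> measure (gauss (insert i J)) {z \<in> space (gauss (insert i J)). c * (z i + 0)\<^sup>2 + qform J l (\<lambda>j. z j + b j) \<in> {..<t}}"
proof -
  have B: "{..<t} \<in> sets borel" by simp
  show ?thesis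
    unfolding gauss_slice(1)[OF J B]
    by (intro integral_mono gauss_slice(2)[OF J B] slice_shift_le c)
qed

lemma qform_split:
  assumes "finite I" "i \<in> I"
  shows "qform I l x = l i * (x i)\<^sup>2 + qform (I - {i}) l x"
  unfolding qform_def using assms by (simp add: sum.remove)

text \<open>A diagonal case of Anderson's inequality. Because the form is diagonal and the
  coordinates are independent, the shifts can be removed one at a time, each by the one-dimensional
  comparison on slices.\<close>

lemma gauss_shift_remove_le:
  assumes fin: "finite I" and l: "\<And>i. i \<in> I \<Longrightarrow> 0 < l i" and K: "finite K" "K \<subseteq> I"
  shows "measure (gauss I) {z \<in> space (gauss I). qform I l (\<lambda>i. z i + a i) < t} \<le>
    measure (gauss I) {z \<in> space (gauss I). qform I l (\<lambda>i. z i + (if i \<in> K then 0 else a i)) < t}"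
  using K
proof (induction K rule: finite_induct)
  case empty
  show ?case by simp
next
  case (insert k K)
  define J where "J = I - {k}"
  have I: "I = insert k J" "finite J" "k \<notin> J" using insert fin by (auto simp: J_def)
  define b where "b i = (if i \<in> K then 0 else a i)" for i
  define b' where "b' i = (if i \<in> insert k K then 0 else a i)" for i
  have k: "k \<in> I" using insert by auto
  have q1: "qform I l (\<lambda>i. z i + b i) = l k * (z k + b k)\<^sup>2 + qform J l (\<lambda>j. z j + b j)" for z
    using qform_split[OF fin k, of l "\<lambda>i. z i + b i"] by (simp add: J_def)
  have q2: "qform I l (\<lambda>i. z i + b' i) = l k * (z k + 0)\<^sup>2 + qform J l (\<lambda>j. z j + b j)" for z
  proof -
    have "qform J l (\<lambda>i. z i + b' i) = qform J l (\<lambda>j. z j + b j)"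
      unfolding qform_def by (intro sum.cong) (auto simp: J_def b_def b'_def)
    then show ?thesis
      using qform_split[OF fin k, of l "\<lambda>i. z i + b' i"] by (simp add: J_def b'_def)
  qed
  have "measure (gauss I) {z \<in> space (gauss I). qform I l (\<lambda>i. z i + b i) < t} \<le>
    measure (gauss I) {z \<in> space (gauss I). qform I l (\<lambda>i. z i + b' i) < t}"
    using gauss_one_shift_le[OF I(2,3) l[OF k], of "b k" l b t] unfolding I(1)[symmetric]
    by (simp add: q1 q2)
  then show ?case using insert by (simp add: b_def b'_def)
qed

text \<open>The constants depend on the index set only through the weight and shift at one index; this lets the gap survive
the truncation of the statistic.\<close>
lemma gauss_gap:
  assumes c: "0 < c" and a0: "0 < a0" and \<beta>: "0 < \<beta>"
  obtains g \<rho> :: real where "0 < g" "0 < \<rho>"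
    "\<And>(I :: 'i set) l a t i0. finite I \<Longrightarrow> (\<And>i. i \<in> I \<Longrightarrow> 0 < l i) \<Longrightarrow> i0 \<in> I \<Longrightarrow> l i0 = c \<Longrightarrow> a0 \<le> \<bar>a i0\<bar> \<Longrightarrow> t \<le> T \<Longrightarrow>
      \<beta> \<le> measure (gauss I) {z \<in> space (gauss I). qform I l z < t + \<rho>} \<Longrightarrow>
      measure (gauss I) {z \<in> space (gauss I). t \<le> qform I l z} + g \<le>
      measure (gauss I) {z \<in> space (gauss I). t \<le> qform I l (\<lambda>i. z i + a i)}"
proof -
  \<comment> \<open>Makes the concentration bound for a shell of width
    \<open>\<rho> + \<rho>\<close> in one coordinate equal to \<open>\<beta> / 2\<close>.\<close>
  define \<rho> where "\<rho> = c * (\<beta> / 4)\<^sup>2 / 2"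
  have \<rho>: "0 < \<rho>" "2 * sqrt ((\<rho> + \<rho>) / c) = \<beta> / 2"
    using c \<beta> by (auto simp: \<rho>_def real_sqrt_abs)
  \<comment> \<open>The gain from \<open>std_normal_ball_shift\<close> for shift \<open>a0\<close>
    and radii between \<open>sqrt (\<rho> / c)\<close> and \<open>sqrt (T / c)\<close>.\<close>
  define g0 where "g0 = a0 / 2 * (std_normal_density (a0 + sqrt (T / c)) * (a0 * sqrt (\<rho> / c)))"
  have g0: "0 < g0" unfolding g0_def using a0 c \<rho> by (intro mult_pos_pos normal_density_pos) auto
  define g where "g = g0 * (\<beta> / 2)"
  have g: "0 < g" using g0 \<beta> by (simp add: g_def)
  have main: "measure (gauss I) {z \<in> space (gauss I). t \<le> qform I l z} + g \<le>
      measure (gauss I) {z \<in> space (gauss I). t \<le> qform I l (\<lambda>i. z i + a i)}"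
    if fin: "finite I" and l: "\<And>i. i \<in> I \<Longrightarrow> 0 < l i" and i0: "i0 \<in> I" "l i0 = c" and a: "a0 \<le> \<bar>a i0\<bar>" and t: "t \<le> T"
      and ass: "\<beta> \<le> measure (gauss I) {z \<in> space (gauss I). qform I l z < t + \<rho>}"
    for I :: "'i set" and l a t i0
  proof -
    interpret G: prob_space "gauss I" by (rule prob_space_gauss)
    define J where "J = I - {i0}"
    have I: "I = insert i0 J" "finite J" "i0 \<notin> J" using i0 fin by (auto simp: J_def)
    interpret GJ: prob_space "gauss J" by (rule prob_space_gauss)
    define R where "R x = qform J l (\<lambda>j. x j + 0)" for x
    have R0: "0 \<le> R x" for x
      unfolding R_def by (rule qform_nonneg) (use l I in \<open>auto intro: less_imp_le\<close>)
    have Rm [measurable]: "R \<in> borel_measurable (gauss J)"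
      unfolding R_def[abs_def] by (rule qform_measurable)
    have Qsplit: "qform I l z = c * (z i0 + 0)\<^sup>2 + R z" for z
      using qform_split[OF fin i0(1), of l z] i0 by (simp add: J_def R_def)
    have Qm [measurable]: "(\<lambda>z. qform I l (\<lambda>i. z i + b i)) \<in> borel_measurable (gauss I)" for b
      by (rule qform_measurable)
    have Qm0 [measurable]: "(\<lambda>z. qform I l z) \<in> borel_measurable (gauss I)"
      using Qm[of "\<lambda>_. 0"] unfolding add_0_right .
    have B: "{..<t} \<in> sets borel" "{..<t + \<rho>} \<in> sets borel" by simp_all
    \<comment> \<open>Where the other coordinates leave room: on \<open>E\<close> the slice in
      coordinate \<open>i0\<close> is an interval of radius at least
      \<open>sqrt (\<rho> / c)\<close>, and the shift has a definite effect. Outside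
      \<open>E\<close> the event with \<open>t + \<rho>\<close> confines coordinate
      \<open>i0\<close> to a shell of mass at most \<open>\<beta> / 2\<close>, so the hypothesis
      forces \<open>E\<close> to have mass at least \<open>\<beta> / 2\<close>.\<close>
    define E where "E = {x \<in> space (gauss J). R x \<le> t - \<rho>}"
    have Es: "E \<in> sets (gauss J)" unfolding E_def by measurable
    have Ei: "integrable (gauss J) (indicat_real E)"
      using Es by (rule integrable_real_indicator) (simp add: GJ.emeasure_eq_measure)
    have Eint: "(\<integral>x. indicat_real E x \<partial>gauss J) = measure (gauss J) E"
    proof -
      have "E \<inter> space (gauss J) = E" unfolding E_def by blast
      then show ?thesis by (simp only: Bochner_Integration.integral_indicator)
    qed
    have slice: "integrable (gauss J) (\<lambda>x. measure std_normal_distribution {y. c * (y + a')\<^sup>2 + R x \<in> {..<t'}})"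
      "measure (gauss I) {z \<in> space (gauss I). c * (z i0 + a')\<^sup>2 + R z < t'} =
        (\<integral>x. measure std_normal_distribution {y. c * (y + a')\<^sup>2 + R x \<in> {..<t'}} \<partial>gauss J)" for a' t'
    proof -
      have B': "{..<t'} \<in> sets borel" by simp
      show "integrable (gauss J) (\<lambda>x. measure std_normal_distribution {y. c * (y + a')\<^sup>2 + R x \<in> {..<t'}})"
        unfolding R_def by (rule gauss_slice(2)[OF I(2,3) B'])
      show "measure (gauss I) {z \<in> space (gauss I). c * (z i0 + a')\<^sup>2 + R z < t'} =
        (\<integral>x. measure std_normal_distribution {y. c * (y + a')\<^sup>2 + R x \<in> {..<t'}} \<partial>gauss J)"
        using gauss_slice(1)[OF I(2,3) B', of c a' l "\<lambda>_. 0"]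
        unfolding R_def I(1)[symmetric] lessThan_iff .
    qed
    have "measure (gauss I) {z \<in> space (gauss I). qform I l z < t + \<rho>} =
      (\<integral>x. measure std_normal_distribution {y. c * (y + 0)\<^sup>2 + R x \<in> {..<t + \<rho>}} \<partial>gauss J)"
      unfolding Qsplit by (rule slice(2))
    also have "\<dots> \<le> (\<integral>x. indicat_real E x + \<beta> / 2 \<partial>gauss J)"
    proof (rule integral_mono)
      show "integrable (gauss J) (\<lambda>x. measure std_normal_distribution {y. c * (y + 0)\<^sup>2 + R x \<in> {..<t + \<rho>}})"
        by (rule slice(1))
      show "integrable (gauss J) (\<lambda>x. indicat_real E x + \<beta> / 2)"
        by (intro Bochner_Integration.integrable_add Ei GJ.integrable_const)
      fix x assume x: "x \<in> space (gauss J)"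
      show "measure std_normal_distribution {y. c * (y + 0)\<^sup>2 + R x \<in> {..<t + \<rho>}} \<le>
        indicat_real E x + \<beta> / 2"
      proof (cases "R x \<le> t - \<rho>")
        case True
        then show ?thesis using x \<beta> prob_space.prob_le_1[OF prob_space_std_normal, of "{y. c * (y + 0)\<^sup>2 + R x \<in> {..<t + \<rho>}}"]
          by (simp add: E_def indicator_def)
      next
        case False
        then have "{y. c * (y + 0)\<^sup>2 + R x \<in> {..<t + \<rho>}} \<subseteq> {y. 0 \<le> c * y\<^sup>2 \<and> c * y\<^sup>2 < \<rho> + \<rho>}"
          using c by auto
        then have "measure std_normal_distribution {y. c * (y + 0)\<^sup>2 + R x \<in> {..<t + \<rho>}} \<le>
          measure std_normal_distribution {y. 0 \<le> c * y\<^sup>2 \<and> c * y\<^sup>2 < \<rho> + \<rho>}"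
          by (intro finite_measure.finite_measure_mono[OF prob_space.finite_measure[OF prob_space_std_normal]]) auto
        also have "\<dots> \<le> \<beta> / 2"
          using std_normal_square_concentration[OF c, of 0 "\<rho> + \<rho>"] \<rho> by simp
        finally show ?thesis
          using indicator_pos_le[of E x, where 'a=real] by linarith
      qed
    qed
    also have "\<dots> = measure (gauss J) E + \<beta> / 2"
      by (subst Bochner_Integration.integral_add[OF Ei GJ.integrable_const]) (simp add: Es[THEN sets.Int_space_eq2] GJ.prob_space)
    finally have pR: "\<beta> / 2 \<le> measure (gauss J) E"
      using ass by linarith
    \<comment> \<open>The shifts away from \<open>i0\<close> are given up; removing them can only
      raise the lower tail.\<close>
    have "measure (gauss I) {z \<in> space (gauss I). qform I l (\<lambda>i. z i + a i) < t} \<le>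
       measure (gauss I) {z \<in> space (gauss I). qform I l (\<lambda>i. z i + (if i \<in> J then 0 else a i)) < t}"
      by (rule gauss_shift_remove_le[OF fin l]) (use I in auto)
    also have "(\<lambda>z. qform I l (\<lambda>i. z i + (if i \<in> J then 0 else a i))) = (\<lambda>z. c * (z i0 + a i0)\<^sup>2 + R z)"
    proof
      fix z
      have *: "qform J l (\<lambda>i. z i + (if i \<in> J then 0 else a i)) = R z"
        unfolding qform_def R_def by (intro sum.cong) auto
      show "qform I l (\<lambda>i. z i + (if i \<in> J then 0 else a i)) = c * (z i0 + a i0)\<^sup>2 + R z"
        using qform_split[OF fin i0(1), of l "\<lambda>i. z i + (if i \<in> J then 0 else a i)"]
        unfolding J_def[symmetric] * i0(2) if_not_P[OF I(3)] .
    qed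
    also have "measure (gauss I) {z \<in> space (gauss I). (c * (z i0 + a i0)\<^sup>2 + R z) < t} =
       (\<integral>x. measure std_normal_distribution {y. c * (y + a i0)\<^sup>2 + R x \<in> {..<t}} \<partial>gauss J)"
      by (rule slice(2))
    finally have shifted: "measure (gauss I) {z \<in> space (gauss I). qform I l (\<lambda>i. z i + a i) < t} \<le>
       (\<integral>x. measure std_normal_distribution {y. c * (y + a i0)\<^sup>2 + R x \<in> {..<t}} \<partial>gauss J)" .
    \<comment> \<open>Slicewise comparison: a gain of \<open>g0\<close> on \<open>E\<close> and no
      loss elsewhere.\<close>
    have "(\<integral>x. measure std_normal_distribution {y. c * (y + a i0)\<^sup>2 + R x \<in> {..<t}} \<partial>gauss J)
       + g0 * measure (gauss J) E =
       (\<integral>x. measure std_normal_distribution {y. c * (y + a i0)\<^sup>2 + R x \<in> {..<t}} +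
          g0 * indicat_real E x \<partial>gauss J)"
      by (subst Bochner_Integration.integral_add[OF slice(1) integrable_mult_right[OF Ei]])
        (simp only: integral_mult_right_zero Eint)
    also have "\<dots> \<le> (\<integral>x. measure std_normal_distribution {y. c * (y + 0)\<^sup>2 + R x \<in> {..<t}} \<partial>gauss J)"
    proof (rule integral_mono)
      show "integrable (gauss J) (\<lambda>x. measure std_normal_distribution {y. c * (y + 0)\<^sup>2 + R x \<in> {..<t}})"
        by (rule slice(1))
      show "integrable (gauss J) (\<lambda>x. measure std_normal_distribution {y. c * (y + a i0)\<^sup>2 + R x \<in> {..<t}} +
          g0 * indicat_real E x)"
        by (intro Bochner_Integration.integrable_add slice(1) integrable_mult_right Ei)
      fix x assume x: "x \<in> space (gauss J)"
      show "measure std_normal_distribution {y. c * (y + a i0)\<^sup>2 + R x \<in> {..<t}} +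
          g0 * indicat_real E x
        \<le> measure std_normal_distribution {y. c * (y + 0)\<^sup>2 + R x \<in> {..<t}}"
      proof (cases "R x \<le> t - \<rho>")
        case False
        then have "indicat_real E x = 0" by (simp only: E_def indicator_def mem_Collect_eq simp_thms of_bool_eq)
        then show ?thesis using slice_shift_le[OF c, of "a i0" "R x" t] by (simp only: mult_zero_right add_0_right)
      next
        case True
        define r where "r = sqrt ((t - R x) / c)"
        have r1: "sqrt (\<rho> / c) \<le> r" unfolding r_def using True c by (simp add: divide_right_mono)
        have r2: "r \<le> sqrt (T / c)" unfolding r_def using t R0[of x] c by (simp add: divide_right_mono)
        have "measure std_normal_distribution {y. \<bar>y + a i0\<bar> < r} = measure std_normal_distribution {y. \<bar>y + \<bar>a i0\<bar>\<bar> < r}"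
          by (rule std_normal_ball_shift(1)[symmetric])
        also have "\<dots> \<le> measure std_normal_distribution {y. \<bar>y + a0\<bar> < r}"
          using a a0 r1 \<rho> c by (intro std_normal_ball_shift(2)) (auto intro: order_trans[OF _ r1])
        also have "\<dots> + g0 \<le> measure std_normal_distribution {y. \<bar>y + 0\<bar> < r}"
          unfolding g0_def using r1 r2 a0 \<rho> c by (intro std_normal_ball_shift(3)) auto
        finally have *: "measure std_normal_distribution {y. \<bar>y + a i0\<bar> < r} + g0 \<le>
          measure std_normal_distribution {y. \<bar>y + 0\<bar> < r}" by linarith
        have "indicat_real E x = 1" using True x by (simp only: E_def indicator_def mem_Collect_eq simp_thms of_bool_eq)
        then show ?thesis using * unfolding square_plus_less_set[OF c] r_def by (simp only: mult_1_right)
      qed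
    qed
    also have "\<dots> = measure (gauss I) {z \<in> space (gauss I). qform I l z < t}"
      unfolding Qsplit by (rule slice(2)[symmetric])
    finally have fin1: "measure (gauss I) {z \<in> space (gauss I). qform I l (\<lambda>i. z i + a i) < t} + g \<le>
      measure (gauss I) {z \<in> space (gauss I). qform I l z < t}"
    proof -
      assume "(\<integral>x. measure std_normal_distribution {y. c * (y + a i0)\<^sup>2 + R x \<in> {..<t}} \<partial>gauss J)
       + g0 * measure (gauss J) E \<le> measure (gauss I) {z \<in> space (gauss I). qform I l z < t}"
      moreover have "g \<le> g0 * measure (gauss J) E"
        unfolding g_def using pR g0 by (intro mult_left_mono) auto
      ultimately show ?thesis using shifted by linarith
    qed
    have compl: "measure (gauss I) {z \<in> space (gauss I). t \<le> V z} = 1 - measure (gauss I) {z \<in> space (gauss I). V z < t}"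
      if [measurable]: "V \<in> borel_measurable (gauss I)" for V
    proof -
      have "{z \<in> space (gauss I). t \<le> V z} = space (gauss I) - {z \<in> space (gauss I). V z < t}" by auto
      then show ?thesis by (simp add: G.prob_compl)
    qed
    show ?thesis unfolding compl[OF Qm] compl[OF Qm0] using fin1 by linarith
  qed
  show ?thesis by (rule that[OF g \<rho>(1) main])
qed

text \<open>Slicing at a single coordinate already spreads the form out. The bound involves only the
  weight \<open>l i0\<close>, hence does not worsen as \<open>I\<close> grows.\<close>

lemma gauss_anticoncentration:
  assumes fin: "finite I" and i0: "i0 \<in> I" "0 < l i0" and d: "0 \<le> d"
  shows "measure (gauss I) {z \<in> space (gauss I). t - d \<le> qform I l z} \<le>
    measure (gauss I) {z \<in> space (gauss I). t \<le> qform I l z} + 2 * sqrt (d / l i0)"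
proof -
  interpret G: prob_space "gauss I" by (rule prob_space_gauss)
  define J where "J = I - {i0}"
  have I: "I = insert i0 J" "finite J" "i0 \<notin> J" using i0 fin by (auto simp: J_def)
  interpret GJ: prob_space "gauss J" by (rule prob_space_gauss)
  have Qsplit: "qform I l z = l i0 * (z i0 + 0)\<^sup>2 + qform J l (\<lambda>j. z j + 0)" for z
    using qform_split[OF fin i0(1), of l z] by (simp add: J_def)
  have Qm [measurable]: "(\<lambda>z. qform I l z) \<in> borel_measurable (gauss I)"
    using qform_measurable[of I l "\<lambda>_. 0"] unfolding add_0_right .
  have B: "{t - d..<t} \<in> sets borel" by simp
  have "measure (gauss I) {z \<in> space (gauss I). qform I l z \<in> {t - d..<t}} =
      (\<integral>x. measure std_normal_distribution {y. l i0 * (y + 0)\<^sup>2 + qform J l (\<lambda>j. x j + 0) \<in> {t - d..<t}} \<partial>gauss J)"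
    using gauss_slice(1)[OF I(2,3) B, of "l i0" 0 l "\<lambda>_. 0"] unfolding I(1)[symmetric] Qsplit by simp
  also have "\<dots> \<le> (\<integral>x. 2 * sqrt (d / l i0) \<partial>gauss J)"
  proof (rule integral_mono)
    show "integrable (gauss J) (\<lambda>x. measure std_normal_distribution {y. l i0 * (y + 0)\<^sup>2 + qform J l (\<lambda>j. x j + 0) \<in> {t - d..<t}})"
      by (rule gauss_slice(2)[OF I(2,3) B])
    fix x
    let ?s = "qform J l (\<lambda>j. x j + 0)"
    have "{y. l i0 * (y + 0)\<^sup>2 + ?s \<in> {t - d..<t}} = {y. t - d - ?s \<le> l i0 * y\<^sup>2 \<and> l i0 * y\<^sup>2 < t - ?s}"
      by auto
    then show "measure std_normal_distribution {y. l i0 * (y + 0)\<^sup>2 + ?s \<in> {t - d..<t}} \<le> 2 * sqrt (d / l i0)"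
      using std_normal_square_concentration[OF i0(2), of "t - d - ?s" "t - ?s"] d by simp
  qed simp
  also have "\<dots> = 2 * sqrt (d / l i0)" by (simp add: GJ.prob_space)
  finally have *: "measure (gauss I) {z \<in> space (gauss I). qform I l z \<in> {t - d..<t}} \<le> 2 * sqrt (d / l i0)" .
  have "measure (gauss I) {z \<in> space (gauss I). t - d \<le> qform I l z} \<le>
    measure (gauss I) ({z \<in> space (gauss I). t \<le> qform I l z} \<union> {z \<in> space (gauss I). qform I l z \<in> {t - d..<t}})"
    by (intro G.finite_measure_mono) auto
  also have "\<dots> \<le> measure (gauss I) {z \<in> space (gauss I). t \<le> qform I l z} + measure (gauss I) {z \<in> space (gauss I). qform I l z \<in> {t - d..<t}}"
    by (rule measure_Un_le) auto
  finally show ?thesis using * by linarith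
qed

section \<open>The sine basis and the rank representation of the statistic\<close>

text \<open>Supported on the open interval, as are the interval integrals in \<open>T_BKR\<close>;
  the clipping below and the quantile at 0 then never matter.\<close>

definition unif :: "real measure" where
  "unif = density lborel (\<lambda>x. ennreal (indicator {0<..<1} x))"

lemma real_distribution_unif: "real_distribution unif"
proof (intro real_distribution.intro prob_spaceI real_distribution_axioms.intro)
  show "emeasure unif (space unif) = 1"
    by (simp add: unif_def emeasure_density ennreal_indicator)
qed (simp_all add: unif_def)

lemma sets_unif [simp, measurable_cong]: "sets unif = sets borel"
  by (simp add: unif_def)

lemma space_unif [simp]: "space unif = UNIV"
  by (simp add: unif_def)

lemma prob_space_unif: "prob_space unif"
  using real_distribution_unif by (simp add: real_distribution_def)

lemma integral_unif:
  fixes f :: "real \<Rightarrow> real"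
  assumes [measurable]: "f \<in> borel_measurable borel"
  shows "(\<integral>u. f u \<partial>unif) = (\<integral>u. indicator {0<..<1} u * f u \<partial>lborel)"
  unfolding unif_def by (subst integral_density) auto

lemma integral_unif_cong:
  fixes f g :: "real \<Rightarrow> real"
  assumes "f \<in> borel_measurable borel" "g \<in> borel_measurable borel" "\<And>u. 0 < u \<Longrightarrow> u < 1 \<Longrightarrow> f u = g u"
  shows "(\<integral>u. f u \<partial>unif) = (\<integral>u. g u \<partial>unif)"
  unfolding integral_unif[OF assms(1)] integral_unif[OF assms(2)]
  using assms(3) by (intro Bochner_Integration.integral_cong) (auto simp: indicator_def)

lemma AE_unif: "AE u in unif. 0 < u \<and> u < 1"
  unfolding unif_def by (subst AE_density) (auto simp: indicator_def)

text \<open>The indicator is built in because the empirical copula is a sum of indicators in each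
  variable, and its sine coefficients are integrals of this shape.\<close>

lemma integral_unif_FTC:
  fixes f F :: "real \<Rightarrow> real"
  assumes F: "\<And>x. (F has_real_derivative f x) (at x)" and f: "\<And>x. isCont f x" and a: "0 \<le> a" "a \<le> 1"
  shows "(\<integral>u. of_bool (a < u) * f u \<partial>unif) = F 1 - F a"
proof -
  have [measurable]: "f \<in> borel_measurable borel"
    using f by (intro borel_measurable_continuous_onI continuous_at_imp_continuous_on) auto
  have "(\<integral>u. of_bool (a < u) * f u \<partial>unif) = (\<integral>u. indicator {0<..<1} u * (of_bool (a < u) * f u) \<partial>lborel)"
    by (rule integral_unif) measurable
  also have "\<dots> = (\<integral>u. f u * indicator {a..1} u \<partial>lborel)"
  proof (rule integral_cong_AE)
    have "AE x in lborel. x \<noteq> a" "AE x in lborel. x \<noteq> (1::real)" by (auto intro: AE_lborel_singleton)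
    then show "AE u in lborel. indicator {0<..<1} u * (of_bool (a < u) * f u) = f u * indicator {a..1} u"
      by eventually_elim (use a in \<open>auto simp: indicator_def\<close>)
  qed auto
  also have "\<dots> = F 1 - F a"
    by (rule integral_FTC_Icc_real[OF a(2) F f])
  finally show ?thesis .
qed

lemma integral_unif_FTC0:
  fixes f F :: "real \<Rightarrow> real"
  assumes F: "\<And>x. (F has_real_derivative f x) (at x)" and f: "\<And>x. isCont f x"
  shows "(\<integral>u. f u \<partial>unif) = F 1 - F 0"
proof -
  have [measurable]: "f \<in> borel_measurable borel"
    using f by (intro borel_measurable_continuous_onI continuous_at_imp_continuous_on) auto
  have "(\<integral>u. f u \<partial>unif) = (\<integral>u. of_bool (0 < u) * f u \<partial>unif)"
    by (rule integral_unif_cong) auto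
  then show ?thesis using integral_unif_FTC[OF F f, of 0] by simp
qed

lemma cos_int_pi: "cos (pi * real j) = (-1) ^ j"
  using cos_npi[of j] by (simp add: mult.commute)

lemma integral_unif_cos_int:
  fixes m :: int
  shows "(\<integral>u. cos (pi * of_int m * u) \<partial>unif) = of_bool (m = 0)"
proof (cases "m = 0")
  case True
  then show ?thesis using prob_space.prob_space[OF prob_space_unif] by simp
next
  case False
  have "(\<integral>u. cos (pi * of_int m * u) \<partial>unif) = sin (pi * of_int m * 1) / (pi * of_int m) - sin (pi * of_int m * 0) / (pi * of_int m)"
    using False by (intro integral_unif_FTC0) (auto intro!: derivative_eq_intros)
  also have "\<dots> = 0" using sin_integer_2pi sin_zero_iff_int2[of "pi * of_int m"] by (auto simp: mult.commute)
  finally show ?thesis using False by simp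
qed

lemma integrable_unif_bounded:
  fixes f :: "real \<Rightarrow> real"
  assumes "f \<in> borel_measurable borel" "\<And>x. \<bar>f x\<bar> \<le> B"
  shows "integrable unif f"
proof -
  interpret prob_space unif by (rule prob_space_unif)
  show ?thesis by (rule integrable_const_bound[where B=B]) (use assms in auto)
qed

lemma integral_unif_cos_cos:
  assumes "0 < j" "0 < k"
  shows "(\<integral>u. cos (pi * real j * u) * cos (pi * real k * u) \<partial>unif) = of_bool (j = k) / 2"
    "(\<integral>u. sin (pi * real j * u) * sin (pi * real k * u) \<partial>unif) = of_bool (j = k) / 2"
    "(\<integral>u. cos (pi * real j * u) \<partial>unif) = 0"
proof -
  have i: "integrable unif (\<lambda>u. cos (pi * of_int m * u))" for m
    by (rule integrable_unif_bounded[where B=1]) auto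
  have a: "pi * real j * u - pi * real k * u = pi * of_int (int j - int k) * u"
     "pi * real j * u + pi * real k * u = pi * of_int (int j + int k) * u" for u
    by (auto simp: algebra_simps)
  have c: "cos (pi * real j * u) * cos (pi * real k * u) =
      (cos (pi * of_int (int j - int k) * u) + cos (pi * of_int (int j + int k) * u)) / 2" for u
    unfolding a[symmetric] by (simp add: cos_diff cos_add)
  have s: "sin (pi * real j * u) * sin (pi * real k * u) =
      (cos (pi * of_int (int j - int k) * u) - cos (pi * of_int (int j + int k) * u)) / 2" for u
    unfolding a[symmetric] by (simp add: cos_diff cos_add)
  have jk: "int j - int k = 0 \<longleftrightarrow> j = k" "int j + int k = 0 \<longleftrightarrow> False" using assms by auto
  have "(\<integral>u. cos (pi * real j * u) * cos (pi * real k * u) \<partial>unif) =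
     ((\<integral>u. cos (pi * of_int (int j - int k) * u) \<partial>unif) + (\<integral>u. cos (pi * of_int (int j + int k) * u) \<partial>unif)) / 2"
    unfolding c using i[of "int j - int k"] i[of "int j + int k"] by simp
  then show "(\<integral>u. cos (pi * real j * u) * cos (pi * real k * u) \<partial>unif) = of_bool (j = k) / 2"
    unfolding integral_unif_cos_int jk by simp
  have "(\<integral>u. sin (pi * real j * u) * sin (pi * real k * u) \<partial>unif) =
     ((\<integral>u. cos (pi * of_int (int j - int k) * u) \<partial>unif) - (\<integral>u. cos (pi * of_int (int j + int k) * u) \<partial>unif)) / 2"
    unfolding s using i[of "int j - int k"] i[of "int j + int k"] by simp
  then show "(\<integral>u. sin (pi * real j * u) * sin (pi * real k * u) \<partial>unif) = of_bool (j = k) / 2"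
    unfolding integral_unif_cos_int jk by simp
  show "(\<integral>u. cos (pi * real j * u) \<partial>unif) = 0"
    using integral_unif_cos_int[of "int j"] assms by simp
qed

text \<open>Normalized eigenfunctions of the Brownian bridge covariance
  \<open>min u v - u * v\<close>, with eigenvalues \<open>1 / (pi * j)^2\<close>. Integrated against
  an indicator they give cosines, which is where the cosine rank scores come from.\<close>

definition sbasis :: "nat \<Rightarrow> real \<Rightarrow> real" where
  "sbasis j u = sqrt 2 * sin (pi * real j * u)"

lemma sbasis_measurable [measurable]: "sbasis j \<in> borel_measurable borel"
  unfolding sbasis_def[abs_def] by measurable

lemma sbasis_bounded: "\<bar>sbasis j u\<bar> \<le> 2"
proof -
  have "\<bar>sbasis j u\<bar> = sqrt 2 * \<bar>sin (pi * real j * u)\<bar>" by (simp add: sbasis_def abs_mult)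
  also have "\<dots> \<le> 2 * 1" by (intro mult_mono) (auto simp: real_le_lsqrt)
  finally show ?thesis by simp
qed

lemma sbasis_orthonormal:
  assumes "0 < j" "0 < k"
  shows "(\<integral>u. sbasis j u * sbasis k u \<partial>unif) = of_bool (j = k)"
proof -
  have "sbasis j u * sbasis k u = 2 * (sin (pi * real j * u) * sin (pi * real k * u))" for u
    by (simp add: sbasis_def)
  then show ?thesis by (simp add: integral_unif_cos_cos(2)[OF assms])
qed

lemma sbasis_integral_tail:
  assumes "0 < j" "0 \<le> a" "a \<le> 1"
  shows "(\<integral>u. of_bool (a < u) * sbasis j u \<partial>unif) = sqrt 2 / (pi * real j) * (cos (pi * real j * a) - (-1) ^ j)"
proof -
  have "(\<integral>u. of_bool (a < u) * sbasis j u \<partial>unif) =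
    (- sqrt 2 * cos (pi * real j * 1) / (pi * real j)) - (- sqrt 2 * cos (pi * real j * a) / (pi * real j))"
    unfolding sbasis_def using assms
    by (intro integral_unif_FTC) (auto intro!: derivative_eq_intros simp: field_simps)
  then show ?thesis by (simp add: cos_int_pi algebra_simps diff_divide_distrib)
qed

lemma sbasis_integral_id:
  assumes "0 < j"
  shows "(\<integral>u. u * sbasis j u \<partial>unif) = - (sqrt 2 / (pi * real j) * (-1) ^ j)"
proof -
  define c where "c = pi * real j"
  have c: "0 < c" using assms by (simp add: c_def)
  have "(\<integral>u. u * (sqrt 2 * sin (c * u)) \<partial>unif) =
    sqrt 2 * (sin (c * 1) / c\<^sup>2 - 1 * cos (c * 1) / c) - sqrt 2 * (sin (c * 0) / c\<^sup>2 - 0 * cos (c * 0) / c)"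
  proof (rule integral_unif_FTC0)
    fix x
    show "((\<lambda>x. sqrt 2 * (sin (c * x) / c\<^sup>2 - x * cos (c * x) / c)) has_real_derivative x * (sqrt 2 * sin (c * x))) (at x)"
      using c by (auto intro!: derivative_eq_intros simp: field_simps power2_eq_square)
  qed auto
  moreover have "sin c = 0" unfolding c_def using sin_npi2 by simp
  ultimately show ?thesis by (simp add: sbasis_def c_def cos_int_pi)
qed

lemma Bessel_inequality_prob:
  fixes D :: "'a \<Rightarrow> real" and e :: "'i \<Rightarrow> 'a \<Rightarrow> real"
  assumes M: "prob_space M" and fin: "finite I"
    and D [measurable]: "D \<in> borel_measurable M" and Db: "\<And>x. \<bar>D x\<bar> \<le> B"
    and e [measurable]: "\<And>i. i \<in> I \<Longrightarrow> e i \<in> borel_measurable M" and eb: "\<And>i x. i \<in> I \<Longrightarrow> \<bar>e i x\<bar> \<le> B"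
    and orth: "\<And>i k. i \<in> I \<Longrightarrow> k \<in> I \<Longrightarrow> (\<integral>x. e i x * e k x \<partial>M) = of_bool (i = k)"
  shows "(\<Sum>i\<in>I. (\<integral>x. D x * e i x \<partial>M)\<^sup>2) \<le> (\<integral>x. (D x)\<^sup>2 \<partial>M)"
proof -
  interpret prob_space M by fact
  define A where "A i = (\<integral>x. D x * e i x \<partial>M)" for i
  have B0: "0 \<le> B" using Db[of undefined] by linarith
  have int: "integrable M (\<lambda>x. f x * g x)"
    if [measurable]: "f \<in> borel_measurable M" "g \<in> borel_measurable M" and "\<And>x. \<bar>f x\<bar> \<le> B" "\<And>x. \<bar>g x\<bar> \<le> B" for f g
    using that(3,4) by (intro integrable_const_bound[where B="B * B"]) (auto simp: abs_mult B0 intro!: mult_mono)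
  have iDD: "integrable M (\<lambda>x. D x * D x)" and iDe: "\<And>i. i \<in> I \<Longrightarrow> integrable M (\<lambda>x. D x * e i x)"
    and iee: "\<And>i k. i \<in> I \<Longrightarrow> k \<in> I \<Longrightarrow> integrable M (\<lambda>x. e i x * e k x)"
    using Db eb by (auto intro!: int)
  have ex: "(D x - (\<Sum>i\<in>I. A i * e i x))\<^sup>2 = D x * D x - (\<Sum>i\<in>I. 2 * A i * (D x * e i x)) + (\<Sum>i\<in>I. \<Sum>k\<in>I. (A i * A k) * (e i x * e k x))" for x
    by (simp add: power2_eq_square algebra_simps sum_product sum_distrib_left sum_distrib_right sum.distrib)
  have "0 \<le> (\<integral>x. (D x - (\<Sum>i\<in>I. A i * e i x))\<^sup>2 \<partial>M)" by simp
  also have "\<dots> = (\<integral>x. D x * D x \<partial>M) - (\<Sum>i\<in>I. 2 * A i * A i) + (\<Sum>i\<in>I. \<Sum>k\<in>I. (A i * A k) * of_bool (i = k))"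
  proof -
    have "(\<integral>x. (D x - (\<Sum>i\<in>I. A i * e i x))\<^sup>2 \<partial>M) = (\<integral>x. D x * D x \<partial>M) - (\<integral>x. (\<Sum>i\<in>I. 2 * A i * (D x * e i x)) \<partial>M)
      + (\<integral>x. (\<Sum>i\<in>I. \<Sum>k\<in>I. (A i * A k) * (e i x * e k x)) \<partial>M)"
      unfolding ex using iDD iDe iee
      by (subst Bochner_Integration.integral_add) (auto simp: Bochner_Integration.integral_diff)
    also have "(\<integral>x. (\<Sum>i\<in>I. 2 * A i * (D x * e i x)) \<partial>M) = (\<Sum>i\<in>I. 2 * A i * A i)"
      using iDe by (simp add: A_def)
    also have "(\<integral>x. (\<Sum>i\<in>I. \<Sum>k\<in>I. (A i * A k) * (e i x * e k x)) \<partial>M) = (\<Sum>i\<in>I. \<Sum>k\<in>I. (A i * A k) * of_bool (i = k))"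
      using iee orth by simp
    finally show ?thesis .
  qed
  also have "(\<Sum>i\<in>I. \<Sum>k\<in>I. (A i * A k) * of_bool (i = k)) = (\<Sum>i\<in>I. A i * A i)"
  proof (intro sum.cong refl)
    fix i assume "i \<in> I"
    have "(\<Sum>k\<in>I. (A i * A k) * of_bool (i = k)) = (\<Sum>k\<in>I. if i = k then A i * A k else 0)"
      by (intro sum.cong) auto
    then show "(\<Sum>k\<in>I. (A i * A k) * of_bool (i = k)) = A i * A i" using fin \<open>i \<in> I\<close> by simp
  qed
  finally show ?thesis by (simp add: A_def power2_eq_square sum_distrib_left[symmetric] mult.assoc)
qed

text \<open>Ranks are counted with the strict inequality, so that a sample point lies at or below the empirical
$u$-quantile exactly when its rank is less than $u$.\<close>
definition srank :: "nat \<Rightarrow> (nat \<Rightarrow> real) \<Rightarrow> nat \<Rightarrow> real" where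
  "srank n x i = real (card {l \<in> {..<n}. x l < x i}) / real n"

lemma srank_bounds: "0 \<le> srank n x i" "srank n x i \<le> 1"
proof -
  have "card {l \<in> {..<n}. x l < x i} \<le> card {..<n}" by (intro card_mono) auto
  then show "srank n x i \<le> 1" by (auto simp: srank_def divide_le_eq_1)
qed (simp add: srank_def)

text \<open>The infimum is at least \<open>a i\<close> exactly when no point to the left of
  \<open>a i\<close> reaches level \<open>u\<close>, that is, when fewer than \<open>n * u\<close>
  observations lie strictly below \<open>a i\<close>. Ties are allowed, so the identity holds for
  every sample.\<close>

lemma le_equantile_iff:
  assumes n: "0 < n" and u: "0 < u" "u \<le> 1" and i: "i < n"
  shows "a i \<le> equantile n a u \<longleftrightarrow> srank n a i < u"
proof
  define A where "A = {x. u \<le> ecdf n a x}"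
  have Q: "equantile n a u = Inf A" by (simp add: equantile_def A_def)
  have bdd: "bdd_below A"
  proof (rule bdd_belowI)
    fix x assume "x \<in> A"
    then have "0 < ecdf n a x" using u by (simp add: A_def)
    then have "{i \<in> {..<n}. a i \<le> x} \<noteq> {}" unfolding ecdf_def by (metis card.empty divide_eq_0_iff of_nat_0 order_less_irrefl)
    then obtain k where "k < n" "a k \<le> x" by auto
    then show "Min (a ` {..<n}) \<le> x" by (meson Min_le finite_imageI finite_lessThan imageI lessThan_iff order_trans)
  qed
  have ne: "A \<noteq> {}"
  proof -
    have "{i \<in> {..<n}. a i \<le> Max (a ` {..<n})} = {..<n}" by auto
    then have "Max (a ` {..<n}) \<in> A" using n u by (simp add: A_def ecdf_def)
    then show ?thesis by auto
  qed
  show "srank n a i < u" if le: "a i \<le> equantile n a u"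
  proof (rule ccontr)
    assume "\<not> srank n a i < u"
    then have u2: "u \<le> srank n a i" by simp
    define L where "L = {l \<in> {..<n}. a l < a i}"
    have "0 < srank n a i" using u u2 by linarith
    then have "L \<noteq> {}" unfolding srank_def L_def[symmetric] by (metis card.empty divide_eq_0_iff of_nat_0 order_less_irrefl)
    \<comment> \<open>The largest observation below \<open>a i\<close>: the empirical cdf there
      already counts everything in \<open>L\<close>, so the quantile could not exceed
      \<open>m\<close>.\<close>
    define m where "m = Max (a ` L)"
    have finL: "finite L" by (simp add: L_def)
    have "m \<in> a ` L" unfolding m_def using finL \<open>L \<noteq> {}\<close> by (intro Max_in) auto
    then have m: "m < a i" by (auto simp: L_def)
    have "card L \<le> card {l \<in> {..<n}. a l \<le> m}"
      using finL by (intro card_mono) (auto simp: m_def L_def)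
    then have "srank n a i \<le> ecdf n a m" using n by (simp add: srank_def ecdf_def L_def divide_right_mono)
    then have "m \<in> A" using u2 by (simp add: A_def)
    then have "equantile n a u \<le> m" unfolding Q by (rule cInf_lower[OF _ bdd])
    then show False using m le by simp
  qed
  show "a i \<le> equantile n a u" if lt: "srank n a i < u"
    unfolding Q
  proof (rule cInf_greatest[OF ne])
    fix x assume x: "x \<in> A"
    show "a i \<le> x"
    proof (rule ccontr)
      assume "\<not> a i \<le> x"
      then have "card {l \<in> {..<n}. a l \<le> x} \<le> card {l \<in> {..<n}. a l < a i}" by (intro card_mono) auto
      then have "ecdf n a x \<le> srank n a i" using n by (simp add: srank_def ecdf_def divide_right_mono)
      then show False using x lt by (simp add: A_def)
    qed
  qed
qed

definition cdiff :: "nat \<Rightarrow> (nat \<Rightarrow> real) \<Rightarrow> (nat \<Rightarrow> real) \<Rightarrow> real \<Rightarrow> real \<Rightarrow> real" where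
  "cdiff n a b u v = (\<Sum>i<n. of_bool (a i < u) * of_bool (b i < v)) / real n - u * v"

definition ranks1 :: "nat \<Rightarrow> (nat \<Rightarrow> real \<times> real) \<Rightarrow> nat \<Rightarrow> real" where
  "ranks1 n w = srank n (\<lambda>i. fst (w i))"

definition ranks2 :: "nat \<Rightarrow> (nat \<Rightarrow> real \<times> real) \<Rightarrow> nat \<Rightarrow> real" where
  "ranks2 n w = srank n (\<lambda>i. snd (w i))"

lemma ecopula_eq:
  assumes n: "0 < n" and u: "0 < u" "u < 1" and v: "0 < v" "v < 1"
  shows "ecopula n w u v - u * v = cdiff n (ranks1 n w) (ranks2 n w) u v"
proof -
  have "{i \<in> {..<n}. fst (w i) \<le> equantile n (\<lambda>i. fst (w i)) u \<and> snd (w i) \<le> equantile n (\<lambda>i. snd (w i)) v} =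
    {i \<in> {..<n}. ranks1 n w i < u \<and> ranks2 n w i < v}"
    using le_equantile_iff[OF n, of u _ "\<lambda>i. fst (w i)"] le_equantile_iff[OF n, of v _ "\<lambda>i. snd (w i)"] u v
    by (auto simp: ranks1_def ranks2_def)
  moreover have "(\<Sum>i<n. of_bool (ranks1 n w i < u) * of_bool (ranks2 n w i < v) :: real) =
      real (card {i \<in> {..<n}. ranks1 n w i < u \<and> ranks2 n w i < v})"
  proof -
    have "(\<Sum>i<n. of_bool (ranks1 n w i < u) * of_bool (ranks2 n w i < v) :: real) =
       (\<Sum>i<n. if ranks1 n w i < u \<and> ranks2 n w i < v then 1 else 0)"
      by (intro sum.cong) auto
    then show ?thesis by (simp add: sum.If_cases Int_def)
  qed
  ultimately show ?thesis by (simp add: ecopula_def ecdf_joint_def cdiff_def)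
qed

definition Tint :: "nat \<Rightarrow> (nat \<Rightarrow> real) \<Rightarrow> (nat \<Rightarrow> real) \<Rightarrow> real" where
  "Tint n a b = (\<integral>p. (cdiff n a b (fst p) (snd p))\<^sup>2 \<partial>(unif \<Otimes>\<^sub>M unif))"

lemma cdiff_measurable: "(\<lambda>p. cdiff n a b (fst p) (snd p)) \<in> borel_measurable (unif \<Otimes>\<^sub>M unif)"
  unfolding cdiff_def by measurable

lemma AE_unif_pair: "AE p in unif \<Otimes>\<^sub>M unif. 0 < fst p \<and> fst p < 1 \<and> 0 < snd p \<and> snd p < 1"
proof -
  interpret U: prob_space unif by (rule prob_space_unif)
  interpret UU: pair_prob_space unif unif ..
  have "AE u in unif. AE v in unif. 0 < u \<and> u < 1 \<and> 0 < v \<and> v < 1"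
    using AE_unif
  proof eventually_elim
    case (elim u)
    show ?case using AE_unif by eventually_elim (use elim in simp)
  qed
  then have AE: "AE u in unif. AE v in unif. 0 < fst (u, v) \<and> fst (u, v) < 1 \<and> 0 < snd (u, v) \<and> snd (u, v) < 1"
    by simp
  show ?thesis by (rule UU.AE_pair_measure[OF _ AE]) measurable
qed

definition clip :: "real \<Rightarrow> real" where "clip u = max 0 (min 1 u)"

text \<open>The clipped version agrees with \<^const>\<open>cdiff\<close> on the unit square and is bounded everywhere.\<close>
definition bcdiff :: "nat \<Rightarrow> (nat \<Rightarrow> real) \<Rightarrow> (nat \<Rightarrow> real) \<Rightarrow> real \<Rightarrow> real \<Rightarrow> real" where
  "bcdiff n a b u v = (\<Sum>i<n. of_bool (a i < u) * of_bool (b i < v)) / real n - clip u * clip v"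

lemma bcdiff_bound: "\<bar>bcdiff n a b u v\<bar> \<le> 1"
proof -
  have "0 \<le> (\<Sum>i<n. of_bool (a i < u) * of_bool (b i < v) :: real)" by (intro sum_nonneg) auto
  moreover have "(\<Sum>i<n. of_bool (a i < u) * of_bool (b i < v) :: real) \<le> (\<Sum>i<n. 1)" by (intro sum_mono) auto
  ultimately have "0 \<le> (\<Sum>i<n. of_bool (a i < u) * of_bool (b i < v)) / real n" "(\<Sum>i<n. of_bool (a i < u) * of_bool (b i < v)) / real n \<le> 1"
    by (auto simp: divide_le_eq_1)
  moreover have "0 \<le> clip u * clip v" "clip u * clip v \<le> 1" by (auto simp: clip_def intro!: mult_le_one)
  ultimately show ?thesis unfolding bcdiff_def by linarith
qed

lemma bcdiff_eq: "0 < u \<Longrightarrow> u < 1 \<Longrightarrow> 0 < v \<Longrightarrow> v < 1 \<Longrightarrow> bcdiff n a b u v = cdiff n a b u v"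
  by (simp add: bcdiff_def cdiff_def clip_def)

lemma clip_measurable [measurable]: "clip \<in> borel_measurable borel"
  unfolding clip_def[abs_def] by measurable

lemma bcdiff_measurable: "(\<lambda>p. bcdiff n a b (fst p) (snd p)) \<in> borel_measurable (unif \<Otimes>\<^sub>M unif)"
  unfolding bcdiff_def by measurable

lemma Tint_bcdiff: "Tint n a b = (\<integral>p. (bcdiff n a b (fst p) (snd p))\<^sup>2 \<partial>(unif \<Otimes>\<^sub>M unif))"
  unfolding Tint_def
proof (rule integral_cong_AE)
  show "AE p in unif \<Otimes>\<^sub>M unif. (cdiff n a b (fst p) (snd p))\<^sup>2 = (bcdiff n a b (fst p) (snd p))\<^sup>2"
    using AE_unif_pair by eventually_elim (simp add: bcdiff_eq)
qed (use cdiff_measurable bcdiff_measurable in auto)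

text \<open>The integrand is replaced by its clipped version, which changes nothing on the open
  square and makes it bounded, so that the iterated interval integrals merge into one integral over
  a probability space.\<close>

lemma T_BKR_eq:
  assumes n: "0 < n"
  shows "T_BKR n w = Tint n (ranks1 n w) (ranks2 n w)"
proof -
  interpret U: prob_space unif by (rule prob_space_unif)
  interpret UU: pair_prob_space unif unif ..
  define d where "d u v = bcdiff n (ranks1 n w) (ranks2 n w) u v" for u v
  have dm [measurable]: "(\<lambda>p. d (fst p) (snd p)) \<in> borel_measurable (unif \<Otimes>\<^sub>M unif)"
    unfolding d_def by (rule bcdiff_measurable)
  have dm1 [measurable]: "d u \<in> borel_measurable borel" for u
    unfolding d_def[abs_def] bcdiff_def by measurable
  have dm2: "(\<lambda>u. \<integral>v. (d u v)\<^sup>2 \<partial>unif) \<in> borel_measurable borel"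
  proof -
    have "(\<lambda>(u, v). (d u v)\<^sup>2) \<in> borel_measurable (unif \<Otimes>\<^sub>M unif)" unfolding split_beta' by measurable
    from U.borel_measurable_lebesgue_integral[OF this] show ?thesis by simp
  qed
  have ein: "einterval 0 1 = {0<..<1::real}" by (auto simp: einterval_def)
  have in1: "(LBINT v=0..1. (ecopula n w u v - u * v)\<^sup>2) = (\<integral>v. (d u v)\<^sup>2 \<partial>unif)" if u: "0 < u" "u < 1" for u
  proof -
    have "(LBINT v=0..1. (ecopula n w u v - u * v)\<^sup>2) = (\<integral>v. indicator {0<..<1} v * (ecopula n w u v - u * v)\<^sup>2 \<partial>lborel)"
      by (simp add: interval_lebesgue_integral_def set_lebesgue_integral_def ein)
    also have "\<dots> = (\<integral>v. indicator {0<..<1} v * (d u v)\<^sup>2 \<partial>lborel)"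
      using ecopula_eq[OF n u] bcdiff_eq[OF u] by (intro Bochner_Integration.integral_cong) (auto simp: indicator_def d_def)
    also have "\<dots> = (\<integral>v. (d u v)\<^sup>2 \<partial>unif)" by (rule integral_unif[symmetric]) measurable
    finally show ?thesis .
  qed
  have "T_BKR n w = (\<integral>u. indicator {0<..<1} u * (LBINT v=0..1. (ecopula n w u v - u * v)\<^sup>2) \<partial>lborel)"
    by (simp add: T_BKR_def interval_lebesgue_integral_def[of lborel 0 1 "\<lambda>u. LBINT v=0..1. (ecopula n w u v - u * v)\<^sup>2"] set_lebesgue_integral_def ein)
  also have "\<dots> = (\<integral>u. indicator {0<..<1} u * (\<integral>v. (d u v)\<^sup>2 \<partial>unif) \<partial>lborel)"
    using in1 by (intro Bochner_Integration.integral_cong) (auto simp: indicator_def)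
  also have "\<dots> = (\<integral>u. (\<integral>v. (d u v)\<^sup>2 \<partial>unif) \<partial>unif)" by (rule integral_unif[symmetric, OF dm2])
  also have "\<dots> = (\<integral>(u,v). (d u v)\<^sup>2 \<partial>(unif \<Otimes>\<^sub>M unif))"
  proof (rule UU.integral_fst)
    show "integrable (unif \<Otimes>\<^sub>M unif) (\<lambda>(u,v). (d u v)\<^sup>2)"
    proof (rule UU.P.integrable_const_bound[where B=1])
      show "(\<lambda>(u,v). (d u v)\<^sup>2) \<in> borel_measurable (unif \<Otimes>\<^sub>M unif)"
        using dm unfolding split_beta' by measurable
    qed (use bcdiff_bound in \<open>auto simp: split_beta' d_def abs_square_le_1\<close>)
  qed
  also have "\<dots> = Tint n (ranks1 n w) (ranks2 n w)"
    unfolding Tint_bcdiff d_def split_beta' ..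
  finally show ?thesis .
qed

text \<open>The coefficient of \<^const>\<open>cdiff\<close> at the tensor product of \<^const>\<open>sbasis\<close> \<open>j\<close> and \<^const>\<open>sbasis\<close> \<open>k\<close>,
computed by integrating the indicators.\<close>
definition cosrank :: "nat \<Rightarrow> (nat \<Rightarrow> real) \<Rightarrow> (nat \<Rightarrow> real) \<Rightarrow> nat \<Rightarrow> nat \<Rightarrow> real" where
  "cosrank n a b j k = 2 / (pi\<^sup>2 * real j * real k) *
     (((\<Sum>i<n. cos (pi * real j * a i) * cos (pi * real k * b i)) - (-1) ^ k * (\<Sum>i<n. cos (pi * real j * a i))
       - (-1) ^ j * (\<Sum>i<n. cos (pi * real k * b i))) / real n)"

text \<open>Bessel's inequality for products of \<open>sbasis\<close> functions. Only this direction
  is used; the other half of the approximation comes from comparing expectations.\<close>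

lemma Tint_ge_cosrank:
  assumes n: "0 < n" and fin: "finite I" and I: "\<And>j k. (j, k) \<in> I \<Longrightarrow> 0 < j \<and> 0 < k"
    and a: "\<And>i. 0 \<le> a i \<and> a i \<le> 1" and b: "\<And>i. 0 \<le> b i \<and> b i \<le> 1"
  shows "(\<Sum>(j, k)\<in>I. (cosrank n a b j k)\<^sup>2) \<le> Tint n a b"
proof -
  interpret U: prob_space unif by (rule prob_space_unif)
  interpret UU: pair_prob_space unif unif ..
  define e where "e p q = sbasis (fst p) (fst q) * sbasis (snd p) (snd q)" for p :: "nat \<times> nat" and q :: "real \<times> real"
  have pint: "(\<integral>q. f (fst q) * g (snd q) \<partial>(unif \<Otimes>\<^sub>M unif)) = (\<integral>u. f u \<partial>unif) * (\<integral>v. g v \<partial>unif)"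
    if "f \<in> borel_measurable borel" "g \<in> borel_measurable borel" "\<And>u. \<bar>f u\<bar> \<le> B" "\<And>u. \<bar>g u\<bar> \<le> B" for f g :: "real \<Rightarrow> real" and B
  proof -
    have B0: "0 \<le> B" using that(3)[of 0] by linarith
    have "(\<integral>q. f (fst q) * g (snd q) \<partial>(unif \<Otimes>\<^sub>M unif)) = (\<integral>(u, v). f u * g v \<partial>(unif \<Otimes>\<^sub>M unif))"
      by (simp add: split_beta')
    also have "\<dots> = (\<integral>u. (\<integral>v. f u * g v \<partial>unif) \<partial>unif)"
    proof (rule UU.integral_fst[symmetric], rule UU.P.integrable_const_bound[where B="B * B"])
      show "AE x in unif \<Otimes>\<^sub>M unif. norm (case x of (u, v) \<Rightarrow> f u * g v) \<le> B * B"
        using that(3,4) B0 by (intro AE_I2) (auto simp: abs_mult intro!: mult_mono)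
      show "(\<lambda>(u, v). f u * g v) \<in> borel_measurable (unif \<Otimes>\<^sub>M unif)"
        using that(1,2) unfolding split_beta' by measurable
    qed
    finally show ?thesis by simp
  qed
  have em [measurable]: "e p \<in> borel_measurable (unif \<Otimes>\<^sub>M unif)" for p
    unfolding e_def[abs_def] by measurable
  have eb: "\<bar>e p q\<bar> \<le> 4" for p q
    unfolding e_def abs_mult using mult_mono[OF sbasis_bounded[of "fst p" "fst q"] sbasis_bounded[of "snd p" "snd q"]] by simp
  have orth: "(\<integral>x. e p x * e p' x \<partial>(unif \<Otimes>\<^sub>M unif)) = of_bool (p = p')" if "p \<in> I" "p' \<in> I" for p p'
  proof -
    have pos: "0 < fst p" "0 < snd p" "0 < fst p'" "0 < snd p'"
      using I[of "fst p" "snd p"] I[of "fst p'" "snd p'"] that by auto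
    have sb: "\<bar>sbasis j u * sbasis k u\<bar> \<le> 4" for j k u
      unfolding abs_mult using mult_mono[OF sbasis_bounded[of j u] sbasis_bounded[of k u]] by simp
    have "(\<integral>x. e p x * e p' x \<partial>(unif \<Otimes>\<^sub>M unif)) =
       (\<integral>q. (sbasis (fst p) (fst q) * sbasis (fst p') (fst q)) * (sbasis (snd p) (snd q) * sbasis (snd p') (snd q)) \<partial>(unif \<Otimes>\<^sub>M unif))"
      by (simp add: e_def algebra_simps)
    also have "\<dots> = of_bool (fst p = fst p') * of_bool (snd p = snd p')"
      using sbasis_orthonormal[OF pos(1,3)] sbasis_orthonormal[OF pos(2,4)]
      by (subst pint[of "\<lambda>u. sbasis (fst p) u * sbasis (fst p') u" "\<lambda>u. sbasis (snd p) u * sbasis (snd p') u" 4, OF _ _ sb sb]) auto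
    also have "\<dots> = of_bool (p = p')" by (simp add: prod_eq_iff)
    finally show ?thesis .
  qed
  define d where "d q = bcdiff n a b (fst q) (snd q)" for q
  have dm [measurable]: "d \<in> borel_measurable (unif \<Otimes>\<^sub>M unif)" unfolding d_def[abs_def] by (rule bcdiff_measurable)
  have db: "\<bar>d q\<bar> \<le> 4" for q using bcdiff_bound[of n a b "fst q" "snd q"] by (simp add: d_def)
  have coef: "(\<integral>q. d q * e p q \<partial>(unif \<Otimes>\<^sub>M unif)) = cosrank n a b (fst p) (snd p)" if "p \<in> I" for p
  proof -
    obtain j k where p: "p = (j, k)" by (cases p)
    have jk: "0 < j" "0 < k" using I that p by auto
    have tb: "\<bar>of_bool (c < u) * sbasis j u\<bar> \<le> 2" for c u j using sbasis_bounded[of j u] by (simp add: abs_mult)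
    have cb: "\<bar>clip u * sbasis j u\<bar> \<le> 2" for u j
    proof -
      have "\<bar>clip u\<bar> * \<bar>sbasis j u\<bar> \<le> 1 * 2" by (intro mult_mono sbasis_bounded) (auto simp: clip_def)
      then show ?thesis by (simp add: abs_mult)
    qed
    have clip_id: "(\<integral>u. clip u * sbasis j u \<partial>unif) = (\<integral>u. u * sbasis j u \<partial>unif)" for j
      by (rule integral_unif_cong) (auto simp: clip_def)
    define t where "t i q = (of_bool (a i < fst q) * sbasis j (fst q)) * (of_bool (b i < snd q) * sbasis k (snd q))" for i q
    define c where "c q = (clip (fst q) * sbasis j (fst q)) * (clip (snd q) * sbasis k (snd q))" for q
    have ti: "(\<integral>q. t i q \<partial>(unif \<Otimes>\<^sub>M unif)) = (sqrt 2 / (pi * real j) * (cos (pi * real j * a i) - (-1) ^ j)) *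
        (sqrt 2 / (pi * real k) * (cos (pi * real k * b i) - (-1) ^ k))" for i
      unfolding t_def
      using sbasis_integral_tail[OF jk(1), of "a i"] sbasis_integral_tail[OF jk(2), of "b i"] a[of i] b[of i]
      by (subst pint[of "\<lambda>u. of_bool (a i < u) * sbasis j u" "\<lambda>u. of_bool (b i < u) * sbasis k u" 2, OF _ _ tb tb]) auto
    have ci: "(\<integral>q. c q \<partial>(unif \<Otimes>\<^sub>M unif)) = (sqrt 2 / (pi * real j) * (-1) ^ j) * (sqrt 2 / (pi * real k) * (-1) ^ k)"
      unfolding c_def
      using sbasis_integral_id[OF jk(1)] sbasis_integral_id[OF jk(2)]
      by (subst pint[of "\<lambda>u. clip u * sbasis j u" "\<lambda>u. clip u * sbasis k u" 2, OF _ _ cb cb]) (auto simp: clip_id)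
    have tint: "integrable (unif \<Otimes>\<^sub>M unif) (t i)" for i
    proof (rule UU.P.integrable_const_bound[where B="2 * 2"])
      show "AE q in unif \<Otimes>\<^sub>M unif. norm (t i q) \<le> 2 * 2"
        unfolding t_def real_norm_def abs_mult[of "of_bool _ * sbasis _ _" "of_bool _ * sbasis _ _"]
        by (intro AE_I2 mult_mono tb) auto
      show "t i \<in> borel_measurable (unif \<Otimes>\<^sub>M unif)" unfolding t_def[abs_def] by measurable
    qed
    have cint: "integrable (unif \<Otimes>\<^sub>M unif) c"
    proof (rule UU.P.integrable_const_bound[where B="2 * 2"])
      show "AE q in unif \<Otimes>\<^sub>M unif. norm (c q) \<le> 2 * 2"
        unfolding c_def real_norm_def abs_mult[of "clip _ * sbasis _ _" "clip _ * sbasis _ _"]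
        by (intro AE_I2 mult_mono cb) auto
      show "c \<in> borel_measurable (unif \<Otimes>\<^sub>M unif)" unfolding c_def[abs_def] by measurable
    qed
    have "d q * e p q = (\<Sum>i<n. t i q) / real n - c q" for q
    proof -
      have gen: "(S / N - x * y) * (E * F) = S * (E * F) / N - (x * E) * (y * F)" for S N x y E F :: real
        by (simp add: algebra_simps)
      have "(\<Sum>i<n. t i q) = (\<Sum>i<n. of_bool (a i < fst q) * of_bool (b i < snd q)) * (sbasis j (fst q) * sbasis k (snd q))"
        unfolding t_def sum_distrib_right by (intro sum.cong refl) (simp only: mult_ac)
      then show ?thesis
        unfolding d_def bcdiff_def e_def p c_def fst_conv snd_conv by (simp only: gen)
    qed
    then have "(\<integral>q. d q * e p q \<partial>(unif \<Otimes>\<^sub>M unif)) = (\<Sum>i<n. \<integral>q. t i q \<partial>(unif \<Otimes>\<^sub>M unif)) / real n - (\<integral>q. c q \<partial>(unif \<Otimes>\<^sub>M unif))"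
      using tint cint by simp
    also have "\<dots> = 2 / (pi\<^sup>2 * real j * real k) * ((\<Sum>i<n. (cos (pi * real j * a i) - (-1) ^ j) * (cos (pi * real k * b i) - (-1) ^ k)) / real n - (-1) ^ j * (-1) ^ k)"
    proof -
      have r: "(sqrt 2 / (pi * real j) * x) * (sqrt 2 / (pi * real k) * y) = 2 / (pi\<^sup>2 * real j * real k) * (x * y)" for x y
      proof -
        have "(sqrt 2 / (pi * real j) * x) * (sqrt 2 / (pi * real k) * y) = (sqrt 2 * sqrt 2) * (x * y) / ((pi * real j) * (pi * real k))"
          by (simp add: mult_ac)
        then show ?thesis by (simp add: power2_eq_square mult_ac)
      qed
      show ?thesis unfolding ti ci r sum_distrib_left[symmetric] by (simp add: right_diff_distrib)
    qed
    \<comment> \<open>The constant term of the expansion, divided by \<open>n\<close>, cancels the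
      contribution of \<open>u * v\<close>; what is left is the double cosine sum corrected by its
      two marginal sums.\<close>
    also have "(\<Sum>i<n. (cos (pi * real j * a i) - (-1) ^ j) * (cos (pi * real k * b i) - (-1) ^ k)) =
      (\<Sum>i<n. cos (pi * real j * a i) * cos (pi * real k * b i)) - (-1) ^ k * (\<Sum>i<n. cos (pi * real j * a i))
       - (-1) ^ j * (\<Sum>i<n. cos (pi * real k * b i)) + real n * ((-1) ^ j * (-1) ^ k)"
      by (simp add: algebra_simps sum.distrib sum_subtractf sum_distrib_left)
    finally show ?thesis
      using n unfolding cosrank_def p by (simp add: add_divide_distrib)
  qed
  have "(\<Sum>p\<in>I. (\<integral>q. d q * e p q \<partial>(unif \<Otimes>\<^sub>M unif))\<^sup>2) \<le> (\<integral>q. (d q)\<^sup>2 \<partial>(unif \<Otimes>\<^sub>M unif))"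
    by (rule Bessel_inequality_prob[OF UU.P.prob_space_axioms fin dm db em eb orth])
  then show ?thesis
    using coef by (simp add: Tint_bcdiff d_def split_beta')
qed

text \<open>Without ties the count of smaller observations is injective into \<open>{..<n}\<close>,
  hence onto. Sums over ranks thereby lose all randomness.\<close>

lemma srank_bij:
  fixes x :: "nat \<Rightarrow> real"
  assumes inj: "inj_on x {..<n}"
  shows "bij_betw (\<lambda>i. card {l \<in> {..<n}. x l < x i}) {..<n} {..<n}"
proof -
  let ?c = "\<lambda>i. card {l \<in> {..<n}. x l < x i}"
  have lt: "?c i < ?c k" if "i < n" "x i < x k" for i k
  proof (rule psubset_card_mono)
    have "{l \<in> {..<n}. x l < x i} \<subseteq> {l \<in> {..<n}. x l < x k}"
    proof
      fix l assume "l \<in> {l \<in> {..<n}. x l < x i}"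
      then have "l < n" "x l < x i" by simp_all
      then show "l \<in> {l \<in> {..<n}. x l < x k}" using that(2) by simp
    qed
    moreover have "i \<in> {l \<in> {..<n}. x l < x k}" "i \<notin> {l \<in> {..<n}. x l < x i}" using that by simp_all
    ultimately show "{l \<in> {..<n}. x l < x i} \<subset> {l \<in> {..<n}. x l < x k}" by blast
  qed simp
  have inj': "inj_on ?c {..<n}"
  proof (rule inj_onI)
    fix i k assume ik: "i \<in> {..<n}" "k \<in> {..<n}" "?c i = ?c k"
    then have "\<not> x i < x k" "\<not> x k < x i" using lt[of i k] lt[of k i] by auto
    then show "i = k" using inj ik by (auto dest: inj_onD)
  qed
  moreover have "?c ` {..<n} \<subseteq> {..<n}"
  proof
    fix y assume "y \<in> ?c ` {..<n}"
    then obtain i where i: "i < n" "y = ?c i" by auto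
    have "{l \<in> {..<n}. x l < x i} \<subseteq> {..<n} - {i}" by auto
    then have "?c i \<le> card ({..<n} - {i})" by (intro card_mono) auto
    also have "\<dots> < card {..<n}" using i by (intro card_Diff1_less) auto
    finally have "?c i < card {..<n}" .
    then show "y \<in> {..<n}" using i by simp
  qed
  ultimately show ?thesis
    unfolding bij_betw_def using endo_inj_surj[OF finite_lessThan] by blast
qed

lemma sum_srank:
  fixes x :: "nat \<Rightarrow> real" and f :: "real \<Rightarrow> real"
  assumes inj: "inj_on x {..<n}"
  shows "(\<Sum>i<n. f (srank n x i)) = (\<Sum>r<n. f (real r / real n))"
  using sum.reindex_bij_betw[OF srank_bij[OF inj], of "\<lambda>r. f (real r / real n)"] unfolding srank_def .

text \<open>Multiplication by \<open>2 * sin (x / 2)\<close> telescopes the sum. The value is 0 or 1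
  whatever \<open>n\<close> is, so the marginal sums in \<open>cosrank\<close> disappear after
  division by \<open>sqrt n\<close>.\<close>

lemma sum_cos_grid:
  assumes "0 < j" "j < n"
  shows "(\<Sum>r<n. cos (pi * real j * (real r / real n))) = (1 - (-1) ^ j) / 2"
proof -
  define x where "x = pi * real j / real n"
  have "2 * sin (x / 2) * cos (real r * x) = sin ((real (Suc r) - 1 / 2) * x) - sin ((real r - 1 / 2) * x)" for r
  proof -
    have e: "(real (Suc r) - 1 / 2) * x = real r * x + x / 2" "(real r - 1 / 2) * x = real r * x - x / 2"
      by (simp_all add: algebra_simps)
    show ?thesis unfolding e sin_add sin_diff by (simp add: mult.commute)
  qed
  then have "2 * sin (x / 2) * (\<Sum>r<n. cos (real r * x)) = (\<Sum>r<n. sin ((real (Suc r) - 1 / 2) * x) - sin ((real r - 1 / 2) * x))"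
    by (simp add: sum_distrib_left)
  also have "\<dots> = sin ((real n - 1 / 2) * x) - sin ((real 0 - 1 / 2) * x)"
    by (rule sum_lessThan_telescope)
  also have "(real n - 1 / 2) * x = pi * real j - x / 2"
    using assms by (simp add: x_def left_diff_distrib diff_divide_distrib)
  also have "sin (pi * real j - x / 2) = - ((-1) ^ j * sin (x / 2))"
    by (simp add: sin_diff cos_int_pi)
  also have "(real 0 - 1 / 2) * x = - (x / 2)" by simp
  finally have "2 * sin (x / 2) * (\<Sum>r<n. cos (real r * x)) = 2 * sin (x / 2) * ((1 - (-1) ^ j) / 2)"
    by (simp add: algebra_simps)
  moreover have "sin (x / 2) > 0"
  proof (rule sin_gt_zero)
    show "0 < x / 2" using assms by (simp add: x_def)
    have "real j / real n < 2" using assms by (simp add: divide_less_eq)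
    then have "pi * (real j / real n) < pi * 2" by (intro mult_strict_left_mono) auto
    then show "x / 2 < pi" unfolding x_def by simp
  qed
  ultimately have "(\<Sum>r<n. cos (real r * x)) = (1 - (-1) ^ j) / 2" by simp
  then show ?thesis by (simp add: x_def mult_ac)
qed

section \<open>Ranks under an atomless distribution\<close>

lemma integral_pair_product:
  fixes f :: "'a \<Rightarrow> real" and g :: "'b \<Rightarrow> real"
  assumes M: "prob_space M" and N: "prob_space N"
    and f [measurable]: "f \<in> borel_measurable M" and g [measurable]: "g \<in> borel_measurable N"
    and fb: "\<And>x. \<bar>f x\<bar> \<le> B" and gb: "\<And>y. \<bar>g y\<bar> \<le> B'"
  shows "integrable (M \<Otimes>\<^sub>M N) (\<lambda>p. f (fst p) * g (snd p))"
    "(\<integral>p. f (fst p) * g (snd p) \<partial>(M \<Otimes>\<^sub>M N)) = (\<integral>x. f x \<partial>M) * (\<integral>y. g y \<partial>N)"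
proof -
  interpret M: prob_space M by fact
  interpret N: prob_space N by fact
  interpret MN: pair_prob_space M N ..
  have B0: "0 \<le> B" using fb[of undefined] by linarith
  show i: "integrable (M \<Otimes>\<^sub>M N) (\<lambda>p. f (fst p) * g (snd p))"
    by (rule MN.P.integrable_const_bound[where B="B * B'"]) (auto simp: abs_mult B0 intro!: mult_mono fb gb)
  then have i': "integrable (M \<Otimes>\<^sub>M N) (\<lambda>(x, y). f x * g y)" by (simp add: split_beta')
  have "(\<integral>p. f (fst p) * g (snd p) \<partial>(M \<Otimes>\<^sub>M N)) = (\<integral>(x, y). f x * g y \<partial>(M \<Otimes>\<^sub>M N))"
    by (simp add: split_beta')
  also have "\<dots> = (\<integral>x. (\<integral>y. f x * g y \<partial>N) \<partial>M)" by (rule MN.integral_fst[OF i', symmetric])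
  finally show "(\<integral>p. f (fst p) * g (snd p) \<partial>(M \<Otimes>\<^sub>M N)) = (\<integral>x. f x \<partial>M) * (\<integral>y. g y \<partial>N)" by simp
qed

lemma srank_sum: "srank n x i = (\<Sum>l<n. of_bool (x l < x i)) / real n"
proof -
  have "(\<Sum>l<n. of_bool (x l < x i) :: real) = (\<Sum>l<n. if x l < x i then 1 else 0)"
    by (intro sum.cong) auto
  then show ?thesis by (simp add: srank_def sum.If_cases Int_def)
qed

lemma srank_cong: "(\<And>l. l < n \<Longrightarrow> x l = y l) \<Longrightarrow> i < n \<Longrightarrow> srank n x i = srank n y i"
  by (simp add: srank_sum)

text \<open>Equals the ceiling of \<open>n * u\<close>. Without ties it is also the number of sample
  ranks below \<open>u\<close>, a deterministic quantity.\<close>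

definition upper :: "nat \<Rightarrow> real \<Rightarrow> real" where
  "upper n u = real (card {r \<in> {..<n}. real r / real n < u})"

locale atomless_distribution = real_distribution M for M +
  assumes atomless: "measure M {a} = 0"
begin

abbreviation F where "F \<equiv> cdf M"

lemma F01: "0 \<le> F x" "F x \<le> 1"
  by (auto simp: cdf_nonneg cdf_bounded_prob)

lemma F_measurable [measurable]: "F \<in> borel_measurable borel"
  by (intro borel_measurable_mono monoI cdf_nondecreasing)

lemma measure_lessThan: "measure M {..<x} = F x"
proof -
  have "measure M ({..<x} \<union> {x}) = measure M {..<x} + measure M {x}"
    by (rule finite_measure_Union) auto
  moreover have "{..<x} \<union> {x} = {..x}" by auto
  ultimately show ?thesis by (simp add: atomless cdf_def)
qed

lemma F_attains:
  assumes "0 < t" "t < 1"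
  shows "\<exists>x. F x = t"
proof -
  have "eventually (\<lambda>x. F x < t) at_bot" using cdf_lim_at_bot assms by (auto dest: order_tendstoD)
  then obtain a where a: "F a < t" by (auto simp: eventually_at_bot_linorder)
  have "eventually (\<lambda>x. t < F x) at_top" using cdf_lim_at_top_prob assms by (auto dest: order_tendstoD)
  then obtain b where b: "t < F b" by (auto simp: eventually_at_top_linorder)
  have "a \<le> b" using a b cdf_nondecreasing[of b a] by linarith
  then have "\<exists>x\<ge>a. x \<le> b \<and> F x = t"
    using a b by (intro IVT) (auto simp: isCont_cdf atomless)
  then show ?thesis by auto
qed

text \<open>The probability integral transform, proved without a quantile function: attained levels
  slightly above \<open>t\<close> bound the set from outside, and a point attaining \<open>t\<close>
  bounds it from inside. Flat pieces of \<open>F\<close> do no harm.\<close>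

lemma measure_F_le: "measure M {x. F x \<le> t} = max 0 (min 1 t)"
proof -
  have upper: "measure M {x. F x \<le> t} \<le> s" if st: "t < s" "0 < s" "s < 1" for s
  proof -
    obtain z where z: "F z = s" using F_attains[of s] st(2,3) by blast
    have "{x. F x \<le> t} \<subseteq> {..z}"
    proof
      fix x assume "x \<in> {x. F x \<le> t}"
      then have "F x < F z" using z st by simp
      then have "\<not> z \<le> x" using cdf_nondecreasing[of z x] by linarith
      then show "x \<in> {..z}" by simp
    qed
    then have "measure M {x. F x \<le> t} \<le> measure M {..z}" by (intro finite_measure_mono) auto
    then show ?thesis using z by (simp add: cdf_def)
  qed
  consider "t \<le> 0" | "0 < t" "t < 1" | "1 \<le> t" by linarith
  then show ?thesis
  proof cases
    case 1
    have "measure M {x. F x \<le> t} \<le> 0"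
    proof (rule field_le_epsilon)
      fix e :: real assume "0 < e"
      have "measure M {x. F x \<le> t} \<le> min e (1/2)" using 1 \<open>0 < e\<close> by (intro upper) auto
      then show "measure M {x. F x \<le> t} \<le> 0 + e" by simp
    qed
    then show ?thesis using 1 by (simp add: measure_le_0_iff)
  next
    case 2
    have "measure M {x. F x \<le> t} \<le> t"
    proof (rule field_le_epsilon)
      fix e :: real assume "0 < e"
      have "measure M {x. F x \<le> t} \<le> min (t + e) ((1 + t) / 2)" using 2 \<open>0 < e\<close> by (intro upper) (auto simp: min_def)
      then show "measure M {x. F x \<le> t} \<le> t + e" by simp
    qed
    moreover obtain y where y: "F y = t" using F_attains[of t] 2 by blast
    have "{..y} \<subseteq> {x. F x \<le> t}" using y cdf_nondecreasing by auto
    then have "measure M {..y} \<le> measure M {x. F x \<le> t}" by (intro finite_measure_mono) auto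
    then have "t \<le> measure M {x. F x \<le> t}" using y by (simp add: cdf_def)
    ultimately show ?thesis using 2 by simp
  next
    case 3
    then have "{x. F x \<le> t} = space M" using F01(2) by (auto intro: order_trans)
    then have "measure M {x. F x \<le> t} = 1" using prob_space by (simp only:)
    then show ?thesis using 3 by simp
  qed
qed

lemma cdf_unif: "cdf unif t = max 0 (min 1 t)"
proof -
  have "emeasure unif {..t} = emeasure lborel ({0<..<1} \<inter> {..t})"
    by (simp add: unif_def emeasure_density ennreal_indicator flip: indicator_inter_arith)
  moreover have "emeasure lborel ({0<..<1} \<inter> {..t}) = ennreal (max 0 (min 1 t))"
  proof -
    consider "t \<le> 0" | "0 < t" "t < 1" | "1 \<le> t" by linarith
    then show ?thesis
    proof cases
      case 1 then have "{0<..<1} \<inter> {..t} = {}" by auto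
      then show ?thesis using 1 by simp
    next
      case 2 then have "{0<..<1} \<inter> {..t} = {0<..t}" by auto
      then show ?thesis using 2 by simp
    next
      case 3 then have "{0<..<1} \<inter> {..t} = {0<..<1}" by auto
      then show ?thesis using 3 by simp
    qed
  qed
  ultimately show ?thesis unfolding cdf_def measure_def by (simp only: enn2real_ennreal max.cobounded1)
qed

lemma distr_F: "distr M borel F = unif"
proof (rule cdf_unique)
  show "real_distribution (distr M borel F)" by (rule real_distribution_distr) simp
  show "real_distribution unif" by (rule real_distribution_unif)
  show "cdf (distr M borel F) = cdf unif"
  proof
    fix t
    have "cdf (distr M borel F) t = measure M {x. F x \<le> t}"
      unfolding cdf_def2[of "distr M borel F" t] by (subst measure_distr) (simp_all add: vimage_def)
    then show "cdf (distr M borel F) t = cdf unif t" by (simp add: measure_F_le cdf_unif)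
  qed
qed

lemma integral_F:
  fixes f :: "real \<Rightarrow> real"
  assumes "f \<in> borel_measurable borel"
  shows "(\<integral>x. f (F x) \<partial>M) = (\<integral>u. f u \<partial>unif)"
  unfolding distr_F[symmetric] using assms by (subst integral_distr) auto

section \<open>Ranks of an independent sample from an atomless law\<close>

lemma prob_PiM: "prob_space (Pi\<^sub>M I (\<lambda>_. M))"
  by (rule prob_space_PiM) (rule prob_space_axioms)

lemma component_measurable: "i \<in> I \<Longrightarrow> (\<lambda>x. x i) \<in> borel_measurable (Pi\<^sub>M I (\<lambda>_. M))"
  using measurable_component_singleton[of i I "\<lambda>_. M"] by simp

lemma srank_measurable [measurable (raw)]:
  "i < n \<Longrightarrow> (\<lambda>x. srank n x i) \<in> borel_measurable (Pi\<^sub>M {..<n} (\<lambda>_. M))"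
  unfolding srank_sum
proof (intro borel_measurable_divide borel_measurable_sum borel_measurable_const)
  fix l assume "i < n" "l \<in> {..<n}"
  then have "(\<lambda>x. x l) \<in> borel_measurable (Pi\<^sub>M {..<n} (\<lambda>_. M))" "(\<lambda>x. x i) \<in> borel_measurable (Pi\<^sub>M {..<n} (\<lambda>_. M))"
    by (auto intro: component_measurable)
  then have [measurable]: "Measurable.pred (Pi\<^sub>M {..<n} (\<lambda>_. M)) (\<lambda>x. x l < x i)"
    by (rule borel_measurable_pred_less)
  show "(\<lambda>x. of_bool (x l < x i) :: real) \<in> borel_measurable (Pi\<^sub>M {..<n} (\<lambda>_. M))"
    by measurable
qed

lemma AE_inj: "AE x in Pi\<^sub>M {..<n::nat} (\<lambda>_. M). inj_on x {..<n}"
proof -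
  have "AE x in Pi\<^sub>M {..<n} (\<lambda>_. M). \<forall>i\<in>{..<n}. \<forall>l\<in>{..<n}. i \<noteq> l \<longrightarrow> x i \<noteq> x l"
  proof (intro AE_finite_allI finite_lessThan)
    fix i l assume "i \<in> {..<n}" "l \<in> {..<n}"
    then show "AE x in Pi\<^sub>M {..<n} (\<lambda>_. M). i \<noteq> l \<longrightarrow> x i \<noteq> x l"
      using AE_PiM_neq[OF real_distribution_axioms atomless finite_lessThan[of n], of i l] by (cases "i = l") auto
  qed
  then show ?thesis by eventually_elim (auto simp: inj_on_def)
qed

text \<open>Given the value \<open>y\<close> of observation \<open>i\<close>, its rank counts how
  many of the \<open>n - 1\<close> others fall below \<open>y\<close>, a centred sum of variance at
  most \<open>n\<close> around its mean. Division by \<open>n\<close> leaves an error of order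
  \<open>1 / n\<close>.\<close>

lemma srank_error:
  assumes i: "i < n"
  shows "(\<integral>x. (srank n x i - F (x i))\<^sup>2 \<partial>Pi\<^sub>M {..<n} (\<lambda>_. M)) \<le> 4 / real n"
proof -
  define J where "J = {..<n} - {i}"
  have J: "{..<n} = insert i J" "finite J" "i \<notin> J" "real (card J) = real n - 1"
    using i by (auto simp: J_def of_nat_diff)
  interpret S: product_sigma_finite "\<lambda>_. M"
    by (simp add: product_sigma_finite_def sigma_finite_measure_axioms)
  interpret PJ: prob_space "Pi\<^sub>M J (\<lambda>_. M)" by (rule prob_PiM)
  interpret P: prob_space "Pi\<^sub>M {..<n} (\<lambda>_. M)" by (rule prob_PiM)
  interpret PJM: pair_prob_space "Pi\<^sub>M J (\<lambda>_. M)" M ..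
  define f where "f x = (srank n x i - F (x i))\<^sup>2" for x :: "nat \<Rightarrow> real"
  have [measurable]: "(\<lambda>x. x i) \<in> borel_measurable (Pi\<^sub>M {..<n} (\<lambda>_. M))"
    using i by (intro component_measurable) simp
  have fm: "f \<in> borel_measurable (Pi\<^sub>M {..<n} (\<lambda>_. M))"
    using i unfolding f_def[abs_def] by measurable
  have f1: "\<bar>f x\<bar> \<le> 1" for x
  proof -
    have "\<bar>srank n x i - F (x i)\<bar> \<le> 1" using srank_bounds[of n x i] F01[of "x i"] by (simp add: abs_le_iff)
    then show ?thesis by (simp add: f_def abs_square_le_1)
  qed
  have fi: "integrable (Pi\<^sub>M (insert i J) (\<lambda>_. M)) f"
    unfolding J(1)[symmetric] by (rule P.integrable_const_bound[where B=1]) (use f1 fm in auto)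
  \<comment> \<open>The squared error as a function of the other observations and of the value
    inserted at \<open>i\<close>; the strict inequality makes observation \<open>i\<close> drop out
    of its own count.\<close>
  define g where "g x y = ((\<Sum>l\<in>J. of_bool (x l < y)) / real n - F y)\<^sup>2" for x :: "nat \<Rightarrow> real" and y
  have fg: "f (x(i := y)) = g x y" for x y
  proof -
    have "(\<Sum>l<n. of_bool ((x(i := y)) l < (x(i := y)) i) :: real) = (\<Sum>l\<in>J. of_bool (x l < y))"
    proof -
      have "(\<Sum>l\<in>J. of_bool ((x(i := y)) l < y) :: real) = (\<Sum>l\<in>J. of_bool (x l < y))"
        using J by (intro sum.cong) auto
      then show ?thesis unfolding J(1) using J by simp
    qed
    then show ?thesis unfolding f_def g_def srank_sum by simp
  qed
  have gi: "integrable (Pi\<^sub>M J (\<lambda>_. M) \<Otimes>\<^sub>M M) (case_prod g)"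
  proof (rule PJM.P.integrable_const_bound[where B=1])
    show "AE p in Pi\<^sub>M J (\<lambda>_. M) \<Otimes>\<^sub>M M. norm (case p of (x, y) \<Rightarrow> g x y) \<le> 1"
      using f1 by (auto simp: fg[symmetric])
    have [measurable]: "(\<lambda>p. fst p l) \<in> borel_measurable (Pi\<^sub>M J (\<lambda>_. M) \<Otimes>\<^sub>M M)" if "l \<in> J" for l
      using measurable_compose[OF measurable_fst component_measurable[OF that]] .
    have [measurable]: "snd \<in> borel_measurable (Pi\<^sub>M J (\<lambda>_. M) \<Otimes>\<^sub>M M)"
      using measurable_snd[of "Pi\<^sub>M J (\<lambda>_. M)" M] by simp
    show "(\<lambda>(x, y). g x y) \<in> borel_measurable (Pi\<^sub>M J (\<lambda>_. M) \<Otimes>\<^sub>M M)"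
      unfolding g_def split_beta' by measurable
  qed
  have "(\<integral>x. f x \<partial>Pi\<^sub>M {..<n} (\<lambda>_. M)) = (\<integral>x. (\<integral>y. g x y \<partial>M) \<partial>Pi\<^sub>M J (\<lambda>_. M))"
    unfolding J(1) using S.product_integral_insert[OF J(2,3) fi] by (simp add: fg)
  also have "\<dots> = (\<integral>y. (\<integral>x. g x y \<partial>Pi\<^sub>M J (\<lambda>_. M)) \<partial>M)"
    by (rule PJM.Fubini_integral[OF gi, symmetric])
  also have "\<dots> \<le> (\<integral>y. 4 / real n \<partial>M)"
  proof (rule integral_mono)
    show "integrable M (\<lambda>y. \<integral>x. g x y \<partial>Pi\<^sub>M J (\<lambda>_. M))" by (rule PJM.integrable_snd[OF gi])
    fix y
    define \<psi> where "\<psi> x = of_bool (x < y) - F y" for x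
    have \<psi>m: "\<psi> \<in> borel_measurable M" unfolding \<psi>_def[abs_def] by measurable
    have \<psi>b: "\<bar>\<psi> x\<bar> \<le> 1" for x using F01[of y] by (auto simp: \<psi>_def)
    have \<psi>0: "(\<integral>x. \<psi> x \<partial>M) = 0"
    proof -
      have "(\<lambda>x. of_bool (x < y) :: real) = indicator {..<y}" by (auto simp: indicator_def)
      then have "integrable M (\<lambda>x. of_bool (x < y) :: real)" "(\<integral>x. of_bool (x < y) \<partial>M) = F y"
        by (simp_all add: measure_lessThan integrable_real_indicator emeasure_eq_measure)
      then show ?thesis by (simp add: \<psi>_def prob_space[simplified])
    qed
    have \<psi>2: "(\<integral>x. (\<psi> x)\<^sup>2 \<partial>M) \<le> 1"
    proof -
      have "(\<integral>x. (\<psi> x)\<^sup>2 \<partial>M) \<le> (\<integral>x. 1 \<partial>M)"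
        using \<psi>m \<psi>b by (intro integral_mono integrable_const_bound[where B=1]) (auto simp: abs_square_le_1)
      then show ?thesis by (simp add: prob_space[simplified])
    qed
    have sq: "(\<integral>x. (\<Sum>l\<in>J. 1 * \<psi> (x l))\<^sup>2 \<partial>Pi\<^sub>M J (\<lambda>_. M)) = (\<Sum>l\<in>J. 1\<^sup>2) * (\<integral>x. (\<psi> x)\<^sup>2 \<partial>M)"
      by (rule PiM_integral_sum_square[OF prob_space_axioms J(2) \<psi>m \<psi>b \<psi>0])
    have sm: "(\<lambda>x. \<Sum>l\<in>J. \<psi> (x l)) \<in> borel_measurable (Pi\<^sub>M J (\<lambda>_. M))"
    proof (rule borel_measurable_sum)
      fix l assume "l \<in> J"
      show "(\<lambda>x. \<psi> (x l)) \<in> borel_measurable (Pi\<^sub>M J (\<lambda>_. M))"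
        by (rule measurable_compose[OF measurable_component_singleton[OF \<open>l \<in> J\<close>] \<psi>m])
    qed
    have si: "integrable (Pi\<^sub>M J (\<lambda>_. M)) (\<lambda>x. (\<Sum>l\<in>J. \<psi> (x l))\<^sup>2)"
    proof (rule PJ.integrable_const_bound[where B="(real (card J))\<^sup>2"])
      have "(\<Sum>l\<in>J. \<psi> (x l))\<^sup>2 \<le> (real (card J))\<^sup>2" for x
      proof -
        have "\<bar>\<Sum>l\<in>J. \<psi> (x l)\<bar> \<le> (\<Sum>l\<in>J. \<bar>\<psi> (x l)\<bar>)" by (rule sum_abs)
        also have "\<dots> \<le> (\<Sum>l\<in>J. 1)" by (intro sum_mono \<psi>b)
        finally have "\<bar>\<Sum>l\<in>J. \<psi> (x l)\<bar> \<le> \<bar>real (card J)\<bar>" by simp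
        then show ?thesis by (simp only: abs_le_square_iff)
      qed
      then show "AE x in Pi\<^sub>M J (\<lambda>_. M). norm ((\<Sum>l\<in>J. \<psi> (x l))\<^sup>2) \<le> (real (card J))\<^sup>2"
        by (intro AE_I2) simp
    qed (use sm in measurable)
    \<comment> \<open>There are \<open>n - 1\<close> summands but the normalization is
      \<open>n\<close>; the mismatch is the extra \<open>F y\<close>, which is at most 1.\<close>
    have gle: "g x y \<le> 2 / (real n)\<^sup>2 * (\<Sum>l\<in>J. \<psi> (x l))\<^sup>2 + 2 / (real n)\<^sup>2" for x
    proof -
      have "(\<Sum>l\<in>J. \<psi> (x l)) = (\<Sum>l\<in>J. of_bool (x l < y)) - (real n - 1) * F y"
        using J by (simp add: \<psi>_def sum_subtractf)
      then have "(\<Sum>l\<in>J. of_bool (x l < y)) / real n - F y = ((\<Sum>l\<in>J. \<psi> (x l)) - F y) / real n"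
        using i by (simp add: field_simps)
      then have "g x y = ((\<Sum>l\<in>J. \<psi> (x l)) - F y)\<^sup>2 / (real n)\<^sup>2"
        by (simp add: g_def power_divide)
      also have "((\<Sum>l\<in>J. \<psi> (x l)) - F y)\<^sup>2 \<le> 2 * (\<Sum>l\<in>J. \<psi> (x l))\<^sup>2 + 2 * (F y)\<^sup>2"
        using zero_le_power2[of "(\<Sum>l\<in>J. \<psi> (x l)) + F y"] by (simp add: power2_eq_square algebra_simps)
      also have "(F y)\<^sup>2 \<le> 1" using F01[of y] by (simp add: power_le_one)
      finally have "g x y \<le> (2 * (\<Sum>l\<in>J. \<psi> (x l))\<^sup>2 + 2 * 1) / (real n)\<^sup>2" by (simp add: divide_right_mono)
      then show ?thesis by (simp add: add_divide_distrib)
    qed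
    have "(\<integral>x. g x y \<partial>Pi\<^sub>M J (\<lambda>_. M)) \<le> (\<integral>x. 2 / (real n)\<^sup>2 * (\<Sum>l\<in>J. \<psi> (x l))\<^sup>2 + 2 / (real n)\<^sup>2 \<partial>Pi\<^sub>M J (\<lambda>_. M))"
    proof (rule integral_mono)
      have [measurable]: "(\<lambda>x. x l) \<in> borel_measurable (Pi\<^sub>M J (\<lambda>_. M))" if "l \<in> J" for l
        using that by (rule component_measurable)
      show "integrable (Pi\<^sub>M J (\<lambda>_. M)) (\<lambda>x. g x y)"
      proof (rule PJ.integrable_const_bound[where B=1])
        show "AE x in Pi\<^sub>M J (\<lambda>_. M). norm (g x y) \<le> 1" using f1 by (auto simp: fg[symmetric])
        show "(\<lambda>x. g x y) \<in> borel_measurable (Pi\<^sub>M J (\<lambda>_. M))" unfolding g_def by measurable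
      qed
    qed (use si gle in auto)
    also have "\<dots> = 2 / (real n)\<^sup>2 * ((real n - 1) * (\<integral>x. (\<psi> x)\<^sup>2 \<partial>M)) + 2 / (real n)\<^sup>2"
      using si sq J(4) by (simp add: PJ.prob_space)
    also have "\<dots> \<le> 2 / (real n)\<^sup>2 * (real n * 1) + 2 * real n / (real n)\<^sup>2"
      using i \<psi>2 by (intro add_mono mult_left_mono mult_mono divide_right_mono) auto
    also have "\<dots> = 4 / real n" using i by (simp add: power2_eq_square field_simps)
    finally show "(\<integral>x. g x y \<partial>Pi\<^sub>M J (\<lambda>_. M)) \<le> 4 / real n" .
  qed simp
  finally show ?thesis by (simp add: f_def prob_space[simplified])
qed

lemma cos_srank_error:
  assumes i: "i < n"
  shows "(\<integral>x. (cos (pi * real j * srank n x i) - cos (pi * real j * F (x i)))\<^sup>2 \<partial>Pi\<^sub>M {..<n} (\<lambda>_. M)) \<le> 4 * (pi * real j)\<^sup>2 / real n"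
proof -
  interpret P: prob_space "Pi\<^sub>M {..<n} (\<lambda>_. M)" by (rule prob_PiM)
  have [measurable]: "(\<lambda>x. x i) \<in> borel_measurable (Pi\<^sub>M {..<n} (\<lambda>_. M))"
    using i by (intro component_measurable) simp
  have le: "(cos (pi * real j * srank n x i) - cos (pi * real j * F (x i)))\<^sup>2 \<le> (pi * real j)\<^sup>2 * (srank n x i - F (x i))\<^sup>2" for x
  proof -
    have "\<bar>cos a - cos b\<bar> \<le> \<bar>a - b\<bar>" for a b :: real
    proof -
      have "\<bar>cos a - cos b\<bar> = 2 * (\<bar>sin ((a + b) / 2)\<bar> * \<bar>sin ((b - a) / 2)\<bar>)"
        by (simp add: cos_diff_cos abs_mult)
      also have "\<dots> \<le> 2 * (1 * \<bar>(b - a) / 2\<bar>)"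
        by (intro mult_left_mono mult_mono abs_sin_x_le_abs_x) auto
      also have "\<dots> = \<bar>a - b\<bar>" by (simp add: abs_minus_commute)
      finally show ?thesis .
    qed
    then have "\<bar>cos (pi * real j * srank n x i) - cos (pi * real j * F (x i))\<bar> \<le> \<bar>pi * real j * (srank n x i - F (x i))\<bar>"
      by (metis right_diff_distrib)
    then show ?thesis unfolding power_mult_distrib[symmetric] abs_le_square_iff .
  qed
  have s1: "integrable (Pi\<^sub>M {..<n} (\<lambda>_. M)) (\<lambda>x. (srank n x i - F (x i))\<^sup>2)"
  proof (rule P.integrable_const_bound[where B=1])
    have "\<bar>srank n x i - F (x i)\<bar> \<le> 1" for x using srank_bounds[of n x i] F01[of "x i"] by (simp add: abs_le_iff)
    then show "AE x in Pi\<^sub>M {..<n} (\<lambda>_. M). norm ((srank n x i - F (x i))\<^sup>2) \<le> 1" by (simp add: abs_square_le_1)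
  qed (use i in measurable)
  have "(\<integral>x. (cos (pi * real j * srank n x i) - cos (pi * real j * F (x i)))\<^sup>2 \<partial>Pi\<^sub>M {..<n} (\<lambda>_. M)) \<le>
    (\<integral>x. (pi * real j)\<^sup>2 * (srank n x i - F (x i))\<^sup>2 \<partial>Pi\<^sub>M {..<n} (\<lambda>_. M))"
  proof (rule integral_mono)
    show "integrable (Pi\<^sub>M {..<n} (\<lambda>_. M)) (\<lambda>x. (pi * real j)\<^sup>2 * (srank n x i - F (x i))\<^sup>2)"
      using s1 by simp
    then show "integrable (Pi\<^sub>M {..<n} (\<lambda>_. M)) (\<lambda>x. (cos (pi * real j * srank n x i) - cos (pi * real j * F (x i)))\<^sup>2)"
    proof (rule Bochner_Integration.integrable_bound)
      show "(\<lambda>x. (cos (pi * real j * srank n x i) - cos (pi * real j * F (x i)))\<^sup>2) \<in> borel_measurable (Pi\<^sub>M {..<n} (\<lambda>_. M))"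
        using i by measurable
    qed (use le in auto)
  qed (rule le)
  also have "\<dots> \<le> (pi * real j)\<^sup>2 * (4 / real n)"
    using mult_left_mono[OF srank_error[OF i], of "(pi * real j)\<^sup>2"] by simp
  finally show ?thesis by (simp add: mult.commute)
qed

text \<open>Exchangeability: the product law is invariant under relabelling and ranks are relabelled
  along with the observations.\<close>

lemma permute_integral:
  assumes \<pi>: "bij_betw \<pi> {..<n} {..<n}" and il: "i < n" "l < n" and [measurable]: "h \<in> borel_measurable borel"
  shows "(\<integral>x. h (srank n x (\<pi> i)) * h (srank n x (\<pi> l)) \<partial>Pi\<^sub>M {..<n} (\<lambda>_. M)) =
    (\<integral>x. h (srank n x i) * h (srank n x l) \<partial>Pi\<^sub>M {..<n} (\<lambda>_. M) :: real)"
proof -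
  have inj: "inj_on \<pi> {..<n}" and im: "\<pi> \<in> {..<n} \<rightarrow> {..<n}" using \<pi> by (auto simp: bij_betw_def)
  let ?t = "\<lambda>x. \<lambda>m\<in>{..<n}. x (\<pi> m)"
  have d: "distr (Pi\<^sub>M {..<n} (\<lambda>_. M)) (Pi\<^sub>M {..<n} (\<lambda>_. M)) ?t = Pi\<^sub>M {..<n} (\<lambda>_. M)"
    by (rule distr_PiM_reindex[OF prob_space_axioms inj im])
  have tm: "?t \<in> measurable (Pi\<^sub>M {..<n} (\<lambda>_. M)) (Pi\<^sub>M {..<n} (\<lambda>_. M))"
    using im by (intro measurable_restrict measurable_component_singleton) auto
  have sr: "srank n (?t x) m = srank n x (\<pi> m)" if "m < n" for x m
  proof -
    have "(\<Sum>l<n. of_bool (?t x l < ?t x m) :: real) = (\<Sum>l<n. of_bool (x (\<pi> l) < x (\<pi> m)))"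
      using that by (intro sum.cong) auto
    also have "\<dots> = (\<Sum>l<n. of_bool (x l < x (\<pi> m)))"
      by (rule sum.reindex_bij_betw[OF \<pi>])
    finally show ?thesis by (simp add: srank_sum)
  qed
  have "(\<integral>x. h (srank n x i) * h (srank n x l) \<partial>Pi\<^sub>M {..<n} (\<lambda>_. M)) =
    (\<integral>x. h (srank n x i) * h (srank n x l) \<partial>distr (Pi\<^sub>M {..<n} (\<lambda>_. M)) (Pi\<^sub>M {..<n} (\<lambda>_. M)) ?t)"
    unfolding d ..
  also have "\<dots> = (\<integral>x. h (srank n (?t x) i) * h (srank n (?t x) l) \<partial>Pi\<^sub>M {..<n} (\<lambda>_. M))"
    by (rule integral_distr[OF tm]) (use il in measurable)
  finally show ?thesis using sr il by simp
qed

text \<open>Almost surely the indicators sum to the constant \<open>upper n u\<close>.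
  Exchangeability distributes this total evenly over the \<open>n\<close> indicators, and its square
  over the \<open>n\<close> diagonal and \<open>n * (n - 1)\<close> off-diagonal products, which
  determines the hypergeometric moments.\<close>

lemma rank_indicator_moments:
  assumes n: "2 \<le> n" and il: "i < n" "l < n"
  shows "(\<integral>x. of_bool (srank n x i < u) \<partial>Pi\<^sub>M {..<n} (\<lambda>_. M)) = upper n u / real n"
    "i \<noteq> l \<Longrightarrow> (\<integral>x. of_bool (srank n x i < u) * of_bool (srank n x l < u) \<partial>Pi\<^sub>M {..<n} (\<lambda>_. M)) =
      upper n u * (upper n u - 1) / (real n * (real n - 1))"
proof -
  interpret P: prob_space "Pi\<^sub>M {..<n} (\<lambda>_. M)" by (rule prob_PiM)
  define h where "h s = (of_bool (s < u) :: real)" for s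
  have hm [measurable]: "h \<in> borel_measurable borel" unfolding h_def[abs_def] by measurable
  define m where "m i l = (\<integral>x. h (srank n x i) * h (srank n x l) \<partial>Pi\<^sub>M {..<n} (\<lambda>_. M))" for i l
  have perm: "m (\<pi> i) (\<pi> l) = m i l" if "\<pi> permutes {..<n}" "i < n" "l < n" for \<pi> i l
    unfolding m_def using permutes_imp_bij[OF that(1)] that by (intro permute_integral) auto
  have int: "integrable (Pi\<^sub>M {..<n} (\<lambda>_. M)) (\<lambda>x. h (srank n x i) * h (srank n x l))" if "i < n" "l < n" for i l
    using that by (intro P.integrable_const_bound[where B=1]) (auto simp: h_def)
  have tot: "(\<Sum>i<n. h (srank n x i)) = upper n u" if "inj_on x {..<n}" for x
  proof -
    have "(\<Sum>i<n. h (srank n x i)) = (\<Sum>r<n. if real r / real n < u then 1 else 0)"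
      unfolding sum_srank[OF that] by (intro sum.cong) (auto simp: h_def)
    then show ?thesis by (simp add: upper_def sum.If_cases Int_def)
  qed
  have hh: "h s * h s = h s" for s by (simp add: h_def)
  have diag: "m i i = m 0 0" if "i < n" for i
    using perm[of "Transposition.transpose 0 i" 0 0] that n permutes_swap_id[of 0 "{..<n}" i] by simp
  have sum_diag: "(\<Sum>i<n. m i i) = upper n u"
  proof -
    have "(\<Sum>i<n. m i i) = (\<integral>x. (\<Sum>i<n. h (srank n x i) * h (srank n x i)) \<partial>Pi\<^sub>M {..<n} (\<lambda>_. M))"
      unfolding m_def using int by (subst Bochner_Integration.integral_sum) auto
    also have "\<dots> = (\<integral>x. upper n u \<partial>Pi\<^sub>M {..<n} (\<lambda>_. M))"
      using AE_inj[of n] by (intro integral_cong_AE) (auto simp: hh tot elim: eventually_mono)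
    finally show ?thesis by (simp add: P.prob_space)
  qed
  have "(\<Sum>i<n. m i i) = (\<Sum>i<n. m 0 0)" by (rule sum.cong[OF refl diag]) simp
  then have "real n * m 0 0 = upper n u" using sum_diag by simp
  then have m0: "m i i = upper n u / real n" if "i < n" for i
  proof -
    have "m i i * real n = upper n u" using \<open>real n * m 0 0 = upper n u\<close> diag[OF that] by (simp only: mult.commute)
    then show ?thesis using n by (simp only: eq_divide_eq) simp
  qed
  show "(\<integral>x. of_bool (srank n x i < u) \<partial>Pi\<^sub>M {..<n} (\<lambda>_. M)) = upper n u / real n"
    using m0[OF il(1)] by (simp add: m_def hh) (simp add: h_def)
  \<comment> \<open>Two transpositions carry \<open>(i, l)\<close> to \<open>(0, 1)\<close>: the
    first sends \<open>i\<close> to 0, the second sends the image of \<open>l\<close> to 1 and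
    leaves 0 alone because that image is not 0.\<close>
  have off: "m i l = m 0 1" if "i < n" "l < n" "i \<noteq> l" for i l
  proof -
    define \<tau>1 where "\<tau>1 = Transposition.transpose i 0"
    define \<tau>2 where "\<tau>2 = Transposition.transpose (\<tau>1 l) 1"
    have t1: "\<tau>1 l < n" "\<tau>1 l \<noteq> 0" "\<tau>1 i = 0" using that n by (auto simp: \<tau>1_def Transposition.transpose_def)
    have "\<tau>1 permutes {..<n}" "\<tau>2 permutes {..<n}"
      using that n t1 unfolding \<tau>1_def \<tau>2_def by (auto intro!: permutes_swap_id)
    then have "m i l = m (\<tau>1 i) (\<tau>1 l)" "m (\<tau>1 i) (\<tau>1 l) = m (\<tau>2 (\<tau>1 i)) (\<tau>2 (\<tau>1 l))"
      using that t1 n perm[of \<tau>1 i l] perm[of \<tau>2 "\<tau>1 i" "\<tau>1 l"] by simp_all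
    moreover have "\<tau>2 (\<tau>1 i) = 0" "\<tau>2 (\<tau>1 l) = 1" using t1 by (auto simp: \<tau>2_def Transposition.transpose_def)
    ultimately show ?thesis by simp
  qed
  have "(\<Sum>i<n. \<Sum>l<n. m i l) = (upper n u)\<^sup>2"
  proof -
    have "(\<Sum>i<n. \<Sum>l<n. m i l) = (\<integral>x. (\<Sum>i<n. \<Sum>l<n. h (srank n x i) * h (srank n x l)) \<partial>Pi\<^sub>M {..<n} (\<lambda>_. M))"
      unfolding m_def using int by (subst Bochner_Integration.integral_sum) auto
    also have "\<dots> = (\<integral>x. (upper n u)\<^sup>2 \<partial>Pi\<^sub>M {..<n} (\<lambda>_. M))"
    proof (rule integral_cong_AE)
      show "AE x in Pi\<^sub>M {..<n} (\<lambda>_. M). (\<Sum>i<n. \<Sum>l<n. h (srank n x i) * h (srank n x l)) = (upper n u)\<^sup>2"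
        using AE_inj[of n] by eventually_elim (simp add: sum_product[symmetric] tot power2_eq_square)
    qed auto
    finally show ?thesis by (simp add: P.prob_space)
  qed
  moreover have "(\<Sum>i<n. \<Sum>l<n. m i l) = real n * (upper n u / real n + (real n - 1) * m 0 1)"
  proof -
    have "(\<Sum>l<n. m i l) = upper n u / real n + (real n - 1) * m 0 1" if "i < n" for i
    proof -
      have "(\<Sum>l<n. m i l) = m i i + (\<Sum>l\<in>{..<n} - {i}. m i l)" using that by (subst sum.remove[of _ i]) auto
      also have "(\<Sum>l\<in>{..<n} - {i}. m i l) = (\<Sum>l\<in>{..<n} - {i}. m 0 1)"
        using that by (intro sum.cong refl off) auto
      also have "\<dots> = (real n - 1) * m 0 1" using that by (simp add: of_nat_diff)
      finally show ?thesis using m0 that by simp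
    qed
    then show ?thesis by simp
  qed
  ultimately have "real n * (real n - 1) * m 0 1 = upper n u * (upper n u - 1)"
  proof -
    assume "(\<Sum>i<n. \<Sum>l<n. m i l) = (upper n u)\<^sup>2"
      "(\<Sum>i<n. \<Sum>l<n. m i l) = real n * (upper n u / real n + (real n - 1) * m 0 1)"
    then have "real n * (upper n u / real n + (real n - 1) * m 0 1) = (upper n u)\<^sup>2" by (simp only:)
    moreover have "real n * (upper n u / real n + (real n - 1) * m 0 1) = upper n u + real n * (real n - 1) * m 0 1"
      using n by (simp add: distrib_left)
    ultimately show ?thesis by (simp add: power2_eq_square right_diff_distrib)
  qed
  then have "m 0 1 = upper n u * (upper n u - 1) / (real n * (real n - 1))"
    using n by (simp add: field_simps)
  then show "i \<noteq> l \<Longrightarrow> (\<integral>x. of_bool (srank n x i < u) * of_bool (srank n x l < u) \<partial>Pi\<^sub>M {..<n} (\<lambda>_. M)) =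
      upper n u * (upper n u - 1) / (real n * (real n - 1))"
    using off[OF il] by (simp add: m_def h_def)
qed

end

lemma upper_bounds:
  assumes n: "0 < n" and u: "0 < u" "u < 1"
  shows "real n * u \<le> upper n u" "upper n u \<le> real n * u + 1" "upper n u \<le> real n" "0 \<le> upper n u"
proof -
  have e: "{r \<in> {..<n}. real r / real n < u} = {..<nat \<lceil>real n * u\<rceil>}"
  proof -
    have "real r / real n < u \<longleftrightarrow> r < nat \<lceil>real n * u\<rceil>" for r
    proof -
      have "real r / real n < u \<longleftrightarrow> real r < real n * u" using n by (simp add: pos_divide_less_eq mult.commute)
      also have "\<dots> \<longleftrightarrow> int r < \<lceil>real n * u\<rceil>" by (simp add: less_ceiling_iff)
      also have "\<dots> \<longleftrightarrow> r < nat \<lceil>real n * u\<rceil>" by (rule zless_nat_eq_int_zless[symmetric])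
      finally show ?thesis .
    qed
    moreover have "r < n" if "real r / real n < u" for r
    proof -
      have "real r / real n < 1" using that u by linarith
      then show ?thesis using n by (simp add: divide_less_eq_1)
    qed
    ultimately show ?thesis by auto
  qed
  have c: "upper n u = of_int \<lceil>real n * u\<rceil>" using u unfolding upper_def e by simp
  show "real n * u \<le> upper n u" "upper n u \<le> real n * u + 1" unfolding c by linarith+
  have "card {r \<in> {..<n}. real r / real n < u} \<le> card {..<n}" by (intro card_mono) auto
  then show "upper n u \<le> real n" by (simp add: upper_def)
  show "0 \<le> upper n u" by (simp add: upper_def)
qed

section \<open>Second moment of the empirical copula process\<close>

text \<open>Here \<open>N\<close> is the sample size and \<open>a\<close>, \<open>b\<close> are the
  grid proportions next to \<open>u\<close>, \<open>v\<close>. The left side is an exact variance,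
  with the finite-sample factor \<open>N / (N - 1)\<close>, plus a squared rounding bias. The
  constant 9 is 2 for that factor, 3 for replacing \<open>a\<close>, \<open>b\<close> by
  \<open>u\<close>, \<open>v\<close>, and 4 for the bias.\<close>

lemma scaled_variance_bound:
  fixes N a b u v :: real
  assumes N: "2 \<le> N" and u: "0 < u" "u < 1" and v: "0 < v" "v < 1"
    and a: "u \<le> a" "a \<le> u + 1 / N" "a \<le> 1" and b: "v \<le> b" "b \<le> v + 1 / N" "b \<le> 1"
  shows "N * (a * b / N + a * b * (N * a - 1) * (N * b - 1) / (N * (N - 1)) - 2 * (u * v) * (a * b) + (u * v)\<^sup>2)
    \<le> u * (1 - u) * (v * (1 - v)) + 9 / N"
proof -
  have "N * (a * b / N + a * b * (N * a - 1) * (N * b - 1) / (N * (N - 1)) - 2 * (u * v) * (a * b) + (u * v)\<^sup>2) =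
    a * (1 - a) * (b * (1 - b)) * (N / (N - 1)) + N * (a * b - u * v)\<^sup>2"
    using N by (simp add: field_simps power2_eq_square)
  also have "a * (1 - a) * (b * (1 - b)) * (N / (N - 1)) \<le> a * (1 - a) * (b * (1 - b)) + 2 / N"
  proof -
    define P where "P = a * (1 - a) * (b * (1 - b))"
    have P: "0 \<le> P" "P \<le> 1" using a b u v unfolding P_def by (auto intro!: mult_le_one mult_nonneg_nonneg)
    have "N / (N - 1) = 1 + 1 / (N - 1)" using N by (simp add: field_simps)
    also have "\<dots> \<le> 1 + 2 / N" using N by (simp add: field_simps)
    finally have "P * (N / (N - 1)) \<le> P * (1 + 2 / N)" using P by (intro mult_left_mono) auto
    also have "\<dots> = P + P * (2 / N)" by (simp add: distrib_left)
    also have "P * (2 / N) \<le> 1 * (2 / N)" using P N by (intro mult_right_mono) auto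
    finally show ?thesis by (simp add: P_def)
  qed
  also have "a * (1 - a) * (b * (1 - b)) \<le> u * (1 - u) * (v * (1 - v)) + 3 / N"
  proof -
    have le: "x * (1 - x) \<le> y * (1 - y) + 1 / N" if "y \<le> x" "x \<le> y + 1 / N" "x \<le> 1" "0 < y" "y < 1" for x y
    proof -
      have "x * (1 - x) \<le> (y + 1 / N) * (1 - y)" using that N by (intro mult_mono) auto
      also have "\<dots> = y * (1 - y) + (1 - y) / N" by (simp add: field_simps)
      also have "(1 - y) / N \<le> 1 / N" using that N by (intro divide_right_mono) auto
      finally show ?thesis by simp
    qed
    have "a * (1 - a) * (b * (1 - b)) \<le> (u * (1 - u) + 1 / N) * (v * (1 - v) + 1 / N)"
      using le[OF a u] le[OF b v] a b u v N by (intro mult_mono) auto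
    also have "\<dots> = u * (1 - u) * (v * (1 - v)) + (u * (1 - u) / N + v * (1 - v) / N + 1 / N * (1 / N))"
    proof -
      have "(A + e) * (B + e) = A * B + (A * e + B * e + e * e)" for A B e :: real
        by (simp add: algebra_simps)
      from this[of "u * (1 - u)" "1 / N" "v * (1 - v)"] show ?thesis by simp
    qed
    also have "u * (1 - u) / N + v * (1 - v) / N + 1 / N * (1 / N) \<le> 1 / N + 1 / N + 1 / N * 1"
      using u v N by (intro add_mono divide_right_mono mult_left_mono mult_le_one) auto
    finally show ?thesis by simp
  qed
  also have "N * (a * b - u * v)\<^sup>2 \<le> 4 / N"
  proof -
    have "a * b - u * v = a * (b - v) + v * (a - u)" by (simp add: algebra_simps)
    also have "\<dots> \<le> 1 * (1 / N) + 1 * (1 / N)" using a b u v by (intro add_mono mult_mono) auto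
    finally have 1: "a * b - u * v \<le> 2 / N" by simp
    have "u * v \<le> a * b" using a b u v by (intro mult_mono) auto
    then have "(a * b - u * v)\<^sup>2 \<le> (2 / N)\<^sup>2" using 1 by (intro power_mono) auto
    then have "N * (a * b - u * v)\<^sup>2 \<le> N * (2 / N)\<^sup>2" using N by (intro mult_left_mono) auto
    then show ?thesis using N by (simp add: power2_eq_square)
  qed
  finally show ?thesis by simp
qed

locale indep_model = X: atomless_distribution \<mu> + Y: atomless_distribution \<nu> for \<mu> \<nu>
begin

abbreviation W where "W n \<equiv> Pi\<^sub>M {..<n::nat} (\<lambda>_. \<mu> \<Otimes>\<^sub>M \<nu>)"
abbreviation XY where "XY n \<equiv> Pi\<^sub>M {..<n::nat} (\<lambda>_. \<mu>) \<Otimes>\<^sub>M Pi\<^sub>M {..<n} (\<lambda>_. \<nu>)"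

text \<open>The restriction to \<open>{..<n}\<close> places the result in the product space, which
  consists of functions undefined off the index set.\<close>

definition zipn :: "nat \<Rightarrow> (nat \<Rightarrow> real) \<times> (nat \<Rightarrow> real) \<Rightarrow> nat \<Rightarrow> real \<times> real" where
  "zipn n = (\<lambda>(x, y). \<lambda>i\<in>{..<n}. (x i, y i))"

lemma prob_pair: "prob_space (\<mu> \<Otimes>\<^sub>M \<nu>)"
proof -
  interpret pair_prob_space \<mu> \<nu> ..
  show ?thesis by (rule P.prob_space_axioms)
qed

lemma prob_W: "prob_space (W n)"
  by (rule prob_space_PiM) (rule prob_pair)

lemma prob_XY: "prob_space (XY n)"
proof -
  interpret A: prob_space "Pi\<^sub>M {..<n} (\<lambda>_. \<mu>)" by (rule X.prob_PiM)
  interpret B: prob_space "Pi\<^sub>M {..<n} (\<lambda>_. \<nu>)" by (rule Y.prob_PiM)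
  interpret pair_prob_space "Pi\<^sub>M {..<n} (\<lambda>_. \<mu>)" "Pi\<^sub>M {..<n} (\<lambda>_. \<nu>)" ..
  show ?thesis by (rule P.prob_space_axioms)
qed

lemma zipn_measurable: "zipn n \<in> measurable (XY n) (W n)"
  unfolding zipn_def split_beta' by measurable

lemma distr_zipn: "distr (XY n) (W n) (zipn n) = W n"
  unfolding zipn_def by (rule distr_PiM_pair[OF X.prob_space_axioms Y.prob_space_axioms finite_lessThan])

lemma integral_W:
  fixes f :: "_ \<Rightarrow> real"
  assumes "f \<in> borel_measurable (W n)"
  shows "(\<integral>w. f w \<partial>W n) = (\<integral>p. f (zipn n p) \<partial>XY n)"
  using integral_distr[OF zipn_measurable, of f n] assms unfolding distr_zipn by simp

lemma ranks_zipn: "i < n \<Longrightarrow> ranks1 n (zipn n p) i = srank n (fst p) i"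
  "i < n \<Longrightarrow> ranks2 n (zipn n p) i = srank n (snd p) i"
  unfolding ranks1_def ranks2_def zipn_def split_beta' by (auto intro!: srank_cong)

lemma component_W: "i < n \<Longrightarrow> (\<lambda>w. fst (w i)) \<in> borel_measurable (W n)"
  "i < n \<Longrightarrow> (\<lambda>w. snd (w i)) \<in> borel_measurable (W n)"
proof -
  assume "i < n"
  then have "(\<lambda>w. w i) \<in> measurable (W n) (\<mu> \<Otimes>\<^sub>M \<nu>)" by (intro measurable_component_singleton) auto
  note c = measurable_compose[OF this measurable_fst] measurable_compose[OF this measurable_snd]
  show "(\<lambda>w. fst (w i)) \<in> borel_measurable (W n)"
    using c(1) unfolding measurable_cong_sets[OF refl X.events_eq_borel] .
  show "(\<lambda>w. snd (w i)) \<in> borel_measurable (W n)"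
    using c(2) unfolding measurable_cong_sets[OF refl Y.events_eq_borel] .
qed

lemma ranks_measurable:
  assumes "i < n"
  shows "(\<lambda>w. ranks1 n w i) \<in> borel_measurable (W n)" "(\<lambda>w. ranks2 n w i) \<in> borel_measurable (W n)"
proof -
  have *: "(\<lambda>x. of_bool (fst (x l) < fst (x i)) :: real) \<in> borel_measurable (W n)"
    "(\<lambda>x. of_bool (snd (x l) < snd (x i)) :: real) \<in> borel_measurable (W n)" if "l \<in> {..<n}" for l
  proof -
    have l: "l < n" using that by simp
    have [measurable]: "Measurable.pred (W n) (\<lambda>x. fst (x l) < fst (x i))" "Measurable.pred (W n) (\<lambda>x. snd (x l) < snd (x i))"
      using component_W[OF l] component_W[OF assms] by (auto intro: borel_measurable_pred_less)
    show "(\<lambda>x. of_bool (fst (x l) < fst (x i)) :: real) \<in> borel_measurable (W n)"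
      "(\<lambda>x. of_bool (snd (x l) < snd (x i)) :: real) \<in> borel_measurable (W n)"
      by measurable
  qed
  show "(\<lambda>w. ranks1 n w i) \<in> borel_measurable (W n)"
    unfolding ranks1_def srank_sum by (rule borel_measurable_divide[OF borel_measurable_sum[OF *(1)] borel_measurable_const])
  show "(\<lambda>w. ranks2 n w i) \<in> borel_measurable (W n)"
    unfolding ranks2_def srank_sum by (rule borel_measurable_divide[OF borel_measurable_sum[OF *(2)] borel_measurable_const])
qed

definition Dw :: "nat \<Rightarrow> (nat \<Rightarrow> real \<times> real) \<Rightarrow> real \<times> real \<Rightarrow> real" where
  "Dw n w q = bcdiff n (ranks1 n w) (ranks2 n w) (fst q) (snd q)"

lemma Dw_measurable: "(\<lambda>(w, q). Dw n w q) \<in> borel_measurable (W n \<Otimes>\<^sub>M (unif \<Otimes>\<^sub>M unif))"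
proof -
  have [measurable]: "(\<lambda>z. ranks1 n (fst z) i) \<in> borel_measurable (W n \<Otimes>\<^sub>M (unif \<Otimes>\<^sub>M unif))"
    "(\<lambda>z. ranks2 n (fst z) i) \<in> borel_measurable (W n \<Otimes>\<^sub>M (unif \<Otimes>\<^sub>M unif))" if "i < n" for i
    using measurable_compose[OF measurable_fst ranks_measurable(1)[OF that]]
      measurable_compose[OF measurable_fst ranks_measurable(2)[OF that]] by auto
  show ?thesis unfolding split_beta' Dw_def bcdiff_def by measurable
qed

lemma T_eq_Dw: "0 < n \<Longrightarrow> T_BKR n w = (\<integral>q. (Dw n w q)\<^sup>2 \<partial>(unif \<Otimes>\<^sub>M unif))"
  by (simp add: T_BKR_eq Tint_bcdiff Dw_def)

lemma prob_UU: "prob_space (unif \<Otimes>\<^sub>M unif)"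
proof -
  interpret prob_space unif by (rule prob_space_unif)
  interpret UU: pair_prob_space unif unif ..
  show ?thesis by (rule UU.P.prob_space_axioms)
qed

lemma T_measurable:
  assumes "0 < n"
  shows "T_BKR n \<in> borel_measurable (W n)"
proof -
  interpret UU: prob_space "unif \<Otimes>\<^sub>M unif" by (rule prob_UU)
  have "(\<lambda>(w, q). (Dw n w q)\<^sup>2) \<in> borel_measurable (W n \<Otimes>\<^sub>M (unif \<Otimes>\<^sub>M unif))"
    using Dw_measurable[of n] unfolding split_beta' by measurable
  from UU.borel_measurable_lebesgue_integral[OF this] show ?thesis
    using T_eq_Dw[OF assms] by (simp cong: measurable_cong)
qed

lemma Dw_bound: "(Dw n w q)\<^sup>2 \<le> 1"
  using bcdiff_bound by (simp add: Dw_def abs_square_le_1)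

lemma T_bounds: "0 < n \<Longrightarrow> 0 \<le> T_BKR n w" "0 < n \<Longrightarrow> T_BKR n w \<le> 1"
proof -
  interpret UU: prob_space "unif \<Otimes>\<^sub>M unif" by (rule prob_UU)
  assume n: "0 < n"
  show "0 \<le> T_BKR n w" by (simp add: T_eq_Dw[OF n])
  have dm: "(\<lambda>q. (Dw n w q)\<^sup>2) \<in> borel_measurable (unif \<Otimes>\<^sub>M unif)"
    using bcdiff_measurable[of n "ranks1 n w" "ranks2 n w"] unfolding Dw_def by measurable
  have "(\<integral>q. (Dw n w q)\<^sup>2 \<partial>(unif \<Otimes>\<^sub>M unif)) \<le> (\<integral>q. 1 \<partial>(unif \<Otimes>\<^sub>M unif))"
    using dm Dw_bound by (intro integral_mono UU.integrable_const_bound[where B=1]) auto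
  then show "T_BKR n w \<le> 1" by (simp add: T_eq_Dw[OF n] UU.prob_space)
qed

text \<open>The square is a double sum over observations; each term is a product of an X-rank factor
  and a Y-rank factor, independent under \<open>XY n\<close>, so the hypergeometric moments of both
  samples give its exact mean. The limit \<open>u * (1 - u) * (v * (1 - v))\<close> is a product of
  two Brownian bridge variances.\<close>

lemma integral_Dw:
  assumes n: "2 \<le> n" and u: "0 < u" "u < 1" and v: "0 < v" "v < 1"
  shows "real n * (\<integral>w. (Dw n w (u, v))\<^sup>2 \<partial>W n) \<le> u * (1 - u) * (v * (1 - v)) + 9 / real n"
proof -
  interpret P: prob_space "XY n" by (rule prob_XY)
  define \<alpha> where "\<alpha> i x = (of_bool (srank n x i < u) :: real)" for i and x :: "nat \<Rightarrow> real"
  define \<beta> where "\<beta> i y = (of_bool (srank n y i < v) :: real)" for i and y :: "nat \<Rightarrow> real"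
  have \<alpha>m: "\<alpha> i \<in> borel_measurable (Pi\<^sub>M {..<n} (\<lambda>_. \<mu>))" if "i < n" for i
  proof -
    note [measurable] = X.srank_measurable[OF that]
    show ?thesis unfolding \<alpha>_def[abs_def] by measurable
  qed
  have \<beta>m: "\<beta> i \<in> borel_measurable (Pi\<^sub>M {..<n} (\<lambda>_. \<nu>))" if "i < n" for i
  proof -
    note [measurable] = Y.srank_measurable[OF that]
    show ?thesis unfolding \<beta>_def[abs_def] by measurable
  qed
  have dm: "(\<lambda>w. (Dw n w (u, v))\<^sup>2) \<in> borel_measurable (W n)"
    using measurable_compose[OF measurable_Pair2'[of "(u, v)" "unif \<Otimes>\<^sub>M unif"] Dw_measurable[of n]]
    by (simp add: space_pair_measure)
  define p where "p = upper n u"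
  define q where "q = upper n v"
  have e1: "(\<integral>x. \<alpha> i x \<partial>Pi\<^sub>M {..<n} (\<lambda>_. \<mu>)) = p / real n" "(\<integral>y. \<beta> i y \<partial>Pi\<^sub>M {..<n} (\<lambda>_. \<nu>)) = q / real n" if "i < n" for i
    unfolding \<alpha>_def \<beta>_def p_def q_def using that n by (auto intro!: X.rank_indicator_moments(1) Y.rank_indicator_moments(1))
  have e2: "(\<integral>x. \<alpha> i x * \<alpha> l x \<partial>Pi\<^sub>M {..<n} (\<lambda>_. \<mu>)) = p * (p - 1) / (real n * (real n - 1))"
    "(\<integral>y. \<beta> i y * \<beta> l y \<partial>Pi\<^sub>M {..<n} (\<lambda>_. \<nu>)) = q * (q - 1) / (real n * (real n - 1))" if "i < n" "l < n" "i \<noteq> l" for i l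
    unfolding \<alpha>_def \<beta>_def p_def q_def using that n by (auto intro!: X.rank_indicator_moments(2) Y.rank_indicator_moments(2))
  have aa: "\<alpha> i x * \<alpha> i x = \<alpha> i x" "\<beta> i x * \<beta> i x = \<beta> i x" for i x by (simp_all add: \<alpha>_def \<beta>_def)
  define t where "t i l z = (\<alpha> i (fst z) * \<alpha> l (fst z)) * (\<beta> i (snd z) * \<beta> l (snd z))" for i l and z :: "(nat \<Rightarrow> real) \<times> (nat \<Rightarrow> real)"
  define s where "s i z = \<alpha> i (fst z) * \<beta> i (snd z)" for i and z :: "(nat \<Rightarrow> real) \<times> (nat \<Rightarrow> real)"
  have \<alpha>1: "\<bar>\<alpha> i x\<bar> \<le> 1" "\<bar>\<beta> i x\<bar> \<le> 1" "\<bar>\<alpha> i x * \<alpha> l x\<bar> \<le> 1" "\<bar>\<beta> i x * \<beta> l x\<bar> \<le> 1" for i l x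
    by (auto simp: \<alpha>_def \<beta>_def)
  have tint: "integrable (XY n) (t i l)" "(\<integral>z. t i l z \<partial>XY n) = (\<integral>x. \<alpha> i x * \<alpha> l x \<partial>Pi\<^sub>M {..<n} (\<lambda>_. \<mu>)) * (\<integral>y. \<beta> i y * \<beta> l y \<partial>Pi\<^sub>M {..<n} (\<lambda>_. \<nu>))"
    if "i < n" "l < n" for i l
    unfolding t_def[abs_def] using that \<alpha>m \<beta>m \<alpha>1
    by (auto intro!: integral_pair_product[OF X.prob_PiM Y.prob_PiM, where B=1 and B'=1])
  have sint: "integrable (XY n) (s i)" "(\<integral>z. s i z \<partial>XY n) = p * q / (real n)\<^sup>2" if "i < n" for i
  proof -
    note * = integral_pair_product[OF X.prob_PiM Y.prob_PiM \<alpha>m[OF that] \<beta>m[OF that] \<alpha>1(1,2)]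
    show "integrable (XY n) (s i)" unfolding s_def[abs_def] by (rule *(1))
    show "(\<integral>z. s i z \<partial>XY n) = p * q / (real n)\<^sup>2"
      unfolding s_def *(2) using e1[OF that] by (simp add: power2_eq_square)
  qed
  have ex: "(Dw n (zipn n z) (u, v))\<^sup>2 = (\<Sum>i<n. \<Sum>l<n. t i l z) / (real n)\<^sup>2 - (2 * (u * v) / real n) * (\<Sum>i<n. s i z) + (u * v)\<^sup>2" for z
  proof -
    have "Dw n (zipn n z) (u, v) = (\<Sum>i<n. s i z) / real n - u * v"
      using u v ranks_zipn[of _ n z] by (simp add: Dw_def bcdiff_eq cdiff_def s_def \<alpha>_def \<beta>_def)
    moreover have "(\<Sum>i<n. \<Sum>l<n. t i l z) = (\<Sum>i<n. s i z)\<^sup>2"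
      by (simp add: power2_eq_square sum_product t_def s_def mult_ac)
    ultimately show ?thesis by (simp add: power2_diff power_divide)
  qed
  have "(\<integral>w. (Dw n w (u, v))\<^sup>2 \<partial>W n) = (\<integral>z. (Dw n (zipn n z) (u, v))\<^sup>2 \<partial>XY n)"
    by (rule integral_W[OF dm])
  also have "\<dots> = (\<Sum>i<n. \<Sum>l<n. \<integral>z. t i l z \<partial>XY n) / (real n)\<^sup>2 - (2 * (u * v) / real n) * (\<Sum>i<n. \<integral>z. s i z \<partial>XY n) + (u * v)\<^sup>2"
  proof -
    have i1: "integrable (XY n) (\<lambda>z. \<Sum>i<n. \<Sum>l<n. t i l z)"
      by (intro Bochner_Integration.integrable_sum tint(1)) auto
    have i2: "integrable (XY n) (\<lambda>z. \<Sum>i<n. s i z)"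
      by (intro Bochner_Integration.integrable_sum sint(1)) auto
    have "(\<integral>z. (\<Sum>i<n. \<Sum>l<n. t i l z) / (real n)\<^sup>2 - (2 * (u * v) / real n) * (\<Sum>i<n. s i z) + (u * v)\<^sup>2 \<partial>XY n) =
      (\<integral>z. (\<Sum>i<n. \<Sum>l<n. t i l z) \<partial>XY n) / (real n)\<^sup>2 - (2 * (u * v) / real n) * (\<integral>z. (\<Sum>i<n. s i z) \<partial>XY n) + (u * v)\<^sup>2"
      using i1 i2 by (simp add: P.prob_space del: Bochner_Integration.integral_sum)
    moreover have "(\<integral>z. (\<Sum>i<n. \<Sum>l<n. t i l z) \<partial>XY n) = (\<Sum>i<n. \<Sum>l<n. \<integral>z. t i l z \<partial>XY n)"
    proof -
      have "integrable (XY n) (\<lambda>z. \<Sum>l<n. t i l z)" if "i \<in> {..<n}" for i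
        using that by (intro Bochner_Integration.integrable_sum tint(1)) auto
      then have "(\<integral>z. (\<Sum>i<n. \<Sum>l<n. t i l z) \<partial>XY n) = (\<Sum>i<n. \<integral>z. (\<Sum>l<n. t i l z) \<partial>XY n)"
        by (rule Bochner_Integration.integral_sum)
      also have "\<dots> = (\<Sum>i<n. \<Sum>l<n. \<integral>z. t i l z \<partial>XY n)"
        by (intro sum.cong refl Bochner_Integration.integral_sum tint(1)) auto
      finally show ?thesis .
    qed
    moreover have "(\<integral>z. (\<Sum>i<n. s i z) \<partial>XY n) = (\<Sum>i<n. \<integral>z. s i z \<partial>XY n)"
      by (intro Bochner_Integration.integral_sum sint(1)) auto
    ultimately show ?thesis unfolding ex by simp
  qed
  also have "(\<Sum>i<n. \<integral>z. s i z \<partial>XY n) = p * q / real n"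
    using sint(2) n by (simp add: power2_eq_square)
  also have "(\<Sum>i<n. \<Sum>l<n. \<integral>z. t i l z \<partial>XY n) = p * q / real n + p * (p - 1) * q * (q - 1) / (real n * (real n - 1))"
  proof -
    define K where "K = p * (p - 1) / (real n * (real n - 1)) * (q * (q - 1) / (real n * (real n - 1)))"
    have "(\<Sum>l<n. \<integral>z. t i l z \<partial>XY n) = p * q / (real n)\<^sup>2 + (real n - 1) * K" if "i < n" for i
    proof -
      have "(\<Sum>l<n. \<integral>z. t i l z \<partial>XY n) = (\<integral>z. t i i z \<partial>XY n) + (\<Sum>l\<in>{..<n} - {i}. \<integral>z. t i l z \<partial>XY n)"
        using that by (subst sum.remove[of _ i]) auto
      also have "(\<integral>z. t i i z \<partial>XY n) = p * q / (real n)\<^sup>2"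
        unfolding tint(2)[OF that that] aa using e1[OF that] by (simp add: power2_eq_square)
      also have "(\<Sum>l\<in>{..<n} - {i}. \<integral>z. t i l z \<partial>XY n) = (\<Sum>l\<in>{..<n} - {i}. K)"
      proof (intro sum.cong refl)
        fix l assume "l \<in> {..<n} - {i}"
        then have l: "l < n" "i \<noteq> l" by auto
        show "(\<integral>z. t i l z \<partial>XY n) = K" unfolding tint(2)[OF that l(1)] e2[OF that l] K_def ..
      qed
      also have "\<dots> = (real n - 1) * K" using that by (simp add: of_nat_diff)
      finally show ?thesis .
    qed
    then have "(\<Sum>i<n. \<Sum>l<n. \<integral>z. t i l z \<partial>XY n) = real n * (p * q / (real n)\<^sup>2 + (real n - 1) * K)" by simp
    also have "\<dots> = p * q / real n + (real n * (real n - 1)) * K"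
      using n by (simp add: power2_eq_square distrib_left)
    also have "(real n * (real n - 1)) * K = p * (p - 1) * q * (q - 1) / (real n * (real n - 1))"
      using n by (simp add: K_def)
    finally show ?thesis .
  qed
  finally have val: "(\<integral>w. (Dw n w (u, v))\<^sup>2 \<partial>W n) = (p * q / real n + p * (p - 1) * q * (q - 1) / (real n * (real n - 1))) / (real n)\<^sup>2
    - (2 * (u * v) / real n) * (p * q / real n) + (u * v)\<^sup>2" .
  define N where "N = real n"
  define a where "a = p / N"
  define b where "b = q / N"
  have N: "2 \<le> N" using n by (simp add: N_def)
  have pq: "p = N * a" "q = N * b" using N by (auto simp: a_def b_def)
  have "(p * q / N + p * (p - 1) * q * (q - 1) / (N * (N - 1))) / N\<^sup>2 - (2 * (u * v) / N) * (p * q / N) + (u * v)\<^sup>2 =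
    a * b / N + a * b * (N * a - 1) * (N * b - 1) / (N * (N - 1)) - 2 * (u * v) * (a * b) + (u * v)\<^sup>2"
    unfolding pq using N by (simp add: power2_eq_square add_divide_distrib) (simp add: mult_ac)
  moreover have "N * (a * b / N + a * b * (N * a - 1) * (N * b - 1) / (N * (N - 1)) - 2 * (u * v) * (a * b) + (u * v)\<^sup>2)
      \<le> u * (1 - u) * (v * (1 - v)) + 9 / N"
  proof (rule scaled_variance_bound[OF N u v])
    have n0: "0 < n" using n by simp
    note up = upper_bounds[OF n0 u, folded p_def N_def] and vp = upper_bounds[OF n0 v, folded q_def N_def]
    show "u \<le> a" "v \<le> b" using up(1) vp(1) N by (simp_all add: a_def b_def pos_le_divide_eq mult.commute)
    show "a \<le> u + 1 / N" "b \<le> v + 1 / N" using up(2) vp(2) N by (simp_all add: a_def b_def field_simps)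
    show "a \<le> 1" "b \<le> 1" using up(3) vp(3) N by (simp_all add: a_def b_def)
  qed
  ultimately show ?thesis unfolding val N_def[symmetric] by simp
qed

text \<open>Fubini and the pointwise second moment; the integral of \<open>u * (1 - u)\<close> over
  the unit interval is 1/6 in each variable. An upper bound is all that \<open>T_upper\<close> and
  \<open>T_tight\<close> require.\<close>

lemma expected_T:
  assumes n: "2 \<le> n"
  shows "(\<integral>w. real n * T_BKR n w \<partial>W n) \<le> 1 / 36 + 9 / real n"
proof -
  interpret UU: prob_space "unif \<Otimes>\<^sub>M unif" by (rule prob_UU)
  interpret Wn: prob_space "W n" by (rule prob_W)
  interpret WU: pair_prob_space "W n" "unif \<Otimes>\<^sub>M unif" ..
  have n0: "0 < n" using n by simp
  have di: "integrable (W n \<Otimes>\<^sub>M (unif \<Otimes>\<^sub>M unif)) (\<lambda>(w, q). (Dw n w q)\<^sup>2)"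
  proof (rule WU.P.integrable_const_bound[where B=1])
    show "(\<lambda>(w, q). (Dw n w q)\<^sup>2) \<in> borel_measurable (W n \<Otimes>\<^sub>M (unif \<Otimes>\<^sub>M unif))"
      using Dw_measurable[of n] unfolding split_beta' by measurable
  qed (use Dw_bound in \<open>auto intro!: AE_I2\<close>)
  define g where "g u = clip u * (1 - clip u)" for u
  have gm [measurable]: "g \<in> borel_measurable borel" unfolding g_def[abs_def] by measurable
  have gb: "\<bar>g u\<bar> \<le> 1" for u unfolding g_def abs_mult by (intro mult_le_one) (auto simp: clip_def)
  have g6: "(\<integral>u. g u \<partial>unif) = 1 / 6"
  proof -
    have "(\<integral>u. g u \<partial>unif) = (\<integral>u. u * (1 - u) \<partial>unif)"
      by (rule integral_unif_cong) (auto simp: g_def clip_def)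
    also have "\<dots> = (1\<^sup>2 / 2 - 1 ^ 3 / 3) - (0\<^sup>2 / 2 - 0 ^ 3 / 3)"
      by (rule integral_unif_FTC0) (auto intro!: derivative_eq_intros simp: algebra_simps power2_eq_square)
    finally show ?thesis by simp
  qed
  have gi: "integrable (unif \<Otimes>\<^sub>M unif) (\<lambda>q. g (fst q) * g (snd q))"
    "(\<integral>q. g (fst q) * g (snd q) \<partial>(unif \<Otimes>\<^sub>M unif)) = 1 / 36"
  proof -
    have gm': "g \<in> borel_measurable unif" using gm by simp
    note ip = integral_pair_product[OF prob_space_unif prob_space_unif gm' gm' gb gb]
    show "integrable (unif \<Otimes>\<^sub>M unif) (\<lambda>q. g (fst q) * g (snd q))" by (rule ip(1))
    show "(\<integral>q. g (fst q) * g (snd q) \<partial>(unif \<Otimes>\<^sub>M unif)) = 1 / 36" unfolding ip(2) g6 by simp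
  qed
  have "(\<integral>w. real n * T_BKR n w \<partial>W n) = real n * (\<integral>w. (\<integral>q. (Dw n w q)\<^sup>2 \<partial>(unif \<Otimes>\<^sub>M unif)) \<partial>W n)"
    by (simp add: T_eq_Dw[OF n0])
  also have "(\<integral>w. (\<integral>q. (Dw n w q)\<^sup>2 \<partial>(unif \<Otimes>\<^sub>M unif)) \<partial>W n) = (\<integral>q. (\<integral>w. (Dw n w q)\<^sup>2 \<partial>W n) \<partial>(unif \<Otimes>\<^sub>M unif))"
    by (rule WU.Fubini_integral[OF di, symmetric])
  also have "real n * \<dots> = (\<integral>q. real n * (\<integral>w. (Dw n w q)\<^sup>2 \<partial>W n) \<partial>(unif \<Otimes>\<^sub>M unif))" by simp
  also have "\<dots> \<le> (\<integral>q. g (fst q) * g (snd q) + 9 / real n \<partial>(unif \<Otimes>\<^sub>M unif))"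
  proof (rule integral_mono_AE)
    show "integrable (unif \<Otimes>\<^sub>M unif) (\<lambda>q. real n * (\<integral>w. (Dw n w q)\<^sup>2 \<partial>W n))"
      using WU.integrable_snd[OF di] by simp
    show "integrable (unif \<Otimes>\<^sub>M unif) (\<lambda>q. g (fst q) * g (snd q) + 9 / real n)" using gi by simp
    show "AE q in unif \<Otimes>\<^sub>M unif. real n * (\<integral>w. (Dw n w q)\<^sup>2 \<partial>W n) \<le> g (fst q) * g (snd q) + 9 / real n"
      using AE_unif_pair
    proof eventually_elim
      case (elim q)
      then show ?case using integral_Dw[OF n, of "fst q" "snd q"] by (simp add: g_def clip_def)
    qed
  qed
  also have "\<dots> = 1 / 36 + 9 / real n" using gi by (simp add: UU.prob_space)
  finally show ?thesis .
qed

section \<open>Linearization of the rank coefficients\<close>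

text \<open>Each cosine of a uniform variable has second moment 1/2, so the factor 2 makes the
  family orthonormal under independence.\<close>

definition phi :: "nat \<times> nat \<Rightarrow> real \<times> real \<Rightarrow> real" where
  "phi p z = 2 * cos (pi * real (fst p) * cdf \<mu> (fst z)) * cos (pi * real (snd p) * cdf \<nu> (snd z))"

definition Sstat :: "nat \<Rightarrow> (nat \<Rightarrow> real \<times> real) \<Rightarrow> nat \<times> nat \<Rightarrow> real" where
  "Sstat n w p = (\<Sum>i<n. phi p (w i)) / sqrt (real n)"

text \<open>Scaled so that \<open>lam p * (Rstat n w p)\<^sup>2\<close> is exactly \<open>n\<close>
  times the squared coefficient of the empirical copula difference.\<close>

definition Rstat :: "nat \<Rightarrow> (nat \<Rightarrow> real \<times> real) \<Rightarrow> nat \<times> nat \<Rightarrow> real" where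
  "Rstat n w p = sqrt (real n) * (pi\<^sup>2 * real (fst p) * real (snd p)) * cosrank n (ranks1 n w) (ranks2 n w) (fst p) (snd p)"

text \<open>Product of two Brownian bridge eigenvalues.\<close>

definition lam :: "nat \<times> nat \<Rightarrow> real" where
  "lam p = (1 / (pi\<^sup>2 * real (fst p) * real (snd p)))\<^sup>2"

lemma phi_measurable [measurable]: "phi p \<in> borel_measurable (\<mu> \<Otimes>\<^sub>M \<nu>)"
proof -
  have [measurable]: "fst \<in> borel_measurable (\<mu> \<Otimes>\<^sub>M \<nu>)" "snd \<in> borel_measurable (\<mu> \<Otimes>\<^sub>M \<nu>)"
    using measurable_fst[of \<mu> \<nu>] measurable_snd[of \<mu> \<nu>]
    unfolding measurable_cong_sets[OF refl X.events_eq_borel] measurable_cong_sets[OF refl Y.events_eq_borel] .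
  show ?thesis unfolding phi_def[abs_def] by measurable
qed

lemma phi_bound: "\<bar>phi p z\<bar> \<le> 2"
proof -
  have "\<bar>phi p z\<bar> = 2 * (\<bar>cos (pi * real (fst p) * cdf \<mu> (fst z))\<bar> * \<bar>cos (pi * real (snd p) * cdf \<nu> (snd z))\<bar>)"
    by (simp add: phi_def abs_mult)
  also have "\<dots> \<le> 2 * 1" by (intro mult_left_mono mult_le_one) auto
  finally show ?thesis by simp
qed

lemma cos_cos_mu:
  assumes "0 < j" "0 < k"
  shows "(\<integral>x. cos (pi * real j * cdf \<mu> x) \<partial>\<mu>) = 0"
    "(\<integral>x. cos (pi * real j * cdf \<mu> x) * cos (pi * real k * cdf \<mu> x) \<partial>\<mu>) = of_bool (j = k) / 2"
    "(\<integral>x. cos (pi * real j * cdf \<nu> x) \<partial>\<nu>) = 0"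
    "(\<integral>x. cos (pi * real j * cdf \<nu> x) * cos (pi * real k * cdf \<nu> x) \<partial>\<nu>) = of_bool (j = k) / 2"
  using X.integral_F[of "\<lambda>u. cos (pi * real j * u)"] X.integral_F[of "\<lambda>u. cos (pi * real j * u) * cos (pi * real k * u)"]
    Y.integral_F[of "\<lambda>u. cos (pi * real j * u)"] Y.integral_F[of "\<lambda>u. cos (pi * real j * u) * cos (pi * real k * u)"]
    integral_unif_cos_cos[OF assms] by simp_all

lemma cosF_measurable:
  "(\<lambda>x. cos (pi * real j * cdf \<mu> x)) \<in> borel_measurable \<mu>" "(\<lambda>x. cos (pi * real j * cdf \<nu> x)) \<in> borel_measurable \<nu>"
  by measurable

lemma phi_mean:
  assumes "0 < fst p" "0 < snd p"
  shows "(\<integral>z. phi p z \<partial>(\<mu> \<Otimes>\<^sub>M \<nu>)) = 0"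
proof -
  have "(\<integral>z. phi p z \<partial>(\<mu> \<Otimes>\<^sub>M \<nu>)) = 2 * (\<integral>z. cos (pi * real (fst p) * cdf \<mu> (fst z)) * cos (pi * real (snd p) * cdf \<nu> (snd z)) \<partial>(\<mu> \<Otimes>\<^sub>M \<nu>))"
    by (simp add: phi_def mult.assoc)
  also have "\<dots> = 0"
    using integral_pair_product(2)[OF X.prob_space_axioms Y.prob_space_axioms cosF_measurable(1)[of "fst p"]
        cosF_measurable(2)[of "snd p"] abs_cos_le_one abs_cos_le_one]
      cos_cos_mu(1)[OF assms(1) assms(2)] by simp
  finally show ?thesis .
qed

lemma phi_orthonormal:
  assumes "0 < fst p" "0 < snd p" "0 < fst q" "0 < snd q"
  shows "(\<integral>z. phi p z * phi q z \<partial>(\<mu> \<Otimes>\<^sub>M \<nu>)) = of_bool (p = q)"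
proof -
  let ?f = "\<lambda>x. cos (pi * real (fst p) * cdf \<mu> x) * cos (pi * real (fst q) * cdf \<mu> x)"
  let ?g = "\<lambda>x. cos (pi * real (snd p) * cdf \<nu> x) * cos (pi * real (snd q) * cdf \<nu> x)"
  have m: "?f \<in> borel_measurable \<mu>" "?g \<in> borel_measurable \<nu>" by measurable
  have b: "\<bar>?f x\<bar> \<le> 1" "\<bar>?g x\<bar> \<le> 1" for x by (auto simp: abs_mult intro!: mult_le_one)
  have "(\<integral>z. phi p z * phi q z \<partial>(\<mu> \<Otimes>\<^sub>M \<nu>)) = (\<integral>z. 4 * (?f (fst z) * ?g (snd z)) \<partial>(\<mu> \<Otimes>\<^sub>M \<nu>))"
    by (intro Bochner_Integration.integral_cong refl) (simp add: phi_def)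
  also have "\<dots> = 4 * (\<integral>z. ?f (fst z) * ?g (snd z) \<partial>(\<mu> \<Otimes>\<^sub>M \<nu>))" by simp
  also have "(\<integral>z. ?f (fst z) * ?g (snd z) \<partial>(\<mu> \<Otimes>\<^sub>M \<nu>)) = (\<integral>x. ?f x \<partial>\<mu>) * (\<integral>x. ?g x \<partial>\<nu>)"
    by (rule integral_pair_product(2)[OF X.prob_space_axioms Y.prob_space_axioms m b])
  also have "4 * \<dots> = of_bool (p = q)"
    by (simp add: cos_cos_mu(2)[OF assms(1,3)] cos_cos_mu(4)[OF assms(2,4)] prod_eq_iff)
  finally show ?thesis .
qed

lemma Sstat_measurable: "(\<lambda>w. Sstat n w p) \<in> borel_measurable (W n)"
  unfolding Sstat_def
proof (intro borel_measurable_divide borel_measurable_sum borel_measurable_const)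
  fix i assume i: "i \<in> {..<n}"
  show "(\<lambda>w. phi p (w i)) \<in> borel_measurable (W n)"
    by (rule measurable_compose[OF measurable_component_singleton[OF i, of "\<lambda>_. \<mu> \<Otimes>\<^sub>M \<nu>"] phi_measurable])
qed

lemma Sstat_second_moment:
  assumes "0 < fst p" "0 < snd p" "0 < n"
  shows "(\<integral>w. (Sstat n w p)\<^sup>2 \<partial>W n) = 1"
proof -
  have "(\<integral>w. (Sstat n w p)\<^sup>2 \<partial>W n) = (\<integral>w. (\<Sum>i<n. (1 / sqrt (real n)) * phi p (w i))\<^sup>2 \<partial>W n)"
    by (simp add: Sstat_def sum_divide_distrib)
  also have "\<dots> = (\<Sum>i<n. (1 / sqrt (real n))\<^sup>2) * (\<integral>z. (phi p z)\<^sup>2 \<partial>(\<mu> \<Otimes>\<^sub>M \<nu>))"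
    by (rule PiM_integral_sum_square[OF prob_pair finite_lessThan phi_measurable phi_bound phi_mean[OF assms(1,2)]])
  also have "\<dots> = 1"
    using phi_orthonormal[OF assms(1,2,1,2)] assms(3) by (simp add: power2_eq_square power_divide)
  finally show ?thesis .
qed

lemma Sstat_bound: "\<bar>Sstat n w p\<bar> \<le> 2 * sqrt (real n)"
proof -
  have "\<bar>\<Sum>i<n. phi p (w i)\<bar> \<le> (\<Sum>i<n. \<bar>phi p (w i)\<bar>)" by (rule sum_abs)
  also have "\<dots> \<le> (\<Sum>i<n. 2)" by (intro sum_mono phi_bound)
  finally have "\<bar>\<Sum>i<n. phi p (w i)\<bar> \<le> 2 * real n" by simp
  then have "\<bar>Sstat n w p\<bar> \<le> 2 * real n / sqrt (real n)"
    unfolding Sstat_def abs_divide by (simp add: divide_right_mono)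
  also have "2 * real n / sqrt (real n) = 2 * (real n / sqrt (real n))" by simp
  also have "real n / sqrt (real n) = sqrt (real n)" by (rule real_div_sqrt) simp
  finally show ?thesis .
qed

text \<open>The bound is free of \<open>n\<close> although the sum has \<open>n\<close> terms. The
  error splits as \<open>d * b' + a' * e + d * e\<close>. In the first two parts the rank errors of
  one sample act as fixed weights on centred independent terms of the other, so second moments add;
  the third is a product of small errors.\<close>

lemma cos_product_error:
  fixes j k n :: nat
  assumes n: "0 < n"
  defines "a \<equiv> \<lambda>i x. cos (pi * real j * srank n x i)" and "a' \<equiv> \<lambda>x. cos (pi * real j * cdf \<mu> x)"
    and "b \<equiv> \<lambda>i y. cos (pi * real k * srank n y i)" and "b' \<equiv> \<lambda>y. cos (pi * real k * cdf \<nu> y)"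
  assumes jk: "0 < j" "0 < k"
  shows "(\<integral>p. (\<Sum>i<n. a i (fst p) * b i (snd p) - a' (fst p i) * b' (snd p i))\<^sup>2 \<partial>XY n)
    \<le> 3 * (4 * (pi * real j)\<^sup>2 + 4 * (pi * real k)\<^sup>2 + 4 * (pi * real j)\<^sup>2 * (4 * (pi * real k)\<^sup>2))"
    (is "_ \<le> ?C")
proof -
  let ?X = "Pi\<^sub>M {..<n} (\<lambda>_. \<mu>)" and ?Y = "Pi\<^sub>M {..<n} (\<lambda>_. \<nu>)"
  interpret A: prob_space ?X by (rule X.prob_PiM)
  interpret B: prob_space ?Y by (rule Y.prob_PiM)
  interpret P: pair_prob_space ?X ?Y ..
  define d where "d i x = a i x - a' (x i)" for i x
  define e where "e i y = b i y - b' (y i)" for i y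
  have a'm: "a' \<in> borel_measurable \<mu>" "b' \<in> borel_measurable \<nu>" unfolding a'_def b'_def by measurable
  have ab1: "\<bar>a i x\<bar> \<le> 1" "\<bar>b i x\<bar> \<le> 1" "\<bar>a' u\<bar> \<le> 1" "\<bar>b' u\<bar> \<le> 1" for i x u
    by (auto simp: a_def b_def a'_def b'_def)
  have de2: "\<bar>d i x\<bar> \<le> 2" "\<bar>e i x\<bar> \<le> 2" for i x
    using ab1(1)[of i x] ab1(3)[of "x i"] ab1(2)[of i x] ab1(4)[of "x i"] by (auto simp: d_def e_def)
  have am: "a i \<in> borel_measurable ?X" "(\<lambda>x. a' (x i)) \<in> borel_measurable ?X" "d i \<in> borel_measurable ?X" if "i < n" for i
  proof -
    note [measurable] = X.srank_measurable[OF that]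
    show 1: "a i \<in> borel_measurable ?X" unfolding a_def by measurable
    show 2: "(\<lambda>x. a' (x i)) \<in> borel_measurable ?X"
      by (rule measurable_compose[OF measurable_component_singleton[of i "{..<n}" "\<lambda>_. \<mu>"] a'm(1)]) (use that in simp)
    show "d i \<in> borel_measurable ?X" unfolding d_def[abs_def] using 1 2 by (rule borel_measurable_diff)
  qed
  have bm: "b i \<in> borel_measurable ?Y" "(\<lambda>x. b' (x i)) \<in> borel_measurable ?Y" "e i \<in> borel_measurable ?Y" if "i < n" for i
  proof -
    note [measurable] = Y.srank_measurable[OF that]
    show 1: "b i \<in> borel_measurable ?Y" unfolding b_def by measurable
    show 2: "(\<lambda>x. b' (x i)) \<in> borel_measurable ?Y"
      by (rule measurable_compose[OF measurable_component_singleton[of i "{..<n}" "\<lambda>_. \<nu>"] a'm(2)]) (use that in simp)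
    show "e i \<in> borel_measurable ?Y" unfolding e_def[abs_def] using 1 2 by (rule borel_measurable_diff)
  qed
  have sm: "(\<lambda>p. \<Sum>i<n. f i (fst p) * g i (snd p)) \<in> borel_measurable (XY n)"
    if "\<And>i. i < n \<Longrightarrow> f i \<in> borel_measurable ?X" "\<And>i. i < n \<Longrightarrow> g i \<in> borel_measurable ?Y" for f g :: "nat \<Rightarrow> (nat \<Rightarrow> real) \<Rightarrow> real"
  proof (rule borel_measurable_sum)
    fix i assume "i \<in> {..<n}"
    then have "i < n" by simp
    from measurable_compose[OF measurable_fst that(1)[OF this]] measurable_compose[OF measurable_snd that(2)[OF this]]
    show "(\<lambda>p. f i (fst p) * g i (snd p)) \<in> borel_measurable (XY n)" by (rule borel_measurable_times)
  qed
  have si: "integrable (XY n) (\<lambda>p. (\<Sum>i<n. f i (fst p) * g i (snd p))\<^sup>2)"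
    if "\<And>i. i < n \<Longrightarrow> f i \<in> borel_measurable ?X" "\<And>i. i < n \<Longrightarrow> g i \<in> borel_measurable ?Y"
      "\<And>i x. \<bar>f i x\<bar> \<le> 2" "\<And>i x. \<bar>g i x\<bar> \<le> 2" for f g :: "nat \<Rightarrow> (nat \<Rightarrow> real) \<Rightarrow> real"
  proof (rule P.P.integrable_const_bound[where B="(\<Sum>i<n. 2 * 2)\<^sup>2"])
    have "(\<Sum>i<n. f i (fst p) * g i (snd p))\<^sup>2 \<le> (\<Sum>i<n. 2 * 2)\<^sup>2" for p
    proof -
      have "\<bar>\<Sum>i<n. f i (fst p) * g i (snd p)\<bar> \<le> (\<Sum>i<n. \<bar>f i (fst p) * g i (snd p)\<bar>)" by (rule sum_abs)
      also have "\<dots> \<le> (\<Sum>i<n. 2 * 2)" unfolding abs_mult by (intro sum_mono mult_mono that) auto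
      finally have "\<bar>\<Sum>i<n. f i (fst p) * g i (snd p)\<bar> \<le> \<bar>\<Sum>i<n. 2 * 2\<bar>" by simp
      then show ?thesis by (simp only: abs_le_square_iff)
    qed
    then show "AE p in XY n. norm ((\<Sum>i<n. f i (fst p) * g i (snd p))\<^sup>2) \<le> (\<Sum>i<n. 2 * 2)\<^sup>2"
      by (intro AE_I2) (simp only: real_norm_def abs_power2)
    show "(\<lambda>p. (\<Sum>i<n. f i (fst p) * g i (snd p))\<^sup>2) \<in> borel_measurable (XY n)"
      using sm[OF that(1,2)] by (rule borel_measurable_power)
  qed
  have d2: "(\<integral>x. (\<Sum>i<n. (d i x)\<^sup>2) \<partial>?X) \<le> 4 * (pi * real j)\<^sup>2" "integrable ?X (\<lambda>x. \<Sum>i<n. (d i x)\<^sup>2)"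
  proof -
    have di: "integrable ?X (\<lambda>x. (d i x)\<^sup>2)" if "i \<in> {..<n}" for i
    proof (rule A.integrable_const_bound[where B="2\<^sup>2"])
      show "AE x in ?X. norm ((d i x)\<^sup>2) \<le> 2\<^sup>2"
        using de2(1) by (intro AE_I2) (metis abs_le_square_iff abs_numeral abs_power2 real_norm_def)
      show "(\<lambda>x. (d i x)\<^sup>2) \<in> borel_measurable ?X" using am(3)[of i] that by (intro borel_measurable_power) auto
    qed
    then show "integrable ?X (\<lambda>x. \<Sum>i<n. (d i x)\<^sup>2)" by (rule Bochner_Integration.integrable_sum)
    have "(\<integral>x. (\<Sum>i<n. (d i x)\<^sup>2) \<partial>?X) = (\<Sum>i<n. \<integral>x. (d i x)\<^sup>2 \<partial>?X)"
      by (rule Bochner_Integration.integral_sum[OF di])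
    also have "\<dots> \<le> (\<Sum>i<n. 4 * (pi * real j)\<^sup>2 / real n)"
      unfolding d_def a_def a'_def by (intro sum_mono X.cos_srank_error) auto
    also have "\<dots> = 4 * (pi * real j)\<^sup>2" using n by simp
    finally show "(\<integral>x. (\<Sum>i<n. (d i x)\<^sup>2) \<partial>?X) \<le> 4 * (pi * real j)\<^sup>2" .
  qed
  have e2: "(\<integral>x. (\<Sum>i<n. (e i x)\<^sup>2) \<partial>?Y) \<le> 4 * (pi * real k)\<^sup>2" "integrable ?Y (\<lambda>x. \<Sum>i<n. (e i x)\<^sup>2)"
  proof -
    have di: "integrable ?Y (\<lambda>x. (e i x)\<^sup>2)" if "i \<in> {..<n}" for i
    proof (rule B.integrable_const_bound[where B="2\<^sup>2"])
      show "AE x in ?Y. norm ((e i x)\<^sup>2) \<le> 2\<^sup>2"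
        using de2(2) by (intro AE_I2) (metis abs_le_square_iff abs_numeral abs_power2 real_norm_def)
      show "(\<lambda>x. (e i x)\<^sup>2) \<in> borel_measurable ?Y" using bm(3)[of i] that by (intro borel_measurable_power) auto
    qed
    then show "integrable ?Y (\<lambda>x. \<Sum>i<n. (e i x)\<^sup>2)" by (rule Bochner_Integration.integrable_sum)
    have "(\<integral>x. (\<Sum>i<n. (e i x)\<^sup>2) \<partial>?Y) = (\<Sum>i<n. \<integral>x. (e i x)\<^sup>2 \<partial>?Y)"
      by (rule Bochner_Integration.integral_sum[OF di])
    also have "\<dots> \<le> (\<Sum>i<n. 4 * (pi * real k)\<^sup>2 / real n)"
      unfolding e_def b_def b'_def by (intro sum_mono Y.cos_srank_error) auto
    also have "\<dots> = 4 * (pi * real k)\<^sup>2" using n by simp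
    finally show "(\<integral>x. (\<Sum>i<n. (e i x)\<^sup>2) \<partial>?Y) \<le> 4 * (pi * real k)\<^sup>2" .
  qed
  have sq_le1: "(\<integral>x. (a' x)\<^sup>2 \<partial>\<mu>) \<le> 1" "(\<integral>x. (b' x)\<^sup>2 \<partial>\<nu>) \<le> 1"
    using cos_cos_mu(2)[OF jk(1) jk(1)] cos_cos_mu(4)[OF jk(2) jk(2)] by (simp_all add: a'_def b'_def power2_eq_square)
  define s1 where "s1 p = (\<Sum>i<n. d i (fst p) * b' (snd p i))" for p
  define s2 where "s2 p = (\<Sum>i<n. a' (fst p i) * e i (snd p))" for p
  define s3 where "s3 p = (\<Sum>i<n. d i (fst p) * e i (snd p))" for p
  have ab2: "\<bar>a' u\<bar> \<le> 2" "\<bar>b' u\<bar> \<le> 2" for u using ab1(3)[of u] ab1(4)[of u] by auto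
  have i1: "integrable (XY n) (\<lambda>p. (s1 p)\<^sup>2)"
    unfolding s1_def by (rule si[of d "\<lambda>i y. b' (y i)"]) (use am bm de2 ab2 in auto)
  have i2: "integrable (XY n) (\<lambda>p. (s2 p)\<^sup>2)"
    unfolding s2_def by (rule si[of "\<lambda>i y. a' (y i)" e]) (use am bm de2 ab2 in auto)
  have i3: "integrable (XY n) (\<lambda>p. (s3 p)\<^sup>2)"
    unfolding s3_def by (rule si[of d e]) (use am bm de2 ab2 in auto)
  \<comment> \<open>With the X-sample held fixed the inner integral over the Y-sample is a weighted
    sum of squares; then the expected total of the squared rank errors is bounded.\<close>
  have b1: "(\<integral>p. (s1 p)\<^sup>2 \<partial>XY n) \<le> 4 * (pi * real j)\<^sup>2"
  proof -
    have "(\<integral>p. (s1 p)\<^sup>2 \<partial>XY n) = (\<integral>x. (\<integral>y. (s1 (x, y))\<^sup>2 \<partial>?Y) \<partial>?X)"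
      by (rule P.integral_fst'[OF i1, symmetric])
    also have "\<dots> = (\<integral>x. (\<Sum>i<n. (d i x)\<^sup>2) * (\<integral>y. (b' y)\<^sup>2 \<partial>\<nu>) \<partial>?X)"
      unfolding s1_def fst_conv snd_conv
      by (intro Bochner_Integration.integral_cong refl
         PiM_integral_sum_square[OF Y.prob_space_axioms finite_lessThan a'm(2) ab1(4)])
        (use cos_cos_mu(3)[OF jk(2) jk(2)] in \<open>simp add: b'_def\<close>)
    also have "\<dots> = (\<integral>x. (\<Sum>i<n. (d i x)\<^sup>2) \<partial>?X) * (\<integral>y. (b' y)\<^sup>2 \<partial>\<nu>)"
      by (rule integral_mult_left_zero)
    also have "\<dots> \<le> (4 * (pi * real j)\<^sup>2) * 1"
      using d2(1) sq_le1 by (intro mult_mono) auto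
    finally show ?thesis by simp
  qed
  have b2: "(\<integral>p. (s2 p)\<^sup>2 \<partial>XY n) \<le> 4 * (pi * real k)\<^sup>2"
  proof -
    have i2': "integrable (XY n) (\<lambda>(x, y). (s2 (x, y))\<^sup>2)" using i2 by (simp add: split_beta')
    have "(\<integral>p. (s2 p)\<^sup>2 \<partial>XY n) = (\<integral>y. (\<integral>x. (s2 (x, y))\<^sup>2 \<partial>?X) \<partial>?Y)"
      using P.integral_snd[OF i2'] by (simp add: split_beta')
    also have "\<dots> = (\<integral>y. (\<Sum>i<n. (e i y)\<^sup>2) * (\<integral>x. (a' x)\<^sup>2 \<partial>\<mu>) \<partial>?Y)"
    proof (intro Bochner_Integration.integral_cong refl)
      fix y
      have "(\<integral>x. (\<Sum>i<n. e i y * a' (x i))\<^sup>2 \<partial>?X) = (\<Sum>i<n. (e i y)\<^sup>2) * (\<integral>x. (a' x)\<^sup>2 \<partial>\<mu>)"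
        by (rule PiM_integral_sum_square[OF X.prob_space_axioms finite_lessThan a'm(1) ab1(3)])
          (use cos_cos_mu(1)[OF jk(1) jk(1)] in \<open>simp add: a'_def\<close>)
      then show "(\<integral>x. (s2 (x, y))\<^sup>2 \<partial>?X) = (\<Sum>i<n. (e i y)\<^sup>2) * (\<integral>x. (a' x)\<^sup>2 \<partial>\<mu>)"
        by (simp add: s2_def mult.commute)
    qed
    also have "\<dots> = (\<integral>y. (\<Sum>i<n. (e i y)\<^sup>2) \<partial>?Y) * (\<integral>x. (a' x)\<^sup>2 \<partial>\<mu>)"
      by (rule integral_mult_left_zero)
    also have "\<dots> \<le> (4 * (pi * real k)\<^sup>2) * 1"
      using e2(1) sq_le1 by (intro mult_mono) auto
    finally show ?thesis by simp
  qed
  \<comment> \<open>No centring is available here; Cauchy-Schwarz separates the two samples and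
    independence factors the expectation into two bounded totals.\<close>
  have b3: "(\<integral>p. (s3 p)\<^sup>2 \<partial>XY n) \<le> 4 * (pi * real j)\<^sup>2 * (4 * (pi * real k)\<^sup>2)"
  proof -
    define f where "f x = (\<Sum>i<n. (d i x)\<^sup>2)" for x
    define g where "g y = (\<Sum>i<n. (e i y)\<^sup>2)" for y
    have sqb: "(d i x)\<^sup>2 \<le> 4" "(e i x)\<^sup>2 \<le> 4" for i x
      using de2(1)[of i x] de2(2)[of i x] abs_le_square_iff[of "d i x" 2] abs_le_square_iff[of "e i x" 2] by simp_all
    have fb: "\<bar>f x\<bar> \<le> 4 * real n" "\<bar>g x\<bar> \<le> 4 * real n" for x
      using sum_mono[of "{..<n}" "\<lambda>i. (d i x)\<^sup>2" "\<lambda>_. 4"] sum_mono[of "{..<n}" "\<lambda>i. (e i x)\<^sup>2" "\<lambda>_. 4"] sqb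
      by (auto simp: f_def g_def sum_nonneg)
    have fm: "f \<in> borel_measurable ?X" "g \<in> borel_measurable ?Y"
      using d2(2) e2(2) by (auto simp: f_def[abs_def] g_def[abs_def])
    note ip = integral_pair_product[OF A.prob_space_axioms B.prob_space_axioms fm fb]
    have "(\<integral>p. (s3 p)\<^sup>2 \<partial>XY n) \<le> (\<integral>p. f (fst p) * g (snd p) \<partial>XY n)"
      unfolding f_def g_def s3_def
      by (intro integral_mono Cauchy_Schwarz_ineq_sum i3[unfolded s3_def] ip(1)[unfolded f_def g_def])
    also have "\<dots> = (\<integral>x. f x \<partial>?X) * (\<integral>y. g y \<partial>?Y)" by (rule ip(2))
    also have "\<dots> \<le> 4 * (pi * real j)\<^sup>2 * (4 * (pi * real k)\<^sup>2)"
      using d2(1) e2(1) unfolding f_def[symmetric] g_def[symmetric]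
      by (intro mult_mono) (auto simp: f_def g_def sum_nonneg)
    finally show ?thesis .
  qed
  have dec: "(\<Sum>i<n. a i (fst p) * b i (snd p) - a' (fst p i) * b' (snd p i)) = s1 p + s2 p + s3 p" for p
    unfolding s1_def s2_def s3_def sum.distrib[symmetric]
    by (intro sum.cong refl) (simp add: d_def e_def algebra_simps)
  have "(x + y + z)\<^sup>2 \<le> 3 * (x\<^sup>2 + y\<^sup>2 + z\<^sup>2)" for x y z :: real
  proof -
    have "0 \<le> (x - y)\<^sup>2 + (y - z)\<^sup>2 + (x - z)\<^sup>2" by simp
    then show ?thesis by (simp add: power2_eq_square algebra_simps)
  qed
  then have le: "(s1 p + s2 p + s3 p)\<^sup>2 \<le> 3 * ((s1 p)\<^sup>2 + (s2 p)\<^sup>2 + (s3 p)\<^sup>2)" for p .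
  have ii: "integrable (XY n) (\<lambda>p. 3 * ((s1 p)\<^sup>2 + (s2 p)\<^sup>2 + (s3 p)\<^sup>2))" using i1 i2 i3 by simp
  have "(\<integral>p. (s1 p + s2 p + s3 p)\<^sup>2 \<partial>XY n) \<le> (\<integral>p. 3 * ((s1 p)\<^sup>2 + (s2 p)\<^sup>2 + (s3 p)\<^sup>2) \<partial>XY n)"
  proof (rule integral_mono[OF _ ii le])
    have m: "s1 \<in> borel_measurable (XY n)" "s2 \<in> borel_measurable (XY n)" "s3 \<in> borel_measurable (XY n)"
      unfolding s1_def[abs_def] s2_def[abs_def] s3_def[abs_def]
      using sm[of d "\<lambda>i y. b' (y i)"] sm[of "\<lambda>i y. a' (y i)" e] sm[of d e] am bm by auto
    then have "(\<lambda>p. (s1 p + s2 p + s3 p)\<^sup>2) \<in> borel_measurable (XY n)" by measurable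
    from Bochner_Integration.integrable_bound[OF ii this] show "integrable (XY n) (\<lambda>p. (s1 p + s2 p + s3 p)\<^sup>2)"
      using le by auto
  qed
  also have "\<dots> = 3 * ((\<integral>p. (s1 p)\<^sup>2 \<partial>XY n) + (\<integral>p. (s2 p)\<^sup>2 \<partial>XY n) + (\<integral>p. (s3 p)\<^sup>2 \<partial>XY n))"
    using i1 i2 i3 by simp
  also have "\<dots> \<le> ?C" using b1 b2 b3 by simp
  finally show ?thesis unfolding dec .
qed

text \<open>The bound of \<open>cos_product_error\<close>, plus 4 for the two marginal sums; the
  factor 8 is 4 from the squared normalization times 2 from splitting a square.\<close>

definition errC :: "nat \<times> nat \<Rightarrow> real" where
  "errC p = 8 * (3 * (4 * (pi * real (fst p))\<^sup>2 + 4 * (pi * real (snd p))\<^sup>2 + 4 * (pi * real (fst p))\<^sup>2 * (4 * (pi * real (snd p))\<^sup>2)) + 4)"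

lemma cosrank_measurable: "(\<lambda>w. cosrank n (ranks1 n w) (ranks2 n w) j k) \<in> borel_measurable (W n)"
proof -
  have [measurable]: "(\<lambda>w. ranks1 n w i) \<in> borel_measurable (W n)" "(\<lambda>w. ranks2 n w i) \<in> borel_measurable (W n)" if "i < n" for i
    by (rule ranks_measurable[OF that])+
  show ?thesis unfolding cosrank_def by measurable
qed

lemma Rstat_measurable: "(\<lambda>w. Rstat n w p) \<in> borel_measurable (W n)"
  unfolding Rstat_def by (intro borel_measurable_times borel_measurable_const cosrank_measurable)

text \<open>Replacing ranks by the true distribution functions costs a bounded amount in the
  unnormalized sum, and the marginal sums are almost surely at most 1 in absolute value.
  Normalization by \<open>sqrt n\<close> makes the mean square error of order
  \<open>1 / n\<close>.\<close>

lemma Rstat_Sstat_error: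
  assumes p: "0 < fst p" "0 < snd p" "fst p < n" "snd p < n"
  shows "(\<integral>w. (Rstat n w p - Sstat n w p)\<^sup>2 \<partial>W n) \<le> errC p / real n"
proof -
  obtain j k where jk: "p = (j, k)" by (cases p)
  have j: "0 < j" "j < n" and k: "0 < k" "k < n" using p by (auto simp: jk)
  have n: "0 < n" using j by simp
  let ?X = "Pi\<^sub>M {..<n} (\<lambda>_. \<mu>)" and ?Y = "Pi\<^sub>M {..<n} (\<lambda>_. \<nu>)"
  interpret A: prob_space ?X by (rule X.prob_PiM)
  interpret B: prob_space ?Y by (rule Y.prob_PiM)
  interpret P: pair_prob_space ?X ?Y ..
  define D where "D q = (\<Sum>i<n. cos (pi * real j * srank n (fst q) i) * cos (pi * real k * srank n (snd q) i)
     - cos (pi * real j * cdf \<mu> (fst q i)) * cos (pi * real k * cdf \<nu> (snd q i)))" for q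
  define P1 where "P1 x = (\<Sum>i<n. cos (pi * real j * srank n x i))" for x
  define P2 where "P2 y = (\<Sum>i<n. cos (pi * real k * srank n y i))" for y
  have diff: "Rstat n (zipn n q) p - Sstat n (zipn n q) p = (2 / sqrt (real n)) * (D q - (-1) ^ k * P1 (fst q) - (-1) ^ j * P2 (snd q))" for q
  proof -
    have cr: "cosrank n (ranks1 n (zipn n q)) (ranks2 n (zipn n q)) j k =
      2 / (pi\<^sup>2 * real j * real k) * (((\<Sum>i<n. cos (pi * real j * srank n (fst q) i) * cos (pi * real k * srank n (snd q) i))
       - (-1) ^ k * P1 (fst q) - (-1) ^ j * P2 (snd q)) / real n)"
      unfolding cosrank_def P1_def P2_def by (simp add: ranks_zipn)
    have "Rstat n (zipn n q) p = (2 * sqrt (real n) / real n) * ((\<Sum>i<n. cos (pi * real j * srank n (fst q) i) * cos (pi * real k * srank n (snd q) i))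
       - (-1) ^ k * P1 (fst q) - (-1) ^ j * P2 (snd q))"
      unfolding Rstat_def jk fst_conv snd_conv cr using j k by simp
    also have "2 * sqrt (real n) / real n = 2 / sqrt (real n)"
      using n by (simp add: field_simps)
    finally have R: "Rstat n (zipn n q) p = (2 / sqrt (real n)) * ((\<Sum>i<n. cos (pi * real j * srank n (fst q) i) * cos (pi * real k * srank n (snd q) i))
       - (-1) ^ k * P1 (fst q) - (-1) ^ j * P2 (snd q))" .
    have S: "Sstat n (zipn n q) p = (2 / sqrt (real n)) * (\<Sum>i<n. cos (pi * real j * cdf \<mu> (fst q i)) * cos (pi * real k * cdf \<nu> (snd q i)))"
      unfolding Sstat_def phi_def jk zipn_def split_beta' by (simp add: sum_distrib_left sum_divide_distrib mult.assoc)
    show ?thesis unfolding R S D_def sum_subtractf by (simp add: algebra_simps)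
  qed
  have srx: "(\<lambda>x. srank n x i) \<in> borel_measurable ?X" "(\<lambda>x. srank n x i) \<in> borel_measurable ?Y" if "i < n" for i
    using X.srank_measurable[OF that] Y.srank_measurable[OF that] by auto
  have P1m [measurable]: "P1 \<in> borel_measurable ?X"
  proof -
    note [measurable] = srx(1)
    show ?thesis unfolding P1_def[abs_def] by measurable
  qed
  have P2m [measurable]: "P2 \<in> borel_measurable ?Y"
  proof -
    note [measurable] = srx(2)
    show ?thesis unfolding P2_def[abs_def] by measurable
  qed
  have P1b: "\<bar>P1 x\<bar> \<le> 1" if "inj_on x {..<n}" for x
    unfolding P1_def sum_srank[OF that, of "\<lambda>s. cos (pi * real j * s)"] sum_cos_grid[OF j] by (cases "even j") auto
  have P2b: "\<bar>P2 x\<bar> \<le> 1" if "inj_on x {..<n}" for x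
    unfolding P2_def sum_srank[OF that, of "\<lambda>s. cos (pi * real k * s)"] sum_cos_grid[OF k] by (cases "even k") auto
  \<comment> \<open>Almost surely there are no ties, so both marginal sums run over the fixed grid
    \<open>r / n\<close> and equal 0 or 1.\<close>
  have AE1: "AE q in XY n. \<bar>P1 (fst q)\<bar> \<le> 1 \<and> \<bar>P2 (snd q)\<bar> \<le> 1"
  proof (rule P.AE_pair_measure)
    show "{q \<in> space (XY n). \<bar>P1 (fst q)\<bar> \<le> 1 \<and> \<bar>P2 (snd q)\<bar> \<le> 1} \<in> sets (XY n)" by measurable
    show "AE x in ?X. AE y in ?Y. \<bar>P1 (fst (x, y))\<bar> \<le> 1 \<and> \<bar>P2 (snd (x, y))\<bar> \<le> 1"
      using X.AE_inj[of n]
    proof eventually_elim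
      case (elim x)
      show ?case using Y.AE_inj[of n] by eventually_elim (use elim P1b P2b in auto)
    qed
  qed
  have Dm [measurable]: "D \<in> borel_measurable (XY n)"
  proof -
    have [measurable]: "(\<lambda>q. srank n (fst q) i) \<in> borel_measurable (XY n)" "(\<lambda>q. srank n (snd q) i) \<in> borel_measurable (XY n)"
      "(\<lambda>q. fst q i) \<in> borel_measurable (XY n)" "(\<lambda>q. snd q i) \<in> borel_measurable (XY n)" if "i < n" for i
      using measurable_compose[OF measurable_fst srx(1)[OF that]] measurable_compose[OF measurable_snd srx(2)[OF that]]
        measurable_compose[OF measurable_fst X.component_measurable[of i "{..<n}"]]
        measurable_compose[OF measurable_snd Y.component_measurable[of i "{..<n}"]] that by auto
    show ?thesis unfolding D_def[abs_def] by measurable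
  qed
  have Db: "(D q)\<^sup>2 \<le> (2 * real n)\<^sup>2" for q
  proof -
    have "\<bar>D q\<bar> \<le> (\<Sum>i<n. \<bar>cos (pi * real j * srank n (fst q) i) * cos (pi * real k * srank n (snd q) i)
     - cos (pi * real j * cdf \<mu> (fst q i)) * cos (pi * real k * cdf \<nu> (snd q i))\<bar>)"
      unfolding D_def by (rule sum_abs)
    also have "\<dots> \<le> (\<Sum>i<n. 1 * 1 + 1 * 1)"
      by (intro sum_mono order_trans[OF abs_triangle_ineq4] add_mono) (auto simp: abs_mult intro!: mult_le_one)
    finally have "\<bar>D q\<bar> \<le> \<bar>2 * real n\<bar>" by simp
    then show ?thesis by (simp only: abs_le_square_iff)
  qed
  have Di: "integrable (XY n) (\<lambda>q. (D q)\<^sup>2)"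
    by (rule P.P.integrable_const_bound[where B="(2 * real n)\<^sup>2"]) (use Db in \<open>auto intro!: AE_I2\<close>)
  have D2: "(\<integral>q. (D q)\<^sup>2 \<partial>XY n) \<le> errC p / 8 - 4"
  proof -
    define Q where "Q = 3 * (4 * (pi * real j)\<^sup>2 + 4 * (pi * real k)\<^sup>2 + 4 * (pi * real j)\<^sup>2 * (4 * (pi * real k)\<^sup>2))"
    have "errC p = 8 * (Q + 4)" unfolding errC_def jk fst_conv snd_conv Q_def ..
    then have "errC p / 8 - 4 = Q" by (simp add: field_simps)
    then show ?thesis using cos_product_error[OF n j(1) k(1)] unfolding D_def Q_def by simp
  qed
  have m: "(\<lambda>w. (Rstat n w p - Sstat n w p)\<^sup>2) \<in> borel_measurable (W n)"
    using Rstat_measurable[of n p] Sstat_measurable[of n p] by measurable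
  have "(\<integral>w. (Rstat n w p - Sstat n w p)\<^sup>2 \<partial>W n) = (\<integral>q. (Rstat n (zipn n q) p - Sstat n (zipn n q) p)\<^sup>2 \<partial>XY n)"
    by (rule integral_W[OF m])
  also have "\<dots> = (\<integral>q. 4 / real n * (D q - (-1) ^ k * P1 (fst q) - (-1) ^ j * P2 (snd q))\<^sup>2 \<partial>XY n)"
  proof -
    have "(2 / sqrt (real n) * x)\<^sup>2 = 4 / real n * x\<^sup>2" for x
      by (simp add: power_mult_distrib power_divide)
    then show ?thesis unfolding diff by (simp only:)
  qed
  also have "\<dots> \<le> (\<integral>q. 8 / real n * (D q)\<^sup>2 + 32 / real n \<partial>XY n)"
  proof (rule integral_mono_AE')
    show "integrable (XY n) (\<lambda>q. 8 / real n * (D q)\<^sup>2 + 32 / real n)" using Di by simp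
    show "AE q in XY n. 4 / real n * (D q - (-1) ^ k * P1 (fst q) - (-1) ^ j * P2 (snd q))\<^sup>2 \<le> 8 / real n * (D q)\<^sup>2 + 32 / real n"
      using AE1
    proof eventually_elim
      case (elim q)
      define r where "r = (-1) ^ k * P1 (fst q) + (-1) ^ j * P2 (snd q)"
      have "\<bar>r\<bar> \<le> \<bar>(-1) ^ k * P1 (fst q)\<bar> + \<bar>(-1) ^ j * P2 (snd q)\<bar>" unfolding r_def by (rule abs_triangle_ineq)
      also have "\<dots> \<le> 2" using elim by (simp add: abs_mult)
      finally have r: "r\<^sup>2 \<le> 4" using abs_le_square_iff[of r 2] by simp
      have e: "D q - (-1) ^ k * P1 (fst q) - (-1) ^ j * P2 (snd q) = D q - r" by (simp add: r_def)
      have "(D q - r)\<^sup>2 \<le> 2 * (D q)\<^sup>2 + 2 * r\<^sup>2"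
        using zero_le_power2[of "D q + r"] by (simp add: power2_eq_square algebra_simps)
      then have "(D q - (-1) ^ k * P1 (fst q) - (-1) ^ j * P2 (snd q))\<^sup>2 \<le> 2 * (D q)\<^sup>2 + 8"
        unfolding e using r by linarith
      then have "4 / real n * (D q - (-1) ^ k * P1 (fst q) - (-1) ^ j * P2 (snd q))\<^sup>2 \<le> 4 / real n * (2 * (D q)\<^sup>2 + 8)"
        by (intro mult_left_mono) auto
      then show ?case by (simp add: distrib_left)
    qed
  qed simp
  also have "\<dots> = 8 / real n * (\<integral>q. (D q)\<^sup>2 \<partial>XY n) + 32 / real n" using Di by (simp add: P.P.prob_space)
  also have "\<dots> \<le> 8 / real n * (errC p / 8 - 4) + 32 / real n"
    using D2 by (intro add_mono mult_left_mono) auto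
  also have "\<dots> = errC p / real n" by (simp add: right_diff_distrib)
  finally show ?thesis .
qed

end

section \<open>Approximation of the statistic by finite quadratic forms\<close>

lemma (in prob_space) markov_real:
  assumes u: "integrable M u" "\<And>x. 0 \<le> u x" and c: "(0::real) < c"
  shows "measure M {x \<in> space M. c \<le> u x} \<le> (\<integral>x. u x \<partial>M) / c"
proof -
  have [measurable]: "u \<in> borel_measurable M" using u(1) by simp
  have E: "{x \<in> space M. c \<le> u x} \<in> sets M" by measurable
  have "c * measure M {x \<in> space M. c \<le> u x} = (\<integral>x. c * indicator {x \<in> space M. c \<le> u x} x \<partial>M)"
    using E by simp
  also have "\<dots> \<le> (\<integral>x. u x \<partial>M)"
    using u E by (intro integral_mono integrable_mult_right integrable_real_indicator) (auto simp: indicator_def emeasure_eq_measure)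
  finally show ?thesis using c by (simp add: pos_le_divide_eq mult.commute)
qed

context indep_model
begin

lemma lam_pos: "0 < fst p \<Longrightarrow> 0 < snd p \<Longrightarrow> 0 < lam p"
  by (simp add: lam_def)

lemma lam_nonneg: "0 \<le> lam p"
  by (simp add: lam_def)

text \<open>This half of the approximation is deterministic: it holds for every sample and every
  finite \<open>I\<close>.\<close>

lemma qform_Rstat_le_T:
  assumes n: "0 < n" and I: "finite I" "\<And>p. p \<in> I \<Longrightarrow> 0 < fst p \<and> 0 < snd p"
  shows "qform I lam (Rstat n w) \<le> real n * T_BKR n w"
proof -
  have "lam p * (Rstat n w p)\<^sup>2 = real n * (cosrank n (ranks1 n w) (ranks2 n w) (fst p) (snd p))\<^sup>2" if "p \<in> I" for p
    using I(2)[OF that] by (simp add: lam_def Rstat_def power_mult_distrib power_divide)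
  then have "qform I lam (Rstat n w) = real n * (\<Sum>(j, k)\<in>I. (cosrank n (ranks1 n w) (ranks2 n w) j k)\<^sup>2)"
    unfolding qform_def sum_distrib_left by (intro sum.cong) (auto simp: split_beta')
  also have "(\<Sum>(j, k)\<in>I. (cosrank n (ranks1 n w) (ranks2 n w) j k)\<^sup>2) \<le> T_BKR n w"
    unfolding T_BKR_eq[OF n] using n I srank_bounds
    by (intro Tint_ge_cosrank) (auto simp: ranks1_def ranks2_def)
  finally show ?thesis by (simp add: mult_left_mono)
qed

lemma qform_Sstat_measurable: "(\<lambda>w. qform I lam (Sstat n w)) \<in> borel_measurable (W n)"
  unfolding qform_def
  by (intro borel_measurable_sum borel_measurable_times borel_measurable_const borel_measurable_power Sstat_measurable)

lemma qform_Rstat_measurable: "(\<lambda>w. qform I lam (Rstat n w)) \<in> borel_measurable (W n)"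
  unfolding qform_def
  by (intro borel_measurable_sum borel_measurable_times borel_measurable_const borel_measurable_power Rstat_measurable)

lemma Sstat_sq_integrable: "integrable (W n) (\<lambda>w. (Sstat n w p)\<^sup>2)"
proof -
  interpret Wn: prob_space "W n" by (rule prob_W)
  show ?thesis
  proof (rule Wn.integrable_const_bound[where B="(2 * sqrt (real n))\<^sup>2"])
    show "AE w in W n. norm ((Sstat n w p)\<^sup>2) \<le> (2 * sqrt (real n))\<^sup>2"
      using Sstat_bound[of n _ p] by (intro AE_I2) (simp only: real_norm_def abs_power2 abs_le_square_iff[symmetric] abs_of_nonneg zero_le_mult_iff, simp)
    show "(\<lambda>w. (Sstat n w p)\<^sup>2) \<in> borel_measurable (W n)"
      by (intro borel_measurable_power Sstat_measurable)
  qed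
qed

lemma Rstat_sq_integrable:
  assumes "0 < n" "0 < fst p" "0 < snd p"
  shows "integrable (W n) (\<lambda>w. (Rstat n w p)\<^sup>2)"
proof -
  interpret Wn: prob_space "W n" by (rule prob_W)
  show ?thesis
  proof (rule Wn.integrable_const_bound[where B="real n / lam p"])
    have "(Rstat n w p)\<^sup>2 \<le> real n / lam p" for w
    proof -
      have "lam p * (Rstat n w p)\<^sup>2 \<le> real n * T_BKR n w"
        using qform_Rstat_le_T[OF assms(1), of "{p}" w] assms by (simp add: qform_def)
      also have "\<dots> \<le> real n * 1" using T_bounds(2)[OF assms(1)] by (intro mult_left_mono) auto
      finally show ?thesis using lam_pos[OF assms(2,3)] by (simp add: pos_le_divide_eq mult.commute)
    qed
    then show "AE w in W n. norm ((Rstat n w p)\<^sup>2) \<le> real n / lam p" by (intro AE_I2) simp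
    show "(\<lambda>w. (Rstat n w p)\<^sup>2) \<in> borel_measurable (W n)"
      by (intro borel_measurable_power Rstat_measurable)
  qed
qed

definition Delta :: "(nat \<times> nat) set \<Rightarrow> nat \<Rightarrow> real" where
  "Delta I n = (\<integral>w. \<bar>qform I lam (Rstat n w) - qform I lam (Sstat n w)\<bar> \<partial>W n)"

lemma Delta_integrable:
  assumes n: "0 < n" and I: "finite I" "\<And>p. p \<in> I \<Longrightarrow> 0 < fst p \<and> 0 < snd p"
  shows "integrable (W n) (\<lambda>w. qform I lam (Rstat n w))" "integrable (W n) (\<lambda>w. qform I lam (Sstat n w))"
    "integrable (W n) (\<lambda>w. \<bar>qform I lam (Rstat n w) - qform I lam (Sstat n w)\<bar>)"
proof -
  show 1: "integrable (W n) (\<lambda>w. qform I lam (Rstat n w))" "integrable (W n) (\<lambda>w. qform I lam (Sstat n w))"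
    unfolding qform_def using I n
    by (auto intro!: Bochner_Integration.integrable_sum integrable_mult_right Rstat_sq_integrable Sstat_sq_integrable)
  then show "integrable (W n) (\<lambda>w. \<bar>qform I lam (Rstat n w) - qform I lam (Sstat n w)\<bar>)" by simp
qed

text \<open>Mean square closeness of the coordinates passes to the squares in mean through a
  weighted inequality, with weight \<open>1 / sqrt n\<close> on the bounded second moment and about
  \<open>sqrt n\<close> on an error of order \<open>1 / n\<close>.\<close>

lemma Delta_tendsto:
  assumes I: "finite I" "\<And>p. p \<in> I \<Longrightarrow> 0 < fst p \<and> 0 < snd p"
  shows "Delta I \<longlonglongrightarrow> 0"
proof -
  define K where "K = (\<Sum>p\<in>I. fst p + snd p)"
  have K: "fst p \<le> K" "snd p \<le> K" if "p \<in> I" for p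
    using member_le_sum[OF that, of "\<lambda>p. fst p + snd p"] I(1) unfolding K_def by auto
  have bound: "Delta I n \<le> (\<Sum>p\<in>I. lam p * (1 / sqrt (real n) + (1 + sqrt (real n)) * (errC p / real n)))" if nK: "K < n" for n
  proof -
    interpret Wn: prob_space "W n" by (rule prob_W)
    have n: "0 < n" using nK by simp
    \<comment> \<open>Any \<open>c\<close> tending to 0 more slowly than \<open>1 / n\<close> would
      serve; this one balances the two terms.\<close>
    define c where "c = 1 / sqrt (real n)"
    have c: "0 < c" using n by (simp add: c_def)
    have c1: "1 / c = sqrt (real n)" by (simp add: c_def)
    have pt: "\<bar>r\<^sup>2 - s\<^sup>2\<bar> \<le> c * s\<^sup>2 + (1 + 1 / c) * (r - s)\<^sup>2" for r s :: real
    proof -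
      define e where "e = r - s"
      have "0 \<le> (sqrt c * s - e / sqrt c)\<^sup>2" "0 \<le> (sqrt c * s + e / sqrt c)\<^sup>2" by auto
      then have "2 * s * e \<le> c * s\<^sup>2 + e\<^sup>2 / c" "- (2 * s * e) \<le> c * s\<^sup>2 + e\<^sup>2 / c"
        using c by (auto simp: power2_diff power2_sum power_mult_distrib power_divide)
      moreover have "r\<^sup>2 - s\<^sup>2 = 2 * s * e + e\<^sup>2" by (simp add: e_def power2_eq_square algebra_simps)
      ultimately have "\<bar>r\<^sup>2 - s\<^sup>2\<bar> \<le> c * s\<^sup>2 + e\<^sup>2 / c + e\<^sup>2" using zero_le_power2[of e] by linarith
      then show ?thesis by (simp add: e_def distrib_right)
    qed
    have pos: "0 < fst p" "0 < snd p" "fst p < n" "snd p < n" if "p \<in> I" for p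
      using I(2)[OF that] K[OF that] nK by auto
    have si: "integrable (W n) (\<lambda>w. (Rstat n w p - Sstat n w p)\<^sup>2)" if "p \<in> I" for p
    proof (rule Bochner_Integration.integrable_bound)
      show "integrable (W n) (\<lambda>w. 2 * (Rstat n w p)\<^sup>2 + 2 * (Sstat n w p)\<^sup>2)"
        using Rstat_sq_integrable[OF n pos(1,2)[OF that]] Sstat_sq_integrable[of n p] by simp
      show "(\<lambda>w. (Rstat n w p - Sstat n w p)\<^sup>2) \<in> borel_measurable (W n)"
        by (intro borel_measurable_power borel_measurable_diff Rstat_measurable Sstat_measurable)
      have "(r - s)\<^sup>2 \<le> 2 * r\<^sup>2 + 2 * s\<^sup>2" for r s :: real
        using zero_le_power2[of "r + s"] by (simp add: power2_eq_square algebra_simps)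
      then show "AE w in W n. norm ((Rstat n w p - Sstat n w p)\<^sup>2) \<le> norm (2 * (Rstat n w p)\<^sup>2 + 2 * (Sstat n w p)\<^sup>2)"
        by (intro AE_I2) simp
    qed
    have "Delta I n \<le> (\<integral>w. (\<Sum>p\<in>I. lam p * (c * (Sstat n w p)\<^sup>2 + (1 + 1 / c) * (Rstat n w p - Sstat n w p)\<^sup>2)) \<partial>W n)"
      unfolding Delta_def
    proof (rule integral_mono[OF Delta_integrable(3)[OF n I]])
      show "integrable (W n) (\<lambda>w. \<Sum>p\<in>I. lam p * (c * (Sstat n w p)\<^sup>2 + (1 + 1 / c) * (Rstat n w p - Sstat n w p)\<^sup>2))"
        by (intro Bochner_Integration.integrable_sum integrable_mult_right Bochner_Integration.integrable_add Sstat_sq_integrable si)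
      fix w
      have "\<bar>qform I lam (Rstat n w) - qform I lam (Sstat n w)\<bar> = \<bar>\<Sum>p\<in>I. lam p * ((Rstat n w p)\<^sup>2 - (Sstat n w p)\<^sup>2)\<bar>"
        by (simp add: qform_def sum_subtractf right_diff_distrib)
      also have "\<dots> \<le> (\<Sum>p\<in>I. \<bar>lam p * ((Rstat n w p)\<^sup>2 - (Sstat n w p)\<^sup>2)\<bar>)" by (rule sum_abs)
      also have "\<dots> \<le> (\<Sum>p\<in>I. lam p * (c * (Sstat n w p)\<^sup>2 + (1 + 1 / c) * (Rstat n w p - Sstat n w p)\<^sup>2))"
        by (intro sum_mono) (simp add: abs_mult lam_nonneg mult_left_mono pt)
      finally show "\<bar>qform I lam (Rstat n w) - qform I lam (Sstat n w)\<bar> \<le>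
        (\<Sum>p\<in>I. lam p * (c * (Sstat n w p)\<^sup>2 + (1 + 1 / c) * (Rstat n w p - Sstat n w p)\<^sup>2))" .
    qed
    also have "\<dots> = (\<Sum>p\<in>I. \<integral>w. lam p * (c * (Sstat n w p)\<^sup>2 + (1 + 1 / c) * (Rstat n w p - Sstat n w p)\<^sup>2) \<partial>W n)"
      by (intro Bochner_Integration.integral_sum integrable_mult_right Bochner_Integration.integrable_add Sstat_sq_integrable si)
    also have "\<dots> \<le> (\<Sum>p\<in>I. lam p * (c + (1 + 1 / c) * (errC p / real n)))"
    proof (rule sum_mono)
      fix p assume p: "p \<in> I"
      have "(\<integral>w. lam p * (c * (Sstat n w p)\<^sup>2 + (1 + 1 / c) * (Rstat n w p - Sstat n w p)\<^sup>2) \<partial>W n) =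
        lam p * (c * (\<integral>w. (Sstat n w p)\<^sup>2 \<partial>W n) + (1 + 1 / c) * (\<integral>w. (Rstat n w p - Sstat n w p)\<^sup>2 \<partial>W n))"
        using Sstat_sq_integrable[of n p] si[OF p] by simp
      also have "\<dots> \<le> lam p * (c * 1 + (1 + 1 / c) * (errC p / real n))"
        using Sstat_second_moment[OF pos(1,2)[OF p] n] Rstat_Sstat_error[OF pos[OF p]] c
        by (intro mult_left_mono add_mono) (auto simp: lam_nonneg)
      finally show "(\<integral>w. lam p * (c * (Sstat n w p)\<^sup>2 + (1 + 1 / c) * (Rstat n w p - Sstat n w p)\<^sup>2) \<partial>W n)
        \<le> lam p * (c + (1 + 1 / c) * (errC p / real n))" by simp
    qed
    finally show ?thesis unfolding c1 by (simp only: c_def)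
  qed
  have lim: "(\<lambda>n. \<Sum>p\<in>I. lam p * (1 / sqrt (real n) + (1 + sqrt (real n)) * (errC p / real n))) \<longlonglongrightarrow> (\<Sum>p\<in>I. lam p * (0 + 0))"
  proof (intro tendsto_intros)
    fix p
    have s0: "(\<lambda>n. 1 / sqrt (real n)) \<longlonglongrightarrow> 0"
      by (intro tendsto_divide_0[OF tendsto_const] filterlim_at_top_imp_at_infinity filterlim_compose[OF sqrt_at_top] filterlim_real_sequentially)
    then show "(\<lambda>n. 1 / sqrt (real n)) \<longlonglongrightarrow> 0" .
    have "(\<lambda>n. errC p * (1 / real n + 1 / sqrt (real n))) \<longlonglongrightarrow> errC p * (0 + 0)"
      by (intro tendsto_intros s0 lim_1_over_n)
    moreover have "errC p * (1 / real n + 1 / sqrt (real n)) = (1 + sqrt (real n)) * (errC p / real n)" for n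
    proof (cases "n = 0")
      case False
      then have "1 / sqrt (real n) = sqrt (real n) / real n" by (simp add: field_simps)
      then show ?thesis by (simp add: algebra_simps add_divide_distrib)
    qed simp
    ultimately show "(\<lambda>n. (1 + sqrt (real n)) * (errC p / real n)) \<longlonglongrightarrow> 0" by simp
  qed
  show ?thesis
  proof (rule tendsto_sandwich[OF _ _ tendsto_const])
    show "\<forall>\<^sub>F n in sequentially. 0 \<le> Delta I n" by (simp add: Delta_def)
    show "\<forall>\<^sub>F n in sequentially. Delta I n \<le> (\<Sum>p\<in>I. lam p * (1 / sqrt (real n) + (1 + sqrt (real n)) * (errC p / real n)))"
      using eventually_gt_at_top[of K] by eventually_elim (rule bound)
  qed (use lim in simp)
qed

text \<open>The statistic always dominates the form in \<open>Rstat\<close>, so the event requires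
  the forms in \<open>Rstat\<close> and \<open>Sstat\<close> to differ by \<eta>, which Markov's
  inequality excludes in the limit.\<close>

lemma T_lower:
  assumes I: "finite I" "\<And>p. p \<in> I \<Longrightarrow> 0 < fst p \<and> 0 < snd p" and \<eta>: "0 < \<eta>"
  shows "(\<lambda>n. measure (W n) {w \<in> space (W n). real n * T_BKR n w < qform I lam (Sstat n w) - \<eta>}) \<longlonglongrightarrow> 0"
proof (rule tendsto_sandwich[OF _ _ tendsto_const])
  show "\<forall>\<^sub>F n in sequentially. 0 \<le> measure (W n) {w \<in> space (W n). real n * T_BKR n w < qform I lam (Sstat n w) - \<eta>}" by simp
  show "\<forall>\<^sub>F n in sequentially. measure (W n) {w \<in> space (W n). real n * T_BKR n w < qform I lam (Sstat n w) - \<eta>} \<le> Delta I n / \<eta>"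
    using eventually_gt_at_top[of 0]
  proof eventually_elim
    case (elim n)
    interpret Wn: prob_space "W n" by (rule prob_W)
    note [measurable] = qform_Sstat_measurable[of I n] qform_Rstat_measurable[of I n] T_measurable[OF elim]
    have "{w \<in> space (W n). real n * T_BKR n w < qform I lam (Sstat n w) - \<eta>} \<subseteq>
       {w \<in> space (W n). \<eta> \<le> \<bar>qform I lam (Rstat n w) - qform I lam (Sstat n w)\<bar>}"
    proof
      fix w assume "w \<in> {w \<in> space (W n). real n * T_BKR n w < qform I lam (Sstat n w) - \<eta>}"
      then show "w \<in> {w \<in> space (W n). \<eta> \<le> \<bar>qform I lam (Rstat n w) - qform I lam (Sstat n w)\<bar>}"
        using qform_Rstat_le_T[OF elim I, of w] by auto
    qed
    then have "measure (W n) {w \<in> space (W n). real n * T_BKR n w < qform I lam (Sstat n w) - \<eta>} \<le>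
      measure (W n) {w \<in> space (W n). \<eta> \<le> \<bar>qform I lam (Rstat n w) - qform I lam (Sstat n w)\<bar>}"
      by (intro Wn.finite_measure_mono) measurable
    also have "\<dots> \<le> Delta I n / \<eta>"
      unfolding Delta_def by (rule Wn.markov_real[OF Delta_integrable(3)[OF elim I] _ \<eta>]) simp_all
    finally show ?case .
  qed
  show "(\<lambda>n. Delta I n / \<eta>) \<longlonglongrightarrow> 0" using tendsto_divide[OF Delta_tendsto[OF I] tendsto_const, of \<eta>] \<eta> by simp
qed

lemma T_integrable:
  assumes "0 < n"
  shows "integrable (W n) (\<lambda>w. real n * T_BKR n w)"
proof -
  interpret Wn: prob_space "W n" by (rule prob_W)
  have "integrable (W n) (T_BKR n)"
    using T_bounds[OF assms] T_measurable[OF assms] by (intro Wn.integrable_const_bound[where B=1]) auto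
  then show ?thesis by simp
qed

text \<open>Here $1/36$ is both the sum of all \<open>lam p\<close> and the limit of the expected statistic,
so the first term is Markov's bound for the coefficients outside \<open>I\<close>.\<close>
lemma T_upper:
  assumes I: "finite I" "\<And>p. p \<in> I \<Longrightarrow> 0 < fst p \<and> 0 < snd p" and \<eta>: "0 < \<eta>" and \<xi>: "0 < \<xi>"
  shows "\<forall>\<^sub>F n in sequentially. measure (W n) {w \<in> space (W n). qform I lam (Sstat n w) + 2 * \<eta> \<le> real n * T_BKR n w}
    \<le> (1 / 36 - (\<Sum>p\<in>I. lam p)) / \<eta> + \<xi>"
proof -
  have "(\<lambda>n. (9 * (1 / real n) + 2 * Delta I n) / \<eta>) \<longlonglongrightarrow> (9 * 0 + 2 * 0) / \<eta>"
    using \<eta> by (intro tendsto_intros Delta_tendsto I lim_1_over_n) auto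
  then have "\<forall>\<^sub>F n in sequentially. (9 * (1 / real n) + 2 * Delta I n) / \<eta> < \<xi>"
    using \<xi> by (auto dest: order_tendstoD(2))
  then show ?thesis using eventually_ge_at_top[of 2]
  proof eventually_elim
    case (elim n)
    have n: "0 < n" using elim by simp
    interpret Wn: prob_space "W n" by (rule prob_W)
    note [measurable] = qform_Sstat_measurable[of I n] qform_Rstat_measurable[of I n] T_measurable[OF n]
    note ints = Delta_integrable[OF n I] T_integrable[OF n]
    have "{w \<in> space (W n). qform I lam (Sstat n w) + 2 * \<eta> \<le> real n * T_BKR n w} \<subseteq>
      {w \<in> space (W n). \<eta> \<le> \<bar>qform I lam (Rstat n w) - qform I lam (Sstat n w)\<bar>} \<union>
      {w \<in> space (W n). \<eta> \<le> real n * T_BKR n w - qform I lam (Rstat n w)}"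
      by auto
    then have "measure (W n) {w \<in> space (W n). qform I lam (Sstat n w) + 2 * \<eta> \<le> real n * T_BKR n w} \<le>
      measure (W n) ({w \<in> space (W n). \<eta> \<le> \<bar>qform I lam (Rstat n w) - qform I lam (Sstat n w)\<bar>} \<union>
      {w \<in> space (W n). \<eta> \<le> real n * T_BKR n w - qform I lam (Rstat n w)})"
      by (intro Wn.finite_measure_mono) measurable
    also have "\<dots> \<le> measure (W n) {w \<in> space (W n). \<eta> \<le> \<bar>qform I lam (Rstat n w) - qform I lam (Sstat n w)\<bar>} +
      measure (W n) {w \<in> space (W n). \<eta> \<le> real n * T_BKR n w - qform I lam (Rstat n w)}"
      by (intro measure_Un_le) measurable
    also have "\<dots> \<le> Delta I n / \<eta> + (\<integral>w. real n * T_BKR n w - qform I lam (Rstat n w) \<partial>W n) / \<eta>"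
      unfolding Delta_def using ints qform_Rstat_le_T[OF n I]
      by (intro add_mono Wn.markov_real \<eta>) auto
    \<comment> \<open>Each \<open>Sstat\<close> coordinate has second moment exactly 1, so the form
      in \<open>Sstat\<close> has mean equal to the sum of the weights; \<open>Delta\<close> pays
      for the passage to \<open>Rstat\<close>.\<close>
    also have "(\<integral>w. real n * T_BKR n w - qform I lam (Rstat n w) \<partial>W n) \<le> 1 / 36 + 9 / real n - ((\<Sum>p\<in>I. lam p) - Delta I n)"
    proof -
      have "(\<integral>w. qform I lam (Sstat n w) \<partial>W n) = (\<Sum>p\<in>I. lam p)"
      proof -
        have "(\<integral>w. qform I lam (Sstat n w) \<partial>W n) = (\<Sum>p\<in>I. \<integral>w. lam p * (Sstat n w p)\<^sup>2 \<partial>W n)"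
          unfolding qform_def by (intro Bochner_Integration.integral_sum integrable_mult_right Sstat_sq_integrable)
        then show ?thesis using Sstat_second_moment I(2) n by simp
      qed
      moreover have "(\<integral>w. qform I lam (Sstat n w) - qform I lam (Rstat n w) \<partial>W n) \<le> Delta I n"
        unfolding Delta_def using ints by (intro integral_mono) auto
      ultimately have "(\<Sum>p\<in>I. lam p) - Delta I n \<le> (\<integral>w. qform I lam (Rstat n w) \<partial>W n)" using ints by simp
      then show ?thesis using expected_T[OF elim(2)] ints by simp
    qed
    also have "Delta I n / \<eta> + (1 / 36 + 9 / real n - ((\<Sum>p\<in>I. lam p) - Delta I n)) / \<eta> =
      (1 / 36 - (\<Sum>p\<in>I. lam p)) / \<eta> + (9 * (1 / real n) + 2 * Delta I n) / \<eta>"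
      by (simp add: add_divide_distrib diff_divide_distrib)
    finally show ?case using elim(1) \<eta> by (simp add: divide_right_mono)
  qed
qed

text \<open>Serves to keep the critical values in a compact interval. The constant rounds up
  \<open>1 / 36 + 9 / 2\<close>.\<close>

lemma T_tight:
  assumes "2 \<le> n" "0 < B"
  shows "measure (W n) {w \<in> space (W n). B \<le> real n * T_BKR n w} \<le> 10 / B"
proof -
  interpret Wn: prob_space "W n" by (rule prob_W)
  have n: "0 < n" using assms by simp
  have "measure (W n) {w \<in> space (W n). B \<le> real n * T_BKR n w} \<le> (\<integral>w. real n * T_BKR n w \<partial>W n) / B"
    using T_bounds(1)[OF n] by (intro Wn.markov_real T_integrable n assms) auto
  also have "\<dots> \<le> (1 / 36 + 9 / real n) / B"
    using expected_T[OF assms(1)] assms by (intro divide_right_mono) auto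
  also have "\<dots> \<le> 10 / B"
  proof -
    have "9 / real n \<le> 9 / 2" using assms by (intro divide_left_mono) auto
    then show ?thesis using assms by (intro divide_right_mono) auto
  qed
  finally show ?thesis .
qed

text \<open>The square sum factors into two copies of the Basel series, each divided by
  \<open>pi^2\<close>.\<close>

lemma sum_lam_tendsto: "(\<lambda>K. \<Sum>p\<in>{1..K} \<times> {1..K}. lam p) \<longlonglongrightarrow> 1 / 36"
proof -
  have "(\<lambda>K. \<Sum>j=1..K. 1 / (real j)\<^sup>2) \<longlonglongrightarrow> pi\<^sup>2 / 6"
  proof -
    have "(\<lambda>K. \<Sum>j<K. 1 / (real j + 1)\<^sup>2) \<longlonglongrightarrow> pi\<^sup>2 / 6"
      using inverse_squares_sums by (simp add: sums_def add.commute)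
    moreover have "(\<Sum>j<K. 1 / (real j + 1)\<^sup>2) = (\<Sum>j=1..K. 1 / (real j)\<^sup>2)" for K
      by (rule sum.reindex_bij_witness[of _ "\<lambda>j. j - 1" Suc]) (auto simp: of_nat_diff)
    ultimately show ?thesis by simp
  qed
  then have "(\<lambda>K. (1 / pi\<^sup>2 * (\<Sum>j=1..K. 1 / (real j)\<^sup>2)) * (1 / pi\<^sup>2 * (\<Sum>j=1..K. 1 / (real j)\<^sup>2))) \<longlonglongrightarrow> (1 / pi\<^sup>2 * (pi\<^sup>2 / 6)) * (1 / pi\<^sup>2 * (pi\<^sup>2 / 6))"
    by (intro tendsto_intros)
  moreover have "(1 / pi\<^sup>2 * (\<Sum>j=1..K. 1 / (real j)\<^sup>2)) * (1 / pi\<^sup>2 * (\<Sum>j=1..K. 1 / (real j)\<^sup>2)) = (\<Sum>p\<in>{1..K} \<times> {1..K}. lam p)" for K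
  proof -
    define f where "f j = 1 / pi\<^sup>2 * (1 / (real j)\<^sup>2)" for j
    have "(1 / pi\<^sup>2 * (\<Sum>j=1..K. 1 / (real j)\<^sup>2)) * (1 / pi\<^sup>2 * (\<Sum>j=1..K. 1 / (real j)\<^sup>2)) = (\<Sum>j=1..K. f j) * (\<Sum>j=1..K. f j)"
      unfolding f_def sum_distrib_left ..
    also have "\<dots> = (\<Sum>(j, k)\<in>{1..K} \<times> {1..K}. f j * f k)"
      unfolding sum_product sum.cartesian_product ..
    also have "\<dots> = (\<Sum>p\<in>{1..K} \<times> {1..K}. lam p)"
      by (intro sum.cong refl) (auto simp: lam_def f_def power_mult_distrib power_divide power2_eq_square)
    finally show ?thesis .
  qed
  ultimately show ?thesis by simp
qed

end

section \<open>Local alternatives\<close>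

text \<open>Compare \<open>z n\<close> with \<open>exp (w / m n)\<close>. Both lie in the closed
  unit disc, the latter because \<open>Re w\<close> is nonpositive, so their \<open>m n\<close>-th
  powers differ by at most \<open>m n\<close> times their distance; both satisfy the same
  first-order asymptotics.\<close>

lemma power_tendsto_exp:
  fixes z :: "nat \<Rightarrow> complex" and w :: complex and m :: "nat \<Rightarrow> nat"
  assumes m: "filterlim m at_top sequentially" and z1: "\<And>n. norm (z n) \<le> 1" and w: "Re w \<le> 0"
    and lim: "(\<lambda>n. of_nat (m n) * (z n - 1)) \<longlonglongrightarrow> w"
  shows "(\<lambda>n. z n ^ m n) \<longlonglongrightarrow> exp w"
proof -
  have mr: "filterlim (\<lambda>n. real (m n)) at_top sequentially"
    using filterlim_compose[OF filterlim_real_sequentially m] .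
  have m_pos: "\<forall>\<^sub>F n in sequentially. 0 < m n"
    using eventually_compose_filterlim[OF eventually_gt_at_top m] .
  have inv0: "(\<lambda>n. 1 / of_nat (m n) :: complex) \<longlonglongrightarrow> 0"
    by (rule filterlim_compose[OF lim_1_over_n m])
  have der: "((\<lambda>h. (exp (h * w) - 1) / h) \<longlongrightarrow> w) (at 0)"
  proof -
    have "((\<lambda>h. exp (h * w)) has_field_derivative (exp (0 * w) * w)) (at 0)"
      by (auto intro!: derivative_eq_intros)
    then show ?thesis by (simp add: DERIV_def)
  qed
  have "filterlim (\<lambda>n. 1 / of_nat (m n) :: complex) (at 0) sequentially"
    using inv0 m_pos by (intro filterlim_atI) (auto elim: eventually_mono)
  from filterlim_compose[OF der this]
  have e1: "(\<lambda>n. of_nat (m n) * (exp (w / of_nat (m n)) - 1)) \<longlonglongrightarrow> w"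
    by (simp add: mult.commute)
  have "(\<lambda>n. norm (of_nat (m n) * (z n - 1) - of_nat (m n) * (exp (w / of_nat (m n)) - 1))) \<longlonglongrightarrow> 0"
    using tendsto_norm_zero[OF LIM_zero[OF tendsto_diff[OF lim e1]]] by simp
  then have bound: "(\<lambda>n. norm (z n ^ m n - exp (w / of_nat (m n)) ^ m n)) \<longlonglongrightarrow> 0"
  proof (rule Lim_null_comparison[rotated])
    show "\<forall>\<^sub>F n in sequentially. norm (norm (z n ^ m n - exp (w / of_nat (m n)) ^ m n)) \<le>
      norm (of_nat (m n) * (z n - 1) - of_nat (m n) * (exp (w / of_nat (m n)) - 1))"
    proof (rule always_eventually, rule allI)
      fix n
      have "norm (exp (w / of_nat (m n))) \<le> 1"
        using w by (cases "m n = 0") (auto simp: norm_exp_eq_Re Re_divide_of_nat divide_nonpos_nonneg)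
      then have "norm (z n ^ m n - exp (w / of_nat (m n)) ^ m n) \<le> of_nat (m n) * norm (z n - exp (w / of_nat (m n)))"
        by (rule norm_power_diff[OF z1])
      also have "\<dots> = norm (of_nat (m n) * (z n - exp (w / of_nat (m n))))" by (simp add: norm_mult)
      also have "of_nat (m n) * (z n - exp (w / of_nat (m n))) = of_nat (m n) * (z n - 1) - of_nat (m n) * (exp (w / of_nat (m n)) - 1)"
        by (simp add: algebra_simps)
      finally show "norm (norm (z n ^ m n - exp (w / of_nat (m n)) ^ m n)) \<le>
        norm (of_nat (m n) * (z n - 1) - of_nat (m n) * (exp (w / of_nat (m n)) - 1))" by simp
    qed
  qed
  have "\<forall>\<^sub>F n in sequentially. exp (w / of_nat (m n)) ^ m n = exp w"
    using m_pos by eventually_elim (simp add: exp_of_nat_mult[symmetric])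
  then have "\<forall>\<^sub>F n in sequentially. norm (z n ^ m n - exp (w / of_nat (m n)) ^ m n) = norm (z n ^ m n - exp w)"
    by eventually_elim simp
  then have "(\<lambda>n. norm (z n ^ m n - exp w)) \<longlonglongrightarrow> 0"
    using bound by (rule Lim_transform_eventually[rotated])
  then show ?thesis by (simp add: LIM_zero_iff tendsto_norm_zero_iff)
qed

lemma iexp_second_order: "norm (iexp x - (of_real (1 - x\<^sup>2 / 2) + \<i> * of_real x)) \<le> \<bar>x\<bar> ^ 3 / 6"
proof -
  have "(\<Sum>k\<le>2. (\<i> * of_real x) ^ k / fact k) = of_real (1 - x\<^sup>2 / 2) + \<i> * of_real x"
    by (simp add: numeral_2_eq_2 power_mult_distrib)
  moreover have "fact (Suc 2) = (6 :: real)" by (simp add: eval_nat_numeral)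
  moreover have "Suc 2 = 3" by simp
  ultimately show ?thesis using iexp_approx1[of x 2] by (simp only:)
qed

text \<open>Second-order expansion of the exponential under the density
  \<open>1 + \<theta> * s\<close>. The quadratic term gives the variance, and the cross term of tilt
  and linear term, multiplied by the sample size, gives the drift \<open>\<delta>\<close> times the
  covariance of \<open>s\<close> and \<psi>. Boundedness of \<psi> controls the cubic remainder
  uniformly.\<close>

lemma local_char_limit:
  fixes s \<psi> :: "'a \<Rightarrow> real" and \<theta> :: "nat \<Rightarrow> real" and m :: "nat \<Rightarrow> nat"
  assumes M: "prob_space M"
    and s [measurable]: "s \<in> borel_measurable M" and sb: "\<And>x. \<bar>s x\<bar> \<le> B" and s0: "(\<integral>x. s x \<partial>M) = 0"
    and \<psi> [measurable]: "\<psi> \<in> borel_measurable M" and \<psi>b: "\<And>x. \<bar>\<psi> x\<bar> \<le> C" and \<psi>0: "(\<integral>x. \<psi> x \<partial>M) = 0"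
    and m: "filterlim m at_top sequentially" and \<theta>B: "\<And>n. \<bar>\<theta> n\<bar> * B \<le> 1"
    and \<delta>: "(\<lambda>n. sqrt (real (m n)) * \<theta> n) \<longlonglongrightarrow> \<delta>"
  shows "(\<lambda>n. (\<integral>x. of_real (1 + \<theta> n * s x) * iexp (\<psi> x / sqrt (real (m n))) \<partial>M) ^ m n) \<longlonglongrightarrow>
     of_real (exp (- (\<integral>x. (\<psi> x)\<^sup>2 \<partial>M) / 2)) * iexp (\<delta> * (\<integral>x. s x * \<psi> x \<partial>M))"
proof -
  interpret prob_space M by fact
  define V where "V = (\<integral>x. (\<psi> x)\<^sup>2 \<partial>M)"
  define c where "c = (\<integral>x. s x * \<psi> x \<partial>M)"
  define e where "e = (\<integral>x. s x * (\<psi> x)\<^sup>2 \<partial>M)"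
  define w where "w = Complex (- V / 2) (\<delta> * c)"
  define z where "z n = (\<integral>x. of_real (1 + \<theta> n * s x) * iexp (\<psi> x / sqrt (real (m n))) \<partial>M)" for n
  have B0: "0 \<le> B" using sb[of undefined] by linarith
  have C0: "0 \<le> C" using \<psi>b[of undefined] by linarith
  have ts: "\<bar>\<theta> n * s x\<bar> \<le> 1" for n x
  proof -
    have "\<bar>\<theta> n * s x\<bar> \<le> \<bar>\<theta> n\<bar> * B" unfolding abs_mult by (intro mult_left_mono sb) auto
    then show ?thesis using \<theta>B[of n] by linarith
  qed
  have ts0: "0 \<le> 1 + \<theta> n * s x" "1 + \<theta> n * s x \<le> 2" for n x using ts[of n x] by (auto simp: abs_le_iff)
  have psq: "(\<psi> x)\<^sup>2 \<le> C\<^sup>2" for x using \<psi>b[of x] C0 by (metis abs_le_square_iff abs_of_nonneg)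
  have i1: "integrable M s" by (rule integrable_const_bound[where B=B]) (use sb in auto)
  have i2: "integrable M \<psi>" by (rule integrable_const_bound[where B=C]) (use \<psi>b in auto)
  have i3: "integrable M (\<lambda>x. (\<psi> x)\<^sup>2)" by (rule integrable_const_bound[where B="C\<^sup>2"]) (use psq in auto)
  have i4: "integrable M (\<lambda>x. s x * \<psi> x)"
    by (rule integrable_const_bound[where B="B * C"]) (use B0 in \<open>auto simp: abs_mult intro!: mult_mono sb \<psi>b\<close>)
  have i5: "integrable M (\<lambda>x. s x * (\<psi> x)\<^sup>2)"
    by (rule integrable_const_bound[where B="B * C\<^sup>2"]) (use B0 in \<open>auto simp: abs_mult intro!: mult_mono sb psq\<close>)
  have zi: "integrable M (\<lambda>x. of_real (1 + \<theta> n * s x) * iexp (\<psi> x / r))" for n r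
    by (rule integrable_const_bound[where B=2]) (use ts0 in \<open>auto simp: norm_mult intro!: AE_I2 simp del: of_real_add of_real_mult of_real_divide\<close>)
  have z1: "norm (z n) \<le> 1" for n
  proof -
    have "norm (z n) \<le> (\<integral>x. norm (of_real (1 + \<theta> n * s x) * iexp (\<psi> x / sqrt (real (m n)))) \<partial>M)"
      unfolding z_def by (rule integral_norm_bound)
    also have "\<dots> = (\<integral>x. 1 + \<theta> n * s x \<partial>M)"
      using ts0 by (intro Bochner_Integration.integral_cong refl) (simp add: norm_mult del: of_real_add of_real_mult of_real_divide)
    also have "\<dots> = 1" using i1 s0 by (simp add: prob_space)
    finally show ?thesis .
  qed
  \<comment> \<open>Explicit in \<open>n\<close>: besides the limit there is only the term
    \<open>\<theta> n * e / 2\<close>, which dies with \<theta>, and a cubic remainder of order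
    \<open>1 / sqrt (m n)\<close>, its factor 2 in the weight coming from
    \<open>ts0\<close>.\<close>
  have approx: "norm (of_nat (m n) * (z n - 1) - Complex (- V / 2 - \<theta> n * e / 2) (sqrt (real (m n)) * \<theta> n * c)) \<le> C ^ 3 / (3 * sqrt (real (m n)))"
    if mp: "0 < m n" for n
  proof -
    define r where "r = sqrt (real (m n))"
    have r: "0 < r" "r\<^sup>2 = real (m n)" using mp by (auto simp: r_def)
    define p where "p x = of_real ((1 + \<theta> n * s x) * (1 - (\<psi> x / r)\<^sup>2 / 2)) + \<i> * of_real ((1 + \<theta> n * s x) * (\<psi> x / r))" for x
    have ia: "integrable M (\<lambda>x. (1 + \<theta> n * s x) * (1 - (\<psi> x / r)\<^sup>2 / 2))"
      "(\<integral>x. (1 + \<theta> n * s x) * (1 - (\<psi> x / r)\<^sup>2 / 2) \<partial>M) = 1 - V / (2 * r\<^sup>2) - \<theta> n * e / (2 * r\<^sup>2)"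
    proof -
      have e1: "(1 + \<theta> n * s x) * (1 - (\<psi> x / r)\<^sup>2 / 2) = 1 + \<theta> n * s x - (1 / (2 * r\<^sup>2)) * (\<psi> x)\<^sup>2 - (\<theta> n / (2 * r\<^sup>2)) * (s x * (\<psi> x)\<^sup>2)" for x
        by (simp add: power_divide algebra_simps add_divide_distrib)
      show "integrable M (\<lambda>x. (1 + \<theta> n * s x) * (1 - (\<psi> x / r)\<^sup>2 / 2))" unfolding e1 using i1 i3 i5 by simp
      show "(\<integral>x. (1 + \<theta> n * s x) * (1 - (\<psi> x / r)\<^sup>2 / 2) \<partial>M) = 1 - V / (2 * r\<^sup>2) - \<theta> n * e / (2 * r\<^sup>2)"
        unfolding e1 using i1 i3 i5 s0 by (simp add: V_def e_def prob_space)
    qed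
    have ib: "integrable M (\<lambda>x. (1 + \<theta> n * s x) * (\<psi> x / r))"
      "(\<integral>x. (1 + \<theta> n * s x) * (\<psi> x / r) \<partial>M) = \<theta> n * c / r"
    proof -
      have e1: "(1 + \<theta> n * s x) * (\<psi> x / r) = (1 / r) * \<psi> x + (\<theta> n / r) * (s x * \<psi> x)" for x
        by (simp add: algebra_simps add_divide_distrib)
      show "integrable M (\<lambda>x. (1 + \<theta> n * s x) * (\<psi> x / r))" unfolding e1 using i2 i4 by simp
      show "(\<integral>x. (1 + \<theta> n * s x) * (\<psi> x / r) \<partial>M) = \<theta> n * c / r"
        unfolding e1 using i2 i4 \<psi>0 by (simp add: c_def)
    qed
    have ip: "integrable M p" unfolding p_def using ia(1) ib(1)
      by (intro Bochner_Integration.integrable_add integrable_mult_right integrable_of_real)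
    have pint: "(\<integral>x. p x \<partial>M) = Complex (1 - V / (2 * r\<^sup>2) - \<theta> n * e / (2 * r\<^sup>2)) (\<theta> n * c / r)"
    proof -
      have "(\<integral>x. p x \<partial>M) = of_real (\<integral>x. (1 + \<theta> n * s x) * (1 - (\<psi> x / r)\<^sup>2 / 2) \<partial>M) + \<i> * of_real (\<integral>x. (1 + \<theta> n * s x) * (\<psi> x / r) \<partial>M)"
        unfolding p_def using ia(1) ib(1)
        by (subst Bochner_Integration.integral_add) (auto simp del: of_real_add of_real_mult of_real_divide of_real_diff)
      then show ?thesis unfolding ia(2) ib(2) by (simp add: complex_eq_iff)
    qed
    have "norm (z n - (\<integral>x. p x \<partial>M)) = norm (\<integral>x. of_real (1 + \<theta> n * s x) * iexp (\<psi> x / r) - p x \<partial>M)"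
      unfolding z_def r_def[symmetric] using zi[of n r] ip by simp
    also have "\<dots> \<le> (\<integral>x. norm (of_real (1 + \<theta> n * s x) * iexp (\<psi> x / r) - p x) \<partial>M)"
      by (rule integral_norm_bound)
    also have "\<dots> \<le> (\<integral>x. 2 * ((C / r) ^ 3 / 6) \<partial>M)"
    proof (rule integral_mono)
      show "integrable M (\<lambda>x. norm (of_real (1 + \<theta> n * s x) * iexp (\<psi> x / r) - p x))"
        using zi[of n r] ip by (intro integrable_norm Bochner_Integration.integrable_diff)
      fix x
      have "of_real (1 + \<theta> n * s x) * iexp (\<psi> x / r) - p x =
        of_real (1 + \<theta> n * s x) * (iexp (\<psi> x / r) - (of_real (1 - (\<psi> x / r)\<^sup>2 / 2) + \<i> * of_real (\<psi> x / r)))"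
        unfolding p_def by (simp only: of_real_mult) (simp only: right_diff_distrib distrib_left mult.left_commute)
      then have "norm (of_real (1 + \<theta> n * s x) * iexp (\<psi> x / r) - p x) =
         (1 + \<theta> n * s x) * norm (iexp (\<psi> x / r) - (of_real (1 - (\<psi> x / r)\<^sup>2 / 2) + \<i> * of_real (\<psi> x / r)))"
        using ts0(1)[of n x] by (simp only: norm_mult norm_of_real abs_of_nonneg)
      also have "\<dots> \<le> 2 * (\<bar>\<psi> x / r\<bar> ^ 3 / 6)"
        using ts0[of n x] by (intro mult_mono iexp_second_order) auto
      also have "\<dots> \<le> 2 * ((C / r) ^ 3 / 6)"
        using \<psi>b[of x] r by (intro mult_left_mono divide_right_mono power_mono) (auto simp: divide_right_mono)
      finally show "norm (of_real (1 + \<theta> n * s x) * iexp (\<psi> x / r) - p x) \<le> 2 * ((C / r) ^ 3 / 6)" .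
    qed simp
    also have "\<dots> = C ^ 3 / (3 * r ^ 3)" by (simp add: prob_space power_divide)
    finally have n1: "norm (z n - (\<integral>x. p x \<partial>M)) \<le> C ^ 3 / (3 * r ^ 3)" .
    have "of_nat (m n) * (z n - 1) - Complex (- V / 2 - \<theta> n * e / 2) (r * \<theta> n * c) = of_real (r\<^sup>2) * (z n - (\<integral>x. p x \<partial>M))"
      unfolding pint using r mp by (simp add: complex_eq_iff field_simps power2_eq_square)
    then have "norm (of_nat (m n) * (z n - 1) - Complex (- V / 2 - \<theta> n * e / 2) (r * \<theta> n * c)) = r\<^sup>2 * norm (z n - (\<integral>x. p x \<partial>M))"
      by (simp only: norm_mult norm_of_real abs_power2)
    also have "\<dots> \<le> r\<^sup>2 * (C ^ 3 / (3 * r ^ 3))" using n1 by (intro mult_left_mono) auto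
    also have "\<dots> = C ^ 3 / (3 * r)" using r(1) by (simp add: power2_eq_square power3_eq_cube)
    finally show ?thesis by (simp only: r_def)
  qed
  have sq_lim: "filterlim (\<lambda>n. sqrt (real (m n))) at_top sequentially"
    by (rule filterlim_compose[OF sqrt_at_top filterlim_compose[OF filterlim_real_sequentially m]])
  have inv_sq: "(\<lambda>n. 1 / sqrt (real (m n))) \<longlonglongrightarrow> 0"
    by (intro tendsto_divide_0[OF tendsto_const] filterlim_at_top_imp_at_infinity sq_lim)
  have m_pos: "\<forall>\<^sub>F n in sequentially. 0 < m n"
    using eventually_compose_filterlim[OF eventually_gt_at_top m] .
  have \<theta>0: "\<theta> \<longlonglongrightarrow> 0"
  proof -
    have "(\<lambda>n. (sqrt (real (m n)) * \<theta> n) * (1 / sqrt (real (m n)))) \<longlonglongrightarrow> \<delta> * 0" by (intro tendsto_intros \<delta> inv_sq)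
    moreover have "\<forall>\<^sub>F n in sequentially. (sqrt (real (m n)) * \<theta> n) * (1 / sqrt (real (m n))) = \<theta> n"
      using m_pos by eventually_elim simp
    ultimately show ?thesis by (simp add: tendsto_cong)
  qed
  have "(\<lambda>n. Complex (- V / 2 - \<theta> n * e / 2) (sqrt (real (m n)) * \<theta> n * c)) \<longlonglongrightarrow> Complex (- V / 2 - 0 * e / 2) (\<delta> * c)"
    by (intro tendsto_intros \<theta>0 \<delta>) auto
  moreover have "(\<lambda>n. of_nat (m n) * (z n - 1) - Complex (- V / 2 - \<theta> n * e / 2) (sqrt (real (m n)) * \<theta> n * c)) \<longlonglongrightarrow> 0"
  proof (rule Lim_null_comparison)
    show "\<forall>\<^sub>F n in sequentially. norm (of_nat (m n) * (z n - 1) - Complex (- V / 2 - \<theta> n * e / 2) (sqrt (real (m n)) * \<theta> n * c)) \<le> (C ^ 3 / 3) * (1 / sqrt (real (m n)))"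
      using m_pos by eventually_elim (use approx in simp)
    show "(\<lambda>n. (C ^ 3 / 3) * (1 / sqrt (real (m n)))) \<longlonglongrightarrow> 0" by (rule tendsto_mult_right_zero[OF inv_sq])
  qed
  ultimately have "(\<lambda>n. of_nat (m n) * (z n - 1)) \<longlonglongrightarrow> w"
    unfolding w_def using Lim_transform2 tendsto_add by fastforce
  then have "(\<lambda>n. z n ^ m n) \<longlonglongrightarrow> exp w"
    by (rule power_tendsto_exp[OF m z1, rotated]) (simp add: w_def V_def)
  moreover have "exp w = of_real (exp (- V / 2)) * iexp (\<delta> * c)"
  proof -
    have "w = of_real (- V / 2) + \<i> * of_real (\<delta> * c)" by (simp add: w_def complex_eq_iff)
    then show ?thesis by (simp only: exp_add exp_of_real)
  qed
  ultimately show ?thesis by (simp only: z_def V_def c_def)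
qed

section \<open>Product laws tilted by a bounded score\<close>

context indep_model
begin

text \<open>The linear perturbation of the null density. It is normalized when \<open>s\<close> has
  mean zero and nonnegative when \<theta> times the bound of \<open>s\<close> is at most 1 in
  absolute value; outside these conditions \<open>ennreal\<close> cuts the density at 0 and the
  measure has no meaning here.\<close>

definition tilt :: "(real \<times> real \<Rightarrow> real) \<Rightarrow> nat \<Rightarrow> real \<Rightarrow> (nat \<Rightarrow> real \<times> real) measure" where
  "tilt s n \<theta> = Pi\<^sub>M {..<n} (\<lambda>_. density (\<mu> \<Otimes>\<^sub>M \<nu>) (\<lambda>z. ennreal (1 + \<theta> * s z)))"

lemma tilt_density_facts:
  assumes s [measurable]: "s \<in> borel_measurable (\<mu> \<Otimes>\<^sub>M \<nu>)" and sb: "\<And>z. \<bar>s z\<bar> \<le> B" and s0: "(\<integral>z. s z \<partial>(\<mu> \<Otimes>\<^sub>M \<nu>)) = 0"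
    and \<theta>: "\<bar>\<theta>\<bar> * B \<le> 1"
  shows "0 \<le> 1 + \<theta> * s z" "1 + \<theta> * s z \<le> 2" "(\<integral>\<^sup>+z. ennreal (1 + \<theta> * s z) \<partial>(\<mu> \<Otimes>\<^sub>M \<nu>)) = 1"
    "(\<integral>z. (1 + \<theta> * s z)\<^sup>2 \<partial>(\<mu> \<Otimes>\<^sub>M \<nu>)) \<le> 1 + \<theta>\<^sup>2 * B\<^sup>2" "integrable (\<mu> \<Otimes>\<^sub>M \<nu>) (\<lambda>z. (1 + \<theta> * s z)\<^sup>2)"
    "prob_space (density (\<mu> \<Otimes>\<^sub>M \<nu>) (\<lambda>z. ennreal (1 + \<theta> * s z)))"
proof -
  interpret P: prob_space "\<mu> \<Otimes>\<^sub>M \<nu>" by (rule prob_pair)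
  have B0: "0 \<le> B" using sb[of undefined] by linarith
  have ts: "\<bar>\<theta> * s z\<bar> \<le> 1" for z
  proof -
    have "\<bar>\<theta> * s z\<bar> \<le> \<bar>\<theta>\<bar> * B" unfolding abs_mult by (intro mult_left_mono sb) auto
    then show ?thesis using \<theta> by linarith
  qed
  show ts0: "0 \<le> 1 + \<theta> * s z" "1 + \<theta> * s z \<le> 2" for z using ts[of z] by (auto simp: abs_le_iff)
  have i1: "integrable (\<mu> \<Otimes>\<^sub>M \<nu>) s" by (rule P.integrable_const_bound[where B=B]) (use sb in auto)
  have ssq: "(s z)\<^sup>2 \<le> B\<^sup>2" for z using sb[of z] B0 by (metis abs_le_square_iff abs_of_nonneg)
  have i2: "integrable (\<mu> \<Otimes>\<^sub>M \<nu>) (\<lambda>z. (s z)\<^sup>2)" by (rule P.integrable_const_bound[where B="B\<^sup>2"]) (use ssq in auto)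
  have one: "(\<integral>z. 1 + \<theta> * s z \<partial>(\<mu> \<Otimes>\<^sub>M \<nu>)) = 1" using i1 s0 by (simp add: P.prob_space)
  have "(\<integral>\<^sup>+z. ennreal (1 + \<theta> * s z) \<partial>(\<mu> \<Otimes>\<^sub>M \<nu>)) = ennreal (\<integral>z. 1 + \<theta> * s z \<partial>(\<mu> \<Otimes>\<^sub>M \<nu>))"
    using i1 ts0 by (intro nn_integral_eq_integral) auto
  then show nn: "(\<integral>\<^sup>+z. ennreal (1 + \<theta> * s z) \<partial>(\<mu> \<Otimes>\<^sub>M \<nu>)) = 1" using one by simp
  have ex: "(1 + \<theta> * s z)\<^sup>2 = 1 + 2 * \<theta> * s z + \<theta>\<^sup>2 * (s z)\<^sup>2" for z by (simp add: power2_eq_square algebra_simps)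
  show "integrable (\<mu> \<Otimes>\<^sub>M \<nu>) (\<lambda>z. (1 + \<theta> * s z)\<^sup>2)" unfolding ex using i1 i2 by simp
  have "(\<integral>z. (s z)\<^sup>2 \<partial>(\<mu> \<Otimes>\<^sub>M \<nu>)) \<le> (\<integral>z. B\<^sup>2 \<partial>(\<mu> \<Otimes>\<^sub>M \<nu>))" using i2 ssq by (intro integral_mono) auto
  then have "\<theta>\<^sup>2 * (\<integral>z. (s z)\<^sup>2 \<partial>(\<mu> \<Otimes>\<^sub>M \<nu>)) \<le> \<theta>\<^sup>2 * B\<^sup>2" by (intro mult_left_mono) (auto simp: P.prob_space)
  then show "(\<integral>z. (1 + \<theta> * s z)\<^sup>2 \<partial>(\<mu> \<Otimes>\<^sub>M \<nu>)) \<le> 1 + \<theta>\<^sup>2 * B\<^sup>2"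
    unfolding ex using i1 i2 s0 by (simp add: P.prob_space)
  show "prob_space (density (\<mu> \<Otimes>\<^sub>M \<nu>) (\<lambda>z. ennreal (1 + \<theta> * s z)))"
  proof (rule prob_spaceI)
    have km: "(\<lambda>z. ennreal (1 + \<theta> * s z)) \<in> borel_measurable (\<mu> \<Otimes>\<^sub>M \<nu>)" by measurable
    show "emeasure (density (\<mu> \<Otimes>\<^sub>M \<nu>) (\<lambda>z. ennreal (1 + \<theta> * s z))) (space (density (\<mu> \<Otimes>\<^sub>M \<nu>) (\<lambda>z. ennreal (1 + \<theta> * s z)))) = 1"
      unfolding space_density by (subst emeasure_density[OF km sets.top]) (simp add: nn cong: nn_integral_cong)
  qed
qed

lemma sets_tilt: "sets (tilt s n \<theta>) = sets (W n)"
  unfolding tilt_def by (intro sets_PiM_cong) auto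

lemma space_tilt: "space (tilt s n \<theta>) = space (W n)"
  by (rule sets_eq_imp_space_eq[OF sets_tilt])

text \<open>With \<open>n * \<theta>\<^sup>2\<close> bounded the exponent from
  \<open>PiM_density_contiguity\<close> does not depend on \<open>n\<close>, so null probabilities
  tending to 0 do so along the local alternatives too.\<close>

lemma tilt_contiguity:
  assumes s: "s \<in> borel_measurable (\<mu> \<Otimes>\<^sub>M \<nu>)" and sb: "\<And>z. \<bar>s z\<bar> \<le> B" and s0: "(\<integral>z. s z \<partial>(\<mu> \<Otimes>\<^sub>M \<nu>)) = 0"
    and \<theta>: "\<bar>\<theta>\<bar> * B \<le> 1" and nM: "real n * \<theta>\<^sup>2 \<le> L" and \<kappa>: "0 < \<kappa>" and A: "A \<in> sets (W n)"
  shows "measure (tilt s n \<theta>) A \<le> \<kappa> / 2 * exp (L * B\<^sup>2) + measure (W n) A / (2 * \<kappa>)"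
proof -
  note f = tilt_density_facts[OF s sb s0 \<theta>]
  have "measure (tilt s n \<theta>) A \<le> \<kappa> / 2 * exp (card {..<n} * (\<theta>\<^sup>2 * B\<^sup>2)) + measure (W n) A / (2 * \<kappa>)"
    unfolding tilt_def
  proof (rule PiM_density_contiguity[OF prob_pair finite_lessThan _ f(1) f(3) f(5) f(4) \<kappa> A])
    show "(\<lambda>z. 1 + \<theta> * s z) \<in> borel_measurable (\<mu> \<Otimes>\<^sub>M \<nu>)" using s by measurable
  qed
  also have "real (card {..<n}) * (\<theta>\<^sup>2 * B\<^sup>2) \<le> L * B\<^sup>2"
    using mult_right_mono[OF nM, of "B\<^sup>2"] by (simp add: mult.assoc)
  finally show ?thesis using \<kappa> by simp
qed

text \<open>Le Cam's third lemma for this model, computed directly: the characteristic function of a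
  linear combination of the \<open>Sstat\<close> coordinates is a power of a one-observation
  integral, orthonormality of \<open>phi\<close> turns its variance into the sum of squares of
  \<open>u\<close>, and the covariance with the score is linear in \<open>u\<close>.\<close>

lemma tilt_qform_limit:
  assumes I: "finite I" "\<And>p. p \<in> I \<Longrightarrow> 0 < fst p \<and> 0 < snd p"
    and s: "s \<in> borel_measurable (\<mu> \<Otimes>\<^sub>M \<nu>)" and sb: "\<And>z. \<bar>s z\<bar> \<le> B" and s0: "(\<integral>z. s z \<partial>(\<mu> \<Otimes>\<^sub>M \<nu>)) = 0"
    and m: "filterlim m at_top sequentially" and \<theta>B: "\<And>n. \<bar>\<theta> n\<bar> * B \<le> 1"
    and \<delta>: "(\<lambda>n. sqrt (real (m n)) * \<theta> n) \<longlonglongrightarrow> \<delta>" and \<eta>: "0 < \<eta>"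
  defines "a \<equiv> \<lambda>p. \<delta> * (\<integral>z. s z * phi p z \<partial>(\<mu> \<Otimes>\<^sub>M \<nu>))"
  shows "\<forall>\<^sub>F n in sequentially. measure (gauss I) {z \<in> space (gauss I). x + \<eta> \<le> qform I lam (\<lambda>i. z i + a i)} - \<eta>
      \<le> measure (tilt s (m n) (\<theta> n)) {w \<in> space (tilt s (m n) (\<theta> n)). x \<le> qform I lam (Sstat (m n) w)}"
    and "\<forall>\<^sub>F n in sequentially. measure (tilt s (m n) (\<theta> n)) {w \<in> space (tilt s (m n) (\<theta> n)). x \<le> qform I lam (Sstat (m n) w)}
      \<le> measure (gauss I) {z \<in> space (gauss I). x - \<eta> \<le> qform I lam (\<lambda>i. z i + a i)} + \<eta>"
proof -
  note f = tilt_density_facts[OF s sb s0 \<theta>B]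
  have P: "prob_space (tilt s (m n) (\<theta> n))" for n
    unfolding tilt_def by (rule prob_space_PiM) (rule f(6))
  have Sm: "(\<lambda>w. Sstat (m n) w i) \<in> borel_measurable (tilt s (m n) (\<theta> n))" for n i
    using Sstat_measurable[of "m n" i] unfolding measurable_cong_sets[OF sets_tilt refl] .
  interpret P0: prob_space "\<mu> \<Otimes>\<^sub>M \<nu>" by (rule prob_pair)
  have char_lim: "(\<lambda>n. \<integral>w. iexp (\<Sum>i\<in>I. u i * Sstat (m n) w i) \<partial>tilt s (m n) (\<theta> n)) \<longlonglongrightarrow>
       complex_of_real (exp (- (\<Sum>i\<in>I. (u i)\<^sup>2) / 2)) * iexp (\<Sum>i\<in>I. u i * a i)" for u
  proof -
    define \<psi> where "\<psi> z = (\<Sum>p\<in>I. u p * phi p z)" for z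
    have \<psi>m: "\<psi> \<in> borel_measurable (\<mu> \<Otimes>\<^sub>M \<nu>)" unfolding \<psi>_def[abs_def] by measurable
    have \<psi>b: "\<bar>\<psi> z\<bar> \<le> (\<Sum>p\<in>I. \<bar>u p\<bar> * 2)" for z
      unfolding \<psi>_def by (rule order_trans[OF sum_abs]) (auto simp: abs_mult intro!: sum_mono mult_left_mono phi_bound)
    have ip: "integrable (\<mu> \<Otimes>\<^sub>M \<nu>) (\<lambda>z. phi p z)" for p
      by (rule P0.integrable_const_bound[where B=2]) (use phi_bound in auto)
    have ipq: "integrable (\<mu> \<Otimes>\<^sub>M \<nu>) (\<lambda>z. phi p z * phi q z)" for p q
    proof (rule P0.integrable_const_bound[where B="2 * 2"])
      show "AE z in \<mu> \<Otimes>\<^sub>M \<nu>. norm (phi p z * phi q z) \<le> 2 * 2"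
      proof (rule AE_I2)
        fix z
        have "\<bar>phi p z\<bar> * \<bar>phi q z\<bar> \<le> 2 * 2" by (intro mult_mono phi_bound) auto
        then show "norm (phi p z * phi q z) \<le> 2 * 2" by (simp add: abs_mult)
      qed
    qed measurable
    have B0: "0 \<le> B" using sb[of undefined] by linarith
    have isp: "integrable (\<mu> \<Otimes>\<^sub>M \<nu>) (\<lambda>z. s z * phi p z)" for p
      by (rule P0.integrable_const_bound[where B="B * 2"]) (use s B0 in \<open>auto simp: abs_mult intro!: mult_mono phi_bound sb\<close>)
    have \<psi>0: "(\<integral>z. \<psi> z \<partial>(\<mu> \<Otimes>\<^sub>M \<nu>)) = 0"
      unfolding \<psi>_def using ip phi_mean I(2) by simp
    have V: "(\<integral>z. (\<psi> z)\<^sup>2 \<partial>(\<mu> \<Otimes>\<^sub>M \<nu>)) = (\<Sum>p\<in>I. (u p)\<^sup>2)"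
    proof -
      have "(\<integral>z. (\<psi> z)\<^sup>2 \<partial>(\<mu> \<Otimes>\<^sub>M \<nu>)) = (\<integral>z. (\<Sum>p\<in>I. \<Sum>q\<in>I. (u p * u q) * (phi p z * phi q z)) \<partial>(\<mu> \<Otimes>\<^sub>M \<nu>))"
        by (simp add: \<psi>_def power2_eq_square sum_product mult_ac)
      also have "\<dots> = (\<Sum>p\<in>I. \<Sum>q\<in>I. (u p * u q) * (\<integral>z. phi p z * phi q z \<partial>(\<mu> \<Otimes>\<^sub>M \<nu>)))"
        using ipq by simp
      also have "\<dots> = (\<Sum>p\<in>I. \<Sum>q\<in>I. if p = q then u p * u q else 0)"
        using I(2) by (intro sum.cong refl) (simp add: phi_orthonormal)
      also have "\<dots> = (\<Sum>p\<in>I. (u p)\<^sup>2)" using I(1) by (simp add: power2_eq_square)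
      finally show ?thesis .
    qed
    have c: "\<delta> * (\<integral>z. s z * \<psi> z \<partial>(\<mu> \<Otimes>\<^sub>M \<nu>)) = (\<Sum>i\<in>I. u i * a i)"
    proof -
      have "(\<integral>z. s z * \<psi> z \<partial>(\<mu> \<Otimes>\<^sub>M \<nu>)) = (\<integral>z. (\<Sum>p\<in>I. u p * (s z * phi p z)) \<partial>(\<mu> \<Otimes>\<^sub>M \<nu>))"
        by (simp add: \<psi>_def sum_distrib_left mult_ac)
      also have "\<dots> = (\<Sum>p\<in>I. u p * (\<integral>z. s z * phi p z \<partial>(\<mu> \<Otimes>\<^sub>M \<nu>)))" using isp by simp
      finally show ?thesis by (simp add: a_def sum_distrib_left mult_ac)
    qed
    have eq: "(\<integral>w. iexp (\<Sum>i\<in>I. u i * Sstat (m n) w i) \<partial>tilt s (m n) (\<theta> n)) =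
       (\<integral>z. of_real (1 + \<theta> n * s z) * iexp (\<psi> z / sqrt (real (m n))) \<partial>(\<mu> \<Otimes>\<^sub>M \<nu>)) ^ m n" for n
    proof -
      let ?D = "density (\<mu> \<Otimes>\<^sub>M \<nu>) (\<lambda>z. ennreal (1 + \<theta> n * s z))"
      interpret D: prob_space ?D by (rule f(6))
      interpret S: product_sigma_finite "\<lambda>_. ?D" by (simp add: product_sigma_finite_def D.sigma_finite_measure_axioms)
      have "(\<Sum>i\<in>I. u i * Sstat (m n) w i) = (\<Sum>l<m n. \<psi> (w l) / sqrt (real (m n)))" for w
      proof -
        have "(\<Sum>i\<in>I. u i * Sstat (m n) w i) = (\<Sum>i\<in>I. \<Sum>l<m n. u i * phi i (w l)) / sqrt (real (m n))"
          by (simp add: Sstat_def sum_distrib_left sum_divide_distrib)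
        also have "(\<Sum>i\<in>I. \<Sum>l<m n. u i * phi i (w l)) = (\<Sum>l<m n. \<psi> (w l))"
          unfolding \<psi>_def by (rule sum.swap)
        finally show ?thesis by (simp add: sum_divide_distrib)
      qed
      then have "(\<integral>w. iexp (\<Sum>i\<in>I. u i * Sstat (m n) w i) \<partial>tilt s (m n) (\<theta> n)) =
         (\<integral>w. (\<Prod>l<m n. iexp (\<psi> (w l) / sqrt (real (m n)))) \<partial>tilt s (m n) (\<theta> n))"
        by (simp only: iexp_sum[OF finite_lessThan])
      also have "\<dots> = (\<Prod>l<m n. \<integral>z. iexp (\<psi> z / sqrt (real (m n))) \<partial>?D)"
        unfolding tilt_def
      proof (rule S.product_integral_prod[OF finite_lessThan])
        show "integrable ?D (\<lambda>z. iexp (\<psi> z / sqrt (real (m n))))"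
        proof (rule D.integrable_const_bound[where B=1])
          have "(\<lambda>z. iexp (\<psi> z / sqrt (real (m n)))) \<in> borel_measurable (\<mu> \<Otimes>\<^sub>M \<nu>)" using \<psi>m by measurable
          then show "(\<lambda>z. iexp (\<psi> z / sqrt (real (m n)))) \<in> borel_measurable ?D" by simp
        qed (auto simp del: of_real_divide)
      qed
      also have "(\<integral>z. iexp (\<psi> z / sqrt (real (m n))) \<partial>?D) =
         (\<integral>z. (1 + \<theta> n * s z) *\<^sub>R iexp (\<psi> z / sqrt (real (m n))) \<partial>(\<mu> \<Otimes>\<^sub>M \<nu>))"
        using s \<psi>m f(1) by (intro integral_density) (measurable, auto)
      finally show ?thesis by (simp add: scaleR_conv_of_real)
    qed
    show ?thesis
      unfolding eq using local_char_limit[OF prob_pair s sb s0 \<psi>m \<psi>b \<psi>0 m \<theta>B \<delta>] unfolding V c .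
  qed
  show "\<forall>\<^sub>F n in sequentially. measure (gauss I) {z \<in> space (gauss I). x + \<eta> \<le> qform I lam (\<lambda>i. z i + a i)} - \<eta>
      \<le> measure (tilt s (m n) (\<theta> n)) {w \<in> space (tilt s (m n) (\<theta> n)). x \<le> qform I lam (Sstat (m n) w)}"
    using qform_tail_sandwich(1)[OF I(1) lam_nonneg P, where S="\<lambda>n i w. Sstat (m n) w i", OF Sm char_lim \<eta>] by simp
  show "\<forall>\<^sub>F n in sequentially. measure (tilt s (m n) (\<theta> n)) {w \<in> space (tilt s (m n) (\<theta> n)). x \<le> qform I lam (Sstat (m n) w)}
      \<le> measure (gauss I) {z \<in> space (gauss I). x - \<eta> \<le> qform I lam (\<lambda>i. z i + a i)} + \<eta>"
    using qform_tail_sandwich(2)[OF I(1) lam_nonneg P, where S="\<lambda>n i w. Sstat (m n) w i", OF Sm char_lim \<eta>] by simp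
qed

text \<open>Presents the null law as a tilt, so that its limits are instances of the statements
  about tilts.\<close>

lemma tilt_0: "tilt (\<lambda>_. 0) n 0 = W n"
  by (simp add: tilt_def density_1)

end

section \<open>Completeness of the cosine products\<close>

text \<open>The moment problem on a compact interval for a signed density \<open>q\<close>:
  polynomials approximate continuous functions, and these decrease to the indicator of a closed
  half-line.\<close>

lemma moments_zero_imp_tail_zero:
  fixes q U :: "'a \<Rightarrow> real"
  assumes q: "integrable M q" and U [measurable]: "U \<in> borel_measurable M" and U1: "\<And>x. \<bar>U x\<bar> \<le> 1"
    and mom: "\<And>m. (\<integral>x. q x * U x ^ m \<partial>M) = 0"
  shows "(\<integral>x. q x * of_bool (u \<le> U x) \<partial>M) = 0"
proof -
  have [measurable]: "q \<in> borel_measurable M" using q by simp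
  have qb: "integrable M (\<lambda>x. q x * g x)" if [measurable]: "g \<in> borel_measurable M" and "\<And>x. \<bar>g x\<bar> \<le> B" for g B
  proof (rule Bochner_Integration.integrable_bound[OF integrable_mult_right[OF q, of B]])
    have "0 \<le> B" using that(2)[of undefined] by linarith
    then show "AE x in M. norm (q x * g x) \<le> norm (B * q x)"
      using that(2) by (intro AE_I2) (simp add: abs_mult mult.commute mult_right_mono)
  qed measurable
  have cont: "(\<integral>x. q x * h (U x) \<partial>M) = 0" if h: "continuous_on UNIV h" for h :: "real \<Rightarrow> real"
  proof -
    have [measurable]: "h \<in> borel_measurable borel" using h by (rule borel_measurable_continuous_onI)
    have hc: "continuous_on {-1..1} h" using h by (rule continuous_on_subset) simp
    obtain B where B: "\<And>x. x \<in> {-1..1} \<Longrightarrow> \<bar>h x\<bar> \<le> B"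
      using compact_continuous_image[OF hc] by (fastforce dest!: compact_imp_bounded simp: bounded_iff)
    have hi: "integrable M (\<lambda>x. q x * h (U x))"
      by (rule qb[where B=B]) (use B U1 in \<open>auto simp: abs_le_iff\<close>)
    have "\<bar>\<integral>x. q x * h (U x) \<partial>M\<bar> \<le> 0 + e" if e: "0 < e" for e
    proof -
      define N where "N = (\<integral>x. \<bar>q x\<bar> \<partial>M)"
      have N: "0 \<le> N" by (simp add: N_def)
      \<comment> \<open>The approximation error is integrated against the absolute value of
        \<open>q\<close>, of total mass \<open>N\<close>; the added 1 covers
        \<open>N = 0\<close>.\<close>
      define d where "d = e / (N + 1)"
      have d: "0 < d" using e N by (simp add: d_def)
      then obtain p where p: "real_polynomial_function p" "\<And>x. x \<in> {-1..1} \<Longrightarrow> \<bar>h x - p x\<bar> < d"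
        using Stone_Weierstrass_real_polynomial_function[of "{-1..1}" h d] hc by auto
      then obtain a k where p_sum: "p = (\<lambda>x. \<Sum>i\<le>k. a i * x ^ i)"
        by (auto simp: real_polynomial_function_iff_sum)
      have pm [measurable]: "p \<in> borel_measurable borel" unfolding p_sum by measurable
      have mi: "integrable M (\<lambda>x. q x * U x ^ i)" for i
        by (rule qb[where B=1]) (use U1 in \<open>auto simp: power_abs power_le_one\<close>)
      have p0: "(\<integral>x. q x * p (U x) \<partial>M) = 0" "integrable M (\<lambda>x. q x * p (U x))"
      proof -
        have e: "q x * p (U x) = (\<Sum>i\<le>k. a i * (q x * U x ^ i))" for x
          by (simp add: p_sum sum_distrib_left mult_ac)
        show "(\<integral>x. q x * p (U x) \<partial>M) = 0" unfolding e using mi mom by simp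
        show "integrable M (\<lambda>x. q x * p (U x))" unfolding e using mi by simp
      qed
      have "(\<integral>x. q x * h (U x) \<partial>M) = (\<integral>x. q x * h (U x) - q x * p (U x) \<partial>M)"
        using hi p0 by simp
      also have "\<bar>\<dots>\<bar> \<le> (\<integral>x. \<bar>q x * h (U x) - q x * p (U x)\<bar> \<partial>M)" by (rule integral_abs_bound)
      also have "\<dots> \<le> (\<integral>x. d * \<bar>q x\<bar> \<partial>M)"
      proof (rule integral_mono)
        fix x
        have "\<bar>q x\<bar> * \<bar>h (U x) - p (U x)\<bar> \<le> \<bar>q x\<bar> * d"
          using p(2)[of "U x"] U1[of x] by (intro mult_left_mono) (auto simp: abs_le_iff)
        then show "\<bar>q x * h (U x) - q x * p (U x)\<bar> \<le> d * \<bar>q x\<bar>"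
          by (simp add: abs_mult right_diff_distrib[symmetric] mult.commute)
      qed (use hi p0 q in auto)
      also have "\<dots> = d * N" by (simp add: N_def)
      also have "\<dots> \<le> e" using e N by (simp add: d_def field_simps)
      finally show ?thesis by simp
    qed
    then have "\<bar>\<integral>x. q x * h (U x) \<partial>M\<bar> \<le> 0" by (rule field_le_epsilon)
    then show ?thesis by simp
  qed
  \<comment> \<open>Rises from 0 at \<open>u - 1 / n\<close> to 1 at \<open>u\<close>, so the limit
    is the indicator with the endpoint \<open>u\<close> included.\<close>
  define h where "h n y = max 0 (min 1 (1 + real n * (y - u)))" for n and y :: real
  have hlim: "(\<lambda>n. h n y) \<longlonglongrightarrow> of_bool (u \<le> y)" for y
  proof (cases "u \<le> y")
    case True
    then have "h n y = 1" for n by (simp add: h_def)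
    then show ?thesis using True by simp
  next
    case False
    then have uy: "0 < u - y" by simp
    obtain n0 :: nat where n0: "1 / (u - y) < real n0" using reals_Archimedean2 by blast
    have "h n y = 0" if "n0 \<le> n" for n
    proof -
      have "1 < real n0 * (u - y)" using n0 uy by (simp add: pos_divide_less_eq)
      also have "\<dots> \<le> real n * (u - y)" using that uy by (intro mult_right_mono) auto
      finally have "1 + real n * (y - u) \<le> 0" by (simp add: algebra_simps)
      then show ?thesis by (simp add: h_def)
    qed
    then have "\<forall>\<^sub>F n in sequentially. h n y = of_bool (u \<le> y)"
      using False by (auto simp: eventually_sequentially)
    then show ?thesis by (rule tendsto_eventually)
  qed
  have hm [measurable]: "h n \<in> borel_measurable borel" for n unfolding h_def[abs_def] by measurable
  have "(\<lambda>n. \<integral>x. q x * h n (U x) \<partial>M) \<longlonglongrightarrow> (\<integral>x. q x * of_bool (u \<le> U x) \<partial>M)"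
  proof (rule integral_dominated_convergence[where w="\<lambda>x. \<bar>q x\<bar>"])
    show "AE x in M. (\<lambda>n. q x * h n (U x)) \<longlonglongrightarrow> q x * of_bool (u \<le> U x)"
      by (intro AE_I2 tendsto_intros hlim)
    show "AE x in M. norm (q x * h n (U x)) \<le> \<bar>q x\<bar>" for n
      by (intro AE_I2) (auto simp: abs_mult h_def intro!: mult_left_le)
  qed (use q in auto)
  moreover have "(\<integral>x. q x * h n (U x) \<partial>M) = 0" for n
    by (rule cont) (auto simp: h_def[abs_def] intro!: continuous_intros)
  ultimately show ?thesis by (simp add: LIMSEQ_const_iff)
qed

text \<open>The powers of \<open>cos t\<close> are combinations of the modes
  \<open>cos (j * t)\<close>. The product formula for cosines moves one power at a time into the
  mode.\<close>

lemma cos_modes_imp_cos_powers: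
  fixes q t :: "'a \<Rightarrow> real"
  assumes q: "integrable M q" and t [measurable]: "t \<in> borel_measurable M"
    and modes: "\<And>j::nat. (\<integral>x. q x * cos (real j * t x) \<partial>M) = 0"
  shows "(\<integral>x. q x * cos (t x) ^ m \<partial>M) = 0"
proof -
  have [measurable]: "q \<in> borel_measurable M" using q by simp
  have i: "integrable M (\<lambda>x. q x * (cos (t x) ^ m * cos (real j * t x)))" for m j
  proof (rule Bochner_Integration.integrable_bound[OF q])
    have "\<bar>cos (t x) ^ m * cos (real j * t x)\<bar> \<le> 1" for x
      by (simp add: abs_mult power_abs power_le_one mult_le_one)
    then show "AE x in M. norm (q x * (cos (t x) ^ m * cos (real j * t x))) \<le> norm (q x)"
      by (intro AE_I2) (simp add: abs_mult[of "q _"] mult_left_le)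
  qed measurable
  \<comment> \<open>The induction has to carry an arbitrary mode as a factor, because lowering the
    power shifts the mode to \<open>j + 1\<close> and \<open>j - 1\<close>; mode 0 is treated apart
    since \<open>j - 1\<close> is then not a natural number.\<close>
  have "\<forall>j. (\<integral>x. q x * (cos (t x) ^ m * cos (real j * t x)) \<partial>M) = 0"
  proof (induction m)
    case 0
    then show ?case using modes by simp
  next
    case (Suc m)
    show ?case
    proof
      fix j
      show "(\<integral>x. q x * (cos (t x) ^ Suc m * cos (real j * t x)) \<partial>M) = 0"
      proof (cases j)
        case 0
        then have "q x * (cos (t x) ^ Suc m * cos (real j * t x)) = q x * (cos (t x) ^ m * cos (real 1 * t x))" for x by simp
        then show ?thesis using Suc.IH[rule_format, of 1] by (simp only:)
      next
        case (Suc k)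
        have e: "q x * (cos (t x) ^ Suc m * cos (real j * t x)) =
           (q x * (cos (t x) ^ m * cos (real (Suc j) * t x)) + q x * (cos (t x) ^ m * cos (real k * t x))) / 2" for x
        proof -
          have "real (Suc j) * t x = real j * t x + t x" "real k * t x = real j * t x - t x"
            using Suc by (simp_all add: algebra_simps)
          then have "cos (real (Suc j) * t x) + cos (real k * t x) = 2 * (cos (t x) * cos (real j * t x))"
            by (simp add: cos_add cos_diff mult.commute)
          then show ?thesis by (simp add: distrib_left[symmetric] mult_ac)
        qed
        have "(\<integral>x. q x * (cos (t x) ^ Suc m * cos (real j * t x)) \<partial>M) =
          ((\<integral>x. q x * (cos (t x) ^ m * cos (real (Suc j) * t x)) \<partial>M) + (\<integral>x. q x * (cos (t x) ^ m * cos (real k * t x)) \<partial>M)) / 2"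
          unfolding e using i[of m "Suc j"] i[of m k] by (simp del: of_nat_Suc)
        then show ?thesis using Suc.IH by (simp del: of_nat_Suc)
      qed
    qed
  qed
  from this[rule_format, of 0] show ?thesis by simp
qed

text \<open>The positive and negative parts of \<open>r\<close> define two finite measures that
  agree on lower left quadrants, an intersection-stable generator of the Borel sets of the plane;
  equal measures have almost everywhere equal densities.\<close>

lemma quadrant_integrals_zero_imp_AE_zero:
  fixes r :: "real \<times> real \<Rightarrow> real"
  assumes M: "finite_measure M" and sets: "sets M = sets borel" and r: "integrable M r"
    and zero: "\<And>x y. (\<integral>z. r z * of_bool (fst z \<le> x \<and> snd z \<le> y) \<partial>M) = 0"
  shows "AE z in M. r z = 0"
proof -
  interpret finite_measure M by fact
  have rm [measurable]: "r \<in> borel_measurable M" using r by simp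
  have space: "space M = UNIV" using sets_eq_imp_space_eq[OF sets] by simp
  define rp where "rp z = max 0 (r z)" for z
  define rn where "rn z = max 0 (- r z)" for z
  have [measurable]: "rp \<in> borel_measurable M" "rn \<in> borel_measurable M" by (auto simp: rp_def[abs_def] rn_def[abs_def])
  have ip: "integrable M rp" "integrable M rn" using r by (auto simp: rp_def[abs_def] rn_def[abs_def])
  have rpn: "r z = rp z - rn z" "0 \<le> rp z" "0 \<le> rn z" for z by (auto simp: rp_def rn_def)
  have em: "emeasure (density M (\<lambda>z. ennreal (f z))) A = ennreal (\<integral>z. f z * indicator A z \<partial>M)"
    if "integrable M f" "\<And>z. 0 \<le> f z" "A \<in> sets M" for f A
  proof -
    have [measurable]: "f \<in> borel_measurable M" using that(1) by simp
    have "emeasure (density M (\<lambda>z. ennreal (f z))) A = (\<integral>\<^sup>+z. ennreal (f z * indicator A z) \<partial>M)"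
      using that by (subst emeasure_density) (auto intro!: nn_integral_cong simp: indicator_def)
    also have "\<dots> = ennreal (\<integral>z. f z * indicator A z \<partial>M)"
      using that by (intro nn_integral_eq_integral integrable_real_mult_indicator) auto
    finally show ?thesis .
  qed
  define E where "E = range (\<lambda>a::real \<times> real. {..a})"
  have at: "{..(x, y)} = {z::real \<times> real. fst z \<le> x \<and> snd z \<le> y}" for x y
    by (auto simp: less_eq_prod_def)
  have atM: "{..a} \<in> sets M" for a :: "real \<times> real" unfolding sets by simp
  have eq: "density M (\<lambda>z. ennreal (rp z)) = density M (\<lambda>z. ennreal (rn z))"
  proof (rule measure_eqI_generator_eq[where E=E and \<Omega>=UNIV and A="\<lambda>i. {..(real i, real i)}"])
    have "{..a} \<inter> {..b} = {..inf a b}" for a b :: "real \<times> real" by auto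
    then show "Int_stable E" unfolding E_def Int_stable_def by auto
    show "E \<subseteq> Pow UNIV" by simp
    show "emeasure (density M (\<lambda>z. ennreal (rp z))) X = emeasure (density M (\<lambda>z. ennreal (rn z))) X" if XE: "X \<in> E" for X
    proof -
      obtain x y where X: "X = {..(x, y)}" using XE by (auto simp: E_def)
      have ind: "indicator X z = (of_bool (fst z \<le> x \<and> snd z \<le> y) :: real)" for z
        unfolding X at by (simp add: indicator_def)
      have XM: "X \<in> sets M" unfolding X by (rule atM)
      have "(\<integral>z. rp z * indicator X z \<partial>M) - (\<integral>z. rn z * indicator X z \<partial>M) = (\<integral>z. r z * indicator X z \<partial>M)"
        using ip XM by (subst Bochner_Integration.integral_diff[symmetric])
          (auto simp: rpn(1) left_diff_distrib intro!: integrable_real_mult_indicator)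
      also have "\<dots> = 0" unfolding ind by (rule zero)
      finally have "(\<integral>z. rp z * indicator X z \<partial>M) = (\<integral>z. rn z * indicator X z \<partial>M)" by simp
      then show ?thesis using em[OF ip(1) rpn(2) XM] em[OF ip(2) rpn(3) XM] by simp
    qed
    have "sets M = sigma_sets UNIV E" unfolding sets E_def borel_eq_atMost by simp
    then show "sets (density M (\<lambda>z. ennreal (rp z))) = sigma_sets UNIV E" "sets (density M (\<lambda>z. ennreal (rn z))) = sigma_sets UNIV E" by simp_all
    show "range (\<lambda>i. {..(real i, real i)}) \<subseteq> E" by (auto simp: E_def)
    show "(\<Union>i. {..(real i, real i)}) = UNIV"
    proof -
      have "\<exists>i::nat. z \<in> {..(real i, real i)}" for z :: "real \<times> real"
      proof -
        obtain i :: nat where "max (fst z) (snd z) \<le> real i" using real_arch_simple by blast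
        then show ?thesis unfolding at by auto
      qed
      then show ?thesis by auto
    qed
    show "emeasure (density M (\<lambda>z. ennreal (rp z))) {..(real i, real i)} \<noteq> \<infinity>" for i
      using em[OF ip(1) rpn(2) atM] by simp
  qed
  have "AE z in M. ennreal (rp z) = ennreal (rn z)"
    by (rule density_unique[OF _ _ eq]) auto
  then show ?thesis by eventually_elim (use rpn in \<open>auto simp: ennreal_inj\<close>)
qed

context indep_model
begin

text \<open>The additive projection of \<open>s\<close> is its two conditional means minus the total
  mean. The residual is orthogonal to every cosine product, modes 0 included, and is shown to vanish
  by passing from modes to powers, to tails, and to quadrants, one variable at a time.\<close>

lemma additive_of_phi_orthogonal:
  assumes s: "integrable (\<mu> \<Otimes>\<^sub>M \<nu>) s"
    and orth: "\<And>p. 0 < fst p \<Longrightarrow> 0 < snd p \<Longrightarrow> (\<integral>z. s z * phi p z \<partial>(\<mu> \<Otimes>\<^sub>M \<nu>)) = 0"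
  shows "\<exists>a b. AE z in \<mu> \<Otimes>\<^sub>M \<nu>. s z = a (fst z) + b (snd z)"
proof -
  let ?P = "\<mu> \<Otimes>\<^sub>M \<nu>"
  interpret P: pair_prob_space \<mu> \<nu> ..
  define a where "a x = (\<integral>y. s (x, y) \<partial>\<nu>)" for x
  define b where "b y = (\<integral>x. s (x, y) \<partial>\<mu>)" for y
  define c where "c = (\<integral>z. s z \<partial>?P)"
  have s2: "integrable ?P (\<lambda>(x, y). s (x, y))" using s by simp
  have ai: "integrable \<mu> a" unfolding a_def[abs_def] using P.integrable_fst'[OF s] .
  have bi: "integrable \<nu> b" unfolding b_def[abs_def] using P.integrable_snd[OF s2] .
  \<comment> \<open>Doubly centred: integrating out either variable gives 0, which is orthogonality
    to the products in which one mode is 0. Positive modes do not see the additive part, and there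
    the hypothesis on \<open>s\<close> applies.\<close>
  define r where "r z = s z - a (fst z) - b (snd z) + c" for z
  have fstm [measurable]: "fst \<in> borel_measurable ?P" and sndm [measurable]: "snd \<in> borel_measurable ?P"
    using measurable_fst[of \<mu> \<nu>] measurable_snd[of \<mu> \<nu>]
    unfolding measurable_cong_sets[OF refl X.events_eq_borel] measurable_cong_sets[OF refl Y.events_eq_borel] .
  have prod_int: "integrable ?P (\<lambda>z. f (fst z) * g (snd z)) \<and> (\<integral>z. f (fst z) * g (snd z) \<partial>?P) = (\<integral>x. f x \<partial>\<mu>) * (\<integral>y. g y \<partial>\<nu>)"
    if f: "integrable \<mu> f" and g: "integrable \<nu> g" for f g :: "real \<Rightarrow> real"
  proof -
    have [measurable]: "f \<in> borel_measurable \<mu>" "g \<in> borel_measurable \<nu>" using f g by auto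
    have i: "integrable ?P (\<lambda>(x, y). f x * g y)"
    proof (rule P.Fubini_integrable)
      show "(\<lambda>(x, y). f x * g y) \<in> borel_measurable ?P" unfolding split_beta' by measurable
      show "integrable \<mu> (\<lambda>x. \<integral>y. norm (case (x, y) of (x, y) \<Rightarrow> f x * g y) \<partial>\<nu>)"
        using f by (simp add: abs_mult)
      show "AE x in \<mu>. integrable \<nu> (\<lambda>y. case (x, y) of (x, y) \<Rightarrow> f x * g y)" using g by simp
    qed
    have "(\<integral>x. (\<integral>y. f x * g y \<partial>\<nu>) \<partial>\<mu>) = (\<integral>(x, y). f x * g y \<partial>?P)" by (rule P.integral_fst[OF i])
    then show ?thesis using i by (simp add: split_beta')
  qed
  have aint: "integrable ?P (\<lambda>z. a (fst z))" "integrable ?P (\<lambda>z. b (snd z))"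
    using prod_int[OF ai, of "\<lambda>_. 1"] prod_int[OF _ bi, of "\<lambda>_. 1"] by simp_all
  have ri: "integrable ?P r" unfolding r_def[abs_def] using s aint by simp
  have r_test: "(\<integral>z. r z * (f (fst z) * g (snd z)) \<partial>?P) = (\<integral>z. s z * (f (fst z) * g (snd z)) \<partial>?P)
      - (\<integral>x. a x * f x \<partial>\<mu>) * (\<integral>y. g y \<partial>\<nu>) - (\<integral>x. f x \<partial>\<mu>) * (\<integral>y. b y * g y \<partial>\<nu>) + c * ((\<integral>x. f x \<partial>\<mu>) * (\<integral>y. g y \<partial>\<nu>))"
    and s_test1: "(\<integral>z. s z * f (fst z) \<partial>?P) = (\<integral>x. a x * f x \<partial>\<mu>)"
    and s_test2: "(\<integral>z. s z * g (snd z) \<partial>?P) = (\<integral>y. b y * g y \<partial>\<nu>)"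
    if fm [measurable]: "f \<in> borel_measurable borel" and gm [measurable]: "g \<in> borel_measurable borel"
      and fb: "\<And>x. \<bar>f x\<bar> \<le> 1" and gb: "\<And>x. \<bar>g x\<bar> \<le> 1" for f g :: "real \<Rightarrow> real"
  proof -
    have mulb: "integrable N (\<lambda>x. u x * v x)" if "integrable N u" "v \<in> borel_measurable N" "\<And>x. \<bar>v x\<bar> \<le> 1" for N :: "'c measure" and u v :: "'c \<Rightarrow> real"
    proof (rule Bochner_Integration.integrable_bound[OF that(1)])
      show "(\<lambda>x. u x * v x) \<in> borel_measurable N" using that(1,2) by measurable
      show "AE x in N. norm (u x * v x) \<le> norm (u x)" using that(3) by (intro AE_I2) (simp add: abs_mult mult_left_le)
    qed
    have fi: "integrable \<mu> f" by (rule X.integrable_const_bound[where B=1]) (use fb in auto)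
    have gi: "integrable \<nu> g" by (rule Y.integrable_const_bound[where B=1]) (use gb in auto)
    have afi: "integrable \<mu> (\<lambda>x. a x * f x)" by (rule mulb[OF ai]) (use fb in auto)
    have bgi: "integrable \<nu> (\<lambda>y. b y * g y)" by (rule mulb[OF bi]) (use gb in auto)
    have fgb: "\<bar>f (fst z) * g (snd z)\<bar> \<le> 1" for z using fb gb by (simp add: abs_mult mult_le_one)
    have sfg: "integrable ?P (\<lambda>z. s z * (f (fst z) * g (snd z)))" by (rule mulb[OF s]) (use fgb in auto)
    have sf: "integrable ?P (\<lambda>z. s z * f (fst z))" by (rule mulb[OF s]) (use fb in auto)
    have sg: "integrable ?P (\<lambda>z. s z * g (snd z))" by (rule mulb[OF s]) (use gb in auto)
    have "(\<integral>z. r z * (f (fst z) * g (snd z)) \<partial>?P) = (\<integral>z. s z * (f (fst z) * g (snd z))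
       - (a (fst z) * f (fst z)) * g (snd z) - f (fst z) * (b (snd z) * g (snd z)) + c * (f (fst z) * g (snd z)) \<partial>?P)"
      by (intro Bochner_Integration.integral_cong refl) (simp add: r_def algebra_simps)
    also have "\<dots> = (\<integral>z. s z * (f (fst z) * g (snd z)) \<partial>?P)
      - (\<integral>x. a x * f x \<partial>\<mu>) * (\<integral>y. g y \<partial>\<nu>) - (\<integral>x. f x \<partial>\<mu>) * (\<integral>y. b y * g y \<partial>\<nu>) + c * ((\<integral>x. f x \<partial>\<mu>) * (\<integral>y. g y \<partial>\<nu>))"
      using sfg prod_int[OF afi gi] prod_int[OF fi bgi] prod_int[OF fi gi] by simp
    finally show "(\<integral>z. r z * (f (fst z) * g (snd z)) \<partial>?P) = (\<integral>z. s z * (f (fst z) * g (snd z)) \<partial>?P)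
      - (\<integral>x. a x * f x \<partial>\<mu>) * (\<integral>y. g y \<partial>\<nu>) - (\<integral>x. f x \<partial>\<mu>) * (\<integral>y. b y * g y \<partial>\<nu>) + c * ((\<integral>x. f x \<partial>\<mu>) * (\<integral>y. g y \<partial>\<nu>))" .
    show "(\<integral>z. s z * f (fst z) \<partial>?P) = (\<integral>x. a x * f x \<partial>\<mu>)"
      using P.integral_fst'[OF sf] by (simp add: a_def)
    have sg': "integrable ?P (\<lambda>(x, y). s (x, y) * g y)" using sg by (simp add: split_beta')
    show "(\<integral>z. s z * g (snd z) \<partial>?P) = (\<integral>y. b y * g y \<partial>\<nu>)"
      using P.integral_snd[OF sg'] by (simp add: b_def split_beta')
  qed
  have c_int: "(\<integral>x. a x \<partial>\<mu>) = c" "(\<integral>y. b y \<partial>\<nu>) = c"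
    using P.integral_fst'[OF s] P.integral_snd[OF s2] by (simp_all add: a_def b_def c_def)
  define A where "A j x = cos (real j * (pi * cdf \<mu> x))" for j x
  define B where "B k y = cos (real k * (pi * cdf \<nu> y))" for k y
  have AB: "A j \<in> borel_measurable borel" "B k \<in> borel_measurable borel" "\<bar>A j x\<bar> \<le> 1" "\<bar>B k x\<bar> \<le> 1" for j k x
  proof -
    show "A j \<in> borel_measurable borel" unfolding A_def[abs_def] by measurable
    show "B k \<in> borel_measurable borel" unfolding B_def[abs_def] by measurable
  qed (simp_all add: A_def B_def)
  have modes: "(\<integral>z. r z * (A j (fst z) * B k (snd z)) \<partial>?P) = 0" for j k
  proof -
    note rt = r_test[OF AB(1)[of j] AB(2)[of k] AB(3)[of j] AB(4)[of k]]
      and st1 = s_test1[OF AB(1)[of j] AB(2)[of k] AB(3)[of j] AB(4)[of k]]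
      and st2 = s_test2[OF AB(1)[of j] AB(2)[of k] AB(3)[of j] AB(4)[of k]]
    consider "j = 0" | "k = 0" | "0 < j" "0 < k" by auto
    then show ?thesis
    proof cases
      case 1
      then have "A j = (\<lambda>_. 1)" by (simp add: A_def fun_eq_iff)
      then show ?thesis using rt st2 c_int X.prob_space Y.prob_space by (simp add: X.prob_space[simplified])
    next
      case 2
      then have "B k = (\<lambda>_. 1)" by (simp add: B_def fun_eq_iff)
      then show ?thesis using rt st1 c_int by (simp add: Y.prob_space[simplified])
    next
      case 3
      have A0: "(\<integral>x. A j x \<partial>\<mu>) = 0" "(\<integral>y. B k y \<partial>\<nu>) = 0"
        using cos_cos_mu(1)[OF 3(1,1)] cos_cos_mu(3)[OF 3(2,2)] by (simp_all add: A_def B_def mult_ac)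
      have "(\<integral>z. s z * phi (j, k) z \<partial>?P) = 2 * (\<integral>z. s z * (A j (fst z) * B k (snd z)) \<partial>?P)"
      proof -
        have "(\<integral>z. s z * phi (j, k) z \<partial>?P) = (\<integral>z. 2 * (s z * (A j (fst z) * B k (snd z))) \<partial>?P)"
          by (intro Bochner_Integration.integral_cong refl) (simp add: phi_def A_def B_def mult_ac)
        then show ?thesis by (simp only: integral_mult_right_zero)
      qed
      then show ?thesis using rt A0 orth[of "(j, k)"] 3 by simp
    qed
  qed
  have rb: "integrable ?P (\<lambda>z. r z * g z)" if "g \<in> borel_measurable ?P" "\<And>z. \<bar>g z\<bar> \<le> 1" for g
  proof (rule Bochner_Integration.integrable_bound[OF ri])
    show "(\<lambda>z. r z * g z) \<in> borel_measurable ?P" using ri that(1) by measurable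
    show "AE z in ?P. norm (r z * g z) \<le> norm (r z)" using that(2) by (intro AE_I2) (simp add: abs_mult mult_left_le)
  qed
  have tm [measurable]: "(\<lambda>z. pi * cdf \<mu> (fst z)) \<in> borel_measurable ?P" "(\<lambda>z. pi * cdf \<nu> (snd z)) \<in> borel_measurable ?P"
    by measurable
  \<comment> \<open>The factor in the second variable is absorbed into the weight \<open>q\<close>,
    so the one-variable lemmas apply to a function of two variables.\<close>
  have step1: "(\<integral>z. (r z * B k (snd z)) * cos (pi * cdf \<mu> (fst z)) ^ m \<partial>?P) = 0" for k m
  proof (rule cos_modes_imp_cos_powers[OF _ tm(1)])
    show "integrable ?P (\<lambda>z. r z * B k (snd z))" by (rule rb) (use AB in auto)
    show "(\<integral>z. r z * B k (snd z) * cos (real j * (pi * cdf \<mu> (fst z))) \<partial>?P) = 0" for j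
      using modes[of j k] by (simp add: A_def mult_ac)
  qed
  have step2: "(\<integral>z. (r z * cos (pi * cdf \<mu> (fst z)) ^ m) * cos (pi * cdf \<nu> (snd z)) ^ l \<partial>?P) = 0" for m l
  proof (rule cos_modes_imp_cos_powers[OF _ tm(2)])
    show "integrable ?P (\<lambda>z. r z * cos (pi * cdf \<mu> (fst z)) ^ m)"
      by (rule rb) (auto simp: power_abs power_le_one)
    show "(\<integral>z. r z * cos (pi * cdf \<mu> (fst z)) ^ m * cos (real j * (pi * cdf \<nu> (snd z))) \<partial>?P) = 0" for j
      using step1[of j m] by (simp add: B_def mult_ac)
  qed
  have step3: "(\<integral>z. (r z * cos (pi * cdf \<nu> (snd z)) ^ l) * of_bool (u \<le> cos (pi * cdf \<mu> (fst z))) \<partial>?P) = 0" for l u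
  proof (rule moments_zero_imp_tail_zero)
    show "integrable ?P (\<lambda>z. r z * cos (pi * cdf \<nu> (snd z)) ^ l)"
      by (rule rb) (auto simp: power_abs power_le_one)
    show "(\<integral>z. r z * cos (pi * cdf \<nu> (snd z)) ^ l * cos (pi * cdf \<mu> (fst z)) ^ m \<partial>?P) = 0" for m
      using step2[of m l] by (simp add: mult_ac)
  qed auto
  have step4: "(\<integral>z. (r z * of_bool (u \<le> cos (pi * cdf \<mu> (fst z)))) * of_bool (v \<le> cos (pi * cdf \<nu> (snd z))) \<partial>?P) = 0" for u v
  proof (rule moments_zero_imp_tail_zero)
    show "integrable ?P (\<lambda>z. r z * of_bool (u \<le> cos (pi * cdf \<mu> (fst z))))" by (rule rb) auto
    show "(\<integral>z. r z * of_bool (u \<le> cos (pi * cdf \<mu> (fst z))) * cos (pi * cdf \<nu> (snd z)) ^ m \<partial>?P) = 0" for m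
      using step3[of m u] by (simp add: mult_ac)
  qed auto
  \<comment> \<open>On the unit interval the cosine of \<open>pi * t\<close> is strictly decreasing,
    so upper tails of the cosines are lower sets of the distribution functions.\<close>
  have cos_iff: "cos (pi * t) \<le> cos (pi * t') \<longleftrightarrow> t' \<le> t" if "0 \<le> t" "t \<le> 1" "0 \<le> t'" "t' \<le> 1" for t t'
    using that by (subst cos_mono_le_eq) auto
  \<comment> \<open>The distribution function may be flat to the right of \<open>x0\<close>, but
    such a flat piece carries no mass.\<close>
  have AE1: "AE x in \<mu>. (cdf \<mu> x \<le> cdf \<mu> x0) = (x \<le> x0)" for x0
  proof -
    have "measure \<mu> ({x. cdf \<mu> x \<le> cdf \<mu> x0} - {..x0}) = measure \<mu> {x. cdf \<mu> x \<le> cdf \<mu> x0} - measure \<mu> {..x0}"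
      using X.cdf_nondecreasing by (intro X.finite_measure_Diff) auto
    also have "\<dots> = 0" using X.measure_F_le[of "cdf \<mu> x0"] X.F01[of x0] by (simp add: cdf_def2)
    finally have "emeasure \<mu> ({x. cdf \<mu> x \<le> cdf \<mu> x0} - {..x0}) = 0" by (simp add: X.emeasure_eq_measure)
    then have "AE x in \<mu>. x \<notin> {x. cdf \<mu> x \<le> cdf \<mu> x0} - {..x0}"
      by (intro AE_not_in null_setsI) auto
    then show ?thesis by eventually_elim (use X.cdf_nondecreasing in auto)
  qed
  have AE2: "AE x in \<nu>. (cdf \<nu> x \<le> cdf \<nu> x0) = (x \<le> x0)" for x0
  proof -
    have "measure \<nu> ({x. cdf \<nu> x \<le> cdf \<nu> x0} - {..x0}) = measure \<nu> {x. cdf \<nu> x \<le> cdf \<nu> x0} - measure \<nu> {..x0}"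
      using Y.cdf_nondecreasing by (intro Y.finite_measure_Diff) auto
    also have "\<dots> = 0" using Y.measure_F_le[of "cdf \<nu> x0"] Y.F01[of x0] by (simp add: cdf_def2)
    finally have "emeasure \<nu> ({x. cdf \<nu> x \<le> cdf \<nu> x0} - {..x0}) = 0" by (simp add: Y.emeasure_eq_measure)
    then have "AE x in \<nu>. x \<notin> {x. cdf \<nu> x \<le> cdf \<nu> x0} - {..x0}"
      by (intro AE_not_in null_setsI) auto
    then show ?thesis by eventually_elim (use Y.cdf_nondecreasing in auto)
  qed
  have setsP: "sets ?P = sets borel"
    unfolding borel_prod[symmetric] by (intro sets_pair_measure_cong X.events_eq_borel Y.events_eq_borel)
  have quad: "(\<integral>z. r z * of_bool (fst z \<le> x \<and> snd z \<le> y) \<partial>?P) = 0" for x y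
  proof -
    have "(\<integral>z. r z * of_bool (fst z \<le> x \<and> snd z \<le> y) \<partial>?P) =
      (\<integral>z. (r z * of_bool (cos (pi * cdf \<mu> x) \<le> cos (pi * cdf \<mu> (fst z)))) * of_bool (cos (pi * cdf \<nu> y) \<le> cos (pi * cdf \<nu> (snd z))) \<partial>?P)"
    proof (rule integral_cong_AE)
      show "AE z in ?P. r z * of_bool (fst z \<le> x \<and> snd z \<le> y) =
        (r z * of_bool (cos (pi * cdf \<mu> x) \<le> cos (pi * cdf \<mu> (fst z)))) * of_bool (cos (pi * cdf \<nu> y) \<le> cos (pi * cdf \<nu> (snd z)))"
      proof -
        have "AE z in ?P. (cdf \<mu> (fst z) \<le> cdf \<mu> x) = (fst z \<le> x) \<and> (cdf \<nu> (snd z) \<le> cdf \<nu> y) = (snd z \<le> y)"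
        proof (rule P.AE_pair_measure)
          show "AE u in \<mu>. AE v in \<nu>. (cdf \<mu> (fst (u, v)) \<le> cdf \<mu> x) = (fst (u, v) \<le> x) \<and> (cdf \<nu> (snd (u, v)) \<le> cdf \<nu> y) = (snd (u, v) \<le> y)"
            using AE1[of x]
          proof eventually_elim
            case (elim u)
            show ?case using AE2[of y] by eventually_elim (use elim in simp)
          qed
        qed measurable
        then show ?thesis
          by eventually_elim (simp add: cos_iff X.F01 Y.F01)
      qed
    qed (use ri in measurable)
    also have "\<dots> = 0" by (rule step4)
    finally show ?thesis .
  qed
  have "AE z in ?P. r z = 0"
    by (rule quadrant_integrals_zero_imp_AE_zero[OF P.P.finite_measure_axioms setsP ri quad])
  then have "AE z in ?P. s z = a (fst z) + (b (snd z) - c)"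
    by eventually_elim (simp add: r_def)
  then show ?thesis by (intro exI[of _ a] exI[of _ "\<lambda>y. b y - c"])
qed

end

section \<open>Quadratic mean differentiability\<close>

lemma prob_densityD:
  assumes "prob_density f"
  shows "f \<in> borel_measurable borel" "\<And>x. 0 \<le> f x" "(\<integral>\<^sup>+x. ennreal (f x) \<partial>lborel) = 1"
  using assms by (auto simp: prob_density_def)

lemma prob_space_density_law:
  assumes "prob_density f"
  shows "prob_space (density_law f)"
proof (rule prob_spaceI)
  note f = prob_densityD[OF assms]
  have m: "(\<lambda>x. ennreal (f x)) \<in> borel_measurable lborel" using f(1) by measurable
  show "emeasure (density_law f) (space (density_law f)) = 1"
    unfolding density_law_def space_density by (subst emeasure_density[OF m sets.top]) (simp add: f(3) cong: nn_integral_cong)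
qed

lemma sets_density_law [simp]: "sets (density_law f) = sets borel"
  by (simp add: density_law_def)

lemma atomless_density_law:
  fixes f :: "real \<Rightarrow> real"
  assumes "prob_density f"
  shows "atomless_distribution (density_law f)"
proof -
  interpret P: prob_space "density_law f" by (rule prob_space_density_law[OF assms])
  have m: "(\<lambda>x. ennreal (f x)) \<in> borel_measurable lborel" using prob_densityD(1)[OF assms] by measurable
  show ?thesis
  proof
    fix a :: real
    have "emeasure (density_law f) {a} = (\<integral>\<^sup>+x. ennreal (f x) * indicator {a} x \<partial>lborel)"
      unfolding density_law_def by (rule emeasure_density[OF m]) simp
    also have "\<dots> = (\<integral>\<^sup>+x. 0 \<partial>(lborel :: real measure))"
      by (rule nn_integral_cong_AE) (use AE_lborel_singleton[of a] in \<open>eventually_elim, simp add: indicator_def\<close>)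
    finally show "measure (density_law f) {a} = 0" by (simp add: measure_def)
  qed simp
qed

lemma density_law_product:
  fixes f g :: "real \<Rightarrow> real"
  assumes f: "prob_density f" and g: "prob_density g" and H: "\<And>x y. H (x, y) = f x * g y"
  shows "density_law H = density_law f \<Otimes>\<^sub>M density_law g"
proof -
  note fd = prob_densityD[OF f] and gd = prob_densityD[OF g]
  have m: "(\<lambda>x. ennreal (f x)) \<in> borel_measurable lborel" "(\<lambda>x. ennreal (g x)) \<in> borel_measurable lborel"
    using fd(1) gd(1) by measurable
  have "density_law f \<Otimes>\<^sub>M density_law g = density (lborel \<Otimes>\<^sub>M lborel) (\<lambda>(x, y). ennreal (f x) * ennreal (g y))"
    unfolding density_law_def
    by (rule pair_measure_density[OF m])
      (use prob_space_density_law[OF g] in \<open>auto simp: density_law_def intro: prob_space_imp_sigma_finite lborel.sigma_finite_measure_axioms\<close>)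
  also have "(\<lambda>(x, y). ennreal (f x) * ennreal (g y)) = (\<lambda>z. ennreal (H z))"
    by (auto simp: fun_eq_iff H ennreal_mult fd(2) gd(2))
  also have "density (lborel \<Otimes>\<^sub>M lborel) (\<lambda>z. ennreal (H z)) = density_law H"
    unfolding lborel_prod density_law_def ..
  finally show ?thesis by simp
qed

text \<open>Formulated with nonnegative integrals so that finiteness is a conclusion; square
  integrability of the score is obtained this way.\<close>

lemma nn_integral_square_sum3:
  fixes x y z :: "'a \<Rightarrow> real"
  assumes [measurable]: "x \<in> borel_measurable M" "y \<in> borel_measurable M" "z \<in> borel_measurable M"
    and A: "(\<integral>\<^sup>+w. ennreal ((x w)\<^sup>2) \<partial>M) \<le> ennreal A" "0 \<le> A"
    and B: "(\<integral>\<^sup>+w. ennreal ((y w)\<^sup>2) \<partial>M) \<le> ennreal B" "0 \<le> B"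
    and C: "(\<integral>\<^sup>+w. ennreal ((z w)\<^sup>2) \<partial>M) \<le> ennreal C" "0 \<le> C"
  shows "(\<integral>\<^sup>+w. ennreal ((x w + y w + z w)\<^sup>2) \<partial>M) \<le> ennreal (3 * (A + B + C))"
proof -
  have sq: "(a + b + c)\<^sup>2 \<le> 3 * (a\<^sup>2 + b\<^sup>2 + c\<^sup>2)" for a b c :: real
  proof -
    have "0 \<le> (a - b)\<^sup>2 + (b - c)\<^sup>2 + (a - c)\<^sup>2" by simp
    then show ?thesis by (simp add: power2_eq_square algebra_simps)
  qed
  have three: "ennreal (3 * (a + b + c)) = 3 * (ennreal a + ennreal b + ennreal c)" if "0 \<le> a" "0 \<le> b" "0 \<le> c" for a b c
    using ennreal_mult[of 3 "a + b + c"] that by (simp add: add_nonneg_nonneg)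
  have "(\<integral>\<^sup>+w. ennreal ((x w + y w + z w)\<^sup>2) \<partial>M) \<le> (\<integral>\<^sup>+w. 3 * (ennreal ((x w)\<^sup>2) + ennreal ((y w)\<^sup>2) + ennreal ((z w)\<^sup>2)) \<partial>M)"
  proof (rule nn_integral_mono)
    fix w
    have "3 * (ennreal ((x w)\<^sup>2) + ennreal ((y w)\<^sup>2) + ennreal ((z w)\<^sup>2)) = ennreal (3 * ((x w)\<^sup>2 + (y w)\<^sup>2 + (z w)\<^sup>2))"
      by (rule three[symmetric]) auto
    then show "ennreal ((x w + y w + z w)\<^sup>2) \<le> 3 * (ennreal ((x w)\<^sup>2) + ennreal ((y w)\<^sup>2) + ennreal ((z w)\<^sup>2))"
      using ennreal_leI[OF sq[of "x w" "y w" "z w"]] by simp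
  qed
  also have "\<dots> = 3 * ((\<integral>\<^sup>+w. ennreal ((x w)\<^sup>2) \<partial>M) + (\<integral>\<^sup>+w. ennreal ((y w)\<^sup>2) \<partial>M) + (\<integral>\<^sup>+w. ennreal ((z w)\<^sup>2) \<partial>M))"
    by (simp add: nn_integral_cmult nn_integral_add)
  also have "\<dots> \<le> 3 * (ennreal A + ennreal B + ennreal C)"
    using A B C by (intro mult_left_mono add_mono) auto
  also have "\<dots> = ennreal (3 * (A + B + C))"
    using A B C by (intro three[symmetric])
  finally show ?thesis .
qed

lemma qmd_remainder_small:
  assumes qmd: "qmd_at_0 h s" and \<xi>: "0 < \<xi>"
  shows "\<forall>\<^sub>F \<theta> in at 0. (\<integral>\<^sup>+z. ennreal ((sqrt (h \<theta> z) - sqrt (h 0 z) - 1/2 * \<theta> * s z * sqrt (h 0 z))\<^sup>2) \<partial>lborel) \<le> ennreal (\<xi> * \<theta>\<^sup>2)"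
proof -
  let ?R = "\<lambda>\<theta>. \<integral>\<^sup>+z. ennreal ((sqrt (h \<theta> z) - sqrt (h 0 z) - 1/2 * \<theta> * s z * sqrt (h 0 z))\<^sup>2) \<partial>lborel"
  have "\<forall>\<^sub>F \<theta> in at 0. ?R \<theta> / ennreal (\<theta>\<^sup>2) < ennreal \<xi>"
    using qmd \<xi> unfolding qmd_at_0_def by (intro order_tendstoD(2)) auto
  moreover have "\<forall>\<^sub>F \<theta>::real in at 0. \<theta> \<noteq> 0" by (simp add: eventually_at_filter)
  ultimately show ?thesis
  proof eventually_elim
    case (elim \<theta>)
    have "?R \<theta> = (?R \<theta> / ennreal (\<theta>\<^sup>2)) * ennreal (\<theta>\<^sup>2)"
      unfolding ennreal_divide_times using elim(2) by (subst ennreal_divide_self) simp_all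
    also have "\<dots> \<le> ennreal \<xi> * ennreal (\<theta>\<^sup>2)" using elim(1) by (intro mult_right_mono) auto
    also have "\<dots> = ennreal (\<xi> * \<theta>\<^sup>2)" using \<xi> by (simp add: ennreal_mult)
    finally show ?case .
  qed
qed

lemma eventually_at_0_abs_less: "0 < (c::real) \<Longrightarrow> \<forall>\<^sub>F \<theta> in at 0. \<bar>\<theta>\<bar> < c \<and> \<theta> \<noteq> 0"
  unfolding eventually_at by (intro exI[of _ c]) (simp add: dist_real_def)

text \<open>One parameter value with a finite remainder is enough: there
  \<open>1/2 * \<theta> * s z * sqrt (h 0 z)\<close> is a combination of the remainder and two
  square roots of densities, all three square integrable.\<close>

lemma score_square_integrable:
  assumes dens: "\<And>\<eta>. \<bar>\<eta>\<bar> < 1 \<Longrightarrow> prob_density (h \<eta>)" and s [measurable]: "s \<in> borel_measurable borel"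
    and qmd: "qmd_at_0 h s"
  shows "integrable (density_law (h 0)) (\<lambda>z. (s z)\<^sup>2)"
proof -
  have "\<forall>\<^sub>F \<theta> in at 0. \<bar>\<theta>\<bar> < (1::real) \<and> \<theta> \<noteq> 0" by (rule eventually_at_0_abs_less) simp
  with qmd_remainder_small[OF qmd, of 1]
  have ev: "\<forall>\<^sub>F \<theta> in at 0. (\<integral>\<^sup>+z. ennreal ((sqrt (h \<theta> z) - sqrt (h 0 z) - 1/2 * \<theta> * s z * sqrt (h 0 z))\<^sup>2) \<partial>lborel) \<le> ennreal (1 * \<theta>\<^sup>2) \<and> \<bar>\<theta>\<bar> < 1 \<and> \<theta> \<noteq> 0"
    by (auto elim: eventually_elim2)
  obtain \<theta> where \<theta>: "(\<integral>\<^sup>+z. ennreal ((sqrt (h \<theta> z) - sqrt (h 0 z) - 1/2 * \<theta> * s z * sqrt (h 0 z))\<^sup>2) \<partial>lborel) \<le> ennreal (\<theta>\<^sup>2)"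
    "\<bar>\<theta>\<bar> < 1" "\<theta> \<noteq> 0"
    using eventually_happens'[OF at_neq_bot ev] by auto
  note h0 = prob_densityD[OF dens[of 0, simplified]] and ht = prob_densityD[OF dens[OF \<theta>(2)]]
  note [measurable] = h0(1) ht(1)
  have le: "(\<integral>\<^sup>+z. ennreal (((sqrt (h \<theta> z) - sqrt (h 0 z) - 1/2 * \<theta> * s z * sqrt (h 0 z)) + - sqrt (h \<theta> z) + sqrt (h 0 z))\<^sup>2) \<partial>lborel) \<le> ennreal (3 * (\<theta>\<^sup>2 + 1 + 1))"
  proof (rule nn_integral_square_sum3)
    show "(\<integral>\<^sup>+z. ennreal ((- sqrt (h \<theta> z))\<^sup>2) \<partial>lborel) \<le> ennreal 1"
      using ht(2,3) by simp
    show "(\<integral>\<^sup>+z. ennreal ((sqrt (h 0 z))\<^sup>2) \<partial>lborel) \<le> ennreal 1"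
      using h0(2,3) by simp
  qed (use \<theta>(1) in \<open>auto\<close>)
  have sq: "((sqrt (h \<theta> z) - sqrt (h 0 z) - 1/2 * \<theta> * s z * sqrt (h 0 z)) + - sqrt (h \<theta> z) + sqrt (h 0 z))\<^sup>2 = (\<theta>\<^sup>2 / 4) * (h 0 z * (s z)\<^sup>2)" for z
    using h0(2)[of z] by (simp add: power_mult_distrib power_divide mult_ac)
  have "(\<integral>\<^sup>+z. ennreal ((\<theta>\<^sup>2 / 4) * (h 0 z * (s z)\<^sup>2)) \<partial>lborel) < \<infinity>"
    using le unfolding sq by (rule le_less_trans) simp
  then have "integrable lborel (\<lambda>z. (\<theta>\<^sup>2 / 4) * (h 0 z * (s z)\<^sup>2))"
    using h0(2) by (intro integrableI_nonneg) auto
  then have "integrable lborel (\<lambda>z. (4 / \<theta>\<^sup>2) * ((\<theta>\<^sup>2 / 4) * (h 0 z * (s z)\<^sup>2)))" by (rule integrable_mult_right)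
  moreover have "(4 / \<theta>\<^sup>2) * ((\<theta>\<^sup>2 / 4) * u) = u" for u :: real using \<theta>(3) by simp
  ultimately have "integrable lborel (\<lambda>z. h 0 z * (s z)\<^sup>2)" by (simp only:)
  then show ?thesis
    unfolding density_law_def using h0(2) by (subst integrable_density) auto
qed

lemma nn_integral_density_law:
  assumes "prob_density H" and [measurable]: "u \<in> borel_measurable borel"
  shows "(\<integral>\<^sup>+z. ennreal (H z * (u z)\<^sup>2) \<partial>lborel) = (\<integral>\<^sup>+z. ennreal ((u z)\<^sup>2) \<partial>density_law H)"
proof -
  note H = prob_densityD[OF assms(1)]
  note [measurable] = H(1)
  show ?thesis unfolding density_law_def using H(2)
    by (subst nn_integral_density) (auto intro!: nn_integral_cong simp: ennreal_mult)
qed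

text \<open>Square roots of densities have norm 1, while the linearization has squared norm
  \<open>1 + \<theta> * m\<close> plus a nonnegative term of second order. A remainder of smaller
  order than \<theta> leaves no room for a nonzero \<open>m\<close>, since \<theta> takes both
  signs.\<close>

lemma score_mean_zero:
  assumes dens: "\<And>\<eta>. \<bar>\<eta>\<bar> < 1 \<Longrightarrow> prob_density (h \<eta>)" and s [measurable]: "s \<in> borel_measurable borel"
    and qmd: "qmd_at_0 h s"
  shows "(\<integral>z. s z \<partial>density_law (h 0)) = 0"
proof -
  let ?P = "density_law (h 0)"
  have d0: "prob_density (h 0)" using dens[of 0] by simp
  interpret P: prob_space ?P by (rule prob_space_density_law[OF d0])
  note h0 = prob_densityD[OF d0]
  note [measurable] = h0(1)
  have s2: "integrable ?P (\<lambda>z. (s z)\<^sup>2)" by (rule score_square_integrable[OF dens s qmd])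
  have si: "integrable ?P s"
    by (rule P.square_integrable_imp_integrable[OF _ s2]) (simp add: density_law_def)
  define m where "m = (\<integral>z. s z \<partial>?P)"
  \<comment> \<open>The weighted inequality for the square of a difference, with free weight
    \<kappa>, compares the squared norm of the linearization with 1; the nonnegative term in the
    square of the score is discarded.\<close>
  have key: "\<theta> * m \<le> \<kappa> + (1 + 1 / \<kappa>) * (\<xi> * \<theta>\<^sup>2)"
    if \<theta>: "\<bar>\<theta>\<bar> < 1" and \<kappa>: "0 < \<kappa>" and \<xi>: "0 \<le> \<xi>"
      and R: "(\<integral>\<^sup>+z. ennreal ((sqrt (h \<theta> z) - sqrt (h 0 z) - 1/2 * \<theta> * s z * sqrt (h 0 z))\<^sup>2) \<partial>lborel) \<le> ennreal (\<xi> * \<theta>\<^sup>2)"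
    for \<theta> \<kappa> \<xi> :: real
  proof -
    note ht = prob_densityD[OF dens[OF \<theta>]]
    note [measurable] = ht(1)
    define r where "r z = sqrt (h \<theta> z) - sqrt (h 0 z) - 1/2 * \<theta> * s z * sqrt (h 0 z)" for z
    have rm [measurable]: "r \<in> borel_measurable borel" unfolding r_def[abs_def] by measurable
    have pt: "h 0 z * (1 + 1/2 * \<theta> * s z)\<^sup>2 \<le> (1 + \<kappa>) * h \<theta> z + (1 + 1 / \<kappa>) * (r z)\<^sup>2" for z
    proof -
      define a where "a = sqrt (h \<theta> z)"
      have "sqrt (h 0 z) * (1 + 1/2 * \<theta> * s z) = a - r z" by (simp add: a_def r_def algebra_simps)
      moreover have "h 0 z * (1 + 1/2 * \<theta> * s z)\<^sup>2 = (sqrt (h 0 z) * (1 + 1/2 * \<theta> * s z))\<^sup>2"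
        using h0(2)[of z] by (simp add: power_mult_distrib)
      moreover have "(a - r z)\<^sup>2 \<le> (1 + \<kappa>) * a\<^sup>2 + (1 + 1 / \<kappa>) * (r z)\<^sup>2"
      proof -
        have "0 \<le> (sqrt \<kappa> * a + r z / sqrt \<kappa>)\<^sup>2" by simp
        also have "\<dots> = \<kappa> * a\<^sup>2 + 2 * a * r z + (r z)\<^sup>2 / \<kappa>"
          using \<kappa> by (simp add: power2_sum power_mult_distrib power_divide)
        finally show ?thesis using \<kappa> by (simp add: power2_diff algebra_simps)
      qed
      moreover have "a\<^sup>2 = h \<theta> z" using ht(2)[of z] by (simp add: a_def)
      ultimately show ?thesis by simp
    qed
    have ex: "(1 + 1/2 * \<theta> * s z)\<^sup>2 = 1 + \<theta> * s z + \<theta>\<^sup>2 / 4 * (s z)\<^sup>2" for z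
      by (simp add: power2_eq_square algebra_simps)
    have i: "integrable ?P (\<lambda>z. (1 + 1/2 * \<theta> * s z)\<^sup>2)" unfolding ex using si s2 by simp
    have "ennreal (\<integral>z. (1 + 1/2 * \<theta> * s z)\<^sup>2 \<partial>?P) = (\<integral>\<^sup>+z. ennreal ((1 + 1/2 * \<theta> * s z)\<^sup>2) \<partial>?P)"
      using i by (intro nn_integral_eq_integral[symmetric]) auto
    also have "\<dots> = (\<integral>\<^sup>+z. ennreal (h 0 z * (1 + 1/2 * \<theta> * s z)\<^sup>2) \<partial>lborel)"
      by (rule nn_integral_density_law[OF d0, symmetric]) measurable
    also have "\<dots> \<le> (\<integral>\<^sup>+z. ennreal (1 + \<kappa>) * ennreal (h \<theta> z) + ennreal (1 + 1 / \<kappa>) * ennreal ((r z)\<^sup>2) \<partial>lborel)"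
    proof (rule nn_integral_mono)
      fix z
      have "ennreal (1 + \<kappa>) * ennreal (h \<theta> z) + ennreal (1 + 1 / \<kappa>) * ennreal ((r z)\<^sup>2) = ennreal ((1 + \<kappa>) * h \<theta> z + (1 + 1 / \<kappa>) * (r z)\<^sup>2)"
        using \<kappa> ht(2)[of z] by (simp add: ennreal_mult[symmetric] ennreal_plus[symmetric] del: ennreal_plus)
      then show "ennreal (h 0 z * (1 + 1/2 * \<theta> * s z)\<^sup>2) \<le> ennreal (1 + \<kappa>) * ennreal (h \<theta> z) + ennreal (1 + 1 / \<kappa>) * ennreal ((r z)\<^sup>2)"
        using pt[of z] by (simp only: ennreal_leI)
    qed
    also have "\<dots> = ennreal (1 + \<kappa>) * (\<integral>\<^sup>+z. ennreal (h \<theta> z) \<partial>lborel) + ennreal (1 + 1 / \<kappa>) * (\<integral>\<^sup>+z. ennreal ((r z)\<^sup>2) \<partial>lborel)"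
      by (subst nn_integral_add) (auto simp: nn_integral_cmult)
    also have "\<dots> \<le> ennreal (1 + \<kappa>) * 1 + ennreal (1 + 1 / \<kappa>) * ennreal (\<xi> * \<theta>\<^sup>2)"
      using ht(3) R unfolding r_def by (intro add_mono mult_left_mono) auto
    also have "\<dots> = ennreal (1 + \<kappa> + (1 + 1 / \<kappa>) * (\<xi> * \<theta>\<^sup>2))"
      using \<kappa> \<xi> by (simp add: ennreal_mult[symmetric] ennreal_plus[symmetric] del: ennreal_plus)
    finally have "(\<integral>z. (1 + 1/2 * \<theta> * s z)\<^sup>2 \<partial>?P) \<le> 1 + \<kappa> + (1 + 1 / \<kappa>) * (\<xi> * \<theta>\<^sup>2)"
      using \<kappa> \<xi> by (subst (asm) ennreal_le_iff) auto
    moreover have "(\<integral>z. (1 + 1/2 * \<theta> * s z)\<^sup>2 \<partial>?P) = 1 + \<theta> * m + \<theta>\<^sup>2 / 4 * (\<integral>z. (s z)\<^sup>2 \<partial>?P)"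
      unfolding ex using si s2 by (simp add: m_def P.prob_space)
    moreover have "0 \<le> \<theta>\<^sup>2 / 4 * (\<integral>z. (s z)\<^sup>2 \<partial>?P)" by simp
    ultimately show ?thesis by linarith
  qed
  have small: "\<bar>m\<bar> \<le> 3 * \<omega>" if \<omega>: "0 < \<omega>" "\<omega> < 1" for \<omega>
  proof -
    have "\<forall>\<^sub>F \<theta> in at 0. \<bar>\<theta>\<bar> < (1::real) \<and> \<theta> \<noteq> 0" by (rule eventually_at_0_abs_less) simp
    with qmd_remainder_small[OF qmd, of "\<omega>\<^sup>2"] \<omega>
    have ev: "\<forall>\<^sub>F \<theta> in at 0. (\<integral>\<^sup>+z. ennreal ((sqrt (h \<theta> z) - sqrt (h 0 z) - 1/2 * \<theta> * s z * sqrt (h 0 z))\<^sup>2) \<partial>lborel) \<le> ennreal (\<omega>\<^sup>2 * \<theta>\<^sup>2) \<and> \<bar>\<theta>\<bar> < 1 \<and> \<theta> \<noteq> 0"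
      by (auto elim: eventually_elim2)
    then obtain d where d: "0 < d" and dP: "\<And>\<theta>::real. \<theta> \<noteq> 0 \<Longrightarrow> \<bar>\<theta>\<bar> < d \<Longrightarrow>
        (\<integral>\<^sup>+z. ennreal ((sqrt (h \<theta> z) - sqrt (h 0 z) - 1/2 * \<theta> * s z * sqrt (h 0 z))\<^sup>2) \<partial>lborel) \<le> ennreal (\<omega>\<^sup>2 * \<theta>\<^sup>2) \<and> \<bar>\<theta>\<bar> < 1"
      unfolding eventually_at by (auto simp: dist_real_def)
    have one: "\<theta> * m \<le> 3 * \<omega> * \<bar>\<theta>\<bar>" if \<theta>: "\<theta> \<noteq> 0" "\<bar>\<theta>\<bar> < d" for \<theta>
    proof -
      \<comment> \<open>With \<kappa> equal to \<open>\<omega> * \<bar>\<theta>\<bar>\<close> and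
        remainder coefficient \<open>\<omega>\<^sup>2\<close>, each of the three resulting terms is
        at most \<open>\<omega> * \<bar>\<theta>\<bar>\<close>.\<close>
      have "\<theta> * m \<le> \<omega> * \<bar>\<theta>\<bar> + (1 + 1 / (\<omega> * \<bar>\<theta>\<bar>)) * (\<omega>\<^sup>2 * \<theta>\<^sup>2)"
        using dP[OF \<theta>] \<theta> \<omega> by (intro key) auto
      also have "(1 + 1 / (\<omega> * \<bar>\<theta>\<bar>)) * (\<omega>\<^sup>2 * \<theta>\<^sup>2) = \<omega>\<^sup>2 * \<theta>\<^sup>2 + \<omega> * \<bar>\<theta>\<bar>"
      proof -
        have "\<omega>\<^sup>2 * \<theta>\<^sup>2 = (\<omega> * \<bar>\<theta>\<bar>) * (\<omega> * \<bar>\<theta>\<bar>)" by (simp add: power2_eq_square mult_ac abs_mult_self_eq)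
        then show ?thesis using \<theta> \<omega> by (simp add: distrib_right)
      qed
      also have "\<omega>\<^sup>2 * \<theta>\<^sup>2 \<le> \<omega> * \<bar>\<theta>\<bar>"
      proof -
        have "\<omega> * \<bar>\<theta>\<bar> \<le> 1" using \<omega> dP[OF \<theta>] by (intro mult_le_one) auto
        then have "(\<omega> * \<bar>\<theta>\<bar>) * (\<omega> * \<bar>\<theta>\<bar>) \<le> (\<omega> * \<bar>\<theta>\<bar>) * 1" using \<omega> by (intro mult_left_mono) auto
        then show ?thesis by (simp add: power2_eq_square mult_ac)
      qed
      finally show ?thesis by simp
    qed
    have "(d/2) * m \<le> 3 * \<omega> * (d/2)" "(- (d/2)) * m \<le> 3 * \<omega> * (d/2)"
      using one[of "d/2"] one[of "- (d/2)"] d by auto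
    then have "(d/2) * m \<le> (d/2) * (3 * \<omega>)" "(d/2) * (- m) \<le> (d/2) * (3 * \<omega>)" by (auto simp: mult_ac)
    then have "m \<le> 3 * \<omega>" "- m \<le> 3 * \<omega>" using d by (auto simp only: mult_le_cancel_left_pos half_gt_zero)
    then show ?thesis by simp
  qed
  have "\<bar>m\<bar> \<le> 0"
  proof (rule field_le_epsilon)
    fix e :: real assume e: "0 < e"
    have "\<bar>m\<bar> \<le> 3 * min (e / 3) (1 / 2)" using e by (intro small) auto
    also have "\<dots> \<le> e" by (simp add: min_def)
    finally show "\<bar>m\<bar> \<le> 0 + e" by simp
  qed
  then show ?thesis by (simp add: m_def)
qed

section \<open>Hellinger distance from the family to bounded tilts\<close>

text \<open>Truncate and recentre. As \<open>s\<close> has mean zero, the mean of the truncation is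
  minus the mean of the truncation error, so recentring at most doubles the root mean square
  error.\<close>

lemma bounded_mean_zero_approx:
  assumes P: "prob_space P" and s [measurable]: "s \<in> borel_measurable P" and s2: "integrable P (\<lambda>z. (s z)\<^sup>2)"
    and s0: "(\<integral>z. s z \<partial>P) = 0" and e: "(0::real) < e"
  obtains s' B where "s' \<in> borel_measurable P" "\<And>z. \<bar>s' z\<bar> \<le> B" "(\<integral>z. s' z \<partial>P) = 0"
    "integrable P (\<lambda>z. (s z - s' z)\<^sup>2)" "(\<integral>z. (s z - s' z)\<^sup>2 \<partial>P) \<le> e"
proof -
  interpret P: prob_space P by fact
  have si: "integrable P s" by (rule P.square_integrable_imp_integrable[OF s s2])
  define tr where "tr n z = (if \<bar>s z\<bar> \<le> real n then s z else 0)" for n z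
  have tm [measurable]: "tr n \<in> borel_measurable P" for n unfolding tr_def[abs_def] by measurable
  have ptle: "(s z - tr n z)\<^sup>2 \<le> (s z)\<^sup>2" for n z by (simp add: tr_def)
  have di: "integrable P (\<lambda>z. (s z - tr n z)\<^sup>2)" for n
    by (rule Bochner_Integration.integrable_bound[OF s2]) (use ptle in auto)
  have "(\<lambda>n. \<integral>z. (s z - tr n z)\<^sup>2 \<partial>P) \<longlonglongrightarrow> (\<integral>z. 0 \<partial>P)"
  proof (rule integral_dominated_convergence[where w="\<lambda>z. (s z)\<^sup>2"])
    show "AE z in P. (\<lambda>n. (s z - tr n z)\<^sup>2) \<longlonglongrightarrow> 0"
    proof (rule AE_I2)
      fix z
      obtain n0 :: nat where "\<bar>s z\<bar> \<le> real n0" using real_arch_simple by blast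
      then have "\<forall>n\<ge>n0. (s z - tr n z)\<^sup>2 = 0" by (auto simp: tr_def)
      then have "\<forall>\<^sub>F n in sequentially. (s z - tr n z)\<^sup>2 = 0" by (auto simp: eventually_sequentially)
      then show "(\<lambda>n. (s z - tr n z)\<^sup>2) \<longlonglongrightarrow> 0" by (rule tendsto_eventually)
    qed
  qed (use s2 ptle in auto)
  \<comment> \<open>The target \<open>e / 4\<close> is counted four times: twice for the truncation
    error and twice for the squared mean removed.\<close>
  then have "\<forall>\<^sub>F n in sequentially. (\<integral>z. (s z - tr n z)\<^sup>2 \<partial>P) < e / 4"
    using e by (intro order_tendstoD(2)) auto
  then obtain n where n: "(\<integral>z. (s z - tr n z)\<^sup>2 \<partial>P) < e / 4" by (auto simp: eventually_sequentially)
  have tb: "\<bar>tr n z\<bar> \<le> real n" for z by (simp add: tr_def)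
  have ti: "integrable P (tr n)" by (rule P.integrable_const_bound[where B="real n"]) (use tb in auto)
  define c where "c = (\<integral>z. tr n z \<partial>P)"
  define s' where "s' z = tr n z - c" for z
  have c2: "c\<^sup>2 \<le> (\<integral>z. (s z - tr n z)\<^sup>2 \<partial>P)"
  proof -
    define u where "u z = s z - tr n z" for z
    have ui: "integrable P u" unfolding u_def[abs_def] using si ti by simp
    have u2: "integrable P (\<lambda>z. (u z)\<^sup>2)" unfolding u_def by (rule di)
    have uc: "(\<integral>z. u z \<partial>P) = - c" using si ti s0 by (simp add: u_def c_def)
    have "0 \<le> (\<integral>z. (u z + c)\<^sup>2 \<partial>P)" by simp
    also have "(\<integral>z. (u z + c)\<^sup>2 \<partial>P) = (\<integral>z. (u z)\<^sup>2 + (2 * c) * u z + c\<^sup>2 \<partial>P)"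
      by (intro Bochner_Integration.integral_cong refl) (simp add: power2_sum)
    also have "\<dots> = (\<integral>z. (u z)\<^sup>2 \<partial>P) + 2 * c * (- c) + c\<^sup>2"
      using ui u2 uc by (simp add: P.prob_space)
    finally show ?thesis unfolding u_def by (simp add: power2_eq_square)
  qed
  have le: "(s z - s' z)\<^sup>2 \<le> 2 * (s z - tr n z)\<^sup>2 + 2 * c\<^sup>2" for z
  proof -
    define u where "u = s z - tr n z"
    have e: "s z - s' z = u + c" by (simp add: s'_def u_def)
    have "(u + c)\<^sup>2 \<le> 2 * u\<^sup>2 + 2 * c\<^sup>2"
      using zero_le_power2[of "u - c"] by (simp add: power2_eq_square algebra_simps)
    then show ?thesis unfolding e u_def[symmetric] .
  qed
  have bi: "integrable P (\<lambda>z. 2 * (s z - tr n z)\<^sup>2 + 2 * c\<^sup>2)" using di[of n] by simp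
  have s'm [measurable]: "s' \<in> borel_measurable P" unfolding s'_def[abs_def] by measurable
  have ii: "integrable P (\<lambda>z. (s z - s' z)\<^sup>2)"
    by (rule Bochner_Integration.integrable_bound[OF bi]) (use le in auto)
  show ?thesis
  proof (rule that[of s' "real n + \<bar>c\<bar>"])
    show "\<bar>s' z\<bar> \<le> real n + \<bar>c\<bar>" for z
      using tb[of z] by (auto simp: s'_def intro: order_trans[OF abs_triangle_ineq4])
    show "(\<integral>z. s' z \<partial>P) = 0" using ti by (simp add: s'_def c_def P.prob_space)
    have "(\<integral>z. (s z - s' z)\<^sup>2 \<partial>P) \<le> (\<integral>z. 2 * (s z - tr n z)\<^sup>2 + 2 * c\<^sup>2 \<partial>P)"
      using ii bi le by (rule integral_mono)
    also have "\<dots> = 2 * (\<integral>z. (s z - tr n z)\<^sup>2 \<partial>P) + 2 * c\<^sup>2" using di[of n] by (simp add: P.prob_space)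
    also have "\<dots> \<le> e" using n c2 by linarith
    finally show "(\<integral>z. (s z - s' z)\<^sup>2 \<partial>P) \<le> e" .
  qed (use ii s'm in auto)
qed

text \<open>The difference times its conjugate is \<open>x\<^sup>2 / 4\<close>, and the conjugate is
  at least 1/2.\<close>

lemma sqrt_linearization:
  assumes "\<bar>x\<bar> \<le> (1::real)"
  shows "(1 + x / 2 - sqrt (1 + x))\<^sup>2 \<le> x ^ 4 / 4"
proof -
  define q where "q = sqrt (1 + x)"
  have q: "0 \<le> q" "q\<^sup>2 = 1 + x" using assms by (auto simp: q_def)
  have pos: "1 / 2 \<le> 1 + x / 2 + q" using assms q by (simp add: abs_le_iff)
  have prod: "(1 + x / 2 - q) * (1 + x / 2 + q) = x\<^sup>2 / 4"
    using q by (simp add: power2_eq_square algebra_simps)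
  have ne: "1 + x / 2 + q \<noteq> 0" using pos by linarith
  have e: "1 + x / 2 - q = x\<^sup>2 / 4 / (1 + x / 2 + q)" using prod unfolding nonzero_eq_divide_eq[OF ne] .
  have n: "0 \<le> 1 + x / 2 - q" unfolding e using pos by simp
  have "1 + x / 2 - q \<le> x\<^sup>2 / 4 / (1 / 2)" unfolding e using pos by (intro divide_left_mono) auto
  then have "(1 + x / 2 - q)\<^sup>2 \<le> (x\<^sup>2 / 2)\<^sup>2" using n by (intro power_mono) auto
  then show ?thesis by (simp add: q_def power_divide)
qed

text \<open>Three sources of error: the differentiability remainder, the replacement of
  \<open>s\<close> by \<open>s'\<close>, and the linearization of the square root of
  \<open>1 + \<theta> * s'\<close>. The first and third are of smaller order than \<theta> and go
  into \<xi>; the second is of the same order as \<theta> but with the small coefficient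
  \<open>D\<close>.\<close>

lemma qmd_hellinger_tilt:
  assumes dens: "\<And>\<eta>. \<bar>\<eta>\<bar> < 1 \<Longrightarrow> prob_density (h \<eta>)" and s [measurable]: "s \<in> borel_measurable borel"
    and qmd: "qmd_at_0 h s"
    and s' [measurable]: "s' \<in> borel_measurable borel" and sb: "\<And>z. \<bar>s' z\<bar> \<le> B"
    and D: "integrable (density_law (h 0)) (\<lambda>z. (s z - s' z)\<^sup>2)" "(\<integral>z. (s z - s' z)\<^sup>2 \<partial>density_law (h 0)) \<le> D"
    and \<xi>: "0 < \<xi>"
  shows "\<forall>\<^sub>F \<theta> in at 0. (\<integral>\<^sup>+z. ennreal ((sqrt (h \<theta> z) - sqrt (h 0 z * (1 + \<theta> * s' z)))\<^sup>2) \<partial>lborel) \<le> ennreal (\<theta>\<^sup>2 * (D + 4 * \<xi>))"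
proof -
  have d0: "prob_density (h 0)" using dens[of 0] by simp
  note h0 = prob_densityD[OF d0]
  note [measurable] = h0(1)
  have B0: "0 \<le> B" using sb[of undefined] by linarith
  have D0: "0 \<le> D" by (rule order_trans[OF _ D(2)]) simp
  have ev1: "\<forall>\<^sub>F \<theta> in at 0. \<bar>\<theta>\<bar> < min 1 (1 / (B + 1)) \<and> \<theta> \<noteq> (0::real)"
    using B0 by (intro eventually_at_0_abs_less) auto
  \<comment> \<open>This radius gives \<open>\<theta>\<^sup>2 * B ^ 4 \<le> \<xi>\<close>, which
    tames the fourth power in \<open>sqrt_linearization\<close>.\<close>
  have ev2: "\<forall>\<^sub>F \<theta> in at 0. \<bar>\<theta>\<bar> < sqrt \<xi> / (B\<^sup>2 + 1) \<and> \<theta> \<noteq> (0::real)"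
    using \<xi> by (intro eventually_at_0_abs_less divide_pos_pos) (auto intro: add_nonneg_pos)
  show ?thesis using ev1 ev2 qmd_remainder_small[OF qmd \<xi>]
  proof eventually_elim
    case (elim \<theta>)
    have \<theta>1: "\<bar>\<theta>\<bar> < 1" using elim by simp
    have \<theta>B: "\<bar>\<theta>\<bar> * B \<le> 1"
    proof -
      have "\<bar>\<theta>\<bar> * B \<le> (1 / (B + 1)) * (B + 1)" using elim B0 by (intro mult_mono) auto
      then show ?thesis using B0 by simp
    qed
    have \<theta>2: "\<theta>\<^sup>2 * B ^ 4 \<le> \<xi>"
    proof -
      have "\<bar>\<theta>\<bar> * B\<^sup>2 \<le> (sqrt \<xi> / (B\<^sup>2 + 1)) * (B\<^sup>2 + 1)" using elim by (intro mult_mono) auto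
      also have "\<dots> = sqrt \<xi>" by (simp add: add_nonneg_eq_0_iff)
      finally have "(\<bar>\<theta>\<bar> * B\<^sup>2)\<^sup>2 \<le> (sqrt \<xi>)\<^sup>2" by (intro power_mono) auto
      then show ?thesis using \<xi> by (simp add: power_mult_distrib power_mult[symmetric])
    qed
    note ht = prob_densityD[OF dens[OF \<theta>1]]
    note [measurable] = ht(1)
    define r1 where "r1 z = sqrt (h \<theta> z) - sqrt (h 0 z) - 1/2 * \<theta> * s z * sqrt (h 0 z)" for z
    define r2 where "r2 z = 1/2 * \<theta> * (s z - s' z) * sqrt (h 0 z)" for z
    define r3 where "r3 z = sqrt (h 0 z) * (1 + \<theta> * s' z / 2 - sqrt (1 + \<theta> * s' z))" for z
    have rm: "r1 \<in> borel_measurable lborel" "r2 \<in> borel_measurable lborel" "r3 \<in> borel_measurable lborel"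
      unfolding r1_def[abs_def] r2_def[abs_def] r3_def[abs_def] by measurable
    have sum: "sqrt (h \<theta> z) - sqrt (h 0 z * (1 + \<theta> * s' z)) = r1 z + r2 z + r3 z" for z
    proof -
      have e: "sqrt (h 0 z * (1 + \<theta> * s' z)) = sqrt (h 0 z) * sqrt (1 + \<theta> * s' z)" by (rule real_sqrt_mult)
      show ?thesis unfolding e r1_def r2_def r3_def by (simp add: algebra_simps diff_divide_distrib add_divide_distrib)
    qed
    have b2: "(\<integral>\<^sup>+z. ennreal ((r2 z)\<^sup>2) \<partial>lborel) \<le> ennreal (\<theta>\<^sup>2 / 4 * D)"
    proof -
      have "(\<integral>\<^sup>+z. ennreal ((r2 z)\<^sup>2) \<partial>lborel) = (\<integral>\<^sup>+z. ennreal (h 0 z * (1/2 * \<theta> * (s z - s' z))\<^sup>2) \<partial>lborel)"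
        by (intro nn_integral_cong) (simp only: r2_def power_mult_distrib real_sqrt_pow2[OF h0(2)] mult_ac)
      also have "\<dots> = (\<integral>\<^sup>+z. ennreal ((1/2 * \<theta> * (s z - s' z))\<^sup>2) \<partial>density_law (h 0))"
        by (rule nn_integral_density_law[OF d0]) measurable
      also have "\<dots> = (\<integral>\<^sup>+z. ennreal (\<theta>\<^sup>2 / 4 * (s z - s' z)\<^sup>2) \<partial>density_law (h 0))"
        by (simp add: power_mult_distrib power_divide)
      also have "\<dots> = ennreal (\<integral>z. \<theta>\<^sup>2 / 4 * (s z - s' z)\<^sup>2 \<partial>density_law (h 0))"
        using D(1) by (intro nn_integral_eq_integral integrable_mult_right) auto
      also have "\<dots> \<le> ennreal (\<theta>\<^sup>2 / 4 * D)"
        unfolding integral_mult_right_zero using D(2) by (intro ennreal_leI mult_left_mono) auto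
      finally show ?thesis .
    qed
    have b3: "(\<integral>\<^sup>+z. ennreal ((r3 z)\<^sup>2) \<partial>lborel) \<le> ennreal (\<theta>\<^sup>2 * \<xi> / 4)"
    proof -
      have "(\<integral>\<^sup>+z. ennreal ((r3 z)\<^sup>2) \<partial>lborel) \<le> (\<integral>\<^sup>+z. ennreal (\<theta>\<^sup>2 * \<xi> / 4) * ennreal (h 0 z) \<partial>lborel)"
      proof (rule nn_integral_mono)
        fix z
        have x: "\<bar>\<theta> * s' z\<bar> \<le> \<bar>\<theta>\<bar> * B" unfolding abs_mult by (intro mult_left_mono sb) auto
        have "(1 + \<theta> * s' z / 2 - sqrt (1 + \<theta> * s' z))\<^sup>2 \<le> (\<theta> * s' z) ^ 4 / 4"
          by (rule sqrt_linearization) (use x \<theta>B in linarith)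
        also have "(\<theta> * s' z) ^ 4 \<le> (\<bar>\<theta>\<bar> * B) ^ 4"
          using power_mono[OF x, of 4] by (simp add: power_even_abs)
        also have "(\<bar>\<theta>\<bar> * B) ^ 4 = \<theta>\<^sup>2 * (\<theta>\<^sup>2 * B ^ 4)"
          by (simp add: power_mult_distrib power_even_abs power_add[symmetric] mult.assoc[symmetric])
        also have "\<dots> \<le> \<theta>\<^sup>2 * \<xi>" using \<theta>2 by (intro mult_left_mono) auto
        finally have "(1 + \<theta> * s' z / 2 - sqrt (1 + \<theta> * s' z))\<^sup>2 \<le> \<theta>\<^sup>2 * \<xi> / 4" by simp
        then have "h 0 z * (1 + \<theta> * s' z / 2 - sqrt (1 + \<theta> * s' z))\<^sup>2 \<le> h 0 z * (\<theta>\<^sup>2 * \<xi> / 4)"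
          using h0(2)[of z] by (intro mult_left_mono) auto
        moreover have "(r3 z)\<^sup>2 = h 0 z * (1 + \<theta> * s' z / 2 - sqrt (1 + \<theta> * s' z))\<^sup>2"
          using h0(2)[of z] by (simp add: r3_def power_mult_distrib)
        ultimately have "(r3 z)\<^sup>2 \<le> \<theta>\<^sup>2 * \<xi> / 4 * h 0 z" by (simp add: mult.commute)
        then show "ennreal ((r3 z)\<^sup>2) \<le> ennreal (\<theta>\<^sup>2 * \<xi> / 4) * ennreal (h 0 z)"
          using \<xi> h0(2)[of z] by (simp add: ennreal_mult[symmetric] ennreal_leI)
      qed
      also have "\<dots> = ennreal (\<theta>\<^sup>2 * \<xi> / 4)" using h0(3) by (simp add: nn_integral_cmult)
      finally show ?thesis .
    qed
    have "(\<integral>\<^sup>+z. ennreal ((r1 z + r2 z + r3 z)\<^sup>2) \<partial>lborel) \<le> ennreal (3 * (\<xi> * \<theta>\<^sup>2 + \<theta>\<^sup>2 / 4 * D + \<theta>\<^sup>2 * \<xi> / 4))"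
      using elim(3) b2 b3 rm D0 \<xi> by (intro nn_integral_square_sum3) (auto simp: r1_def)
    also have "\<dots> \<le> ennreal (\<theta>\<^sup>2 * (D + 4 * \<xi>))"
    proof (rule ennreal_leI)
      have "3 * (\<xi> * \<theta>\<^sup>2 + \<theta>\<^sup>2 / 4 * D + \<theta>\<^sup>2 * \<xi> / 4) = \<theta>\<^sup>2 * (3 / 4 * D + 15 / 4 * \<xi>)" by (simp add: algebra_simps)
      also have "\<dots> \<le> \<theta>\<^sup>2 * (D + 4 * \<xi>)" using D0 \<xi> by (intro mult_left_mono) auto
      finally show "3 * (\<xi> * \<theta>\<^sup>2 + \<theta>\<^sup>2 / 4 * D + \<theta>\<^sup>2 * \<xi> / 4) \<le> \<theta>\<^sup>2 * (D + 4 * \<xi>)" .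
    qed
    finally show ?case unfolding sum .
  qed
qed

section \<open>Asymptotic power\<close>

context indep_model
begin

lemma T_event_measurable: "0 < n \<Longrightarrow> {w \<in> space (W n). t \<le> real n * T_BKR n w} \<in> sets (W n)"
proof -
  assume n: "0 < n"
  have [measurable]: "T_BKR n \<in> borel_measurable (W n)" by (rule T_measurable[OF n])
  show ?thesis by measurable
qed

text \<open>The domination of the quadratic form by the statistic fails only on an event that is
  null in the limit under independence, and contiguity keeps it so under the tilt. The three margins
  \<eta> in the threshold pay for the distance of \<open>t n\<close> from \<open>t0\<close>, for
  \<open>T_lower\<close>, and for the Gaussian limit.\<close>

lemma tilt_T_lower:
  assumes I: "finite I" "\<And>p. p \<in> I \<Longrightarrow> 0 < fst p \<and> 0 < snd p"
    and s: "s \<in> borel_measurable (\<mu> \<Otimes>\<^sub>M \<nu>)" and sb: "\<And>z. \<bar>s z\<bar> \<le> B" and s0: "(\<integral>z. s z \<partial>(\<mu> \<Otimes>\<^sub>M \<nu>)) = 0"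
    and m: "filterlim m at_top sequentially" and \<theta>B: "\<And>n. \<bar>\<theta> n\<bar> * B \<le> 1"
    and L: "\<And>n. real (m n) * (\<theta> n)\<^sup>2 \<le> L"
    and \<delta>: "(\<lambda>n. sqrt (real (m n)) * \<theta> n) \<longlonglongrightarrow> \<delta>" and t: "t \<longlonglongrightarrow> t0" and \<eta>: "0 < \<eta>"
  defines "a \<equiv> \<lambda>p. \<delta> * (\<integral>z. s z * phi p z \<partial>(\<mu> \<Otimes>\<^sub>M \<nu>))"
  shows "\<forall>\<^sub>F n in sequentially. measure (gauss I) {z \<in> space (gauss I). t0 + 3 * \<eta> \<le> qform I lam (\<lambda>i. z i + a i)} - 2 * \<eta>
      \<le> measure (tilt s (m n) (\<theta> n)) {w \<in> space (W (m n)). t n \<le> real (m n) * T_BKR (m n) w}"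
proof -
  \<comment> \<open>Makes the first contiguity term \<open>\<eta> / 2\<close>; a null probability
    below \<open>\<kappa> * \<eta>\<close> makes the second one \<open>\<eta> / 2\<close>.\<close>
  define \<kappa> where "\<kappa> = \<eta> / exp (L * B\<^sup>2)"
  have \<kappa>: "0 < \<kappa>" using \<eta> by (simp add: \<kappa>_def)
  have lim0: "(\<lambda>n. measure (W (m n)) {w \<in> space (W (m n)). real (m n) * T_BKR (m n) w < qform I lam (Sstat (m n) w) - \<eta>}) \<longlonglongrightarrow> 0"
    using filterlim_compose[OF T_lower[OF I \<eta>] m] .
  have "\<forall>\<^sub>F n in sequentially. measure (W (m n)) {w \<in> space (W (m n)). real (m n) * T_BKR (m n) w < qform I lam (Sstat (m n) w) - \<eta>} < \<kappa> * \<eta>"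
    using order_tendstoD(2)[OF lim0] \<kappa> \<eta> by simp
  moreover have "\<forall>\<^sub>F n in sequentially. measure (gauss I) {z \<in> space (gauss I). (t0 + 2 * \<eta>) + \<eta> \<le> qform I lam (\<lambda>i. z i + a i)} - \<eta>
      \<le> measure (tilt s (m n) (\<theta> n)) {w \<in> space (tilt s (m n) (\<theta> n)). t0 + 2 * \<eta> \<le> qform I lam (Sstat (m n) w)}"
    unfolding a_def by (rule tilt_qform_limit(1)[OF I s sb s0 m \<theta>B \<delta> \<eta>])
  moreover have "\<forall>\<^sub>F n in sequentially. t n < t0 + \<eta>" using order_tendstoD(2)[OF t] \<eta> by simp
  moreover have "\<forall>\<^sub>F n in sequentially. 0 < m n"
    using eventually_compose_filterlim[OF eventually_gt_at_top m] .
  ultimately show ?thesis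
  proof eventually_elim
    case (elim n)
    interpret Q: prob_space "tilt s (m n) (\<theta> n)"
      unfolding tilt_def by (rule prob_space_PiM) (rule tilt_density_facts(6)[OF s sb s0 \<theta>B])
    let ?T = "{w \<in> space (W (m n)). t n \<le> real (m n) * T_BKR (m n) w}"
    let ?S = "{w \<in> space (W (m n)). t0 + 2 * \<eta> \<le> qform I lam (Sstat (m n) w)}"
    let ?N = "{w \<in> space (W (m n)). real (m n) * T_BKR (m n) w < qform I lam (Sstat (m n) w) - \<eta>}"
    have [measurable]: "T_BKR (m n) \<in> borel_measurable (W (m n))" by (rule T_measurable[OF elim(4)])
    note [measurable] = qform_Sstat_measurable[of I "m n"]
    have sets: "?T \<in> sets (W (m n))" "?S \<in> sets (W (m n))" "?N \<in> sets (W (m n))" by measurable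
    have "measure (tilt s (m n) (\<theta> n)) ?S \<le> measure (tilt s (m n) (\<theta> n)) (?T \<union> ?N)"
      using elim(3) sets by (intro Q.finite_measure_mono) (auto simp: sets_tilt)
    also have "\<dots> \<le> measure (tilt s (m n) (\<theta> n)) ?T + measure (tilt s (m n) (\<theta> n)) ?N"
      using sets by (intro measure_Un_le) (simp_all add: sets_tilt)
    also have "measure (tilt s (m n) (\<theta> n)) ?N \<le> \<kappa> / 2 * exp (L * B\<^sup>2) + measure (W (m n)) ?N / (2 * \<kappa>)"
      by (rule tilt_contiguity[OF s sb s0 \<theta>B L \<kappa> sets(3)])
    also have "\<kappa> / 2 * exp (L * B\<^sup>2) = \<eta> / 2" by (simp add: \<kappa>_def)
    also have "measure (W (m n)) ?N / (2 * \<kappa>) \<le> \<kappa> * \<eta> / (2 * \<kappa>)"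
      using elim(1) \<kappa> by (intro divide_right_mono) auto
    also have "\<kappa> * \<eta> / (2 * \<kappa>) = \<eta> / 2" using \<kappa> by simp
    finally have "measure (tilt s (m n) (\<theta> n)) ?S \<le> measure (tilt s (m n) (\<theta> n)) ?T + (\<eta> / 2 + \<eta> / 2)" by simp
    moreover have "measure (gauss I) {z \<in> space (gauss I). t0 + 3 * \<eta> \<le> qform I lam (\<lambda>i. z i + a i)} - \<eta> \<le> measure (tilt s (m n) (\<theta> n)) ?S"
      using elim(2) by (simp add: space_tilt algebra_simps)
    ultimately show ?case by simp
  qed
qed

text \<open>Brackets \<alpha> between Gaussian tails at thresholds \<open>7 * \<eta>\<close> apart,
  without any limit law for the statistic. The extra term in the second bound is the weight left
  outside \<open>I\<close>, from \<open>T_upper\<close>.\<close>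

lemma null_T_bounds:
  assumes I: "finite I" "\<And>p. p \<in> I \<Longrightarrow> 0 < fst p \<and> 0 < snd p"
    and m: "filterlim m at_top sequentially" and t: "t \<longlonglongrightarrow> t0" and \<eta>: "0 < \<eta>"
    and lim: "(\<lambda>n. measure (W (m n)) {w \<in> space (W (m n)). t n \<le> real (m n) * T_BKR (m n) w}) \<longlonglongrightarrow> \<alpha>"
  shows "measure (gauss I) {z \<in> space (gauss I). t0 + 3 * \<eta> \<le> qform I lam z} - 2 * \<eta> \<le> \<alpha>"
    and "\<alpha> \<le> measure (gauss I) {z \<in> space (gauss I). t0 - 4 * \<eta> \<le> qform I lam z} + (1 / 36 - (\<Sum>p\<in>I. lam p)) / \<eta> + 2 * \<eta>"
proof -
  have "\<forall>\<^sub>F n in sequentially. measure (gauss I) {z \<in> space (gauss I). t0 + 3 * \<eta> \<le> qform I lam (\<lambda>i. z i + 0 * (\<integral>z. 0 * phi i z \<partial>(\<mu> \<Otimes>\<^sub>M \<nu>)))} - 2 * \<eta>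
      \<le> measure (tilt (\<lambda>_. 0) (m n) 0) {w \<in> space (W (m n)). t n \<le> real (m n) * T_BKR (m n) w}"
    by (rule tilt_T_lower[where B = 0 and L = 0, OF I _ _ _ m _ _ _ t \<eta>]) simp_all
  then have "\<forall>\<^sub>F n in sequentially. measure (gauss I) {z \<in> space (gauss I). t0 + 3 * \<eta> \<le> qform I lam z} - 2 * \<eta>
      \<le> measure (W (m n)) {w \<in> space (W (m n)). t n \<le> real (m n) * T_BKR (m n) w}"
    by (simp add: tilt_0)
  then show "measure (gauss I) {z \<in> space (gauss I). t0 + 3 * \<eta> \<le> qform I lam z} - 2 * \<eta> \<le> \<alpha>"
    by (rule tendsto_lowerbound[OF lim]) simp
  have "\<forall>\<^sub>F n in sequentially. measure (tilt (\<lambda>_. 0) (m n) 0) {w \<in> space (tilt (\<lambda>_. 0) (m n) 0). t0 - 3 * \<eta> \<le> qform I lam (Sstat (m n) w)}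
      \<le> measure (gauss I) {z \<in> space (gauss I). (t0 - 3 * \<eta>) - \<eta> \<le> qform I lam (\<lambda>i. z i + 0 * (\<integral>z. 0 * phi i z \<partial>(\<mu> \<Otimes>\<^sub>M \<nu>)))} + \<eta>"
    by (rule tilt_qform_limit(2)[where B = 0, OF I _ _ _ m _ _ \<eta>]) simp_all
  then have "\<forall>\<^sub>F n in sequentially. measure (W (m n)) {w \<in> space (W (m n)). t0 - 3 * \<eta> \<le> qform I lam (Sstat (m n) w)}
      \<le> measure (gauss I) {z \<in> space (gauss I). t0 - 4 * \<eta> \<le> qform I lam z} + \<eta>"
    by (simp add: tilt_0)
  moreover have "\<forall>\<^sub>F n in sequentially. measure (W (m n)) {w \<in> space (W (m n)). qform I lam (Sstat (m n) w) + 2 * \<eta> \<le> real (m n) * T_BKR (m n) w}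
      \<le> (1 / 36 - (\<Sum>p\<in>I. lam p)) / \<eta> + \<eta>"
    using eventually_compose_filterlim[OF T_upper[OF I \<eta> \<eta>] m] .
  moreover have "\<forall>\<^sub>F n in sequentially. t0 - \<eta> < t n" using order_tendstoD(1)[OF t] \<eta> by simp
  moreover have "\<forall>\<^sub>F n in sequentially. 0 < m n"
    using eventually_compose_filterlim[OF eventually_gt_at_top m] .
  ultimately have "\<forall>\<^sub>F n in sequentially. measure (W (m n)) {w \<in> space (W (m n)). t n \<le> real (m n) * T_BKR (m n) w}
      \<le> measure (gauss I) {z \<in> space (gauss I). t0 - 4 * \<eta> \<le> qform I lam z} + (1 / 36 - (\<Sum>p\<in>I. lam p)) / \<eta> + 2 * \<eta>"
  proof eventually_elim
    case (elim n)
    interpret Q: prob_space "W (m n)" by (rule prob_W)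
    let ?T = "{w \<in> space (W (m n)). t n \<le> real (m n) * T_BKR (m n) w}"
    let ?S = "{w \<in> space (W (m n)). t0 - 3 * \<eta> \<le> qform I lam (Sstat (m n) w)}"
    let ?N = "{w \<in> space (W (m n)). qform I lam (Sstat (m n) w) + 2 * \<eta> \<le> real (m n) * T_BKR (m n) w}"
    have [measurable]: "T_BKR (m n) \<in> borel_measurable (W (m n))" by (rule T_measurable[OF elim(4)])
    note [measurable] = qform_Sstat_measurable[of I "m n"]
    have sets: "?T \<in> sets (W (m n))" "?S \<in> sets (W (m n))" "?N \<in> sets (W (m n))" by measurable
    have "measure (W (m n)) ?T \<le> measure (W (m n)) (?S \<union> ?N)"
      using elim(3) sets by (intro Q.finite_measure_mono) auto
    also have "\<dots> \<le> measure (W (m n)) ?S + measure (W (m n)) ?N"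
      using sets by (intro measure_Un_le) simp_all
    finally show ?case using elim(1,2) by linarith
  qed
  then show "\<alpha> \<le> measure (gauss I) {z \<in> space (gauss I). t0 - 4 * \<eta> \<le> qform I lam z} + (1 / 36 - (\<Sum>p\<in>I. lam p)) / \<eta> + 2 * \<eta>"
    by (rule tendsto_upperbound[OF lim]) simp
qed

text \<open>The gap comes from a single coefficient \<open>p0\<close>, whose weight, size bound
  \<open>c0\<close> and drift bound \<epsilon> fix \<open>g\<close> before \<eta> and the index set
  are chosen. It is uniform over all bounded scores with that coefficient bound, because the score
  approximating the true one is chosen only after \<open>g\<close> is known.\<close>

lemma local_power_gap:
  fixes \<alpha> c0 \<epsilon> T :: real
  assumes \<alpha>: "\<alpha> < 1" and c0: "0 < c0" and \<epsilon>: "0 < \<epsilon>" and p0: "0 < fst p0" "0 < snd p0"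
  obtains g where "0 < g"
    "\<And>s B m \<theta> L \<delta> t t0. s \<in> borel_measurable (\<mu> \<Otimes>\<^sub>M \<nu>) \<Longrightarrow> (\<And>z. \<bar>s z\<bar> \<le> B) \<Longrightarrow> (\<integral>z. s z \<partial>(\<mu> \<Otimes>\<^sub>M \<nu>)) = 0 \<Longrightarrow>
      c0 \<le> \<bar>\<integral>z. s z * phi p0 z \<partial>(\<mu> \<Otimes>\<^sub>M \<nu>)\<bar> \<Longrightarrow> filterlim m at_top sequentially \<Longrightarrow> (\<And>n. \<bar>\<theta> n\<bar> * B \<le> 1) \<Longrightarrow>
      (\<And>n. real (m n) * (\<theta> n)\<^sup>2 \<le> L) \<Longrightarrow> (\<lambda>n. sqrt (real (m n)) * \<theta> n) \<longlonglongrightarrow> \<delta> \<Longrightarrow> \<epsilon> \<le> \<bar>\<delta>\<bar> \<Longrightarrow> t \<longlonglongrightarrow> t0 \<Longrightarrow> t0 \<le> T \<Longrightarrow>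
      (\<lambda>n. measure (W (m n)) {w \<in> space (W (m n)). t n \<le> real (m n) * T_BKR (m n) w}) \<longlonglongrightarrow> \<alpha> \<Longrightarrow>
      \<forall>\<^sub>F n in sequentially. \<alpha> + g \<le> measure (tilt s (m n) (\<theta> n)) {w \<in> space (W (m n)). t n \<le> real (m n) * T_BKR (m n) w}"
proof -
  define c where "c = lam p0"
  have c: "0 < c" using p0 by (simp add: c_def lam_pos)
  have b: "0 < (1 - \<alpha>) / 2" using \<alpha> by simp
  obtain g \<rho> :: real where g: "0 < g" "0 < \<rho>" and
    gap: "\<And>(I :: (nat \<times> nat) set) l a t i0. finite I \<Longrightarrow> (\<And>i. i \<in> I \<Longrightarrow> 0 < l i) \<Longrightarrow> i0 \<in> I \<Longrightarrow> l i0 = c \<Longrightarrow> \<epsilon> * c0 \<le> \<bar>a i0\<bar> \<Longrightarrow> t \<le> T + 1 \<Longrightarrow>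
      (1 - \<alpha>) / 2 \<le> measure (gauss I) {z \<in> space (gauss I). qform I l z < t + \<rho>} \<Longrightarrow>
      measure (gauss I) {z \<in> space (gauss I). t \<le> qform I l z} + g \<le>
      measure (gauss I) {z \<in> space (gauss I). t \<le> qform I l (\<lambda>i. z i + a i)}"
    by (fact gauss_gap[where 'i = "nat \<times> nat" and T = "T + 1", OF c mult_pos_pos[OF \<epsilon> c0] b])
  \<comment> \<open>In order: keeps \<open>t0 + 3 * \<eta>\<close> below \<open>T + 1\<close>; keeps
    the mass below the threshold at least \<open>(1 - \<alpha>) / 2\<close>; limits the four
    additive errors \<eta> to \<open>g / 4\<close>; makes anticoncentration over width
    \<open>7 * \<eta>\<close> cost at most \<open>g / 8\<close>.\<close>
  define \<eta> where "\<eta> = Min {1 / 3, (1 - \<alpha>) / 4, g / 16, c * (g / 16)\<^sup>2 / 7}"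
  have \<eta>: "0 < \<eta>" "\<eta> \<le> 1 / 3" "\<eta> \<le> (1 - \<alpha>) / 4" "\<eta> \<le> g / 16" "\<eta> \<le> c * (g / 16)\<^sup>2 / 7"
  proof -
    show "0 < \<eta>" using g \<alpha> c by (simp add: \<eta>_def)
  qed (unfold \<eta>_def, (rule Min_le; simp)+)
  have anti: "2 * sqrt (7 * \<eta> / c) \<le> g / 8"
  proof -
    have "7 * \<eta> / c \<le> (g / 16)\<^sup>2" using \<eta>(5) c by (simp add: field_simps)
    then have "sqrt (7 * \<eta> / c) \<le> g / 16" using g by (intro real_le_lsqrt) auto
    then show ?thesis by simp
  qed
  \<comment> \<open>The weight left out is divided by \<eta> in \<open>T_upper\<close>, hence the
    level \<open>\<eta> * (g / 8)\<close>. The losses then are \<open>g / 8\<close> here,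
    \<open>g / 8\<close> for anticoncentration and \<open>g / 4\<close> for \<eta>, leaving half of
    the gap.\<close>
  have "\<forall>\<^sub>F K in sequentially. 1 / 36 - \<eta> * (g / 8) < (\<Sum>p\<in>{1..K} \<times> {1..K}. lam p)"
    using order_tendstoD(1)[OF sum_lam_tendsto] \<eta>(1) g by simp
  moreover have "\<forall>\<^sub>F K in sequentially. fst p0 \<le> K \<and> snd p0 \<le> K"
    using eventually_ge_at_top[of "fst p0"] eventually_ge_at_top[of "snd p0"] by (rule eventually_conj)
  ultimately have "\<forall>\<^sub>F K in sequentially. 1 / 36 - \<eta> * (g / 8) < (\<Sum>p\<in>{1..K} \<times> {1..K}. lam p) \<and> fst p0 \<le> K \<and> snd p0 \<le> K"
    by (rule eventually_conj)
  then obtain K where K: "1 / 36 - \<eta> * (g / 8) < (\<Sum>p\<in>{1..K} \<times> {1..K}. lam p)" "fst p0 \<le> K" "snd p0 \<le> K"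
    using eventually_happens'[OF sequentially_bot] by blast
  define I where "I = {1..K} \<times> {1..K}"
  have I: "finite I" "\<And>p. p \<in> I \<Longrightarrow> 0 < fst p \<and> 0 < snd p" "p0 \<in> I"
    using K(2,3) p0 by (auto simp: I_def mem_Times_iff)
  have tail: "(1 / 36 - (\<Sum>p\<in>I. lam p)) / \<eta> \<le> g / 8"
    using K(1) \<eta>(1) by (simp add: I_def pos_divide_le_eq mult.commute)
  have lp: "0 < lam p" if "p \<in> I" for p using I(2)[OF that] by (simp add: lam_pos)
  interpret G: prob_space "gauss I" by (rule prob_space_gauss)
  show thesis
  proof (rule that[of "g / 2"])
    show "0 < g / 2" using g by simp
    fix s B m \<theta> L \<delta> t t0
    assume s: "s \<in> borel_measurable (\<mu> \<Otimes>\<^sub>M \<nu>)" "\<And>z. \<bar>s z\<bar> \<le> B" "(\<integral>z. s z \<partial>(\<mu> \<Otimes>\<^sub>M \<nu>)) = 0"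
      and sc: "c0 \<le> \<bar>\<integral>z. s z * phi p0 z \<partial>(\<mu> \<Otimes>\<^sub>M \<nu>)\<bar>" and m: "filterlim m at_top sequentially"
      and \<theta>: "\<And>n. \<bar>\<theta> n\<bar> * B \<le> 1" "\<And>n. real (m n) * (\<theta> n)\<^sup>2 \<le> L" "(\<lambda>n. sqrt (real (m n)) * \<theta> n) \<longlonglongrightarrow> \<delta>"
      and \<delta>: "\<epsilon> \<le> \<bar>\<delta>\<bar>" and t: "t \<longlonglongrightarrow> t0" "t0 \<le> T"
      and lim: "(\<lambda>n. measure (W (m n)) {w \<in> space (W (m n)). t n \<le> real (m n) * T_BKR (m n) w}) \<longlonglongrightarrow> \<alpha>"
    let ?a = "\<lambda>p. \<delta> * (\<integral>z. s z * phi p z \<partial>(\<mu> \<Otimes>\<^sub>M \<nu>))"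
    have null: "measure (gauss I) {z \<in> space (gauss I). t0 + 3 * \<eta> \<le> qform I lam z} - 2 * \<eta> \<le> \<alpha>"
      "\<alpha> \<le> measure (gauss I) {z \<in> space (gauss I). t0 - 4 * \<eta> \<le> qform I lam z} + (1 / 36 - (\<Sum>p\<in>I. lam p)) / \<eta> + 2 * \<eta>"
      by (rule null_T_bounds[OF I(1,2) m t(1) \<eta>(1) lim], assumption)+
    have Qm [measurable]: "(\<lambda>z. qform I lam z) \<in> borel_measurable (gauss I)"
      using qform_measurable[of I lam "\<lambda>_. 0"] unfolding add_0_right .
    have \<beta>: "(1 - \<alpha>) / 2 \<le> measure (gauss I) {z \<in> space (gauss I). qform I lam z < t0 + 3 * \<eta> + \<rho>}"
    proof -
      have "measure (gauss I) (space (gauss I) - {z \<in> space (gauss I). t0 + 3 * \<eta> \<le> qform I lam z}) =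
        1 - measure (gauss I) {z \<in> space (gauss I). t0 + 3 * \<eta> \<le> qform I lam z}"
        by (rule G.prob_compl) measurable
      moreover have "measure (gauss I) (space (gauss I) - {z \<in> space (gauss I). t0 + 3 * \<eta> \<le> qform I lam z}) \<le>
        measure (gauss I) {z \<in> space (gauss I). qform I lam z < t0 + 3 * \<eta> + \<rho>}"
        using g by (intro G.finite_measure_mono) auto
      moreover have "(1 - \<alpha>) / 2 \<le> w" if "v = 1 - u" "v \<le> w" "u - 2 * \<eta> \<le> \<alpha>" for u v w :: real
        using that \<eta>(3) by (simp add: field_simps)
      ultimately show ?thesis using null(1) by blast
    qed
    have shift: "measure (gauss I) {z \<in> space (gauss I). t0 + 3 * \<eta> \<le> qform I lam z} + g \<le>
      measure (gauss I) {z \<in> space (gauss I). t0 + 3 * \<eta> \<le> qform I lam (\<lambda>i. z i + ?a i)}"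
    proof (rule gap[OF I(1) lp I(3) _ _ _ \<beta>])
      show "\<epsilon> * c0 \<le> \<bar>?a p0\<bar>" unfolding abs_mult using sc \<delta> c0 \<epsilon> by (intro mult_mono) auto
    qed (use c_def t(2) \<eta>(2) in auto)
    have "measure (gauss I) {z \<in> space (gauss I). t0 + 3 * \<eta> - 7 * \<eta> \<le> qform I lam z} \<le>
      measure (gauss I) {z \<in> space (gauss I). t0 + 3 * \<eta> \<le> qform I lam z} + 2 * sqrt (7 * \<eta> / lam p0)"
      using I(1,3) lp \<eta>(1) by (intro gauss_anticoncentration) auto
    then have ac: "measure (gauss I) {z \<in> space (gauss I). t0 - 4 * \<eta> \<le> qform I lam z} \<le>
      measure (gauss I) {z \<in> space (gauss I). t0 + 3 * \<eta> \<le> qform I lam z} + g / 8"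
      using anti by (simp add: c_def)
    have "\<forall>\<^sub>F n in sequentially. measure (gauss I) {z \<in> space (gauss I). t0 + 3 * \<eta> \<le> qform I lam (\<lambda>i. z i + ?a i)} - 2 * \<eta>
      \<le> measure (tilt s (m n) (\<theta> n)) {w \<in> space (W (m n)). t n \<le> real (m n) * T_BKR (m n) w}"
      by (rule tilt_T_lower[OF I(1,2) s m \<theta> t(1) \<eta>(1)])
    then show "\<forall>\<^sub>F n in sequentially. \<alpha> + g / 2 \<le> measure (tilt s (m n) (\<theta> n)) {w \<in> space (W (m n)). t n \<le> real (m n) * T_BKR (m n) w}"
    proof eventually_elim
      case (elim n)
      then show ?case using shift ac tail null(2) \<eta>(4) by linarith
    qed
  qed
qed

section \<open>From tilts back to the given family\<close>

lemma tilt_eq_density: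
  assumes law: "density_law H = \<mu> \<Otimes>\<^sub>M \<nu>" and H: "prob_density H" and s: "s \<in> borel_measurable borel"
    and pos: "\<And>z. 0 \<le> 1 + \<theta> * s z"
  shows "density (\<mu> \<Otimes>\<^sub>M \<nu>) (\<lambda>z. ennreal (1 + \<theta> * s z)) = density lborel (\<lambda>z. ennreal (H z * (1 + \<theta> * s z)))"
    and "(\<integral>\<^sup>+z. ennreal (1 + \<theta> * s z) \<partial>(\<mu> \<Otimes>\<^sub>M \<nu>)) = (\<integral>\<^sup>+z. ennreal (H z * (1 + \<theta> * s z)) \<partial>lborel)"
proof -
  note Hd = prob_densityD[OF H]
  have m: "(\<lambda>z. ennreal (H z)) \<in> borel_measurable lborel" "(\<lambda>z. ennreal (1 + \<theta> * s z)) \<in> borel_measurable lborel"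
    using Hd(1) s by measurable
  show "density (\<mu> \<Otimes>\<^sub>M \<nu>) (\<lambda>z. ennreal (1 + \<theta> * s z)) = density lborel (\<lambda>z. ennreal (H z * (1 + \<theta> * s z)))"
    unfolding law[symmetric] density_law_def density_density_eq[OF m] using Hd(2) pos by (simp add: ennreal_mult)
  show "(\<integral>\<^sup>+z. ennreal (1 + \<theta> * s z) \<partial>(\<mu> \<Otimes>\<^sub>M \<nu>)) = (\<integral>\<^sup>+z. ennreal (H z * (1 + \<theta> * s z)) \<partial>lborel)"
    unfolding law[symmetric] density_law_def nn_integral_density[OF m] using Hd(2) pos by (simp add: ennreal_mult)
qed

text \<open>A Cauchy-Schwarz estimate with \<open>phi\<close> bounded by 2, obtained pointwise from
  the inequality \<open>2 * x \<le> x\<^sup>2 / \<tau> + \<tau>\<close>.\<close>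

lemma phi_coefficient_perturb:
  assumes d: "integrable (\<mu> \<Otimes>\<^sub>M \<nu>) (\<lambda>z. (s z - s' z)\<^sup>2)" "(\<integral>z. (s z - s' z)\<^sup>2 \<partial>(\<mu> \<Otimes>\<^sub>M \<nu>)) \<le> \<tau>\<^sup>2"
    and i: "integrable (\<mu> \<Otimes>\<^sub>M \<nu>) s" "integrable (\<mu> \<Otimes>\<^sub>M \<nu>) s'" and \<tau>: "0 < \<tau>"
  shows "\<bar>(\<integral>z. s z * phi p z \<partial>(\<mu> \<Otimes>\<^sub>M \<nu>)) - (\<integral>z. s' z * phi p z \<partial>(\<mu> \<Otimes>\<^sub>M \<nu>))\<bar> \<le> 2 * \<tau>"
proof -
  interpret P: prob_space "\<mu> \<Otimes>\<^sub>M \<nu>" by (rule prob_pair)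
  have phi_i: "integrable (\<mu> \<Otimes>\<^sub>M \<nu>) (\<lambda>z. u z * phi p z)" if u: "integrable (\<mu> \<Otimes>\<^sub>M \<nu>) u" for u
  proof (rule Bochner_Integration.integrable_bound[OF integrable_mult_left[OF u, of 2]])
    have [measurable]: "u \<in> borel_measurable (\<mu> \<Otimes>\<^sub>M \<nu>)" using u by simp
    show "(\<lambda>z. u z * phi p z) \<in> borel_measurable (\<mu> \<Otimes>\<^sub>M \<nu>)" by measurable
    have "\<bar>u z * phi p z\<bar> \<le> \<bar>u z\<bar> * 2" for z unfolding abs_mult by (intro mult_left_mono phi_bound) auto
    then show "AE z in \<mu> \<Otimes>\<^sub>M \<nu>. norm (u z * phi p z) \<le> norm (u z * 2)" by (simp add: abs_mult)
  qed
  have di: "integrable (\<mu> \<Otimes>\<^sub>M \<nu>) (\<lambda>z. s z - s' z)" using i by simp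
  have "(\<integral>z. s z * phi p z \<partial>(\<mu> \<Otimes>\<^sub>M \<nu>)) - (\<integral>z. s' z * phi p z \<partial>(\<mu> \<Otimes>\<^sub>M \<nu>)) = (\<integral>z. (s z - s' z) * phi p z \<partial>(\<mu> \<Otimes>\<^sub>M \<nu>))"
    using phi_i[OF i(1)] phi_i[OF i(2)] by (simp add: left_diff_distrib)
  also have "\<bar>\<dots>\<bar> \<le> (\<integral>z. \<bar>(s z - s' z) * phi p z\<bar> \<partial>(\<mu> \<Otimes>\<^sub>M \<nu>))" by (rule integral_abs_bound)
  also have "\<dots> \<le> (\<integral>z. (s z - s' z)\<^sup>2 / \<tau> + \<tau> \<partial>(\<mu> \<Otimes>\<^sub>M \<nu>))"
  proof (rule integral_mono)
    show "integrable (\<mu> \<Otimes>\<^sub>M \<nu>) (\<lambda>z. \<bar>(s z - s' z) * phi p z\<bar>)" using phi_i[OF di] by simp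
    show "integrable (\<mu> \<Otimes>\<^sub>M \<nu>) (\<lambda>z. (s z - s' z)\<^sup>2 / \<tau> + \<tau>)" using d(1) by simp
    fix z
    define x where "x = \<bar>s z - s' z\<bar>"
    have "\<bar>(s z - s' z) * phi p z\<bar> \<le> x * 2" unfolding abs_mult x_def by (intro mult_left_mono phi_bound) auto
    also have "x * 2 \<le> x\<^sup>2 / \<tau> + \<tau>"
    proof -
      have "x * 2 * \<tau> \<le> x\<^sup>2 + \<tau> * \<tau>" using zero_le_power2[of "x - \<tau>"] by (simp add: power2_eq_square algebra_simps)
      then show ?thesis using \<tau> by (simp add: field_simps)
    qed
    finally show "\<bar>(s z - s' z) * phi p z\<bar> \<le> (s z - s' z)\<^sup>2 / \<tau> + \<tau>" by (simp add: x_def)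
  qed
  also have "\<dots> = (\<integral>z. (s z - s' z)\<^sup>2 \<partial>(\<mu> \<Otimes>\<^sub>M \<nu>)) / \<tau> + \<tau>" using d(1) by (simp add: P.prob_space)
  also have "\<dots> \<le> \<tau>\<^sup>2 / \<tau> + \<tau>" using d(2) \<tau> by (intro add_right_mono divide_right_mono) auto
  also have "\<dots> = 2 * \<tau>" using \<tau> by (simp add: power2_eq_square)
  finally show ?thesis .
qed

text \<open>A negative critical value would reject every sample, as the statistic is nonnegative;
  one above \<open>20 / \<alpha>\<close> would by \<open>T_tight\<close> reject with probability at
  most \<open>\<alpha> / 2\<close>.\<close>

lemma critical_value_bounds:
  assumes n: "2 \<le> n" and \<alpha>: "0 < \<alpha>"
    and p: "\<alpha> / 2 < measure (W n) {w \<in> space (W n). t \<le> real n * T_BKR n w}"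
      "measure (W n) {w \<in> space (W n). t \<le> real n * T_BKR n w} < 1"
  shows "0 \<le> t" "t \<le> 20 / \<alpha>"
proof -
  interpret W: prob_space "W n" by (rule prob_W)
  show "0 \<le> t"
  proof (rule ccontr)
    assume "\<not> 0 \<le> t"
    moreover have "0 \<le> real n * T_BKR n w" for w using T_bounds(1)[of n w] n by simp
    ultimately have "t \<le> real n * T_BKR n w" for w by (meson le_less_trans not_le order_less_imp_le)
    then have "{w \<in> space (W n). t \<le> real n * T_BKR n w} = space (W n)" by auto
    then show False using p(2) W.prob_space by simp
  qed
  show "t \<le> 20 / \<alpha>"
  proof (rule ccontr)
    assume *: "\<not> t \<le> 20 / \<alpha>"
    have E: "{w \<in> space (W n). 20 / \<alpha> \<le> real n * T_BKR n w} \<in> sets (W n)" using n by (intro T_event_measurable) simp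
    have "measure (W n) {w \<in> space (W n). t \<le> real n * T_BKR n w} \<le> measure (W n) {w \<in> space (W n). 20 / \<alpha> \<le> real n * T_BKR n w}"
      using * E by (intro W.finite_measure_mono) auto
    also have "\<dots> \<le> 10 / (20 / \<alpha>)" using n \<alpha> by (intro T_tight) auto
    finally show False using p(1) by simp
  qed
qed

text \<open>Strictness comes from a gap that is the same along every subsequence. Compactness
  supplies limits of the critical value and of the scaled parameter, as required by
  \<open>local_power_gap\<close>, and the bounded tilt is within half of the gap of the true
  alternative.\<close>

lemma liminf_rejection_prob_greater:
  fixes h :: "real \<Rightarrow> real \<times> real \<Rightarrow> real" and \<alpha> \<epsilon> C :: real
  assumes dens: "\<And>\<eta>. \<bar>\<eta>\<bar> < 1 \<Longrightarrow> prob_density (h \<eta>)" and law: "density_law (h 0) = \<mu> \<Otimes>\<^sub>M \<nu>"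
    and s: "s \<in> borel_measurable borel" and qmd: "qmd_at_0 h s"
    and not_additive: "\<not> (\<exists>a b. AE z in \<mu> \<Otimes>\<^sub>M \<nu>. s z = a (fst z) + b (snd z))"
    and \<alpha>: "0 < \<alpha>" "\<alpha> < 1" and level: "(\<lambda>n. rejection_prob h n 0 (t n)) \<longlonglongrightarrow> \<alpha>" and \<epsilon>: "0 < \<epsilon>" "\<epsilon> \<le> C"
    and local_alt: "\<forall>\<^sub>F n in sequentially. \<epsilon> / sqrt (real n) \<le> \<bar>\<theta> n\<bar> \<and> \<bar>\<theta> n\<bar> \<le> C / sqrt (real n) \<and> \<bar>\<theta> n\<bar> < 1"
  shows "liminf (\<lambda>n. ereal (rejection_prob h n (\<theta> n) (t n))) > ereal \<alpha>"
proof -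
  interpret P: prob_space "\<mu> \<Otimes>\<^sub>M \<nu>" by (rule prob_pair)
  have C: "0 < C" using \<epsilon> by simp
  have setsP: "sets (\<mu> \<Otimes>\<^sub>M \<nu>) = sets borel" unfolding law[symmetric] by simp
  have measP: "borel_measurable (\<mu> \<Otimes>\<^sub>M \<nu>) = borel_measurable borel" by (rule measurable_cong_sets[OF setsP refl])
  have sW: "sample_law h n 0 = W n" for n by (simp add: sample_law_def law)
  have rej0: "rejection_prob h n 0 c = measure (W n) {w \<in> space (W n). c \<le> real n * T_BKR n w}" for n c
    by (simp add: rejection_prob_def sW)
  have sP: "s \<in> borel_measurable (\<mu> \<Otimes>\<^sub>M \<nu>)" using s by (simp add: measP)
  have s2: "integrable (\<mu> \<Otimes>\<^sub>M \<nu>) (\<lambda>z. (s z)\<^sup>2)" using score_square_integrable[OF dens s qmd] by (simp add: law)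
  have s0: "(\<integral>z. s z \<partial>(\<mu> \<Otimes>\<^sub>M \<nu>)) = 0" using score_mean_zero[OF dens s qmd] by (simp add: law)
  have si: "integrable (\<mu> \<Otimes>\<^sub>M \<nu>) s" by (rule P.square_integrable_imp_integrable[OF sP s2])
  \<comment> \<open>The only use of non-additivity: some positive cosine mode has a nonzero
    coefficient.\<close>
  obtain p0 where p0: "0 < fst p0" "0 < snd p0" "(\<integral>z. s z * phi p0 z \<partial>(\<mu> \<Otimes>\<^sub>M \<nu>)) \<noteq> 0"
    using additive_of_phi_orthogonal[OF si] not_additive by blast
  define c0 where "c0 = \<bar>\<integral>z. s z * phi p0 z \<partial>(\<mu> \<Otimes>\<^sub>M \<nu>)\<bar>"
  have c0: "0 < c0" using p0(3) by (simp add: c0_def)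
  obtain g where g: "0 < g" and power: "\<And>s B m \<theta> L \<delta> t t0. s \<in> borel_measurable (\<mu> \<Otimes>\<^sub>M \<nu>) \<Longrightarrow> (\<And>z. \<bar>s z\<bar> \<le> B) \<Longrightarrow> (\<integral>z. s z \<partial>(\<mu> \<Otimes>\<^sub>M \<nu>)) = 0 \<Longrightarrow>
      c0 / 2 \<le> \<bar>\<integral>z. s z * phi p0 z \<partial>(\<mu> \<Otimes>\<^sub>M \<nu>)\<bar> \<Longrightarrow> filterlim m at_top sequentially \<Longrightarrow> (\<And>n. \<bar>\<theta> n\<bar> * B \<le> 1) \<Longrightarrow>
      (\<And>n. real (m n) * (\<theta> n)\<^sup>2 \<le> L) \<Longrightarrow> (\<lambda>n. sqrt (real (m n)) * \<theta> n) \<longlonglongrightarrow> \<delta> \<Longrightarrow> \<epsilon> \<le> \<bar>\<delta>\<bar> \<Longrightarrow> t \<longlonglongrightarrow> t0 \<Longrightarrow> t0 \<le> 20 / \<alpha> \<Longrightarrow>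
      (\<lambda>n. measure (W (m n)) {w \<in> space (W (m n)). t n \<le> real (m n) * T_BKR (m n) w}) \<longlonglongrightarrow> \<alpha> \<Longrightarrow>
      \<forall>\<^sub>F n in sequentially. \<alpha> + g \<le> measure (tilt s (m n) (\<theta> n)) {w \<in> space (W (m n)). t n \<le> real (m n) * T_BKR (m n) w}"
    by (rule local_power_gap[where T = "20 / \<alpha>", OF \<alpha>(2) half_gt_zero[OF c0] \<epsilon>(1) p0(1,2)]) (use that in blast)
  \<comment> \<open>The first bound keeps the coefficient of the truncated score at least
    \<open>c0 / 2\<close>, the value for which \<open>g\<close> was obtained; the second, together
    with \<xi>, keeps the sample size times the squared Hellinger distance below
    \<open>g\<^sup>2 / 16\<close>.\<close>
  define D where "D = min ((c0 / 4)\<^sup>2) (g\<^sup>2 / (32 * C\<^sup>2))"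
  define \<xi> where "\<xi> = g\<^sup>2 / (128 * C\<^sup>2)"
  have D: "0 < D" "D \<le> (c0 / 4)\<^sup>2" "C\<^sup>2 * D \<le> g\<^sup>2 / 32"
  proof -
    show "0 < D" "D \<le> (c0 / 4)\<^sup>2" using c0 g C by (auto simp: D_def)
    have "D \<le> g\<^sup>2 / (32 * C\<^sup>2)" by (simp add: D_def)
    then show "C\<^sup>2 * D \<le> g\<^sup>2 / 32" using C by (simp add: field_simps)
  qed
  have \<xi>: "0 < \<xi>" "C\<^sup>2 * (4 * \<xi>) = g\<^sup>2 / 32" using g C by (auto simp: \<xi>_def)
  obtain s' B where s': "s' \<in> borel_measurable (\<mu> \<Otimes>\<^sub>M \<nu>)" "\<And>z. \<bar>s' z\<bar> \<le> B" "(\<integral>z. s' z \<partial>(\<mu> \<Otimes>\<^sub>M \<nu>)) = 0"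
    and d: "integrable (\<mu> \<Otimes>\<^sub>M \<nu>) (\<lambda>z. (s z - s' z)\<^sup>2)" "(\<integral>z. (s z - s' z)\<^sup>2 \<partial>(\<mu> \<Otimes>\<^sub>M \<nu>)) \<le> D"
    by (rule bounded_mean_zero_approx[OF prob_pair sP s2 s0 D(1)]) (use that in blast)
  have s'b: "s' \<in> borel_measurable borel" using s'(1) by (simp add: measP)
  have B0: "0 \<le> B" using s'(2)[of undefined] by linarith
  have s'i: "integrable (\<mu> \<Otimes>\<^sub>M \<nu>) s'" using s'(2) by (intro P.integrable_const_bound[of _ B] s'(1)) auto
  have "\<bar>(\<integral>z. s z * phi p0 z \<partial>(\<mu> \<Otimes>\<^sub>M \<nu>)) - (\<integral>z. s' z * phi p0 z \<partial>(\<mu> \<Otimes>\<^sub>M \<nu>))\<bar> \<le> 2 * (c0 / 4)"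
    using d D c0 by (intro phi_coefficient_perturb si s'i) auto
  then have c': "c0 / 2 \<le> \<bar>\<integral>z. s' z * phi p0 z \<partial>(\<mu> \<Otimes>\<^sub>M \<nu>)\<bar>" unfolding c0_def by linarith
  have hell: "\<forall>\<^sub>F \<theta> in at 0. (\<integral>\<^sup>+z. ennreal ((sqrt (h \<theta> z) - sqrt (h 0 z * (1 + \<theta> * s' z)))\<^sup>2) \<partial>lborel) \<le> ennreal (\<theta>\<^sup>2 * (D + 4 * \<xi>))"
    using d by (intro qmd_hellinger_tilt[OF dens s qmd s'b s'(2) _ _ \<xi>(1)]) (simp_all add: law)
  \<comment> \<open>The total variation bound with its free parameter set to \<open>g / 8\<close>;
    its two terms are then at most \<open>g / 4\<close> each.\<close>
  have tv: "measure (tilt s' n \<theta>) {w \<in> space (W n). c \<le> real n * T_BKR n w} - g / 2 \<le> rejection_prob h n \<theta> c"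
    if n: "0 < n" and th: "\<bar>\<theta>\<bar> < 1" "\<bar>\<theta>\<bar> * B \<le> 1" "real n * \<theta>\<^sup>2 \<le> C\<^sup>2"
      and H: "(\<integral>\<^sup>+z. ennreal ((sqrt (h \<theta> z) - sqrt (h 0 z * (1 + \<theta> * s' z)))\<^sup>2) \<partial>lborel) \<le> ennreal (\<theta>\<^sup>2 * (D + 4 * \<xi>))"
    for n \<theta> c
  proof -
    have d0: "prob_density (h 0)" using dens[of 0] by simp
    note h0 = prob_densityD[OF d0] and ht = prob_densityD[OF dens[OF th(1)]]
    note tf = tilt_density_facts[OF s' th(2)]
    note te = tilt_eq_density[OF law d0 s'b tf(1)]
    have [measurable]: "h 0 \<in> borel_measurable borel" "s' \<in> borel_measurable borel" by (fact h0(1) s'b)+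
    have sets_eq: "sets (Pi\<^sub>M {..<n} (\<lambda>_. lborel :: (real \<times> real) measure)) = sets (W n)"
      by (intro sets_PiM_cong refl) (simp only: sets_lborel setsP)
    let ?A = "{w \<in> space (W n). c \<le> real n * T_BKR n w}"
    have A: "?A \<in> sets (Pi\<^sub>M {..<n} (\<lambda>_. lborel))" unfolding sets_eq by (rule T_event_measurable[OF n])
    have "\<bar>measure (Pi\<^sub>M {..<n} (\<lambda>_. density lborel (\<lambda>x. ennreal (h \<theta> x)))) ?A -
        measure (Pi\<^sub>M {..<n} (\<lambda>_. density lborel (\<lambda>x. ennreal (h 0 x * (1 + \<theta> * s' x))))) ?A\<bar>
      \<le> card {..<n} * (\<theta>\<^sup>2 * (D + 4 * \<xi>)) / (2 * (g / 8)) + 2 * (g / 8)"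
    proof (rule PiM_tv_le_hellinger[OF lborel.sigma_finite_measure_axioms finite_lessThan _ _ ht(3) _ _ _ H _ _ A])
      show "(\<integral>\<^sup>+x. ennreal (h 0 x * (1 + \<theta> * s' x)) \<partial>lborel) = 1" using tf(3) te(2) by simp
    qed (use ht(1,2) h0(1,2) tf(1) g D(1) \<xi>(1) in auto)
    moreover have "card {..<n} * (\<theta>\<^sup>2 * (D + 4 * \<xi>)) / (2 * (g / 8)) \<le> g / 4"
    proof -
      have "card {..<n} * (\<theta>\<^sup>2 * (D + 4 * \<xi>)) = (real n * \<theta>\<^sup>2) * (D + 4 * \<xi>)" by simp
      also have "\<dots> \<le> C\<^sup>2 * (D + 4 * \<xi>)" using th(3) D(1) \<xi>(1) by (intro mult_right_mono) auto
      also have "\<dots> \<le> g\<^sup>2 / 16" unfolding distrib_left using D(3) \<xi>(2) by simp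
      finally have "card {..<n} * (\<theta>\<^sup>2 * (D + 4 * \<xi>)) / (2 * (g / 8)) \<le> g\<^sup>2 / 16 / (2 * (g / 8))"
        using g by (intro divide_right_mono) auto
      also have "\<dots> = g / 4" using g by (simp add: power2_eq_square)
      finally show ?thesis .
    qed
    moreover have "rejection_prob h n \<theta> c = measure (Pi\<^sub>M {..<n} (\<lambda>_. density lborel (\<lambda>x. ennreal (h \<theta> x)))) ?A"
    proof -
      have "sets (sample_law h n \<theta>) = sets (W n)"
        unfolding sample_law_def by (intro sets_PiM_cong refl) (simp only: sets_density_law setsP)
      then show ?thesis unfolding rejection_prob_def by (simp add: sets_eq_imp_space_eq[of "sample_law h n \<theta>" "W n"]) (simp add: sample_law_def density_law_def)
    qed
    ultimately show ?thesis using g unfolding tilt_def te(1) by linarith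
  qed
  let ?X = "\<lambda>n. ereal (rejection_prob h n (\<theta> n) (t n))"
  show ?thesis
  proof (rule ccontr)
    assume "\<not> ?thesis"
    \<comment> \<open>The liminf is at most \<alpha> by assumption; the slack \<open>g / 2\<close>
      makes the inequality strict and so passes to a subsequence. It is exactly what the gap still
      exceeds after the total variation loss.\<close>
    then have lt: "liminf ?X < ereal (\<alpha> + g / 2)" using g by (simp add: not_less) (rule le_less_trans, auto)
    obtain r where r: "strict_mono r" "(?X \<circ> r) \<longlonglongrightarrow> liminf ?X" using liminf_subseq_lim[of ?X] by blast
    have "\<forall>\<^sub>F n in sequentially. ?X (r n) < ereal (\<alpha> + g / 2)" using order_tendstoD(2)[OF r(2) lt] by simp
    then have Xr: "\<forall>\<^sub>F n in sequentially. rejection_prob h (r n) (\<theta> (r n)) (t (r n)) < \<alpha> + g / 2" by simp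
    define v where "v n = (t n, sqrt (real n) * \<theta> n)" for n
    define K :: "(real \<times> real) set" where "K = {0..20 / \<alpha>} \<times> {- C..C}"
    have ev: "\<forall>\<^sub>F n in sequentially. v n \<in> K \<and> \<epsilon> \<le> \<bar>sqrt (real n) * \<theta> n\<bar> \<and> \<bar>\<theta> n\<bar> < 1 \<and> 2 \<le> n"
    proof -
      have "\<forall>\<^sub>F n in sequentially. \<alpha> / 2 < rejection_prob h n 0 (t n)" by (rule order_tendstoD(1)[OF level]) (use \<alpha> in simp)
      moreover have "\<forall>\<^sub>F n in sequentially. rejection_prob h n 0 (t n) < 1" using order_tendstoD(2)[OF level] \<alpha> by simp
      ultimately show ?thesis using local_alt eventually_ge_at_top[of 2]
      proof eventually_elim
        case (elim n)
        have n: "0 < sqrt (real n)" using elim(4) by simp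
        have "0 \<le> t n" "t n \<le> 20 / \<alpha>"
          using critical_value_bounds[OF elim(4) \<alpha>(1) elim(1,2)[unfolded rej0]] by auto
        moreover have "\<epsilon> \<le> \<bar>sqrt (real n) * \<theta> n\<bar>" "\<bar>sqrt (real n) * \<theta> n\<bar> \<le> C"
          using elim(3) n by (auto simp: abs_mult pos_divide_le_eq pos_le_divide_eq mult.commute)
        ultimately show ?case using elim(3,4) by (auto simp: v_def K_def abs_le_iff)
      qed
    qed
    have "\<forall>\<^sub>F n in sequentially. rejection_prob h (r n) (\<theta> (r n)) (t (r n)) < \<alpha> + g / 2 \<and>
        v (r n) \<in> K \<and> \<epsilon> \<le> \<bar>sqrt (real (r n)) * \<theta> (r n)\<bar> \<and> \<bar>\<theta> (r n)\<bar> < 1 \<and> 2 \<le> r n"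
      using eventually_conj[OF Xr eventually_compose_filterlim[OF ev filterlim_subseq[OF r(1)]]] .
    then obtain N where N: "\<And>n. N \<le> n \<Longrightarrow> rejection_prob h (r n) (\<theta> (r n)) (t (r n)) < \<alpha> + g / 2 \<and>
        v (r n) \<in> K \<and> \<epsilon> \<le> \<bar>sqrt (real (r n)) * \<theta> (r n)\<bar> \<and> \<bar>\<theta> (r n)\<bar> < 1 \<and> 2 \<le> r n"
      unfolding eventually_sequentially by blast
    have "compact K" unfolding K_def by (intro compact_Times compact_Icc)
    then have "seq_compact K" by (rule compact_imp_seq_compact)
    moreover have "\<forall>n. v (r (n + N)) \<in> K" using N by simp
    ultimately obtain l q where l: "l \<in> K" "strict_mono q" "((\<lambda>n. v (r (n + N))) \<circ> q) \<longlonglongrightarrow> l"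
      by (rule seq_compactE)
    define m where "m n = r (q n + N)" for n
    have m_mono: "strict_mono m" using r(1) l(2) by (simp add: m_def strict_mono_def)
    have m: "filterlim m at_top sequentially" by (rule filterlim_subseq[OF m_mono])
    have mN: "rejection_prob h (m n) (\<theta> (m n)) (t (m n)) < \<alpha> + g / 2" "v (m n) \<in> K"
      "\<epsilon> \<le> \<bar>sqrt (real (m n)) * \<theta> (m n)\<bar>" "\<bar>\<theta> (m n)\<bar> < 1" "2 \<le> m n" for n
      using N[of "q n + N"] by (simp_all add: m_def)
    have vl: "(\<lambda>n. v (m n)) \<longlonglongrightarrow> l" using l(3) by (simp add: m_def o_def)
    have t_lim: "(\<lambda>n. t (m n)) \<longlonglongrightarrow> fst l" using tendsto_fst[OF vl] by (simp add: v_def)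
    have \<delta>_lim: "(\<lambda>n. sqrt (real (m n)) * \<theta> (m n)) \<longlonglongrightarrow> snd l" using tendsto_snd[OF vl] by (simp add: v_def)
    have \<delta>: "\<epsilon> \<le> \<bar>snd l\<bar>" by (rule tendsto_lowerbound[OF tendsto_rabs[OF \<delta>_lim]]) (use mN(3) in auto)
    have L: "real (m n) * (\<theta> (m n))\<^sup>2 \<le> C\<^sup>2" for n
    proof -
      have "\<bar>sqrt (real (m n)) * \<theta> (m n)\<bar> \<le> \<bar>C\<bar>" using mN(2)[of n] by (auto simp: v_def K_def abs_le_iff)
      then have "(sqrt (real (m n)) * \<theta> (m n))\<^sup>2 \<le> C\<^sup>2" by (simp only: abs_le_square_iff)
      then show ?thesis by (simp add: power_mult_distrib)
    qed
    have inv_lim: "(\<lambda>n. 1 / sqrt (real (m n))) \<longlonglongrightarrow> 0"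
      by (rule filterlim_compose[OF _ m, where g = "\<lambda>n. 1 / sqrt (real n)"]) real_asymp
    have "(\<lambda>n. sqrt (real (m n)) * \<theta> (m n) * (1 / sqrt (real (m n)))) \<longlonglongrightarrow> snd l * 0"
      by (rule tendsto_mult[OF \<delta>_lim inv_lim])
    moreover have "sqrt (real (m n)) * \<theta> (m n) * (1 / sqrt (real (m n))) = \<theta> (m n)" for n using mN(5)[of n] by simp
    ultimately have \<theta>_lim: "(\<lambda>n. \<theta> (m n)) \<longlonglongrightarrow> 0" by simp
    have "\<theta> (m n) \<noteq> 0" for n using mN(3)[of n] \<epsilon>(1) by auto
    then have \<theta>_at: "filterlim (\<lambda>n. \<theta> (m n)) (at 0) sequentially" using \<theta>_lim by (simp add: filterlim_at)
    \<comment> \<open>The power bound asks for a nonnegative tilt density at every index, which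
      holds only eventually; the finitely many offending parameters are replaced by 0.\<close>
    define \<theta>' where "\<theta>' n = (if \<bar>\<theta> (m n)\<bar> * B \<le> 1 then \<theta> (m n) else 0)" for n
    have "(\<lambda>n. \<bar>\<theta> (m n)\<bar> * B) \<longlonglongrightarrow> \<bar>0\<bar> * B" by (intro tendsto_intros \<theta>_lim)
    then have evB: "\<forall>\<^sub>F n in sequentially. \<bar>\<theta> (m n)\<bar> * B < 1" using order_tendstoD(2)[of _ "\<bar>0\<bar> * B" sequentially 1] by simp
    have \<theta>'_eq: "\<forall>\<^sub>F n in sequentially. \<theta>' n = \<theta> (m n)" using evB by eventually_elim (simp add: \<theta>'_def)
    have "\<forall>\<^sub>F n in sequentially. \<alpha> + g \<le> measure (tilt s' (m n) (\<theta>' n)) {w \<in> space (W (m n)). t (m n) \<le> real (m n) * T_BKR (m n) w}"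
    proof (rule power[OF s' c' m _ _ _ \<delta> t_lim])
      show "\<bar>\<theta>' n\<bar> * B \<le> 1" for n by (simp add: \<theta>'_def)
      show "real (m n) * (\<theta>' n)\<^sup>2 \<le> C\<^sup>2" for n using L[of n] by (simp add: \<theta>'_def)
      show "(\<lambda>n. sqrt (real (m n)) * \<theta>' n) \<longlonglongrightarrow> snd l"
        by (rule Lim_transform_eventually[OF \<delta>_lim]) (use \<theta>'_eq in eventually_elim, simp)
      show "fst l \<le> 20 / \<alpha>" using l(1) by (auto simp: K_def)
      show "(\<lambda>n. measure (W (m n)) {w \<in> space (W (m n)). t (m n) \<le> real (m n) * T_BKR (m n) w}) \<longlonglongrightarrow> \<alpha>"
        using filterlim_compose[OF level m] by (simp add: rej0)
    qed
    with evB eventually_compose_filterlim[OF hell \<theta>_at] \<theta>'_eq have "\<forall>\<^sub>F n in sequentially. False"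
    proof eventually_elim
      case (elim n)
      have "measure (tilt s' (m n) (\<theta> (m n))) {w \<in> space (W (m n)). t (m n) \<le> real (m n) * T_BKR (m n) w} - g / 2
        \<le> rejection_prob h (m n) (\<theta> (m n)) (t (m n))"
        using elim(1,2) mN(4,5)[of n] L[of n] by (intro tv) auto
      then show ?case using elim(3,4) mN(1)[of n] by simp
    qed
    then show False by simp
  qed
qed

end

theorem theorem2p1:
  fixes h :: "real \<Rightarrow> real \<times> real \<Rightarrow> real"
    and f0 g0 :: "real \<Rightarrow> real"
    and score :: "real \<times> real \<Rightarrow> real"
    and \<alpha> \<epsilon> M :: real
    and t \<theta> :: "nat \<Rightarrow> real"
  assumes dens: "\<And>\<eta>. \<bar>\<eta>\<bar> < 1 \<Longrightarrow> prob_density (h \<eta>)"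
    and marginals: "prob_density f0" "prob_density g0"
    and indep: "\<And>x y. h 0 (x, y) = f0 x * g0 y"
    and score: "is_score_at_0 h score"
    and qmd: "qmd_at_0 h score"
    and info_pos: "(\<integral>\<^sup>+z. ennreal ((score z)\<^sup>2) \<partial>density_law (h 0)) > 0"
    and not_additive:
      "\<not> (\<exists>a b :: real \<Rightarrow> real. AE z in density_law (h 0). score z = a (fst z) + b (snd z))"
    and alpha: "0 < \<alpha>" "\<alpha> < 1"
    and level: "(\<lambda>n. rejection_prob h n 0 (t n)) \<longlonglongrightarrow> \<alpha>"
    and eps_M: "0 < \<epsilon>" "\<epsilon> \<le> M"
    and local_alt: "\<forall>\<^sub>F n in sequentially.
      \<epsilon> / sqrt (real n) \<le> \<bar>\<theta> n\<bar> \<and> \<bar>\<theta> n\<bar> \<le> M / sqrt (real n) \<and> \<bar>\<theta> n\<bar> < 1"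
  shows "liminf (\<lambda>n. ereal (rejection_prob h n (\<theta> n) (t n))) > ereal \<alpha>"
proof -
  have law: "density_law (h 0) = density_law f0 \<Otimes>\<^sub>M density_law g0"
    by (rule density_law_product[OF marginals indep])
  have s: "score \<in> borel_measurable borel" using score by (simp add: is_score_at_0_def)
  have "indep_model (density_law f0) (density_law g0)"
    by (intro indep_model.intro atomless_density_law marginals)
  from indep_model.liminf_rejection_prob_greater[OF this dens law s qmd not_additive[unfolded law] alpha level eps_M local_alt]
  show ?thesis .
qed

end
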